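(* Let $r\in\mathbb{N}$ and let $m$ be a nonnegative integer with $m\ge r-1$. Let $a\in (l_0(\mathbb{Z}))^{r\times r}$ be a finitely supported mask such that (i) $1$ is a simple eigenvalue of $\widehat{a}(0)$ and all other eigenvalues of $\widehat{a}(0)$ are less than $2^{-m}$ in modulus; (ii) $a$ has order $m+1$ sum rules with respect to some $\upsilon_a\in (l_0(\mathbb{Z}))^{1\times r}$ such that, for some $c_1,\ldots,c_r\in l_0(\mathbb{Z})$ with $\widehat{c_1}(0)=\cdots=\widehat{c_r}(0)=1$, $\widehat{\upsilon_a}(\xi)=(\widehat{c_1}(\xi),i\xi\,\widehat{c_2}(\xi),\ldots,(i\xi)^{r-1}\widehat{c_r}(\xi))+O(|\xi|^{m+1})$ as $\xi\to0$. Let $\phi=(\phi_1,\ldots,\phi_r)^{\mathsf T}$ be the vector of compactly supported distributions satisfying $\widehat{\phi}(2\xi)=\widehat{a}(\xi)\widehat{\phi}(\xi)$ and $\widehat{\upsilon_a}(0)\widehat{\phi}(0)=1$. If the integer shifts of $\phi$ are stable, i.e., $$\mathrm{span}\{\widehat{\phi}(\xi+2\pi k): k\in\mathbb{Z}\}=\mathbb{C}^r\quad\text{for all }\xi\in\mathbb{R},$$ then the following statements are equivalent to each other: (1) The Hermite subdivision scheme of order $r$ associated with the mask $a$ is convergent with limiting functions in $\mathscr{C}^m(\mathbb{R})$. (2) The vector cascade algorithm associated with the mask $a$ is convergent in $\mathscr{C}^m(\mathbb{R})$, that is, for every compactly supported vector function $f\in(\mathscr{C}^m(\mathbb{R}))^r$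 such that $$\widehat{\upsilon_a}(0)\widehat{f}(0)=1\quad\text{and}\quad \widehat{\upsilon_a}(\xi)\widehat{f}(\xi+2\pi k)=O(|\xi|^{m+1}),\ \xi\to0,\ \text{for all } k\in\mathbb{Z}\setminus\{0\},$$ the cascade sequence $\{\mathcal{R}_a^nf\}_{n=1}^\infty$ converges to $\phi$ in $\mathscr{C}^m(\mathbb{R})$, i.e., $\phi\in(\mathscr{C}^m(\mathbb{R}))^r$ and $\lim_{n\to\infty}\|\mathcal{R}_a^nf-\phi\|_{(\mathscr{C}^m(\mathbb{R}))^r}=0$. (3) $\mathrm{sm}_\infty(a)>m$.
   Context: Notation. $(l(\mathbb{Z}))^{s\times r}$ is the space of all sequences $u:\mathbb{Z}\to\mathbb{C}^{s\times r}$, $(l_0(\mathbb{Z}))^{s\times r}$ the finitely supported ones; $l_0(\mathbb{Z})$ and $(l_0(\mathbb{Z}))^r$ are the cases of scalar and $r\times1$ column sequences. For finitely supported $u$, $\widehat u(\xi):=\sum_k u(k)e^{-ik\xi}$. For $f\in L_1(\mathbb{R})$, $\widehat f(\xi):=\int_{\mathbb{R}} f(x)e^{-i\xi x}dx$, extended to tempered distributions. $\boldsymbol{\delta}$ is the sequence with $\boldsymbol{\delta}(0)=1$, $\boldsymbol{\delta}(k)=0$ for $k\neq0$; $I_r$ is the $r\times r$ identity. $\widehat f(\xi)=\widehat g(\xi)+O(|\xi|^{n+1})$ as $\xi\to0$ means $\widehat f^{(j)}(0)=\widehat g^{(j)}(0)$ for $j=0,\ldots,n$. $\|\cdot\|_{(\mathscr{C}^m(\mathbb{R}))^r}$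 is the usual norm given by the sup norms of the derivatives up to order $m$ of all entries (used here for compactly supported functions). Sum rules: $a$ has order $n+1$ sum rules with respect to $\upsilon\in(l_0(\mathbb{Z}))^{1\times r}$ if $\widehat{\upsilon}(0)\neq0$ and, as $\xi\to0$, $\widehat{\upsilon}(2\xi)\widehat a(\xi)=\widehat{\upsilon}(\xi)+O(|\xi|^{n+1})$ and $\widehat{\upsilon}(2\xi)\widehat a(\xi+\pi)=O(|\xi|^{n+1})$. Operators: $(\mathcal{S}_a w)(j):=2\sum_{k\in\mathbb{Z}}w(k)a(j-2k)$, $j\in\mathbb{Z}$, for $w\in(l(\mathbb{Z}))^{s\times r}$; and $\mathcal{R}_a f:=2\sum_{k\in\mathbb{Z}}a(k)f(2\cdot-k)$ for $r\times 1$ vector functions $f$. Hermite subdivision scheme of order $r$ with mask $a$: for $w_0\in(l(\mathbb{Z}))^{1\times r}$ put $w_n:=(\mathcal{S}_a^nw_0)\mathsf{D}^{-n}$, $n\in\mathbb{N}$, with $\mathsf{D}:=\mathrm{diag}(1,2^{-1},\ldots,2^{1-r})$. It is convergent with limiting functions in $\mathscr{C}^m(\mathbb{R})$ if for every $w_0\in(l(\mathbb{Z}))^{1\times r}$ there is $\eta\in\mathscr{C}^m(\mathbb{R})$, $\eta:\mathbb{R}\to\mathbb{C}$, such that for all $K>0$, $$\lim_{n\to\infty}\max_{k\in\mathbb{Z}\cap[-2^nK,2^nK]}\big\|w_n(k)-[\eta(2^{-n}k),\eta'(2^{-n}k),\ldots,\eta^{(r-1)}(2^{-n}k)]\big\|_{\ell_\infty}=0.$$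 The quantity $\mathrm{sm}_\infty(a)$: let $M$ be the largest possible nonnegative integer such that $1$ is a simple eigenvalue of $\widehat a(0)$, all other eigenvalues of $\widehat a(0)$ are less than $2^{-M}$ in modulus, and $a$ has order $M+1$ sum rules with respect to some matching filter, again denoted $\upsilon_a\in(l_0(\mathbb{Z}))^{1\times r}$, with $\widehat{\upsilon_a}(0)\widehat\phi(0)=1$ (i.e., the highest order $M+1$ of sum rules is taken). Let $$\mathscr{V}_{M,\upsilon_a}:=\{u\in(l_0(\mathbb{Z}))^r:\ \widehat{\upsilon_a}(\xi)\widehat u(\xi)=O(|\xi|^{M+1}),\ \xi\to0\},$$ and let $\mathscr{B}_{M,\upsilon_a}\subseteq\mathscr{V}_{M,\upsilon_a}$ be a finite set generating it, i.e., $\mathrm{span}\{u(\cdot-k): u\in\mathscr{B}_{M,\upsilon_a},k\in\mathbb{Z}\}=\mathscr{V}_{M,\upsilon_a}$. Put $a_n:=2^{-n}\mathcal{S}_a^n(\boldsymbol{\delta}I_r)$, i.e., $\widehat{a_n}(\xi)=\widehat a(2^{n-1}\xi)\cdots\widehat a(2\xi)\widehat a(\xi)$, and $a_n*u:=\sum_{k}a_n(\cdot-k)u(k)$. Then $$\rho_{M+1}(a,\upsilon_a)_\infty:=2\max\Big\{\limsup_{n\to\infty}\|a_n*u\|_{(l_\infty(\mathbb{Z}))^r}^{1/n}:\ u\in\mathscr{B}_{M,\upsilon_a}\Big\},\qquad \mathrm{sm}_\infty(a):=-\log_2\rho_{M+1}(a,\upsilon_a)_\infty .$$ *)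

theory Defs
  imports
    "HOL-Analysis.Analysis"
    "Jordan_Normal_Form.Char_Poly"
    "Jordan_Normal_Form.VS_Connect"
begin

text \<open>Matrix-valued sequences on the integers are functions \<open>int \<Rightarrow> complex mat\<close>.
  Row and column vectors are matrices with one row or one column.
  Entries are numbered from \<open>0\<close>, so the \<open>l\<close>-th entry of a
  mathematical vector has index \<open>l - 1\<close> here.\<close>

definition lZ :: "nat \<Rightarrow> nat \<Rightarrow> (int \<Rightarrow> complex mat) set" where
  "lZ s r = {u. \<forall>k. u k \<in> carrier_mat s r}"

definition seq_supp :: "(int \<Rightarrow> complex mat) \<Rightarrow> int set" where
  "seq_supp u = {k. u k \<noteq> 0\<^sub>m (dim_row (u k)) (dim_col (u k))}"

definition l0 :: "nat \<Rightarrow> nat \<Rightarrow> (int \<Rightarrow> complex mat) set" where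
  "l0 s r = {u \<in> lZ s r. finite (seq_supp u)}"

definition scalar_hat :: "(int \<Rightarrow> complex) \<Rightarrow> real \<Rightarrow> complex" where
  "scalar_hat c \<xi> = (\<Sum>k | c k \<noteq> 0. c k * exp (- \<i> * of_int k * of_real \<xi>))"

definition seq_hat :: "(int \<Rightarrow> complex mat) \<Rightarrow> real \<Rightarrow> complex mat" where
  "seq_hat u \<xi> = Matrix.mat (dim_row (u 0)) (dim_col (u 0))
     (\<lambda>(i, j). scalar_hat (\<lambda>k. u k $$ (i, j)) \<xi>)"


subsection \<open>Derivatives and orders of vanishing at the origin\<close>

definition nderiv :: "nat \<Rightarrow> (real \<Rightarrow> complex) \<Rightarrow> real \<Rightarrow> complex" where
  "nderiv n = (\<lambda>g x. vector_derivative g (at x)) ^^ n"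

definition C_k :: "nat \<Rightarrow> (real \<Rightarrow> complex) \<Rightarrow> bool" where
  "C_k m f \<longleftrightarrow> (\<forall>j<m. \<forall>x. nderiv j f differentiable (at x)) \<and> continuous_on UNIV (nderiv m f)"

definition smooth_fun :: "(real \<Rightarrow> complex) \<Rightarrow> bool" where
  "smooth_fun f \<longleftrightarrow> (\<forall>m. C_k m f)"

definition compact_supp :: "(real \<Rightarrow> complex) \<Rightarrow> bool" where
  "compact_supp f \<longleftrightarrow> compact (closure {x. f x \<noteq> 0})"

text \<open>\<open>eq_upto_O N F G\<close> is \<open>F(\<xi>) = G(\<xi>) + O(\<bar>\<xi>\<bar>^N)\<close> as \<open>\<xi> \<rightarrow> 0\<close>, which by convention
  means that the derivatives of order \<open>0, \<dots>, N - 1\<close> at the origin agree, entry by entry.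
  It is used only for smooth \<open>F\<close> and \<open>G\<close> of the same constant size.\<close>

definition eq_upto_O :: "nat \<Rightarrow> (real \<Rightarrow> complex mat) \<Rightarrow> (real \<Rightarrow> complex mat) \<Rightarrow> bool" where
  "eq_upto_O N F G \<longleftrightarrow>
     (\<forall>i<dim_row (F 0). \<forall>j<dim_col (F 0). \<forall>p<N.
        nderiv p (\<lambda>\<xi>. F \<xi> $$ (i, j)) 0 = nderiv p (\<lambda>\<xi>. G \<xi> $$ (i, j)) 0)"


subsection \<open>Conditions on the mask\<close>

text \<open>A simple eigenvalue is one of algebraic multiplicity one.\<close>

definition dominant_eigenvalue_one :: "nat \<Rightarrow> complex mat \<Rightarrow> bool" where
  "dominant_eigenvalue_one m A \<longleftrightarrow>
     eigenvalue A 1 \<and> Polynomial.order 1 (char_poly A) = 1 \<and>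
     (\<forall>\<mu>. eigenvalue A \<mu> \<and> \<mu> \<noteq> 1 \<longrightarrow> cmod \<mu> < 1 / 2 ^ m)"

definition sum_rules :: "nat \<Rightarrow> (int \<Rightarrow> complex mat) \<Rightarrow> (int \<Rightarrow> complex mat) \<Rightarrow> nat \<Rightarrow> bool" where
  "sum_rules r a \<upsilon> N \<longleftrightarrow>
     \<upsilon> \<in> l0 1 r \<and> seq_hat \<upsilon> 0 \<noteq> 0\<^sub>m 1 r \<and>
     eq_upto_O N (\<lambda>\<xi>. seq_hat \<upsilon> (2 * \<xi>) * seq_hat a \<xi>) (seq_hat \<upsilon>) \<and>
     eq_upto_O N (\<lambda>\<xi>. seq_hat \<upsilon> (2 * \<xi>) * seq_hat a (\<xi> + pi)) (\<lambda>_. 0\<^sub>m 1 r)"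

definition hermite_filter :: "nat \<Rightarrow> (int \<Rightarrow> complex mat) \<Rightarrow> nat \<Rightarrow> bool" where
  "hermite_filter r \<upsilon> N \<longleftrightarrow>
     (\<exists>c :: nat \<Rightarrow> int \<Rightarrow> complex.
        (\<forall>l<r. finite {k. c l k \<noteq> 0} \<and> scalar_hat (c l) 0 = 1) \<and>
        eq_upto_O N (seq_hat \<upsilon>)
          (\<lambda>\<xi>. Matrix.mat 1 r (\<lambda>(_, l). (\<i> * of_real \<xi>) ^ l * scalar_hat (c l) \<xi>)))"


subsection \<open>Compactly supported distributions\<close>

text \<open>A compactly supported distribution is a continuous linear functional on the space of smooth
  functions with its Frechet topology; its values on non-smooth functions are irrelevant.\<close>

definition compact_distribution :: "((real \<Rightarrow> complex) \<Rightarrow> complex) \<Rightarrow> bool" where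
  "compact_distribution T \<longleftrightarrow>
     (\<forall>f g \<alpha> \<beta>. smooth_fun f \<and> smooth_fun g \<longrightarrow>
        T (\<lambda>x. \<alpha> * f x + \<beta> * g x) = \<alpha> * T f + \<beta> * T g) \<and>
     (\<exists>R\<ge>0. \<exists>N C. \<forall>f. smooth_fun f \<longrightarrow>
        cmod (T f) \<le> C * (\<Sum>j\<le>N. SUP x\<in>{-R..R}. cmod (nderiv j f x)))"

definition dist_hat ::
  "nat \<Rightarrow> (nat \<Rightarrow> (real \<Rightarrow> complex) \<Rightarrow> complex) \<Rightarrow> real \<Rightarrow> complex mat" where
  "dist_hat r \<phi> \<xi> = Matrix.mat r 1 (\<lambda>(l, _). \<phi> l (\<lambda>x. exp (- \<i> * of_real \<xi> * of_real x)))"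

definition fun_hat :: "nat \<Rightarrow> (nat \<Rightarrow> real \<Rightarrow> complex) \<Rightarrow> real \<Rightarrow> complex mat" where
  "fun_hat r f \<xi> =
     Matrix.mat r 1 (\<lambda>(l, _). LINT x|lborel. f l x * exp (- \<i> * of_real \<xi> * of_real x))"

definition represents :: "(real \<Rightarrow> complex) \<Rightarrow> ((real \<Rightarrow> complex) \<Rightarrow> complex) \<Rightarrow> bool" where
  "represents g T \<longleftrightarrow>
     (\<forall>\<psi>. smooth_fun \<psi> \<and> compact_supp \<psi> \<longrightarrow> T \<psi> = (LINT x|lborel. g x * \<psi> x))"

definition stable_shifts :: "nat \<Rightarrow> (nat \<Rightarrow> (real \<Rightarrow> complex) \<Rightarrow> complex) \<Rightarrow> bool" where
  "stable_shifts r \<phi> \<longleftrightarrow>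
     (\<forall>\<xi>. LinearCombinations.module.span class_ring (module_vec TYPE(complex) r)
            (range (\<lambda>k::int. Matrix.col (dist_hat r \<phi> (\<xi> + 2 * pi * of_int k)) 0))
          = carrier_vec r)"

definition refinable_vector ::
  "nat \<Rightarrow> (int \<Rightarrow> complex mat) \<Rightarrow> (int \<Rightarrow> complex mat) \<Rightarrow>
   (nat \<Rightarrow> (real \<Rightarrow> complex) \<Rightarrow> complex) \<Rightarrow> bool" where
  "refinable_vector r a \<upsilon> \<phi> \<longleftrightarrow>
     (\<forall>l<r. compact_distribution (\<phi> l)) \<and>
     (\<forall>\<xi>. dist_hat r \<phi> (2 * \<xi>) = seq_hat a \<xi> * dist_hat r \<phi> \<xi>) \<and>
     seq_hat \<upsilon> 0 * dist_hat r \<phi> 0 = 1\<^sub>m 1"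


subsection \<open>Hermite subdivision schemes\<close>

text \<open>For a finitely supported mask, only finitely many terms of the sum over all integers are
  nonzero, even when \<open>w\<close> has infinite support; the index set below contains all of them.\<close>

definition subdivision :: "(int \<Rightarrow> complex mat) \<Rightarrow> (int \<Rightarrow> complex mat) \<Rightarrow> int \<Rightarrow> complex mat" where
  "subdivision a w j = Matrix.mat (dim_row (w 0)) (dim_col (a 0))
     (\<lambda>(p, q). 2 * (\<Sum>k | j - 2 * k \<in> seq_supp a. (w k * a (j - 2 * k)) $$ (p, q)))"

text \<open>The \<open>z\<close>-th power of the diagonal matrix with entries \<open>1, 1/2, \<dots>, (1/2)^(r-1)\<close>.\<close>

definition D_pow :: "nat \<Rightarrow> int \<Rightarrow> complex mat" where
  "D_pow r z = mat_diag r (\<lambda>j. ((1 / 2) ^ j) powi z)"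

definition hermite_iter ::
  "nat \<Rightarrow> (int \<Rightarrow> complex mat) \<Rightarrow> (int \<Rightarrow> complex mat) \<Rightarrow> nat \<Rightarrow> int \<Rightarrow> complex mat" where
  "hermite_iter r a w0 n k = ((subdivision a ^^ n) w0) k * D_pow r (- int n)"

definition max_norm :: "complex mat \<Rightarrow> real" where
  "max_norm A = Max (cmod ` elements_mat A)"

definition hermite_scheme_converges :: "nat \<Rightarrow> nat \<Rightarrow> (int \<Rightarrow> complex mat) \<Rightarrow> bool" where
  "hermite_scheme_converges r m a \<longleftrightarrow>
     (\<forall>w0 \<in> lZ 1 r. \<exists>\<eta>. C_k m \<eta> \<and>
        (\<forall>K::real. K > 0 \<longrightarrow>
          (\<lambda>n. Max ((\<lambda>k. max_norm (hermite_iter r a w0 n k -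
                           Matrix.mat 1 r (\<lambda>(_, l). nderiv l \<eta> (of_int k / 2 ^ n))))
                    ` {k::int. - (2 ^ n * K) \<le> of_int k \<and> of_int k \<le> 2 ^ n * K}))
          \<longlonglongrightarrow> 0))"


subsection \<open>Vector cascade algorithms\<close>

definition cascade ::
  "nat \<Rightarrow> (int \<Rightarrow> complex mat) \<Rightarrow> (nat \<Rightarrow> real \<Rightarrow> complex) \<Rightarrow> nat \<Rightarrow> real \<Rightarrow> complex" where
  "cascade r a f l x =
     2 * (\<Sum>k\<in>seq_supp a. \<Sum>j<r. a k $$ (l, j) * f j (2 * x - of_int k))"

definition C_norm :: "nat \<Rightarrow> nat \<Rightarrow> (nat \<Rightarrow> real \<Rightarrow> complex) \<Rightarrow> real" where
  "C_norm r m f = Max ((\<lambda>(l, j). SUP x. cmod (nderiv j (f l) x)) ` ({..<r} \<times> {..m}))"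

definition admissible_initial ::
  "nat \<Rightarrow> nat \<Rightarrow> (int \<Rightarrow> complex mat) \<Rightarrow> (nat \<Rightarrow> real \<Rightarrow> complex) \<Rightarrow> bool" where
  "admissible_initial r m \<upsilon> f \<longleftrightarrow>
     (\<forall>l<r. C_k m (f l) \<and> compact_supp (f l)) \<and>
     seq_hat \<upsilon> 0 * fun_hat r f 0 = 1\<^sub>m 1 \<and>
     (\<forall>k::int. k \<noteq> 0 \<longrightarrow>
        eq_upto_O (m + 1) (\<lambda>\<xi>. seq_hat \<upsilon> \<xi> * fun_hat r f (\<xi> + 2 * pi * of_int k))
          (\<lambda>_. 0\<^sub>m 1 1))"

definition cascade_converges ::
  "nat \<Rightarrow> nat \<Rightarrow> (int \<Rightarrow> complex mat) \<Rightarrow> (int \<Rightarrow> complex mat) \<Rightarrow>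
   (nat \<Rightarrow> (real \<Rightarrow> complex) \<Rightarrow> complex) \<Rightarrow> bool" where
  "cascade_converges r m a \<upsilon> \<phi> \<longleftrightarrow>
     (\<forall>f. admissible_initial r m \<upsilon> f \<longrightarrow>
        (\<exists>g. (\<forall>l<r. C_k m (g l) \<and> represents (g l) (\<phi> l)) \<and>
             (\<lambda>n. C_norm r m (\<lambda>l x. (cascade r a ^^ n) f l x - g l x)) \<longlonglongrightarrow> 0))"


subsection \<open>The smoothness exponent\<close>

text \<open>In the definition of \<open>sm_infty\<close>, \<open>\<phi>\<close> serves only to normalise the matching filter.\<close>

definition matching_filter ::
  "nat \<Rightarrow> (int \<Rightarrow> complex mat) \<Rightarrow> (nat \<Rightarrow> (real \<Rightarrow> complex) \<Rightarrow> complex) \<Rightarrow> nat \<Rightarrow>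
   (int \<Rightarrow> complex mat) \<Rightarrow> bool" where
  "matching_filter r a \<phi> M \<upsilon> \<longleftrightarrow>
     sum_rules r a \<upsilon> (M + 1) \<and> seq_hat \<upsilon> 0 * dist_hat r \<phi> 0 = 1\<^sub>m 1"

definition max_sum_rules ::
  "nat \<Rightarrow> (int \<Rightarrow> complex mat) \<Rightarrow> (nat \<Rightarrow> (real \<Rightarrow> complex) \<Rightarrow> complex) \<Rightarrow> nat" where
  "max_sum_rules r a \<phi> =
     (GREATEST M. dominant_eigenvalue_one M (seq_hat a 0) \<and> (\<exists>\<upsilon>. matching_filter r a \<phi> M \<upsilon>))"

definition V_space :: "nat \<Rightarrow> nat \<Rightarrow> (int \<Rightarrow> complex mat) \<Rightarrow> (int \<Rightarrow> complex mat) set" where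
  "V_space r M \<upsilon> =
     {u \<in> l0 r 1. eq_upto_O (M + 1) (\<lambda>\<xi>. seq_hat \<upsilon> \<xi> * seq_hat u \<xi>) (\<lambda>_. 0\<^sub>m 1 1)}"

definition seq_span :: "nat \<Rightarrow> (int \<Rightarrow> complex mat) set \<Rightarrow> (int \<Rightarrow> complex mat) set" where
  "seq_span r S = {u. \<exists>T c. finite T \<and> T \<subseteq> S \<and>
     u = (\<lambda>j. Matrix.mat r 1 (\<lambda>(p, q). \<Sum>v\<in>T. c v * v j $$ (p, q)))}"

definition generates :: "nat \<Rightarrow> (int \<Rightarrow> complex mat) set \<Rightarrow> (int \<Rightarrow> complex mat) set \<Rightarrow> bool" where
  "generates r B V \<longleftrightarrow>
     finite B \<and> B \<subseteq> V \<and> seq_span r {(\<lambda>j. u (j - k)) | u k. u \<in> B} = V"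

definition mask_iter :: "nat \<Rightarrow> (int \<Rightarrow> complex mat) \<Rightarrow> nat \<Rightarrow> int \<Rightarrow> complex mat" where
  "mask_iter r a n k =
     (1 / 2 ^ n) \<cdot>\<^sub>m ((subdivision a ^^ n) (\<lambda>k. if k = 0 then 1\<^sub>m r else 0\<^sub>m r r)) k"

definition seq_conv :: "(int \<Rightarrow> complex mat) \<Rightarrow> (int \<Rightarrow> complex mat) \<Rightarrow> int \<Rightarrow> complex mat" where
  "seq_conv b u j = Matrix.mat (dim_row (b 0)) (dim_col (u 0))
     (\<lambda>(p, q). \<Sum>k\<in>seq_supp u. (b (j - k) * u k) $$ (p, q))"

definition linf_norm :: "(int \<Rightarrow> complex mat) \<Rightarrow> real" where
  "linf_norm u = (SUP k. max_norm (u k))"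

definition rho_infty :: "nat \<Rightarrow> (int \<Rightarrow> complex mat) \<Rightarrow> (int \<Rightarrow> complex mat) set \<Rightarrow> ereal" where
  "rho_infty r a B =
     2 * Max ((\<lambda>u. limsup (\<lambda>n. ereal (root n (linf_norm (seq_conv (mask_iter r a n) u))))) ` B)"

definition neg_log2 :: "ereal \<Rightarrow> ereal" where
  "neg_log2 \<rho> = (if \<rho> = 0 then \<infinity> else if \<rho> = \<infinity> then - \<infinity> else ereal (- log 2 (real_of_ereal \<rho>)))"

text \<open>The value depends neither on which matching filter is used nor on which finite generating
  set of \<open>V_space\<close> is used; both are picked by the choice operator.\<close>

definition sm_infty ::
  "nat \<Rightarrow> (int \<Rightarrow> complex mat) \<Rightarrow> (nat \<Rightarrow> (real \<Rightarrow> complex) \<Rightarrow> complex) \<Rightarrow> ereal" where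
  "sm_infty r a \<phi> =
     (let M = max_sum_rules r a \<phi>;
          \<upsilon> = (SOME \<upsilon>. matching_filter r a \<phi> M \<upsilon>);
          B = (SOME B. generates r B (V_space r M \<upsilon>))
      in neg_log2 (rho_infty r a B))"

end

theory Submission
  imports Defs "Jordan_Normal_Form.Spectral_Radius"
begin

text \<open>Write \<open>V\<^sub>n\<close> for the finitely supported sequences \<open>u\<close> with \<open>\<upsilon>(\<xi>) u(\<xi>) = O(\<bar>\<xi>\<bar>^n)\<close> on the Fourier side.
 By the sum rules the transition operators map \<open>V\<^sub>n\<close> into itself and act on the one-dimensional quotient
 \<open>V\<^sub>n / V\<^bsub>n+1\<^esub>\<close> as multiplication by \<open>2^(-n-1)\<close>. All three statements are equivalent to the decay
 of \<open>a\<^sub>k * u\<close> at a geometric rate smaller than \<open>2^(-m-1)\<close> for every \<open>u\<close> in \<open>V\<^bsub>m+1\<^esub>\<close>. For (3) the quotients allow one to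
 pass from the maximal order of sum rules down to \<open>m + 1\<close>. Decay gives (2), because the \<open>j\<close>-th derivatives of the samples of \<open>R f - f\<close>
 lie in \<open>V\<^bsub>j+1\<^esub>\<close>, and it gives (1), because \<open>\<delta> e\<^sub>j\<close> and the samples of the \<open>j\<close>-th derivative of \<open>\<phi>\<close> differ by
 an element of \<open>V\<^bsub>j+1\<^esub>\<close>; this is where the Hermite form of \<open>\<upsilon>\<close> enters. Conversely, perturbing a smooth initial function by
 \<open>\<Sum>\<^sub>k u(k) g(x - k)\<close> with a bump function \<open>g\<close> shows that (2) implies decay, and under (1) the limit functions started from
 the unit vectors form a refinable vector of \<open>C\<^sup>m\<close> functions, whose Fourier transform is that of \<open>\<phi>\<close>; stability then
 lets one express elements of \<open>V\<^bsub>m+1\<^esub>\<close> by samples of these functions, on which subdivision takes finite differences of order \<open>m + 1\<close>.\<close>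

section \<open>Derivatives of complex-valued functions of a real variable\<close>

text \<open>Order conditions at the origin concern Taylor coefficients of symbols, which are power
  moments up to powers of -i. They are therefore carried by the functionals \<open>M p c\<close>, on
  which the sum rules act as an exact scaling, and no Fourier analysis of infinite products is
  needed. The convergence statements yield only little-o bounds. These improve to geometric rates
  because every large window of integers is invariant under both transition operators, so that
  finitely many sequences control all others. Limit functions are identified with \<phi> by
  uniqueness: the lowest nonvanishing moments of a difference of refinable functionals would form an
  eigenvector of the symbol at 0 for an eigenvalue 2^k, which the spectral hypothesis and the
  normalisation exclude. The smoothness exponent involves an unspecified filter of maximal order K
  >= m. A maximum exists because K + 1 moments give K + 1 distinct eigenvalues on a space whose
  dimension depends on the mask alone. The spectral gap below 2^(-m) forces the moments up to order
  m of any such filter to be those of \<upsilon>, so both filters define the same V_n for n <= m +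
  1.\<close>

abbreviation wave :: "real => real => complex" where
 "wave \<xi> x \<equiv> exp (- \<i> * of_real \<xi> * of_real x)"

abbreviation intwave :: "int => real => complex" where
 "intwave k \<xi> \<equiv> exp (- \<i> * of_int k * of_real \<xi>)"

lemmas sum_pairs = sum.cartesian_product case_prod_beta

lemma nderiv_0 [simp]: "nderiv 0 f = f"
 by (simp add: nderiv_def)

lemma nderiv_Suc: "nderiv (Suc n) f = (\<lambda>x. vector_derivative (nderiv n f) (at x))"
 by (simp add: nderiv_def)

lemma nderiv_Suc_shift: "nderiv (Suc n) f = nderiv n (\<lambda>x. vector_derivative f (at x))"
 unfolding nderiv_def by (subst funpow_Suc_right) simp

text \<open>Most higher derivatives below are found by guessing a chain \<open>F 0\<close>,
  \<open>F 1\<close>, ... in which each member is the derivative of the one before; this rule turns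
  the guess into a statement about \<open>nderiv\<close>.\<close>

lemma nderiv_chain:
 assumes "!!j x. j < m ==> (F j has_vector_derivative F (Suc j) x) (at x)" "j \<le> m"
 shows "nderiv j (F 0) = F j"
 using assms(2)
proof (induction j)
 case (Suc j)
 then show ?case
  using assms(1)[of j] by (auto simp: nderiv_Suc intro!: ext vector_derivative_at)
qed simp

lemma C_k_chain:
 assumes "!!j x. j < m ==> (F j has_vector_derivative F (Suc j) x) (at x)"
  and "continuous_on UNIV (F m)"
 shows "C_k m (F 0)"
proof -
 have "F j differentiable at x" if "j < m" for j x
  using assms(1)[OF that, of x] by (auto simp: has_vector_derivative_def differentiable_def)
 then show ?thesis
  using assms nderiv_chain[of m F] by (auto simp: C_k_def)
qed

lemma C_k_has_vector_derivative:
 assumes "C_k m f" "j < m"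
 shows "(nderiv j f has_vector_derivative nderiv (Suc j) f x) (at x)"
 using assms vector_derivative_works by (auto simp: C_k_def nderiv_Suc)

lemma C_k_0: "C_k 0 f \<longleftrightarrow> continuous_on UNIV f"
 by (simp add: C_k_def)

lemma C_k_continuous_nderiv:
 assumes "C_k m f" "j \<le> m"
 shows "continuous_on UNIV (nderiv j f)"
proof (cases "j = m")
 case False
 then show ?thesis
  using assms C_k_has_vector_derivative[OF assms(1), of j]
  by (auto intro!: continuous_at_imp_continuous_on has_vector_derivative_continuous)
qed (use assms in \<open>simp add: C_k_def\<close>)

lemma C_k_continuous: "C_k m f ==> continuous_on UNIV f"
 using C_k_continuous_nderiv[of m f 0] by simp

lemma C_k_mono: "C_k m f ==> n \<le> m ==> C_k n f"
 using C_k_continuous_nderiv[of m f n] by (auto simp: C_k_def)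

lemma C_k_Suc:
 assumes "!!x. (f has_vector_derivative f' x) (at x)" "C_k m f'"
 shows "C_k (Suc m) f"
proof -
 have *: "(\<lambda>x. vector_derivative f (at x)) = f'"
  using assms(1) by (auto intro!: ext vector_derivative_at)
 have 1: "f differentiable at x" for x
  using assms(1)[of x] by (auto simp: has_vector_derivative_def differentiable_def)
 have 2: "nderiv (Suc j) f = nderiv j f'" for j
  by (simp add: nderiv_Suc_shift *)
 show ?thesis
  unfolding C_k_def
 proof (intro conjI allI impI)
  fix j x assume "j < Suc m"
  then show "nderiv j f differentiable at x"
   using 1 2 assms(2) by (cases j) (auto simp: C_k_def)
 qed (use 2 assms(2) in \<open>auto simp: C_k_def\<close>)
qed

lemma C_k_SucE:
 assumes "C_k (Suc m) f"
 obtains f' where "!!x. (f has_vector_derivative f' x) (at x)" "C_k m f'" "f' = nderiv 1 f"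
proof
 show "(f has_vector_derivative nderiv 1 f x) (at x)" for x
  using C_k_has_vector_derivative[OF assms, of 0] by simp
 have 2: "nderiv (Suc j) f = nderiv j (nderiv 1 f)" for j
  using nderiv_Suc_shift[of 0 f] by (simp add: nderiv_Suc_shift)
 show "C_k m (nderiv 1 f)"
  using assms unfolding C_k_def using 2 by (metis Suc_less_eq)
qed simp

lemma has_vector_derivative_affine:
 fixes g :: "real => complex"
 assumes "(g has_vector_derivative g') (at (s * x + t))"
 shows "((\<lambda>x. g (s * x + t)) has_vector_derivative of_real s * g') (at x)"
proof -
 have "((\<lambda>x. s * x + t) has_vector_derivative s) (at x)"
  by (auto intro!: derivative_eq_intros simp: has_vector_derivative_def)
 from vector_diff_chain_at[OF this assms] show ?thesis
  by (simp add: o_def scaleR_conv_of_real)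
qed

text \<open>One pair of statements covers all linear operations needed later: the cascade operator,
  sums of integer shifts and, with index sets of one or two elements, substitutions and linear
  combinations.\<close>

lemma
 fixes c :: "'i => complex"
 assumes "!!i. i \<in> I ==> C_k m (f i)"
 shows C_k_affine_sum: "C_k m (\<lambda>x. \<Sum>i\<in>I. c i * f i (s * x + t i))"
  and nderiv_affine_sum: "j \<le> m ==> nderiv j (\<lambda>x. \<Sum>i\<in>I. c i * f i (s * x + t i))
   = (\<lambda>x. of_real s ^ j * (\<Sum>i\<in>I. c i * nderiv j (f i) (s * x + t i)))"
proof -
 define F where "F j x = of_real s ^ j * (\<Sum>i\<in>I. c i * nderiv j (f i) (s * x + t i))" for j x
 have D: "(F j has_vector_derivative F (Suc j) x) (at x)" if "j < m" for j x
 proof -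
  have "((\<lambda>x. of_real s ^ j * (\<Sum>i\<in>I. c i * nderiv j (f i) (s * x + t i)))
   has_vector_derivative of_real s ^ j * (\<Sum>i\<in>I. c i * (of_real s * nderiv (Suc j) (f i) (s * x + t i)))) (at x)"
   using that assms
   by (intro has_vector_derivative_mult_right has_vector_derivative_sum has_vector_derivative_affine
     C_k_has_vector_derivative[of m]) auto
  then show ?thesis
   unfolding F_def by (simp add: sum_distrib_left mult_ac)
 qed
 have "continuous_on UNIV (\<lambda>x. nderiv m (f i) (s * x + t i))" if "i \<in> I" for i
  by (rule continuous_on_compose2[OF C_k_continuous_nderiv[OF assms[OF that] order_refl]])
   (auto intro!: continuous_intros)
 then have "continuous_on UNIV (F m)"
  unfolding F_def by (intro continuous_intros) auto
 with D have "C_k m (F 0)" by (rule C_k_chain)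
 then show "C_k m (\<lambda>x. \<Sum>i\<in>I. c i * f i (s * x + t i))" by (simp add: F_def[abs_def])
 show "nderiv j (\<lambda>x. \<Sum>i\<in>I. c i * f i (s * x + t i))
   = (\<lambda>x. of_real s ^ j * (\<Sum>i\<in>I. c i * nderiv j (f i) (s * x + t i)))" if "j \<le> m"
  using nderiv_chain[of m F j, OF D that] by (simp add: F_def[abs_def])
qed

lemma
 assumes "C_k m f"
 shows C_k_affine: "C_k m (\<lambda>x. f (s * x + t))"
  and nderiv_affine: "j \<le> m ==> nderiv j (\<lambda>x. f (s * x + t)) = (\<lambda>x. of_real s ^ j * nderiv j f (s * x + t))"
 using C_k_affine_sum[of "{()}" m "\<lambda>_. f" "\<lambda>_. 1" s "\<lambda>_. t"]
  nderiv_affine_sum[of "{()}" m "\<lambda>_. f" j "\<lambda>_. 1" s "\<lambda>_. t"] assms by auto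

lemma
 assumes "C_k m f" "C_k m g"
 shows C_k_lincomb: "C_k m (\<lambda>x. \<alpha> * f x + \<beta> * g x)"
  and nderiv_lincomb: "j \<le> m ==>
   nderiv j (\<lambda>x. \<alpha> * f x + \<beta> * g x) = (\<lambda>x. \<alpha> * nderiv j f x + \<beta> * nderiv j g x)"
 using C_k_affine_sum[of "UNIV :: bool set" m "\<lambda>b. if b then f else g" "\<lambda>b. if b then \<alpha> else \<beta>" 1 "\<lambda>_. 0"]
  nderiv_affine_sum[of "UNIV :: bool set" m "\<lambda>b. if b then f else g" j "\<lambda>b. if b then \<alpha> else \<beta>" 1 "\<lambda>_. 0"] assms
 by (auto simp: UNIV_bool add.commute)

lemma
 assumes "C_k m f" "C_k m g"
 shows C_k_diff: "C_k m (\<lambda>x. f x - g x)"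
  and nderiv_diff: "j \<le> m ==> nderiv j (\<lambda>x. f x - g x) = (\<lambda>x. nderiv j f x - nderiv j g x)"
 using C_k_lincomb[OF assms, of 1 "-1"] nderiv_lincomb[OF assms, of j 1 "-1"] by auto

lemma C_k_mult:
 assumes "C_k m f" "C_k m g"
 shows "C_k m (\<lambda>x. f x * g x)"
 using assms
proof (induction m arbitrary: f g)
 case (Suc m)
 obtain f' where f': "!!x. (f has_vector_derivative f' x) (at x)" "C_k m f'"
  using C_k_SucE[OF Suc.prems(1)] by metis
 obtain g' where g': "!!x. (g has_vector_derivative g' x) (at x)" "C_k m g'"
  using C_k_SucE[OF Suc.prems(2)] by metis
 have "((\<lambda>x. f x * g x) has_vector_derivative f x * g' x + f' x * g x) (at x)" for x
  using has_vector_derivative_mult[OF f'(1)[of x] g'(1)[of x]] by simp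
 moreover have "C_k m (\<lambda>x. 1 * (f x * g' x) + 1 * (f' x * g x))"
  using Suc.prems f' g' C_k_mono[of "Suc m" _ m]
  by (intro C_k_lincomb Suc.IH) auto
 ultimately show ?case by (intro C_k_Suc) auto
qed (auto simp: C_k_0 intro!: continuous_intros)

lemma has_vector_derivative_exp_real:
 "((\<lambda>x::real. exp (c * of_real x :: complex)) has_vector_derivative c * exp (c * of_real x)) (at x)"
proof -
 have "((\<lambda>z. exp (c * z)) has_field_derivative c * exp (c * of_real x)) (at (of_real x))"
  by (auto intro!: derivative_eq_intros)
 from has_vector_derivative_real_field[OF this] show ?thesis .
qed

lemma nderiv_exp_sum:
 fixes c \<mu> :: "'s => complex"
 shows "nderiv p (\<lambda>x. \<Sum>s\<in>S. c s * exp (\<mu> s * of_real x)) = (\<lambda>x. \<Sum>s\<in>S. c s * \<mu> s ^ p * exp (\<mu> s * of_real x))"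
proof -
 define F where "F j x = (\<Sum>s\<in>S. c s * \<mu> s ^ j * exp (\<mu> s * of_real x))" for j and x :: real
 have "(F j has_vector_derivative F (Suc j) x) (at x)" for j x
 proof -
  have "(F j has_vector_derivative (\<Sum>s\<in>S. c s * \<mu> s ^ j * (\<mu> s * exp (\<mu> s * of_real x)))) (at x)"
   unfolding F_def
   by (intro has_vector_derivative_sum has_vector_derivative_mult_right has_vector_derivative_exp_real)
  then show ?thesis by (simp add: F_def mult_ac)
 qed
 then have "nderiv p (F 0) = F p" by (rule nderiv_chain[where m = p]) auto
 then show ?thesis by (simp add: F_def[abs_def])
qed

lemma C_k_exp: "C_k m (\<lambda>x. exp (\<mu> * of_real x))"
proof (induction m)
 case (Suc m)
 have "C_k m (\<lambda>x. \<mu> * exp (\<mu> * of_real x) + 0 * exp (\<mu> * of_real x))"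
  by (rule C_k_lincomb[OF Suc Suc])
 then show ?case
  by (intro C_k_Suc[OF has_vector_derivative_exp_real]) auto
qed (auto simp: C_k_0 intro!: continuous_intros)

lemma nderiv_poly:
 "nderiv p (\<lambda>x. poly P (of_real x)) = (\<lambda>x. poly ((pderiv ^^ p) P) (of_real x))"
proof -
 have "((\<lambda>x. poly ((pderiv ^^ j) P) (of_real x)) has_vector_derivative poly ((pderiv ^^ Suc j) P) (of_real x)) (at x)" for j x
  using has_vector_derivative_real_field[OF poly_DERIV[of "(pderiv ^^ j) P" "of_real x"]] by simp
 from nderiv_chain[of p "\<lambda>j x. poly ((pderiv ^^ j) P) (of_real x)", OF this] show ?thesis by simp
qed

lemma C_k_poly: "C_k m (\<lambda>x. poly P (of_real x))"
proof (induction m arbitrary: P)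
 case (Suc m)
 show ?case
  by (rule C_k_Suc[OF has_vector_derivative_real_field[OF poly_DERIV] Suc])
qed (auto simp: C_k_0 intro!: continuous_intros)

lemma pderiv_iter_degree: "(pderiv ^^ p) (P :: complex poly) = 0" if "degree P < p"
 using that
proof (induction p arbitrary: P)
 case (Suc p)
 show ?case
 proof (cases "degree P = 0")
  case True
  then have "pderiv P = 0" by (simp add: pderiv_eq_0_iff)
  moreover have "(pderiv ^^ k) (0 :: complex poly) = 0" for k by (induction k) auto
  ultimately show ?thesis by (simp add: funpow_Suc_right del: funpow.simps)
 next
  case False
  then have "degree (pderiv P) < p" using Suc.prems by (simp add: degree_pderiv)
  then show ?thesis using Suc.IH by (simp add: funpow_Suc_right del: funpow.simps)
 qed
qed simp

lemma pderiv_iter_monom: "(pderiv ^^ p) (monom c p :: complex poly) = [:fact p * c:]"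
proof (induction p arbitrary: c)
 case (Suc p)
 have "pderiv (monom c (Suc p)) = monom (of_nat (Suc p) * c) p"
  by (simp add: pderiv_monom)
 then show ?case using Suc.IH by (simp add: funpow_Suc_right algebra_simps del: funpow.simps)
qed (simp add: monom_0)

text \<open>The derivatives at \<open>0\<close> of \<open>x^l\<close> times an exponential sum; the recursion is Leibniz' rule
 for one factor \<open>x\<close>.\<close>

lemma nderiv_power_exp_sum:
 fixes c \<mu> :: "'s => complex"
 assumes "p \<le> l"
 shows "nderiv p (\<lambda>x. of_real x ^ l * (\<Sum>s\<in>S. c s * exp (\<mu> s * of_real x))) 0 = (if p = l then fact l * (\<Sum>s\<in>S. c s) else 0)"
proof -
 define G where "G = rec_nat (\<lambda>p x. \<Sum>s\<in>S. c s * \<mu> s ^ p * exp (\<mu> s * of_real x))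
  (\<lambda>l Gl p x. of_real x * Gl p x + of_nat p * Gl (p - 1) x)"
 have G0: "G 0 p = (\<lambda>x. \<Sum>s\<in>S. c s * \<mu> s ^ p * exp (\<mu> s * of_real x))"
  and GS: "G (Suc l) p = (\<lambda>x. of_real x * G l p x + of_nat p * G l (p - 1) x)" for l p
  by (auto simp: G_def)
 have D: "(G l p has_vector_derivative G l (Suc p) x) (at x)" for l p x
 proof (induction l arbitrary: p)
  case 0
  have "(G 0 p has_vector_derivative (\<Sum>s\<in>S. c s * \<mu> s ^ p * (\<mu> s * exp (\<mu> s * of_real x)))) (at x)"
   unfolding G0
   by (intro has_vector_derivative_sum has_vector_derivative_mult_right has_vector_derivative_exp_real)
  then show ?case by (simp add: G0 mult.assoc mult.left_commute)
 next
  case (Suc l)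
  have id: "((\<lambda>x. of_real x :: complex) has_vector_derivative 1) (at x)"
   using has_vector_derivative_real_field[of "\<lambda>z. z" 1 x UNIV] by simp
  have "((\<lambda>x. of_real x * G l p x + of_nat p * G l (p - 1) x) has_vector_derivative
    (of_real x * G l (Suc p) x + 1 * G l p x) + of_nat p * G l (Suc (p - 1)) x) (at x)"
   by (intro has_vector_derivative_add has_vector_derivative_mult has_vector_derivative_mult_right id Suc)
  moreover have "(of_real x * G l (Suc p) x + 1 * G l p x) + of_nat p * G l (Suc (p - 1)) x = G (Suc l) (Suc p) x"
   unfolding GS by (cases p) (simp_all add: algebra_simps)
  ultimately show ?case unfolding GS[of l p] by (simp only:)
 qed
 have "G l 0 = (\<lambda>x. of_real x ^ l * (\<Sum>s\<in>S. c s * exp (\<mu> s * of_real x)))" for l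
 proof (induction l)
  case (Suc l) then show ?case by (simp add: GS mult.assoc)
 qed (simp add: G0)
 moreover have "nderiv p (G l 0) = G l p"
  by (rule nderiv_chain[where m = p]) (use D in auto)
 ultimately have "nderiv p (\<lambda>x. of_real x ^ l * (\<Sum>s\<in>S. c s * exp (\<mu> s * of_real x))) = G l p"
  by simp
 moreover have "G l p 0 = (if p = l then fact l * (\<Sum>s\<in>S. c s) else 0)" if "p \<le> l" for l p
  using that
 proof (induction l arbitrary: p)
  case (Suc l)
  show ?case
  proof (cases p)
   case (Suc q)
   then show ?thesis using Suc.IH[of q] Suc.prems by (auto simp: GS)
  qed (simp add: GS)
 qed (simp add: G0)
 ultimately show ?thesis using assms by simp
qed

lemma vector_derivative_zero_outside:
 fixes f :: "real => complex"
 assumes "(f has_vector_derivative D) (at x)" "!!y. L < \<bar>y\<bar> ==> f y = 0" "L < \<bar>x\<bar>"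
 shows "D = 0"
proof -
 have op: "open {y :: real. L < \<bar>y\<bar>}" by (intro open_Collect_less continuous_intros)
 have "(f has_vector_derivative 0) (at x)"
  by (rule has_vector_derivative_transform_within_open[OF has_vector_derivative_const op]) (use assms in auto)
 then show ?thesis using assms(1) vector_derivative_unique_at by blast
qed

lemma nderiv_zero_outside:
 assumes "C_k m f" "!!y. L < \<bar>y\<bar> ==> f y = 0" "j \<le> m" "L < \<bar>x\<bar>"
 shows "nderiv j f x = 0"
 using assms(3,4)
proof (induction j arbitrary: x)
 case (Suc j)
 then show ?case
  by (intro vector_derivative_zero_outside[OF C_k_has_vector_derivative[OF assms(1)]]) auto
qed (use assms in simp)

text \<open>Each derivative converges as a telescoping series, so the error is the tail of a
  geometric series. Uniform convergence at order j + 1 then makes the limit of order j + 1 the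
  derivative of the limit of order j.\<close>

lemma C_k_geometric_limit:
 fixes F :: "nat => real => complex"
 assumes F: "!!n. C_k m (F n)" and \<theta>: "0 \<le> \<theta>" "\<theta> < 1"
  and step: "!!j n x. j \<le> m ==> cmod (nderiv j (F (Suc n)) x - nderiv j (F n) x) \<le> K * \<theta> ^ n"
 shows "\<exists>G. C_k m G \<and> (\<forall>j\<le>m. \<forall>n x. cmod (nderiv j (F n) x - nderiv j G x) \<le> K / (1 - \<theta>) * \<theta> ^ n)"
proof -
 define d where "d j n x = nderiv j (F (Suc n)) x - nderiv j (F n) x" for j n x
 define G where "G j x = nderiv j (F 0) x + (\<Sum>n. d j n x)" for j x
 have sg: "summable (\<lambda>n. K * \<theta> ^ n)" using \<theta> by (intro summable_mult summable_geometric) simp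
 have sum_d: "summable (\<lambda>n. norm (d j n x))" if "j \<le> m" for j x
  by (rule summable_comparison_test'[OF sg, of 0]) (use step[OF that] in \<open>simp add: d_def\<close>)
 have part: "nderiv j (F n) x = nderiv j (F 0) x + (\<Sum>i<n. d j i x)" for j n x
  by (induction n) (auto simp: d_def)
 have bound: "cmod (nderiv j (F n) x - G j x) \<le> K / (1 - \<theta>) * \<theta> ^ n" if "j \<le> m" for j n x
 proof -
  have "(\<Sum>i. d j i x) = (\<Sum>i. d j (i + n) x) + (\<Sum>i<n. d j i x)"
   by (rule suminf_split_initial_segment[OF summable_norm_cancel[OF sum_d[OF that]]])
  then have "nderiv j (F n) x - G j x = - (\<Sum>i. d j (i + n) x)"
   using part[of j n x] by (simp add: G_def)
  then have "cmod (nderiv j (F n) x - G j x) \<le> (\<Sum>i. norm (d j (i + n) x))"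
   using summable_norm[of "\<lambda>i. d j (i + n) x"] sum_d[OF that, of x]
   by (simp add: summable_iff_shift[of "\<lambda>i. norm (d j i x)" n])
  also have "... \<le> (\<Sum>i. K * \<theta> ^ n * \<theta> ^ i)"
  proof (rule suminf_le)
   show "norm (d j (i + n) x) \<le> K * \<theta> ^ n * \<theta> ^ i" for i
    using step[OF that, of "i + n" x] by (simp add: d_def power_add mult_ac)
   show "summable (\<lambda>i. norm (d j (i + n) x))"
    using sum_d[OF that, of x] by (simp add: summable_iff_shift[of "\<lambda>i. norm (d j i x)" n])
   show "summable (\<lambda>i. K * \<theta> ^ n * \<theta> ^ i)"
    using \<theta> by (intro summable_mult summable_geometric) simp
  qed
  also have "... = K * \<theta> ^ n * (1 / (1 - \<theta>))"
   using \<theta> by (simp add: suminf_mult summable_geometric suminf_geometric)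
  finally show ?thesis by simp
 qed
 have small: "\<forall>\<^sub>F n in sequentially. K / (1 - \<theta>) * \<theta> ^ n < e" if "e > 0" for e
 proof -
  have "(\<lambda>n. K / (1 - \<theta>) * \<theta> ^ n) \<longlonglongrightarrow> K / (1 - \<theta>) * 0"
   using \<theta> by (intro tendsto_mult tendsto_const LIMSEQ_power_zero) simp
  then show ?thesis using order_tendstoD(2) that by fastforce
 qed
 have ev: "\<forall>\<^sub>F n in sequentially. \<forall>x. cmod (nderiv j (F n) x - G j x) < e" if "j \<le> m" "e > 0" for j e
  using small[OF that(2)] by eventually_elim (use bound[OF that(1)] le_less_trans in blast)
 have lim: "(\<lambda>n. nderiv j (F n) x) \<longlonglongrightarrow> G j x" if "j \<le> m" for j x
  unfolding tendsto_iff dist_norm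
  by (intro allI impI eventually_mono[OF ev[OF that]]) auto
 have D: "(G j has_vector_derivative G (Suc j) x) (at x)" if j: "j < m" for j x
 proof -
  have "\<exists>g. \<forall>x\<in>UNIV. ((\<lambda>n. nderiv j (F n) x) \<longlonglongrightarrow> g x) \<and> (g has_derivative (\<lambda>h. h *\<^sub>R G (Suc j) x)) (at x within UNIV)"
  proof (rule has_derivative_sequence[where f' = "\<lambda>n x h. h *\<^sub>R nderiv (Suc j) (F n) x", OF convex_UNIV _ _ UNIV_I])
   show "(nderiv j (F n) has_derivative (\<lambda>h. h *\<^sub>R nderiv (Suc j) (F n) x)) (at x within UNIV)" for n x
    using C_k_has_vector_derivative[OF F j] by (simp add: has_vector_derivative_def)
   show "\<forall>\<^sub>F n in sequentially. \<forall>x\<in>UNIV. \<forall>h. norm (h *\<^sub>R nderiv (Suc j) (F n) x - h *\<^sub>R G (Suc j) x) \<le> e * norm h" if "e > 0" for e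
   proof -
    have "\<forall>\<^sub>F n in sequentially. \<forall>x. cmod (nderiv (Suc j) (F n) x - G (Suc j) x) < e"
     using ev[of "Suc j" e] j that by simp
    then show ?thesis
    proof eventually_elim
     case (elim n)
     show ?case
     proof (intro ballI allI)
      fix x h :: real
      have "norm (h *\<^sub>R nderiv (Suc j) (F n) x - h *\<^sub>R G (Suc j) x) = \<bar>h\<bar> * cmod (nderiv (Suc j) (F n) x - G (Suc j) x)"
       by (simp flip: scaleR_diff_right)
      also have "... \<le> \<bar>h\<bar> * e" using elim[rule_format, of x] by (intro mult_left_mono) auto
      finally show "norm (h *\<^sub>R nderiv (Suc j) (F n) x - h *\<^sub>R G (Suc j) x) \<le> e * norm h"
       by (simp add: mult.commute)
     qed
    qed
   qed
   show "(\<lambda>n. nderiv j (F n) 0) \<longlonglongrightarrow> G j 0" using lim j by simp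
  qed
  then obtain g where g: "!!x. (\<lambda>n. nderiv j (F n) x) \<longlonglongrightarrow> g x"
   "!!x. (g has_derivative (\<lambda>h. h *\<^sub>R G (Suc j) x)) (at x)" by auto
  have "g = G j" using g(1) lim[of j] j LIMSEQ_unique by (intro ext) fastforce
  then show ?thesis using g(2) by (simp add: has_vector_derivative_def)
 qed
 have "continuous_on UNIV (G m)"
 proof (rule uniform_limit_theorem[where F = sequentially and f = "\<lambda>n. nderiv m (F n)"])
  show "\<forall>\<^sub>F n in sequentially. continuous_on UNIV (nderiv m (F n))"
   using C_k_continuous_nderiv[OF F] by simp
  show "uniform_limit UNIV (\<lambda>n. nderiv m (F n)) (G m) sequentially"
   unfolding uniform_limit_iff dist_norm using ev[of m] by simp
 qed auto
 then have "C_k m (G 0)" using D by (intro C_k_chain) auto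
 moreover have "nderiv j (G 0) = G j" if "j \<le> m" for j
  by (rule nderiv_chain[where m = m]) (use D that in auto)
 ultimately show ?thesis using bound by (intro exI[of _ "G 0"]) simp
qed

section \<open>Transition operators and sum rules\<close>

text \<open>Summing over the support gives the junk value 0 when the support is infinite.
  Translation, reflection and scaling hold regardless, while additivity carries a finiteness
  hypothesis.\<close>

definition zsum :: "(int => complex) => complex" where
 "zsum f = sum f {k. f k ~= 0}"

lemma zsum_eq: "finite S ==> (!!k. k \<notin> S ==> f k = 0) ==> zsum f = sum f S"
 unfolding zsum_def by (rule sum.mono_neutral_left) auto

lemma zsum_shift: "zsum (\<lambda>k. f (k + c)) = zsum f"
 unfolding zsum_def
 by (rule sum.reindex_bij_witness[of _ "\<lambda>k. k - c" "\<lambda>k. k + c"]) auto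

lemma zsum_reflect: "zsum (\<lambda>k. f (c - k)) = zsum f"
 unfolding zsum_def
 by (rule sum.reindex_bij_witness[of _ "\<lambda>k. c - k" "\<lambda>k. c - k"]) auto

lemma zsum_cmult: "zsum (\<lambda>k. c * f k) = c * zsum f"
proof (cases "c = 0")
 case False
 then have "{k. c * f k ~= 0} = {k. f k ~= 0}" by auto
 then show ?thesis by (simp add: zsum_def sum_distrib_left)
qed (simp add: zsum_def)

lemma zsum_sum:
 assumes "finite A" "!!i. i \<in> A ==> finite {k. f i k ~= 0}"
 shows "zsum (\<lambda>k. \<Sum>i\<in>A. f i k) = (\<Sum>i\<in>A. zsum (f i))"
proof -
 define S where "S = (\<Union>i\<in>A. {k. f i k ~= 0})"
 have S: "finite S" using assms by (auto simp: S_def)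
 have "zsum (\<lambda>k. \<Sum>i\<in>A. f i k) = (\<Sum>k\<in>S. \<Sum>i\<in>A. f i k)"
  by (rule zsum_eq[OF S]) (auto simp: S_def intro!: sum.neutral)
 also have "... = (\<Sum>i\<in>A. \<Sum>k\<in>S. f i k)" by (rule sum.swap)
 also have "... = (\<Sum>i\<in>A. zsum (f i))"
  by (intro sum.cong refl zsum_eq[symmetric] S) (auto simp: S_def)
 finally show ?thesis .
qed

lemma zsum_stride: "zsum (\<lambda>k. f (2 * k + e)) = zsum (\<lambda>n. if even (n - e) then f n else 0)"
 unfolding zsum_def
 by (rule sum.reindex_bij_witness[of _ "\<lambda>n. (n - e) div 2" "\<lambda>k. 2 * k + e"]) (auto split: if_splits)

text \<open>Matrix-valued sequences are curried functions of position, row and column, free of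
  dimension conditions. Only indices below \<open>r\<close> are meaningful, which is why congruence
  rules compare sequences on those rows only.\<close>

locale mask =
 fixes r :: nat and N :: int and a :: "int => nat => nat => complex"
 assumes r: "0 < r" and N: "0 \<le> N" and a_supp: "!!k l j. N < \<bar>k\<bar> ==> a k l j = 0"
begin

text \<open>The value of the convolution a * u at 2k + e: for the digits e = 0 and e = 1 these are
  its even and odd subsequences.\<close>

definition T :: "int => (int => nat => complex) => int => nat => complex" where
 "T e u k l = (\<Sum>i\<in>{-N..N}. \<Sum>j<r. a i l j * u (2 * k + e - i) j)"

text \<open>\<open>C n u\<close> is the convolution \<open>a\<^sub>n * u\<close>, computed digit by digit.\<close>

fun C :: "nat => (int => nat => complex) => int => nat => complex" where
 "C 0 u j = u j"
| "C (Suc n) u j = C n (T (j mod 2) u) (j div 2)"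

definition supp_in :: "int => (int => nat => complex) => bool" where
 "supp_in L u \<longleftrightarrow> (\<forall>k. \<forall>l<r. L < \<bar>k\<bar> --> u k l = 0)"

definition fsupp :: "(int => nat => complex) => bool" where
 "fsupp u \<longleftrightarrow> (\<exists>L. supp_in L u)"

lemma supp_in_mono: "supp_in L u ==> L \<le> L' ==> supp_in L' u"
 by (auto simp: supp_in_def)

lemma fsupp_large:
 assumes "fsupp u" shows "\<exists>L\<ge>B. supp_in L u"
proof -
 obtain L where "supp_in L u" using assms by (auto simp: fsupp_def)
 then have "supp_in (max L B) u" by (rule supp_in_mono) simp
 then show ?thesis by (intro exI[of _ "max L B"]) simp
qed

lemma fsupp_finite:
 assumes "fsupp u" "l < r" shows "finite {k. f k * u k l ~= 0}"
proof -
 obtain L where "supp_in L u" using assms by (auto simp: fsupp_def)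
 then have "{k. f k * u k l ~= 0} \<subseteq> {-L..L}"
  using assms(2) by (force simp: supp_in_def)
 then show ?thesis using finite_subset by blast
qed

text \<open>Decimation by 2 outweighs the spread of the mask: |k| >= L + 1 gives |2k + e - i| >= 2(L
  + 1) - 1 - N >= L + 1. So every window of radius at least \<open>N\<close> is invariant, and the
  transition operators act on a finite-dimensional space.\<close>

lemma supp_in_T:
 assumes "supp_in L u" "N \<le> L" "e \<in> {0, 1}"
 shows "supp_in L (T e u)"
 unfolding supp_in_def T_def
proof (intro allI impI sum.neutral ballI)
 fix k l i j assume *: "L < \<bar>k\<bar>" "i \<in> {-N..N}" "j \<in> {..<r}"
 then have "L < \<bar>2 * k + e - i\<bar>" using assms(2,3) by auto
 then show "a i l j * u (2 * k + e - i) j = 0" using assms(1) * by (auto simp: supp_in_def)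
qed

lemma supp_in_C:
 assumes "supp_in L u" "N \<le> L" "L < \<bar>j div 2 ^ n\<bar>" "l < r"
 shows "C n u j l = 0"
 using assms
proof (induction n arbitrary: u j)
 case (Suc n)
 have "supp_in L (T (j mod 2) u)"
  using Suc.prems by (intro supp_in_T) auto
 moreover have "j div 2 ^ Suc n = j div 2 div 2 ^ n"
  by (simp add: zdiv_zmult2_eq)
 ultimately show ?case using Suc by simp
qed (simp add: supp_in_def)

lemma T_sum: "T e (\<lambda>k l. \<Sum>i\<in>S. c i * u i k l) = (\<lambda>k l. \<Sum>i\<in>S. c i * T e (u i) k l)"
proof (intro ext)
 fix k l
 have "T e (\<lambda>k l. \<Sum>i\<in>S. c i * u i k l) k l
   = (\<Sum>i\<in>{-N..N}. \<Sum>j<r. \<Sum>s\<in>S. c s * (a i l j * u s (2 * k + e - i) j))"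
  unfolding T_def by (intro sum.cong refl) (simp add: sum_distrib_left mult_ac)
 also have "... = (\<Sum>i\<in>{-N..N}. \<Sum>s\<in>S. \<Sum>j<r. c s * (a i l j * u s (2 * k + e - i) j))"
  by (intro sum.cong refl sum.swap)
 also have "... = (\<Sum>s\<in>S. \<Sum>i\<in>{-N..N}. \<Sum>j<r. c s * (a i l j * u s (2 * k + e - i) j))"
  by (rule sum.swap)
 finally show "T e (\<lambda>k l. \<Sum>i\<in>S. c i * u i k l) k l = (\<Sum>i\<in>S. c i * T e (u i) k l)"
  unfolding T_def by (simp add: sum_distrib_left)
qed

lemma C_sum: "C n (\<lambda>k l. \<Sum>i\<in>S. c i * u i k l) j = (\<lambda>l. \<Sum>i\<in>S. c i * C n (u i) j l)"
 by (induction n arbitrary: u j) (auto simp: T_sum)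

lemma C_lincomb: "C n (\<lambda>k l. \<alpha> * u k l + \<beta> * w k l) j l = \<alpha> * C n u j l + \<beta> * C n w j l"
 using C_sum[of n "\<lambda>b. if b then \<alpha> else \<beta>" "\<lambda>b. if b then u else w" "UNIV :: bool set" j]
 by (simp add: UNIV_bool add.commute fun_eq_iff)

lemma T_cong: "(!!k l. l < r ==> u k l = w k l) ==> T e u = T e w"
 by (auto simp: T_def fun_eq_iff intro!: sum.cong)

lemma C_cong: "(!!k l. l < r ==> u k l = w k l) ==> l < r ==> C n u j l = C n w j l"
 by (cases n) (auto simp: T_cong[of u w])

lemma C_shift: "C n (\<lambda>k. u (k - t)) j = C n u (j - t)"
proof (induction n arbitrary: u j t)
 case (Suc n)
 \<comment> \<open>The carry: translating by \<open>t\<close> changes the last binary digit of the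
   position and translates the remaining digits by \<open>s\<close>.\<close>
 define s where "s = j div 2 - (j - t) div 2"
 have s: "2 * (k - s) + (j - t) mod 2 = 2 * k + j mod 2 - t" for k
  unfolding s_def by (simp add: algebra_simps minus_mod_eq_mult_div [symmetric])
 have "T (j mod 2) (\<lambda>k. u (k - t)) = (\<lambda>k. T ((j - t) mod 2) u (k - s))"
  unfolding T_def s by (simp add: algebra_simps)
 then have "C (Suc n) (\<lambda>k. u (k - t)) j = C n (\<lambda>k. T ((j - t) mod 2) u (k - s)) (j div 2)"
  by simp
 also have "... = C n (T ((j - t) mod 2) u) (j div 2 - s)" by (rule Suc)
 also have "j div 2 - s = (j - t) div 2" by (simp add: s_def)
 finally show ?case by simp
qed simp

definition bounded_by :: "real => (int => nat => complex) => bool" where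
 "bounded_by K u \<longleftrightarrow> (\<forall>j. \<forall>l<r. cmod (u j l) \<le> K)"

text \<open>Every position is determined by its last digit and the rest, so a sup norm over all
  positions splits into two. Estimates can thus be proved by induction on \<open>n\<close> without
  mentioning positions.\<close>

lemma bounded_by_C_Suc: "bounded_by K (C (Suc n) u) \<longleftrightarrow> (\<forall>e\<in>{0,1}. bounded_by K (C n (T e u)))"
proof (intro iffI ballI)
 fix e :: int assume *: "bounded_by K (C (Suc n) u)" "e \<in> {0, 1}"
 have "cmod (C n (T e u) j l) \<le> K" if "l < r" for j l
  using *(1)[unfolded bounded_by_def, rule_format, OF that, of "2 * j + e"] *(2) by auto
 then show "bounded_by K (C n (T e u))" by (simp add: bounded_by_def)
next
 assume *: "\<forall>e\<in>{0,1}. bounded_by K (C n (T e u))"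
 show "bounded_by K (C (Suc n) u)"
  unfolding bounded_by_def
 proof (intro allI impI)
  fix j :: int and l assume "l < r"
  have "j mod 2 \<in> {0, 1}" by auto
  then consider "j mod 2 = 0" | "j mod 2 = 1" by auto
  then show "cmod (C (Suc n) u j l) \<le> K"
   using * \<open>l < r\<close> by cases (auto simp: bounded_by_def)
 qed
qed

lemma bounded_by_mono: "bounded_by K u ==> K \<le> K' ==> bounded_by K' u"
 unfolding bounded_by_def by (meson order_trans)

lemma ex_bounded_by:
 assumes "fsupp u" shows "\<exists>K\<ge>0. bounded_by K (C n u)"
 using assms
proof (induction n arbitrary: u)
 case 0
 then obtain L where L: "supp_in L u" by (auto simp: fsupp_def)
 define K where "K = (\<Sum>j\<in>{-L..L}. \<Sum>l<r. cmod (u j l))"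
 have "cmod (u j l) \<le> K" if "l < r" for j l
 proof (cases "\<bar>j\<bar> \<le> L")
  case True
  have "cmod (u j l) \<le> (\<Sum>l<r. cmod (u j l))"
   using that by (intro member_le_sum) auto
  also have "... \<le> K"
   unfolding K_def using True by (intro member_le_sum[of j "{-L..L}" "\<lambda>j. \<Sum>l<r. cmod (u j l)"]) (auto intro: sum_nonneg)
  finally show ?thesis .
 next
  case False
  then have "u j l = 0" using L that by (auto simp: supp_in_def)
  then show ?thesis by (auto simp: K_def intro!: sum_nonneg)
 qed
 then have "bounded_by K (C 0 u)" by (auto simp: bounded_by_def)
 moreover have "0 \<le> K" by (auto simp: K_def intro!: sum_nonneg)
 ultimately show ?case by blast
next
 case (Suc n)
 obtain L where L: "L \<ge> N" "supp_in L u" using Suc.prems fsupp_large[of u N] by auto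
 then have f: "fsupp (T e u)" if "e \<in> {0,1}" for e
  using supp_in_T that by (auto simp: fsupp_def)
 obtain K0 where K0: "0 \<le> K0" "bounded_by K0 (C n (T 0 u))" using Suc.IH[OF f[of 0]] by auto
 obtain K1 where K1: "0 \<le> K1" "bounded_by K1 (C n (T 1 u))" using Suc.IH[OF f[of 1]] by auto
 have "bounded_by (max K0 K1) (C (Suc n) u)"
  unfolding bounded_by_C_Suc using bounded_by_mono[OF K0(2)] bounded_by_mono[OF K1(2)] by auto
 moreover have "0 \<le> max K0 K1" using K0(1) by simp
 ultimately show ?case by blast
qed

end

text \<open>The normalisation \<open>v_hat\<close> of the matching filter is the one forced by the Hermite
 structure: the symbol of \<open>v\<close> takes the value \<open>(1, 0, ..., 0)\<close> at the origin.\<close>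

locale sum_rule_mask = mask +
 fixes v :: "int => nat => complex" and m :: nat
 assumes v_supp: "!!k l. N < \<bar>k\<bar> ==> v k l = 0"
  and v_hat: "!!l. l < r ==> (\<Sum>j\<in>{-N..N}. v j l) = (if l = 0 then 1 else 0)"
  and sum_rule: "!!p l'. p \<le> m ==> l' < r ==>
   (\<Sum>j\<in>{-N..N}. \<Sum>i\<in>{-N..N}. \<Sum>l<r. v j l * a i l l' * (2 * of_int j + of_int i) ^ p) = (\<Sum>j\<in>{-N..N}. v j l' * of_int j ^ p)"
  and sum_rule_alt: "!!p l'. p \<le> m ==> l' < r ==>
   (\<Sum>j\<in>{-N..N}. \<Sum>i\<in>{-N..N}. \<Sum>l<r. v j l * a i l l' * (-1) powi i * (2 * of_int j + of_int i) ^ p) = 0"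
begin

text \<open>The p-th power moment of the scalar sequence v * u about the point -c. For c = 0 it is,
  up to the factor (-i)^p, the p-th derivative at the origin of the product of the two symbols. The
  free centre absorbs translations, digits and, later, sampling offsets.\<close>

definition M :: "nat => complex => (int => nat => complex) => complex" where
 "M p c u = (\<Sum>j\<in>{-N..N}. \<Sum>l<r. v j l * zsum (\<lambda>k. (of_int j + of_int k + c) ^ p * u k l))"

lemma M_cong: "(!!k l. l < r ==> u k l = w k l) ==> M p c u = M p c w"
 by (auto simp: M_def intro!: sum.cong)

lemma M_sum:
 assumes "finite S" "!!i. i \<in> S ==> fsupp (u i)"
 shows "M p c (\<lambda>k l. \<Sum>i\<in>S. x i * u i k l) = (\<Sum>i\<in>S. x i * M p c (u i))"
proof -
 have "zsum (\<lambda>k. (of_int j + of_int k + c) ^ p * (\<Sum>i\<in>S. x i * u i k l))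
   = (\<Sum>i\<in>S. x i * zsum (\<lambda>k. (of_int j + of_int k + c) ^ p * u i k l))" if "l < r" for j l
 proof -
  have "zsum (\<lambda>k. (of_int j + of_int k + c) ^ p * (\<Sum>i\<in>S. x i * u i k l))
    = zsum (\<lambda>k. \<Sum>i\<in>S. x i * (of_int j + of_int k + c) ^ p * u i k l)"
   by (simp add: sum_distrib_left mult_ac)
  also have "... = (\<Sum>i\<in>S. zsum (\<lambda>k. x i * (of_int j + of_int k + c) ^ p * u i k l))"
   using assms that by (intro zsum_sum fsupp_finite) auto
  finally show ?thesis by (simp add: zsum_cmult mult.assoc)
 qed
 then have "M p c (\<lambda>k l. \<Sum>i\<in>S. x i * u i k l) = (\<Sum>j\<in>{-N..N}. \<Sum>l<r. \<Sum>i\<in>S. x i * (v j l * zsum (\<lambda>k. (of_int j + of_int k + c) ^ p * u i k l)))"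
  unfolding M_def by (intro sum.cong refl) (simp add: sum_distrib_left mult_ac)
 also have "... = (\<Sum>j\<in>{-N..N}. \<Sum>i\<in>S. \<Sum>l<r. x i * (v j l * zsum (\<lambda>k. (of_int j + of_int k + c) ^ p * u i k l)))"
  by (intro sum.cong refl sum.swap)
 also have "... = (\<Sum>i\<in>S. \<Sum>j\<in>{-N..N}. \<Sum>l<r. x i * (v j l * zsum (\<lambda>k. (of_int j + of_int k + c) ^ p * u i k l)))"
  by (rule sum.swap)
 finally show ?thesis by (simp add: M_def sum_distrib_left)
qed

lemma M_lincomb:
 assumes "fsupp u" "fsupp w"
 shows "M p c (\<lambda>k l. \<alpha> * u k l + \<beta> * w k l) = \<alpha> * M p c u + \<beta> * M p c w"
 using M_sum[of "UNIV :: bool set" "\<lambda>b. if b then u else w" p c "\<lambda>b. if b then \<alpha> else \<beta>"] assms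
 by (simp add: UNIV_bool add.commute fun_eq_iff)

lemma M_shift: "M p c (\<lambda>k. u (k - t)) = M p (c + of_int t) u"
proof -
 have "zsum (\<lambda>k. (of_int j + of_int k + c) ^ p * u (k - t) l) = zsum (\<lambda>k. (of_int j + of_int k + (c + of_int t)) ^ p * u k l)" for j l
  using zsum_shift[of "\<lambda>k. (of_int j + of_int k + c) ^ p * u (k - t) l" t] by (simp add: algebra_simps)
 then show ?thesis by (simp add: M_def)
qed

lemma M_binomial_add:
 assumes "fsupp u"
 shows "M p (d + c) u = (\<Sum>s\<le>p. of_nat (p choose s) * c ^ (p - s) * M s d u)"
proof -
 have "zsum (\<lambda>k. (of_int j + of_int k + (d + c)) ^ p * u k l)
   = (\<Sum>s\<le>p. of_nat (p choose s) * c ^ (p - s) * zsum (\<lambda>k. (of_int j + of_int k + d) ^ s * u k l))" if "l < r" for j l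
 proof -
  have "(of_int j + of_int k + (d + c)) ^ p * u k l = (\<Sum>s\<le>p. of_nat (p choose s) * c ^ (p - s) * (of_int j + of_int k + d) ^ s * u k l)" for k
   unfolding add.assoc[symmetric]
   by (subst binomial_ring) (simp add: sum_distrib_right sum_distrib_left mult_ac)
  then have "zsum (\<lambda>k. (of_int j + of_int k + (d + c)) ^ p * u k l) = (\<Sum>s\<le>p. zsum (\<lambda>k. of_nat (p choose s) * c ^ (p - s) * (of_int j + of_int k + d) ^ s * u k l))"
   using assms that by (simp only:) (intro zsum_sum fsupp_finite, auto)
  then show ?thesis by (simp add: zsum_cmult mult.assoc)
 qed
 then have "M p (d + c) u = (\<Sum>j\<in>{-N..N}. \<Sum>l<r. \<Sum>s\<le>p. of_nat (p choose s) * c ^ (p - s) * (v j l * zsum (\<lambda>k. (of_int j + of_int k + d) ^ s * u k l)))"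
  unfolding M_def by (intro sum.cong refl) (simp add: sum_distrib_left mult_ac)
 also have "... = (\<Sum>j\<in>{-N..N}. \<Sum>s\<le>p. \<Sum>l<r. of_nat (p choose s) * c ^ (p - s) * (v j l * zsum (\<lambda>k. (of_int j + of_int k + d) ^ s * u k l)))"
  by (intro sum.cong refl sum.swap)
 also have "... = (\<Sum>s\<le>p. \<Sum>j\<in>{-N..N}. \<Sum>l<r. of_nat (p choose s) * c ^ (p - s) * (v j l * zsum (\<lambda>k. (of_int j + of_int k + d) ^ s * u k l)))"
  by (rule sum.swap)
 finally show ?thesis by (simp add: M_def sum_distrib_left)
qed

lemma M_binomial:
 assumes "fsupp u"
 shows "M p c u = (\<Sum>s\<le>p. of_nat (p choose s) * c ^ (p - s) * M s 0 u)"
 using M_binomial_add[OF assms, of p 0 c] by simp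

text \<open>By the binomial theorem, sum rules of all orders up to \<open>p\<close> about 0 combine
  to a sum rule about any centre. \<open>M_T\<close> needs a centre that depends on the position in
  \<open>u\<close>.\<close>

lemma sum_rule_translate:
 assumes "p \<le> m" "l' < r"
 shows "(\<Sum>j\<in>{-N..N}. \<Sum>i\<in>{-N..N}. \<Sum>l<r. v j l * a i l l' * ((2 * of_int j + of_int i) + c) ^ p)
   = (\<Sum>j\<in>{-N..N}. v j l' * (of_int j + c) ^ p)" (is ?A)
  and "(\<Sum>j\<in>{-N..N}. \<Sum>i\<in>{-N..N}. \<Sum>l<r. v j l * a i l l' * (-1) powi i * ((2 * of_int j + of_int i) + c) ^ p) = 0" (is ?B)
proof -
 have *: "(\<Sum>j\<in>{-N..N}. \<Sum>i\<in>{-N..N}. \<Sum>l<r. f j i l * ((2 * of_int j + of_int i) + c) ^ p)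
   = (\<Sum>s\<le>p. of_nat (p choose s) * c ^ (p - s) * (\<Sum>j\<in>{-N..N}. \<Sum>i\<in>{-N..N}. \<Sum>l<r. f j i l * (2 * of_int j + of_int i) ^ s))" for f :: "int => int => nat => complex"
 proof -
  have "(\<Sum>j\<in>{-N..N}. \<Sum>i\<in>{-N..N}. \<Sum>l<r. f j i l * ((2 * of_int j + of_int i) + c) ^ p)
   = (\<Sum>x\<in>{-N..N}\<times>{-N..N}\<times>{..<r}. f (fst x) (fst (snd x)) (snd (snd x)) * (of_int (2 * fst x + fst (snd x)) + c) ^ p)"
   by (simp add: sum_pairs)
  also have "... = (\<Sum>x\<in>{-N..N}\<times>{-N..N}\<times>{..<r}. \<Sum>s\<le>p. of_nat (p choose s) * c ^ (p - s) * (f (fst x) (fst (snd x)) (snd (snd x)) * of_int (2 * fst x + fst (snd x)) ^ s))"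
   by (intro sum.cong refl, subst binomial_ring) (simp add: sum_distrib_left mult_ac)
  also have "... = (\<Sum>s\<le>p. \<Sum>x\<in>{-N..N}\<times>{-N..N}\<times>{..<r}. of_nat (p choose s) * c ^ (p - s) * (f (fst x) (fst (snd x)) (snd (snd x)) * of_int (2 * fst x + fst (snd x)) ^ s))"
   by (rule sum.swap)
  finally show ?thesis by (simp add: sum_pairs sum_distrib_left)
 qed
 have "(\<Sum>j\<in>{-N..N}. v j l' * (of_int j + c) ^ p) = (\<Sum>j\<in>{-N..N}. \<Sum>s\<le>p. of_nat (p choose s) * c ^ (p - s) * (v j l' * of_int j ^ s))"
  by (intro sum.cong refl, subst binomial_ring) (simp add: sum_distrib_left mult_ac)
 also have "... = (\<Sum>s\<le>p. \<Sum>j\<in>{-N..N}. of_nat (p choose s) * c ^ (p - s) * (v j l' * of_int j ^ s))"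
  by (rule sum.swap)
 finally show ?A
  using sum_rule assms by (simp add: * sum_distrib_left)
 show ?B using sum_rule_alt assms by (simp add: *)
qed

text \<open>The sum rules say that the transition operators act on moments like dyadic scaling.\<close>

lemma M_T:
 assumes "fsupp u" "p \<le> m"
 shows "M p c (T e u) = (1 / 2) ^ (p + 1) * M p (2 * c - of_int e) u"
proof -
 \<comment> \<open>The indicator of the even integers is written as half of 1 plus a sign. The
   constant half is then governed by the sum rule at 0, and the alternating half is killed by the
   sum rule at pi.\<close>
 define P where "P i j n l' l = v j l * (a i l l' * ((1 / 2) ^ p * ((2 * of_int j + of_int i) + (of_int n + 2 * c - of_int e)) ^ p * ((1 + (-1) powi (n - e) * (-1) powi i) / 2)))" for i j n l' l
 have split: "x * (y * (h * X * ((1 + s * t) / 2))) = h * (1 / 2) * (x * y * X) + h * (1 / 2) * s * (x * y * t * X)"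
  for x y h X s t :: complex
  by (simp add: field_simps)
 have fin: "finite {k. f k * u (2 * k + t) l' ~= 0}" if l': "l' < r" for f l' t
 proof -
  have "(\<lambda>k. 2 * k + t) ` {k. f k * u (2 * k + t) l' ~= 0} \<subseteq> {n. 1 * u n l' ~= 0}"
   by auto
  then have "finite ((\<lambda>k. 2 * k + t) ` {k. f k * u (2 * k + t) l' ~= 0})"
   by (rule finite_subset) (rule fsupp_finite[OF assms(1) l'])
  then show ?thesis by (rule finite_imageD) (auto simp: inj_on_def)
 qed
 have 1: "zsum (\<lambda>k. (of_int j + of_int k + c) ^ p * T e u k l)
   = (\<Sum>i\<in>{-N..N}. \<Sum>l'<r. a i l l' * zsum (\<lambda>k. (of_int j + of_int k + c) ^ p * u (2 * k + e - i) l'))" for j l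
 proof -
  have "X * T e u k l = (\<Sum>x\<in>{-N..N}\<times>{..<r}. a (fst x) l (snd x) * X * u (2 * k + (e - fst x)) (snd x))" for X k
   unfolding T_def sum.cartesian_product sum_distrib_left
   by (intro sum.cong refl) (auto simp: add_diff_eq)
  then have "zsum (\<lambda>k. (of_int j + of_int k + c) ^ p * T e u k l)
    = (\<Sum>x\<in>{-N..N}\<times>{..<r}. zsum (\<lambda>k. a (fst x) l (snd x) * (of_int j + of_int k + c) ^ p * u (2 * k + (e - fst x)) (snd x)))"
   by (simp only:) (intro zsum_sum fin, auto)
  also have "... = (\<Sum>x\<in>{-N..N}\<times>{..<r}. a (fst x) l (snd x) * zsum (\<lambda>k. (of_int j + of_int k + c) ^ p * u (2 * k + e - fst x) (snd x)))"
   by (simp only: mult.assoc zsum_cmult add_diff_eq)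
  finally show ?thesis
   by (simp add: sum_pairs)
 qed
 have 2: "zsum (\<lambda>k. (of_int j + of_int k + c) ^ p * u (2 * k + e - i) l')
   = zsum (\<lambda>n. (1 / 2) ^ p * ((2 * of_int j + of_int i) + (of_int n + 2 * c - of_int e)) ^ p * ((1 + (-1) powi (n - e) * (-1) powi i) / 2) * u n l')" for i j l'
 proof -
  define f where "f n = ((1 / 2) ^ p * ((2 * of_int j + of_int i) + (of_int n + 2 * c - of_int e)) ^ p) * u n l'" for n :: int
  have "(of_int j + of_int k + c) ^ p * u (2 * k + e - i) l' = f (2 * k + (e - i))" for k
  proof -
   have *: "(2 * of_int j + of_int i) + (of_int (2 * k + (e - i)) + 2 * c - of_int e) = 2 * (of_int j + of_int k + c)" by simp
   show ?thesis unfolding f_def * power_mult_distrib by (simp add: power_divide add_diff_eq)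
  qed
  then have "zsum (\<lambda>k. (of_int j + of_int k + c) ^ p * u (2 * k + e - i) l') = zsum (\<lambda>n. if even (n - (e - i)) then f n else 0)"
   by (simp add: zsum_stride)
  also have "... = zsum (\<lambda>n. (1 + (-1) powi (n - e) * (-1) powi i) / 2 * f n)"
  proof -
   have "(\<lambda>n. if even (n - (e - i)) then f n else 0) = (\<lambda>n. (1 + (-1) powi (n - e) * (-1) powi i) / 2 * f n)"
    by (auto simp: power_int_minus_left fun_eq_iff)
   then show ?thesis by (rule arg_cong)
  qed
  finally show ?thesis by (simp only: f_def mult.assoc mult.commute mult.left_commute)
 qed
 have "M p c (T e u) = (\<Sum>j\<in>{-N..N}. \<Sum>l<r. \<Sum>i\<in>{-N..N}. \<Sum>l'<r. zsum (\<lambda>n. P i j n l' l * u n l'))"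
  unfolding M_def 1 2 sum_distrib_left by (intro sum.cong refl) (simp only: P_def mult.assoc zsum_cmult)
 also have "... = (\<Sum>x\<in>{-N..N}\<times>{..<r}\<times>{-N..N}\<times>{..<r}. zsum (\<lambda>n. P (fst (snd (snd x))) (fst x) n (snd (snd (snd x))) (fst (snd x)) * u n (snd (snd (snd x)))))"
  by (simp add: sum_pairs)
 also have "... = (\<Sum>x\<in>{..<r}\<times>{-N..N}\<times>{-N..N}\<times>{..<r}. zsum (\<lambda>n. P (fst (snd (snd x))) (fst (snd x)) n (fst x) (snd (snd (snd x))) * u n (fst x)))"
  by (rule sum.reindex_bij_witness[of _ "\<lambda>(l',j,i,l). (j,l,i,l')" "\<lambda>(j,l,i,l'). (l',j,i,l)"]) auto
 also have "... = (\<Sum>l'<r. \<Sum>y\<in>{-N..N}\<times>{-N..N}\<times>{..<r}. zsum (\<lambda>n. P (fst (snd y)) (fst y) n l' (snd (snd y)) * u n l'))"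
  by (simp add: sum_pairs)
 also have "... = (\<Sum>l'<r. zsum (\<lambda>n. \<Sum>y\<in>{-N..N}\<times>{-N..N}\<times>{..<r}. P (fst (snd y)) (fst y) n l' (snd (snd y)) * u n l'))"
  using fsupp_finite[OF assms(1)] by (intro sum.cong refl zsum_sum[symmetric]) auto
 also have "... = (\<Sum>l'<r. zsum (\<lambda>n. (\<Sum>j\<in>{-N..N}. \<Sum>i\<in>{-N..N}. \<Sum>l<r. P i j n l' l) * u n l'))"
  by (simp add: sum_pairs sum_distrib_right)
 also have "... = (\<Sum>l'<r. zsum (\<lambda>n. (1 / 2) ^ (p + 1) * (\<Sum>j\<in>{-N..N}. v j l' * (of_int j + of_int n + (2 * c - of_int e)) ^ p) * u n l'))"
 proof (rule sum.cong[OF refl])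
  fix l' assume l': "l' \<in> {..<r}"
  have *: "(\<Sum>j\<in>{-N..N}. \<Sum>i\<in>{-N..N}. \<Sum>l<r. P i j n l' l)
    = (1 / 2) ^ (p + 1) * (\<Sum>j\<in>{-N..N}. \<Sum>i\<in>{-N..N}. \<Sum>l<r. v j l * a i l l' * ((2 * of_int j + of_int i) + (of_int n + 2 * c - of_int e)) ^ p)
    + (1 / 2) ^ (p + 1) * (-1) powi (n - e) * (\<Sum>j\<in>{-N..N}. \<Sum>i\<in>{-N..N}. \<Sum>l<r. v j l * a i l l' * (-1) powi i * ((2 * of_int j + of_int i) + (of_int n + 2 * c - of_int e)) ^ p)" for n
   unfolding sum_distrib_left sum.distrib[symmetric] P_def
   by (intro sum.cong refl) (simp only: power_add power_one_right split)
  have "(\<Sum>j\<in>{-N..N}. \<Sum>i\<in>{-N..N}. \<Sum>l<r. P i j n l' l) = (1 / 2) ^ (p + 1) * (\<Sum>j\<in>{-N..N}. v j l' * (of_int j + (of_int n + 2 * c - of_int e)) ^ p)" for n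
   using l' by (simp only: * sum_rule_translate[OF assms(2), of l'] lessThan_iff mult_zero_right add_0_right)
  then show "zsum (\<lambda>n. (\<Sum>j\<in>{-N..N}. \<Sum>i\<in>{-N..N}. \<Sum>l<r. P i j n l' l) * u n l')
    = zsum (\<lambda>n. (1 / 2) ^ (p + 1) * (\<Sum>j\<in>{-N..N}. v j l' * (of_int j + of_int n + (2 * c - of_int e)) ^ p) * u n l')"
   by (simp only: add.assoc add_diff_eq)
 qed
 also have "... = (\<Sum>l'<r. \<Sum>j\<in>{-N..N}. zsum (\<lambda>n. (1 / 2) ^ (p + 1) * v j l' * (of_int j + of_int n + (2 * c - of_int e)) ^ p * u n l'))"
 proof (rule sum.cong[OF refl])
  fix l' assume l': "l' \<in> {..<r}"
  show "zsum (\<lambda>n. (1 / 2) ^ (p + 1) * (\<Sum>j\<in>{-N..N}. v j l' * (of_int j + of_int n + (2 * c - of_int e)) ^ p) * u n l')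
    = (\<Sum>j\<in>{-N..N}. zsum (\<lambda>n. (1 / 2) ^ (p + 1) * v j l' * (of_int j + of_int n + (2 * c - of_int e)) ^ p * u n l'))"
   unfolding sum_distrib_left sum_distrib_right mult.assoc[symmetric]
   by (rule zsum_sum, simp, rule fsupp_finite[OF assms(1)]) (use l' in simp)
 qed
 also have "... = (\<Sum>j\<in>{-N..N}. \<Sum>l'<r. zsum (\<lambda>n. (1 / 2) ^ (p + 1) * v j l' * (of_int j + of_int n + (2 * c - of_int e)) ^ p * u n l'))"
  by (rule sum.swap)
 finally show ?thesis
  by (simp only: M_def sum_distrib_left zsum_cmult mult.assoc)
qed

end

section \<open>Decay on the spaces of vanishing moments\<close>

context mask
begin

lemma C_0 [simp]: "C 0 u = u"
 by (simp add: fun_eq_iff)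

definition delta :: "int => nat => int => nat => complex" where
 "delta k1 l1 k l = (if k = k1 \<and> l = l1 then 1 else 0)"

lemma fsupp_delta: "fsupp (delta k l)"
 by (auto simp: fsupp_def supp_in_def delta_def intro!: exI[of _ "\<bar>k\<bar>"])

lemma fsupp_sum:
 assumes "finite S" "!!i. i \<in> S ==> fsupp (u i)"
 shows "fsupp (\<lambda>k l. \<Sum>i\<in>S. c i * u i k l)"
proof -
 have "\<forall>i\<in>S. \<exists>L. supp_in L (u i)" using assms by (auto simp: fsupp_def)
 then obtain L where L: "!!i. i \<in> S ==> supp_in (L i) (u i)" by metis
 have "supp_in (Max (L ` S)) (u i)" if "i \<in> S" for i
  using L[OF that] assms(1) that by (auto intro: supp_in_mono)
 then have "supp_in (Max (L ` S)) (\<lambda>k l. \<Sum>i\<in>S. c i * u i k l)"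
  by (auto simp: supp_in_def)
 then show ?thesis by (auto simp: fsupp_def)
qed

lemma fsupp_lincomb: "fsupp u ==> fsupp w ==> fsupp (\<lambda>k l. \<alpha> * u k l + \<beta> * w k l)"
 using fsupp_sum[of "UNIV :: bool set" "\<lambda>b. if b then u else w" "\<lambda>b. if b then \<alpha> else \<beta>"]
 by (simp add: UNIV_bool add.commute fun_eq_iff)

lemma fsupp_shift:
 assumes "fsupp u" shows "fsupp (\<lambda>k. u (k - t))"
proof -
 obtain L where "supp_in L u" using assms by (auto simp: fsupp_def)
 then have "supp_in (L + \<bar>t\<bar>) (\<lambda>k. u (k - t))" by (auto simp: supp_in_def)
 then show ?thesis by (auto simp: fsupp_def)
qed

lemma fsupp_T:
 assumes "fsupp u" "e \<in> {0, 1}" shows "fsupp (T e u)"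
proof -
 obtain L where "N \<le> L" "supp_in L u" using assms fsupp_large[of u N] by auto
 then show ?thesis using supp_in_T assms(2) by (auto simp: fsupp_def)
qed

lemma fsupp_cong: "fsupp u ==> (!!k l. l < r ==> u k l = w k l) ==> fsupp w"
 by (auto simp: fsupp_def supp_in_def)

text \<open>The first \<open>n\<close> digits turn \<open>w\<close> into other members of
  \<open>W\<close>, each of size \<open>K\<close> by assumption; the contraction over the next
  \<open>n0\<close> digits applies to every one of them.\<close>

lemma bounded_by_C_shift_digits:
 assumes "!!w K. W w ==> bounded_by K w ==> bounded_by (\<theta> * K) (C n0 w)"
  and "!!w e. W w ==> e \<in> {0, 1} ==> W (T e w)"
  and "W w" "bounded_by K (C n w)"
 shows "bounded_by (\<theta> * K) (C (n + n0) w)"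
 using assms(3,4)
proof (induction n arbitrary: w)
 case 0
 then show ?case using assms(1) by simp
next
 case (Suc n)
 show ?case
  unfolding add_Suc bounded_by_C_Suc
 proof
  fix e :: int assume e: "e \<in> {0, 1}"
  show "bounded_by (\<theta> * K) (C (n + n0) (T e w))"
   by (rule Suc.IH[OF assms(2)[OF Suc.prems(1) e]]) (use Suc.prems(2)[unfolded bounded_by_C_Suc] e in auto)
 qed
qed

text \<open>A submultiplicativity argument: one contraction by \<open>\<theta>\<close> after \<open>n0\<close> steps gives geometric decay.\<close>

lemma geometric_from_contraction:
 assumes contr: "!!w K. W w ==> bounded_by K w ==> bounded_by (\<theta> * K) (C n0 w)"
  and inv: "!!w e. W w ==> e \<in> {0, 1} ==> W (T e w)"
  and "W u" "fsupp u" "0 < \<theta>" "\<theta> < 1" "0 < n0"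
 obtains K where "0 \<le> K" "!!n. bounded_by (K * root n0 \<theta> ^ n) (C n u)"
proof -
 define q where "q = root n0 \<theta>"
 have q: "0 < q" "q < 1" "q ^ n0 = \<theta>"
  using assms by (auto simp: q_def real_root_pow_pos2)
 have "\<exists>K. 0 \<le> K \<and> bounded_by K (C n u)" for n
  using ex_bounded_by[OF \<open>fsupp u\<close>, of n] by simp
 then obtain B where B: "!!n. 0 \<le> B n" "!!n. bounded_by (B n) (C n u)" by metis
 \<comment> \<open>Dividing by \<open>\<theta>\<close> covers the first \<open>n0\<close> steps,
   where the claimed factor q^n is at least q^n0 = \<open>\<theta>\<close>.\<close>
 define K where "K = (\<Sum>n<n0. B n) / \<theta>"
 have K: "0 \<le> K" using B(1) \<open>0 < \<theta>\<close> by (auto simp: K_def intro!: divide_nonneg_pos sum_nonneg)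
 have "bounded_by (K * q ^ n) (C n u)" for n
 proof (induction n rule: less_induct)
  case (less n)
  show ?case
  proof (cases "n < n0")
   case True
   have "B n \<le> (\<Sum>n<n0. B n)" using B(1) True by (intro member_le_sum) auto
   moreover have "\<theta> \<le> q ^ n" using q True power_decreasing[of n n0 q] by simp
   then have "K * \<theta> \<le> K * q ^ n" using K by (rule mult_left_mono)
   moreover have "K * \<theta> = (\<Sum>n<n0. B n)" using \<open>0 < \<theta>\<close> by (simp add: K_def)
   ultimately show ?thesis using bounded_by_mono[OF B(2)] by simp
  next
   case False
   then have n: "n - n0 + n0 = n" "n - n0 < n" using \<open>0 < n0\<close> by auto
   have "bounded_by (\<theta> * (K * q ^ (n - n0))) (C (n - n0 + n0) u)"
    by (rule bounded_by_C_shift_digits[OF contr inv \<open>W u\<close> less[OF n(2)]]) auto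
   moreover have "\<theta> * (K * q ^ (n - n0)) = K * q ^ n"
    using n(1) q(3) by (metis mult.assoc mult.commute power_add)
   ultimately show ?thesis using n(1) by simp
  qed
 qed
 then show ?thesis using that K by (auto simp: q_def)
qed

text \<open>The linear span of the integer shifts of \<open>B\<close>, with sequences identified
  when their rows below \<open>r\<close> agree. The inductive form provides induction over linear
  combinations directly.\<close>

inductive shift_span :: "(int => nat => complex) set => (int => nat => complex) => bool" for B where
 zero: "(!!k l. l < r ==> u k l = 0) ==> shift_span B u"
| step: "shift_span B w ==> b \<in> B ==> (!!k l. l < r ==> u k l = c * b (k - t) l + w k l) ==> shift_span B u"

lemma shift_span_cong: "shift_span B u ==> (!!k l. l < r ==> u k l = w k l) ==> shift_span B w"
proof (induction arbitrary: w rule: shift_span.induct)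
 case (zero u)
 show ?case by (rule shift_span.zero) (simp add: zero(1) flip: zero(2))
next
 case (step w' b u c t)
 show ?case
  by (rule shift_span.step[OF step.hyps(1,2)]) (simp add: step.hyps(3) flip: step.prems)
qed

lemma shift_span_add: "shift_span B u ==> shift_span B w ==> shift_span B (\<lambda>k l. u k l + w k l)"
proof (induction rule: shift_span.induct)
 case (zero u)
 show ?case by (rule shift_span_cong[OF zero(2)]) (simp add: zero(1))
next
 case (step w' b u c t)
 show ?case by (rule shift_span.step[OF step.IH[OF step.prems] step.hyps(2), of _ c t]) (simp add: step.hyps(3))
qed

lemma shift_span_scale: "shift_span B u ==> shift_span B (\<lambda>k l. x * u k l)"
proof (induction rule: shift_span.induct)
 case (zero u)
 show ?case by (rule shift_span.zero) (simp add: zero(1))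
next
 case (step w' b u c t)
 show ?case by (rule shift_span.step[OF step.IH step.hyps(2), of _ "x * c" t]) (simp add: step.hyps(3) algebra_simps)
qed

lemma shift_span_base: "b \<in> B ==> shift_span B (\<lambda>k. b (k - t))"
 by (rule shift_span.step[OF shift_span.zero[of "\<lambda>_ _. 0" B], of b _ 1 t]) auto

lemma fsupp_shift_span: "shift_span B u ==> (!!b. b \<in> B ==> fsupp b) ==> fsupp u"
proof (induction rule: shift_span.induct)
 case (step w' b u c t)
 have "fsupp (\<lambda>k l. c * b (k - t) l + 1 * w' k l)"
  by (intro fsupp_lincomb fsupp_shift step.prems step.hyps(2) step.IH)
 then show ?case by (rule fsupp_cong) (simp add: step.hyps(3))
qed (auto simp: fsupp_def supp_in_def)

lemma delta_expansion:
 assumes "supp_in L u" "l < r"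
 shows "(\<Sum>x\<in>{-L..L} \<times> {..<r}. u (fst x) (snd x) * delta (fst x) (snd x) k l) = u k l"
proof -
 have "(\<Sum>x\<in>{-L..L} \<times> {..<r}. u (fst x) (snd x) * delta (fst x) (snd x) k l)
   = (\<Sum>x\<in>{-L..L} \<times> {..<r}. if x = (k, l) then u k l else 0)"
  by (intro sum.cong refl) (auto simp: delta_def)
 also have "... = (if (k, l) \<in> {-L..L} \<times> {..<r} then u k l else 0)"
  by (rule sum.delta) simp
 also have "... = u k l"
  using assms by (cases "\<bar>k\<bar> \<le> L") (auto simp: supp_in_def)
 finally show ?thesis .
qed

lemma shift_span_deltas:
 assumes "fsupp u" shows "shift_span ((\<lambda>l. delta 0 l) ` {..<r}) u"
proof -
 obtain L where L: "supp_in L u" using assms by (auto simp: fsupp_def)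
 define w where "w S k l = (\<Sum>s\<in>S. u (fst s) (snd s) * delta 0 (snd s) (k - fst s) l)" for S and k :: int and l :: nat
 have span_w: "shift_span ((\<lambda>l. delta 0 l) ` {..<r}) (w S)" if "finite S" "S \<subseteq> UNIV \<times> {..<r}" for S
  using that
 proof (induction S rule: finite_induct)
  case empty
  show ?case by (rule shift_span.zero) (simp add: w_def)
 next
  case (insert s S)
  have "snd s \<in> {..<r}" using insert.prems by (simp add: mem_Times_iff)
  then have "delta 0 (snd s) \<in> (\<lambda>l. delta 0 l) ` {..<r}" by (rule imageI)
  moreover have "shift_span ((\<lambda>l. delta 0 l) ` {..<r}) (w S)" using insert by simp
  moreover have "w (insert s S) k l = u (fst s) (snd s) * delta 0 (snd s) (k - fst s) l + w S k l" for k l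
   using insert.hyps by (simp add: w_def)
  ultimately show ?case by (intro shift_span.step[of _ "w S" "delta 0 (snd s)" "w (insert s S)" "u (fst s) (snd s)" "fst s"])
 qed
 have "shift_span ((\<lambda>l. delta 0 l) ` {..<r}) (w ({-L..L} \<times> {..<r}))"
  by (rule span_w) auto
 then show ?thesis
 proof (rule shift_span_cong)
  fix k l assume "l < r"
  have "w ({-L..L} \<times> {..<r}) k l = (\<Sum>x\<in>{-L..L} \<times> {..<r}. u (fst x) (snd x) * delta (fst x) (snd x) k l)"
   unfolding w_def by (intro sum.cong refl) (auto simp: delta_def)
  also have "... = u k l" using L \<open>l < r\<close> by (rule delta_expansion)
  finally show "w ({-L..L} \<times> {..<r}) k l = u k l" .
 qed
qed

end

section \<open>The filtration by vanishing moments\<close>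

context sum_rule_mask
begin

text \<open>The index counts vanishing moments, of orders 0 to n - 1; the space attached to M in the
  definition of the smoothness exponent is \<open>V (M + 1)\<close>.\<close>

definition V :: "nat => (int => nat => complex) => bool" where
 "V n u \<longleftrightarrow> fsupp u \<and> (\<forall>p<n. M p 0 u = 0)"

lemma V_fsupp: "V n u ==> fsupp u"
 by (simp add: V_def)

lemma V_mono: "V n u ==> k \<le> n ==> V k u"
 by (auto simp: V_def)

lemma V_Suc: "V (Suc n) u \<longleftrightarrow> V n u \<and> M n 0 u = 0"
 by (auto simp: V_def less_Suc_eq)

lemma V_lincomb: "V n u ==> V n w ==> V n (\<lambda>k l. \<alpha> * u k l + \<beta> * w k l)"
 by (auto simp: V_def M_lincomb fsupp_lincomb)

lemma V_cong:
 assumes "V n u" "!!k l. l < r ==> u k l = w k l"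
 shows "V n w"
 unfolding V_def
proof (intro conjI allI impI)
 show "fsupp w" by (rule fsupp_cong[of u]) (use assms in \<open>auto simp: V_def\<close>)
 fix p assume "p < n"
 have "M p 0 w = M p 0 u" by (rule M_cong) (simp add: assms(2))
 then show "M p 0 w = 0" using \<open>p < n\<close> assms(1) by (simp add: V_def)
qed

text \<open>Recentring a moment adds only moments of lower order, and these vanish. Hence the first
  possibly nonzero moment does not depend on the centre: it is a shift invariant functional on
  \<open>V n\<close> with kernel \<open>V (Suc n)\<close>.\<close>

lemma M_V:
 assumes "V n u" "p \<le> n"
 shows "M p c u = (if p = n then M n 0 u else 0)"
proof -
 have "M p c u = (\<Sum>s\<le>p. if s = n then M n 0 u else 0)"
  by (subst M_binomial[OF V_fsupp[OF assms(1)]], rule sum.cong) (use assms in \<open>auto simp: V_def\<close>)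
 then show ?thesis using assms(2) by (simp add: sum.delta)
qed

lemma M_V_lower: "V n u ==> p < n ==> M p c u = 0"
 using M_V[of n u p c] by simp

lemma M_V_top: "V n u ==> M n c u = M n 0 u"
 using M_V[of n u n c] by simp

lemma V_shift: "V n u ==> V n (\<lambda>k. u (k - t))"
 unfolding V_def[of n "\<lambda>k. u (k - t)"] by (simp add: M_shift M_V_lower V_fsupp fsupp_shift)

lemma V_T: "V n u ==> n \<le> m + 1 ==> e \<in> {0, 1} ==> V n (T e u)"
 unfolding V_def[of n "T e u"] by (simp add: fsupp_T V_fsupp M_T M_V_lower del: insert_iff)

lemma M_T_top: "V n u ==> n \<le> m ==> M n 0 (T e u) = (1 / 2) ^ (n + 1) * M n 0 u"
 using M_V_top[of n u "- of_int e"] by (simp add: M_T V_fsupp)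

fun diff_power :: "nat => int => nat => complex" where
 "diff_power 0 = delta 0 0"
| "diff_power (Suc n) = (\<lambda>k l. 1 * diff_power n k l + (-1) * diff_power n (k - 1) l)"

text \<open>A further difference replaces the top moment M_n by -(n + 1) M_n, one order higher, and
  annihilates all below. Starting from the value 1 given by \<open>v_hat\<close>, the top moment is
  (-1)^n n!, so this sequence spans \<open>V n\<close> modulo \<open>V (Suc n)\<close>.\<close>

lemma diff_power: "V n (diff_power n) \<and> M n 0 (diff_power n) ~= 0"
proof (induction n)
 case 0
 have "zsum (\<lambda>k. delta 0 0 k l) = (if l = 0 then 1 else 0)" for l
  using zsum_eq[of "{0}" "\<lambda>k. delta 0 0 k l"] by (auto simp: delta_def)
 moreover have "(\<Sum>l<r. v j l * (if l = 0 then 1 else 0)) = v j 0" for j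
 proof -
  have "(\<Sum>l<r. v j l * (if l = 0 then 1 else 0)) = (\<Sum>l<r. if l = 0 then v j l else 0)"
   by (intro sum.cong) auto
  then show ?thesis using r by simp
 qed
 ultimately have "M 0 0 (delta 0 0) = (\<Sum>j\<in>{-N..N}. v j 0)"
  by (simp add: M_def)
 also have "... = 1" using v_hat[OF r] by simp
 finally show ?case by (simp add: V_def fsupp_delta)
next
 case (Suc n)
 define u where "u = diff_power n"
 have u: "V n u" "M n 0 u ~= 0" using Suc by (auto simp: u_def)
 have M: "M p 0 (diff_power (Suc n)) = M p 0 u - M p 1 u" for p
  using M_lincomb[of u "\<lambda>k. u (k - 1)" p 0 1 "-1"] V_fsupp[OF u(1)]
  by (simp add: fsupp_shift M_shift flip: u_def)
 have "V (Suc n) (diff_power (Suc n))"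
  unfolding V_def
 proof (intro conjI allI impI)
  show "fsupp (diff_power (Suc n))"
   using fsupp_lincomb[OF V_fsupp[OF u(1)] fsupp_shift[OF V_fsupp[OF u(1)], of 1], of 1 "-1"]
   by (simp add: u_def)
  fix p assume "p < Suc n"
  then show "M p 0 (diff_power (Suc n)) = 0"
   unfolding M using M_V[OF u(1), of p 1] M_V[OF u(1), of p 0] by simp
 qed
 moreover have "M (Suc n) 1 u = M (Suc n) 0 u + of_nat (Suc n) * M n 0 u"
 proof -
  have "(\<Sum>s\<le>n. of_nat (Suc n choose s) * 1 ^ (Suc n - s) * M s 0 u) = (\<Sum>s\<le>n. if s = n then of_nat (Suc n) * M n 0 u else 0)"
   using u(1) by (intro sum.cong) (auto simp: V_def)
  then show ?thesis
   unfolding M_binomial[OF V_fsupp[OF u(1)], of "Suc n" 1]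
   by (simp add: sum.delta del: binomial_Suc_Suc)
 qed
 ultimately show ?case using u(2) unfolding M by (simp del: diff_power.simps of_nat_Suc)
qed

text \<open>On \<open>V n\<close>, the projection onto \<open>V (Suc n)\<close> along the line
  spanned by \<open>diff_power n\<close>.\<close>

definition proj :: "nat => (int => nat => complex) => int => nat => complex" where
 "proj n u = (\<lambda>k l. 1 * u k l + (- (M n 0 u / M n 0 (diff_power n))) * diff_power n k l)"

lemma V_proj:
 assumes "V n u" shows "V (Suc n) (proj n u)"
proof -
 have d: "V n (diff_power n)" "M n 0 (diff_power n) ~= 0" using diff_power[of n] by auto
 have "M n 0 (proj n u) = 1 * M n 0 u + (- (M n 0 u / M n 0 (diff_power n))) * M n 0 (diff_power n)"
  unfolding proj_def by (rule M_lincomb[OF V_fsupp[OF assms] V_fsupp[OF d(1)]])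
 moreover have "V n (proj n u)" unfolding proj_def by (rule V_lincomb[OF assms d(1)])
 ultimately show ?thesis using d(2) by (simp add: V_Suc)
qed

fun frame :: "nat => int => nat => int => nat => complex" where
 "frame 0 k l = delta k l"
| "frame (Suc n) k l = proj n (frame n k l)"

lemma V_frame: "V n (frame n k l)"
 by (induction n) (auto simp: V_proj, simp add: V_def fsupp_delta)

text \<open>Projecting the expansion into deltas does not touch the coefficients, and
  \<open>proj\<close> fixes elements that already have the extra vanishing moment. The coefficients
  therefore remain the values of \<open>u\<close>, bounded by its sup norm, although the frame
  elements may leave the window of \<open>u\<close>.\<close>

lemma frame_expansion:
 assumes "V n u" "supp_in L u" "l' < r"
 shows "u j l' = (\<Sum>x\<in>{-L..L}\<times>{..<r}. u (fst x) (snd x) * frame n (fst x) (snd x) j l')"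
 using assms
proof (induction n arbitrary: j l')
 case 0
 then show ?case by (simp add: delta_expansion)
next
 case (Suc n)
 let ?X = "{-L..L}\<times>{..<r}"
 have Vn: "V n u" "M n 0 u = 0" using Suc.prems(1) by (auto simp: V_Suc)
 have rep: "u j l' = (\<Sum>x\<in>?X. u (fst x) (snd x) * frame n (fst x) (snd x) j l')" if "l' < r" for j l'
  using Suc.IH[OF Vn(1) Suc.prems(2) that] .
 have "0 = M n 0 (\<lambda>k l. \<Sum>x\<in>?X. u (fst x) (snd x) * frame n (fst x) (snd x) k l)"
  using Vn(2) M_cong[of u, OF rep] by simp
 also have "... = (\<Sum>x\<in>?X. u (fst x) (snd x) * M n 0 (frame n (fst x) (snd x)))"
  by (intro M_sum V_fsupp[OF V_frame]) auto
 finally have z: "(\<Sum>x\<in>?X. u (fst x) (snd x) * M n 0 (frame n (fst x) (snd x))) = 0" ..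
 have "(\<Sum>x\<in>?X. u (fst x) (snd x) * frame (Suc n) (fst x) (snd x) j l')
   = (\<Sum>x\<in>?X. u (fst x) (snd x) * frame n (fst x) (snd x) j l')
    - (\<Sum>x\<in>?X. u (fst x) (snd x) * M n 0 (frame n (fst x) (snd x))) * (diff_power n j l' / M n 0 (diff_power n))"
  unfolding proj_def frame.simps sum_distrib_right sum_subtractf[symmetric]
  by (intro sum.cong refl) (simp add: algebra_simps)
 then show ?case
  using rep[OF Suc.prems(3), of j] z by simp
qed

definition decays_at :: "nat => real => bool" where
 "decays_at n h \<longleftrightarrow> (\<forall>u. V n u --> (\<exists>q K. 0 \<le> q \<and> q < h \<and> (\<forall>k. bounded_by (K * q ^ k) (C k u))))"

definition decays :: "nat => bool" where
 "decays n \<longleftrightarrow> decays_at n ((1 / 2) ^ n)"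

text \<open>The little-o form of decay, as delivered by the convergence of derivatives and by the
  estimate for finite differences.\<close>

definition decays_weakly :: "nat => bool" where
 "decays_weakly n \<longleftrightarrow> (\<forall>u. V n u --> (\<forall>\<epsilon>>0. \<forall>\<^sub>F k in sequentially. bounded_by (\<epsilon> * (1 / 2) ^ (n * k)) (C k u)))"

text \<open>On a fixed invariant window only finitely many frame elements occur. After some number
  \<open>n0\<close> of steps all of them are so small that their sum contracts by half of 2^(-n n0),
  and iterating this contraction gives a rate strictly below 2^(-n).\<close>

lemma decays_weakly_imp_decays:
 assumes weak: "decays_weakly n" and n: "n \<le> m + 1"
 shows "decays n"
 unfolding decays_def decays_at_def
proof (intro allI impI)
 fix u assume u: "V n u"
 obtain L where L: "N \<le> L" "supp_in L u" using fsupp_large[OF V_fsupp[OF u], of N] by auto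
 define X where "X = {-L..L}\<times>{..<r}"
 define W where "W w \<longleftrightarrow> V n w \<and> supp_in L w" for w
 define b where "b = frame n"
 have b: "V n (b k l)" for k l by (simp add: b_def V_frame)
 have rep: "u j l' = (\<Sum>x\<in>{-L..L}\<times>{..<r}. u (fst x) (snd x) * b (fst x) (snd x) j l')"
  if "V n u" "supp_in L u" "l' < r" for u L j l'
  unfolding b_def using that by (rule frame_expansion)
 define \<epsilon> where "\<epsilon> = 1 / (2 * (real (card X) + 1))"
 have \<epsilon>: "0 < \<epsilon>" "real (card X) * \<epsilon> \<le> 1 / 2" by (auto simp: \<epsilon>_def field_simps)
 have "\<forall>\<^sub>F k in sequentially. 0 < k \<and> (\<forall>x\<in>X. bounded_by (\<epsilon> * (1 / 2) ^ (n * k)) (C k (b (fst x) (snd x))))"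
  unfolding X_def
  using weak b \<epsilon>(1) eventually_gt_at_top[of 0]
  by (intro eventually_conj eventually_ball_finite) (auto simp: decays_weakly_def)
 then obtain n0 where n0: "0 < n0" "!!x. x \<in> X ==> bounded_by (\<epsilon> * (1 / 2) ^ (n * n0)) (C n0 (b (fst x) (snd x)))"
  by (auto simp: eventually_sequentially)
 define \<theta> where "\<theta> = (1 / 2) * (1 / 2 :: real) ^ (n * n0)"
 have \<theta>: "0 < \<theta>" "\<theta> < 1"
  using power_le_one[of "1 / 2 :: real" "n * n0"] by (auto simp: \<theta>_def)
 have contr: "bounded_by (\<theta> * K) (C n0 w)" if "W w" "bounded_by K w" for w K
  unfolding bounded_by_def
 proof (intro allI impI)
  fix j l assume l: "l < r"
  have K: "0 \<le> K" using that(2) l norm_ge_zero order_trans unfolding bounded_by_def by blast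
  have "C n0 w j l = C n0 (\<lambda>k l. \<Sum>x\<in>X. w (fst x) (snd x) * b (fst x) (snd x) k l) j l"
   using that l rep unfolding W_def X_def by (intro C_cong) auto
  also have "... = (\<Sum>x\<in>X. w (fst x) (snd x) * C n0 (b (fst x) (snd x)) j l)"
   by (simp add: C_sum)
  also have "cmod ... \<le> (\<Sum>x\<in>X. K * (\<epsilon> * (1 / 2) ^ (n * n0)))"
  proof (rule sum_norm_le)
   fix x assume x: "x \<in> X"
   then have "cmod (w (fst x) (snd x)) \<le> K" "cmod (C n0 (b (fst x) (snd x)) j l) \<le> \<epsilon> * (1 / 2) ^ (n * n0)"
    using that(2) n0(2)[OF x] l by (auto simp: bounded_by_def X_def)
   then show "cmod (w (fst x) (snd x) * C n0 (b (fst x) (snd x)) j l) \<le> K * (\<epsilon> * (1 / 2) ^ (n * n0))"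
    unfolding norm_mult using K by (intro mult_mono) auto
  qed
  also have "... = real (card X) * \<epsilon> * (1 / 2) ^ (n * n0) * K" by simp
  also have "... \<le> 1 / 2 * (1 / 2) ^ (n * n0) * K"
   using \<epsilon>(2) K by (intro mult_right_mono) auto
  finally show "cmod (C n0 w j l) \<le> \<theta> * K" by (simp add: \<theta>_def)
 qed
 have inv: "W (T e w)" if "W w" "e \<in> {0, 1}" for w e
  using that V_T[of n w e] supp_in_T[of L w e] n L(1) unfolding W_def by blast
 have "W u" using u L(2) by (simp add: W_def)
 obtain K where K: "0 \<le> K" "!!k. bounded_by (K * root n0 \<theta> ^ k) (C k u)"
  using geometric_from_contraction[OF contr inv \<open>W u\<close> V_fsupp[OF u] \<theta> n0(1)] by blast
 have "root n0 \<theta> < root n0 (((1 / 2) ^ n) ^ n0)"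
  using n0(1) by (simp add: \<theta>_def power_mult)
 also have "... = (1 / 2) ^ n" using n0(1) by (simp add: real_root_power_cancel)
 finally show "\<exists>q K. 0 \<le> q \<and> q < (1 / 2) ^ n \<and> (\<forall>k. bounded_by (K * q ^ k) (C k u))"
  using K(2) real_root_ge_zero[of \<theta> n0] \<theta>(1) by (rule_tac exI[of _ "root n0 \<theta>"], rule_tac exI[of _ K]) simp
qed

text \<open>On the one-dimensional quotient of consecutive spaces \<open>V n\<close> the transition operators act by
 \<open>2^(-n-1)\<close>.\<close>

lemma decays_at_Suc_imp_decays_at:
 assumes dec: "decays_at (Suc n) h" and n: "n \<le> m" and h: "(1 / 2) ^ (n + 1) < h"
 shows "decays_at n h"
 unfolding decays_at_def
proof (intro allI impI)
 fix u assume u: "V n u"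
 define c where "c = (1 / 2 :: real) ^ (n + 1)"
 have c: "0 < c" "c < h" using h by (simp_all add: c_def)
 define w where "w e = (\<lambda>k l. 1 * T e u k l + (- ((1 / 2) ^ (n + 1))) * u k l)" for e
 have w: "V (Suc n) (w e)" if "e \<in> {0, 1}" for e
 proof -
  have T: "V n (T e u)" using that u n by (intro V_T) auto
  show ?thesis
   unfolding w_def V_Suc
   by (intro conjI V_lincomb T u) (simp only: M_lincomb V_fsupp[OF T] V_fsupp[OF u] M_T_top[OF u n], simp)
 qed
 have "\<exists>q K. 0 \<le> q \<and> q < h \<and> (\<forall>k. bounded_by (K * q ^ k) (C k (w e)))" if "e \<in> {0,1}" for e
  using dec w[OF that] by (auto simp: decays_at_def)
 then obtain q K where qK: "!!e. e \<in> {0,1} ==> 0 \<le> q e" "!!e. e \<in> {0,1} ==> q e < h"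
  "!!e k. e \<in> {0,1} ==> bounded_by (K e * q e ^ k) (C k (w e))"
  by metis
 define D where "D = max 0 (max (K 0) (K 1))"
 \<comment> \<open>Strictly between \<open>h\<close> and all rates involved; being strictly above
   the quotient eigenvalue \<open>c\<close>, it admits the choice of \<open>K'\<close>
   below.\<close>
 define Q where "Q = (max c (max (q 0) (q 1)) + h) / 2"
 have Q: "c < Q" "Q < h" "q e \<le> Q" if "e \<in> {0, 1}" for e
  using c qK(2)[of 0] qK(2)[of 1] that by (auto simp: Q_def)
 have Qc: "c < Q" "Q < h" using Q[of 0] by simp_all
 have wD: "bounded_by (D * Q ^ k) (C k (w e))" if "e \<in> {0, 1}" for e k
 proof (rule bounded_by_mono[OF qK(3)[OF that]])
  have "K e * q e ^ k \<le> D * q e ^ k"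
   using qK(1)[OF that] that by (intro mult_right_mono) (auto simp: D_def)
  also have "... \<le> D * Q ^ k"
   using qK(1)[OF that] Q(3)[OF that] by (intro mult_left_mono power_mono) (auto simp: D_def)
  finally show "K e * q e ^ k \<le> D * Q ^ k" .
 qed
 obtain B where B: "0 \<le> B" "bounded_by B (C 0 u)" using ex_bounded_by[OF V_fsupp[OF u], of 0] by blast
 \<comment> \<open>The norms satisfy B_(k+1) <= D Q^k + c B_k. The guess K' Q^k closes this
   recursion exactly when D <= K' (Q - c).\<close>
 define K' where "K' = max B (D / (Q - c))"
 have "D / (Q - c) \<le> K'" by (simp add: K'_def)
 then have "D \<le> K' * (Q - c)" using Qc by (simp add: pos_divide_le_eq)
 moreover have "0 \<le> K'" using B(1) by (simp add: K'_def)
 ultimately have K': "0 \<le> K'" "D + c * K' \<le> K' * Q" by (auto simp: algebra_simps)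
 have "bounded_by (K' * Q ^ k) (C k u)" for k
 proof (induction k)
  case 0
  show ?case using bounded_by_mono[OF B(2), of K'] by (simp add: K'_def)
 next
  case (Suc k)
  show ?case
   unfolding bounded_by_C_Suc
  proof
   fix e :: int assume e: "e \<in> {0, 1}"
   show "bounded_by (K' * Q ^ Suc k) (C k (T e u))"
    unfolding bounded_by_def
   proof (intro allI impI)
    fix j l assume l: "l < r"
    have "C k (w e) j l = 1 * C k (T e u) j l + (- ((1 / 2) ^ (n + 1))) * C k u j l"
     unfolding w_def by (rule C_lincomb)
    then have "C k (T e u) j l = C k (w e) j l + (1 / 2) ^ (n + 1) * C k u j l" by simp
    then have "cmod (C k (T e u) j l) \<le> cmod (C k (w e) j l) + cmod ((1 / 2) ^ (n + 1) * C k u j l)"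
     by (simp only: norm_triangle_ineq)
    also have "cmod ((1 / 2) ^ (n + 1) * C k u j l) = c * cmod (C k u j l)"
     by (simp add: c_def norm_mult norm_power norm_divide)
    also have "cmod (C k (w e) j l) + c * cmod (C k u j l) \<le> D * Q ^ k + c * (K' * Q ^ k)"
     using wD[OF e] Suc l c by (intro add_mono mult_left_mono) (auto simp: bounded_by_def)
    also have "... = (D + c * K') * Q ^ k" by (simp add: algebra_simps)
    also have "... \<le> (K' * Q) * Q ^ k"
     using K' c Qc by (intro mult_right_mono zero_le_power) auto
    finally show "cmod (C k (T e u) j l) \<le> K' * Q ^ Suc k" by simp
   qed
  qed
 qed
 moreover have "0 \<le> Q" using c Qc by simp
 ultimately show "\<exists>q K. 0 \<le> q \<and> q < h \<and> (\<forall>k. bounded_by (K * q ^ k) (C k u))" using Qc(2) by blast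
qed

text \<open>The descent from \<open>n\<close> to \<open>k\<close> meets the quotient eigenvalues
  2^(-i-1) with k <= i < n, all below \<open>h\<close>. The threshold is kept fixed because the
  smoothness exponent asks for the rate 2^(-m-1) on a space with more than m + 1 vanishing
  moments.\<close>

lemma decays_at_antimono:
 assumes "decays_at n h" "k \<le> n" "n \<le> m + 1" "(1 / 2) ^ (k + 1) < h"
 shows "decays_at k h"
 using assms(2)
proof (induction rule: inc_induct)
 case base
 show ?case by (rule assms(1))
next
 case (step i)
 have "(1 / 2 :: real) ^ (i + 1) \<le> (1 / 2) ^ (k + 1)" using step.hyps by (intro power_decreasing) auto
 then have "(1 / 2) ^ (i + 1) < h" using assms(4) by linarith
 moreover have "i \<le> m" using step.hyps assms(3) by simp
 ultimately show ?case using decays_at_Suc_imp_decays_at[OF step.IH] by blast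
qed

lemma decays_antimono:
 assumes "decays n" "k \<le> n" "n \<le> m + 1" shows "decays k"
proof -
 have "(1 / 2 :: real) ^ n \<le> (1 / 2) ^ k" using assms(2) by (intro power_decreasing) auto
 then have "decays_at n ((1 / 2) ^ k)" using assms(1) unfolding decays_def decays_at_def by (meson less_le_trans)
 then show ?thesis unfolding decays_def by (rule decays_at_antimono) (use assms in auto)
qed

text \<open>Generators of \<open>V (Suc n)\<close> are the first differences and the projections of
  generators of \<open>V n\<close>: a shift of \<open>b\<close> differs from \<open>b\<close> by a
  telescoping sum of shifted differences, and shifts do not change the top moment.\<close>

lemma V_finitely_generated:
 "\<exists>B. finite B \<and> (\<forall>b\<in>B. V n b) \<and> (\<forall>u. V n u --> shift_span B u)"
proof (induction n)
 case 0
 show ?case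
  by (rule exI[of _ "(\<lambda>l. delta 0 l) ` {..<r}"]) (simp add: V_def fsupp_delta shift_span_deltas)
next
 case (Suc n)
 then obtain B where "finite B \<and> (\<forall>b\<in>B. V n b) \<and> (\<forall>u. V n u --> shift_span B u)" by (rule exE)
 then have B: "finite B" "!!b. b \<in> B ==> V n b" "!!u. V n u ==> shift_span B u" by simp_all
 define d where "d b = (\<lambda>k l. 1 * b k l + (-1) * b (k - 1) l)" for b :: "int => nat => complex"
 define B' where "B' = d ` B \<union> proj n ` B"
 have diff: "shift_span B' (\<lambda>k l. b (k - t) l - b k l)" if "b \<in> B" for b t
 proof -
  have db: "d b \<in> B'" using that by (simp add: B'_def)
  show ?thesis
  proof (induction t rule: int_induct[of _ 0])
   case base
   show ?case by (rule shift_span.zero) simp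
  next
   case (step1 i)
   show ?case
    by (rule shift_span.step[OF step1(2) db, of _ "-1" i]) (auto simp: d_def algebra_simps)
  next
   case (step2 i)
   show ?case
    by (rule shift_span.step[OF step2(2) db, of _ 1 "i - 1"]) (auto simp: d_def algebra_simps)
  qed
 qed
 have key: "shift_span B' (proj n u)" if "shift_span B u" for u
  using that
 proof (induction rule: shift_span.induct)
  case (zero u)
  have "M n 0 u = M n 0 (\<lambda>_ _. 0)" by (rule M_cong) (use zero in auto)
  also have "... = 0" by (simp add: M_def zsum_def)
  finally show ?case using zero by (intro shift_span.zero) (auto simp: proj_def)
 next
  case (step w b u c t)
  have b: "V n b" using B(2) step(2) by simp
  have fw: "fsupp w" using fsupp_shift_span[OF step(1)] B(2) V_fsupp by blast
  have "M n 0 u = M n 0 (\<lambda>k l. c * b (k - t) l + 1 * w k l)" by (rule M_cong) (use step in auto)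
  also have "... = c * M n 0 b + M n 0 w"
   using M_lincomb[of "\<lambda>k. b (k - t)" w n 0 c 1] fsupp_shift V_fsupp[OF b] fw M_V_top[OF b, of "of_int t"]
   by (simp add: M_shift)
  finally have Mu: "M n 0 u = c * M n 0 b + M n 0 w" .
  have "shift_span B' (\<lambda>k. proj n b (k - 0))"
   by (rule shift_span_base) (use step(2) in \<open>simp add: B'_def\<close>)
  then have "shift_span B' (\<lambda>k l. (c * (b (k - t) l - b k l) + c * proj n b (k - 0) l) + proj n w k l)"
   using diff[OF step(2), of t] step(4) by (intro shift_span_add shift_span_scale)
  then show ?case
   by (rule shift_span_cong) (use step(3) in \<open>simp add: proj_def Mu add_divide_distrib algebra_simps\<close>)
 qed
 have "V (Suc n) (d b)" if "b \<in> B" for b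
 proof -
  have b: "V n b" "V n (\<lambda>k. b (k - 1))" using B(2)[OF that] V_shift by auto
  have "M n 0 (d b) = 1 * M n 0 b + (-1) * M n 0 (\<lambda>k. b (k - 1))"
   unfolding d_def by (rule M_lincomb[OF b[THEN V_fsupp]])
  then have "M n 0 (d b) = 0" using M_V_top[OF b(1), of 1] by (simp add: M_shift)
  moreover have "V n (d b)" unfolding d_def by (rule V_lincomb[OF b])
  ultimately show ?thesis by (simp add: V_Suc)
 qed
 then have "\<forall>b\<in>B'. V (Suc n) b" using B(2) V_proj by (auto simp: B'_def)
 moreover have "shift_span B' u" if u: "V (Suc n) u" for u
 proof -
  have "shift_span B' (proj n u)" using u by (intro key B(3)) (simp add: V_Suc)
  then show ?thesis using u by (simp add: proj_def V_Suc)
 qed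
 ultimately show ?case using B(1) by (intro exI[of _ B']) (simp add: B'_def)
qed

text \<open>On sequences supported in a fixed window the moments \<open>M 0, ..., M m\<close> are eigenvectors of the
 transpose of \<open>T 0\<close> with distinct eigenvalues, so there cannot be more of them than the dimension.\<close>

lemma sum_rule_order_bound:
 assumes W: "0 \<le> W" "!!k l j. W < \<bar>k\<bar> ==> a k l j = 0"
 shows "m + 1 \<le> r * nat (2 * W + 1)"
proof -
 \<comment> \<open>The radius \<open>W\<close> concerns the mask only, whereas \<open>N\<close> also
   bounds the support of \<open>v\<close>. The resulting bound is therefore the same for all
   matching filters.\<close>
 define n where "n = r * nat (2 * W + 1)"
 define ix where "ix i = (int (i div r) - W, i mod r)" for i
 define d where "d i = delta (fst (ix i)) (snd (ix i))" for i
 have ix: "ix i \<in> {-W..W} \<times> {..<r}" if "i < n" for i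
 proof -
  have "i div r < nat (2 * W + 1)" using that r by (simp add: n_def less_mult_imp_div_less mult.commute)
  then show ?thesis using r W by (auto simp: ix_def)
 qed
 have bij: "bij_betw ix {..<n} ({-W..W} \<times> {..<r})"
 proof (rule bij_betw_byWitness[where f' = "\<lambda>x. nat (fst x + W) * r + snd x"])
  show "\<forall>i\<in>{..<n}. nat (fst (ix i) + W) * r + snd (ix i) = i" by (auto simp: ix_def)
  show "\<forall>x\<in>{-W..W} \<times> {..<r}. ix (nat (fst x + W) * r + snd x) = x" using r by (auto simp: ix_def)
  show "ix ` {..<n} \<subseteq> {-W..W} \<times> {..<r}" by (rule image_subsetI, rule ix) simp
  show "(\<lambda>x. nat (fst x + W) * r + snd x) ` ({-W..W} \<times> {..<r}) \<subseteq> {..<n}"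
  proof safe
   fix k l assume *: "k \<in> {-W..W}" "l < r"
   have "nat (k + W) * r + l < (nat (k + W) + 1) * r" using *(2) by simp
   also have "... \<le> nat (2 * W + 1) * r" using *(1) by (intro mult_right_mono) auto
   finally show "nat (fst (k, l) + W) * r + snd (k, l) < n" by (simp add: n_def mult.commute)
  qed
 qed
 have fd: "fsupp (d i)" for i by (simp add: d_def fsupp_delta)
 have expand: "u k l = (\<Sum>i<n. u (fst (ix i)) (snd (ix i)) * d i k l)" if "supp_in W u" "l < r" for u k l
 proof -
  have "(\<Sum>i<n. u (fst (ix i)) (snd (ix i)) * d i k l)
    = (\<Sum>x\<in>{-W..W} \<times> {..<r}. u (fst x) (snd x) * delta (fst x) (snd x) k l)"
   unfolding d_def by (rule sum.reindex_bij_betw[OF bij, of "\<lambda>x. u (fst x) (snd x) * delta (fst x) (snd x) k l"])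
  also have "... = u k l" using that by (rule delta_expansion)
  finally show ?thesis ..
 qed
 have Mexpand: "M p 0 u = (\<Sum>i<n. u (fst (ix i)) (snd (ix i)) * M p 0 (d i))" if "supp_in W u" for u p
  using M_cong[of u, OF expand[OF that]] M_sum[of "{..<n}" d p 0] fd by simp
 define E where "E = Matrix.mat n n (\<lambda>(i, j). T 0 (d i) (fst (ix j)) (snd (ix j)))"
 define y where "y p = Matrix.vec n (\<lambda>i. M p 0 (d i))" for p
 have E: "E \<in> carrier_mat n n" by (simp add: E_def)
 have sd: "supp_in W (d i)" if "i < n" for i
  using ix[OF that] by (auto simp: supp_in_def d_def delta_def)
 have sT: "supp_in ((L + W) div 2) (T 0 u)" if "supp_in L u" for L u
  unfolding supp_in_def T_def
 proof (intro allI impI sum.neutral ballI)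
  fix k l i j assume *: "(L + W) div 2 < \<bar>k\<bar>" "j \<in> {..<r}"
  show "a i l j * u (2 * k + 0 - i) j = 0"
  proof (cases "W < \<bar>i\<bar>")
   case False
   then have "L < \<bar>2 * k + 0 - i\<bar>" using * by auto
   then show ?thesis using that * by (auto simp: supp_in_def)
  qed (simp add: W(2))
 qed
 have eig: "E *\<^sub>v y p = (1 / 2) ^ (p + 1) \<cdot>\<^sub>v y p" if "p \<le> m" for p
 proof (rule eq_vecI)
  fix i assume "i < dim_vec ((1 / 2) ^ (p + 1) \<cdot>\<^sub>v y p)"
  then have i: "i < n" by (simp add: y_def)
  have "vec_index (E *\<^sub>v y p) i = (\<Sum>j<n. T 0 (d i) (fst (ix j)) (snd (ix j)) * M p 0 (d j))"
   using i by (simp add: E_def y_def scalar_prod_def atLeast0LessThan)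
  also have "... = M p 0 (T 0 (d i))"
   by (simp add: Mexpand[OF sT[OF sd[OF i], simplified]])
  also have "... = (1 / 2) ^ (p + 1) * M p 0 (d i)"
   using M_T[OF fd that, of 0 0] by simp
  finally show "vec_index (E *\<^sub>v y p) i = vec_index ((1 / 2) ^ (p + 1) \<cdot>\<^sub>v y p) i" using i by (simp add: y_def)
 qed (simp add: E_def y_def)
 have nz: "y p ~= 0\<^sub>v n" if pm: "p \<le> m" for p
 proof
  assume y0: "y p = 0\<^sub>v n"
  have "M p 0 (d i) = 0" if "i < n" for i
  proof -
   have "M p 0 (d i) = vec_index (y p) i" using that by (simp add: y_def)
   then show ?thesis using that by (simp add: y0)
  qed
  then have z: "M p 0 u = 0" if "supp_in W u" for u
   unfolding Mexpand[OF that] by (intro sum.neutral) simp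
  \<comment> \<open>If the moment vanished on the window, it would vanish everywhere:
    \<open>T 0\<close> shrinks supports towards radius \<open>W\<close>, and the moment of
    \<open>T 0 u\<close> is a nonzero multiple of that of \<open>u\<close>. This contradicts
    \<open>diff_power\<close>.\<close>
  have "M p 0 u = 0" if "supp_in L u" for u L
   using that
  proof (induction "nat (L - W)" arbitrary: L u rule: less_induct)
   case less
   show ?case
   proof (cases "L \<le> W")
    case True
    then show ?thesis using z supp_in_mono less.prems by blast
   next
    case False
    have "supp_in ((L + W) div 2) (T 0 u)" by (rule sT[OF less.prems])
    then have "M p 0 (T 0 u) = 0" by (rule less.hyps[rotated]) (use False in auto)
    moreover have "fsupp u" using less.prems by (auto simp: fsupp_def)
    ultimately show ?thesis using M_T[of u p 0 0] pm by simp
   qed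
  qed
  then show False using diff_power[of p] by (auto simp: V_def fsupp_def)
 qed
 have "eigenvalue E ((1 / 2) ^ (p + 1))" if "p \<le> m" for p
 proof -
  have "y p \<in> carrier_vec (dim_row E)" "y p ~= 0\<^sub>v (dim_row E)"
   using nz[OF that] by (simp_all add: E_def y_def)
  then show ?thesis
   unfolding eigenvalue_def eigenvector_def using eig[OF that] by blast
 qed
 then have "(\<lambda>p. (1 / 2) ^ (p + 1)) ` {..m} \<subseteq> {x. poly (char_poly E) x = 0}"
  using eigenvalue_root_char_poly[OF E] by auto
 moreover have nz: "char_poly E ~= 0" using degree_monic_char_poly[OF E] by auto
 moreover have "inj_on (\<lambda>p. (1 / 2 :: complex) ^ (p + 1)) {..m}"
 proof (rule inj_onI)
  fix x y assume "(1 / 2 :: complex) ^ (x + 1) = (1 / 2) ^ (y + 1)"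
  then have "cmod ((1 / 2) ^ (x + 1)) = cmod ((1 / 2) ^ (y + 1))" by simp
  then have "(1 / 2 :: real) ^ x = (1 / 2) ^ y" by (simp add: norm_power norm_divide norm_mult)
  then show "x = y"
   using power_strict_decreasing[of x y "1 / 2 :: real"] power_strict_decreasing[of y x "1 / 2 :: real"]
   by (cases x y rule: linorder_cases) auto
 qed
 ultimately have "card {..m} \<le> card {x. poly (char_poly E) x = 0}"
  using poly_roots_finite by (metis card_image card_mono)
 also have "... \<le> degree (char_poly E)" by (rule card_poly_roots_bound[OF nz])
 also have "... = n" using degree_monic_char_poly[OF E] by simp
 finally show ?thesis by (simp add: n_def)
qed

end

section \<open>The cascade operator\<close>

context mask
begin

definition R :: "(nat => real => complex) => nat => real => complex" where
 "R f l x = 2 * (\<Sum>i\<in>{-N..N}. \<Sum>j<r. a i l j * f j (2 * x - of_int i))"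

text \<open>The samples of \<open>f\<close> on the coset of \<open>x\<close> modulo the integers,
  read as a sequence. This is the bridge between cascade iterates and sequences.\<close>

definition Phi :: "(nat => real => complex) => real => int => nat => complex" where
 "Phi f x k l = f l (x + of_int k)"

definition csupp :: "real => (nat => real => complex) => bool" where
 "csupp L f \<longleftrightarrow> (\<forall>l<r. \<forall>x. L < \<bar>x\<bar> --> f l x = 0)"

lemma Phi_R: "Phi (R f) ((x + of_int e) / 2) k l = 2 * T e (Phi f x) k l"
proof -
 have "2 * ((x + of_int e) / 2 + of_int k) - of_int i = x + of_int (2 * k + e - i)" for i
  by (simp add: field_simps)
 then show ?thesis unfolding Phi_def R_def T_def by (simp only:)
qed

lemma C_scale: "C n (\<lambda>k l. \<alpha> * u k l) j l = \<alpha> * C n u j l"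
 using C_lincomb[of n \<alpha> u 0 u j l] by simp

text \<open>Refinement halves arguments just as \<open>C\<close> consumes digits, so each step costs
  one factor 2. Every point of the line has the form (x + i) / 2^n with 0 <= x < 1, hence the sup
  norm of an iterate is read off from the sequences \<open>C n (Phi f x)\<close>.\<close>

lemma R_iterate: "(R ^^ n) f l ((x + of_int i) / 2 ^ n) = 2 ^ n * C n (Phi f x) i l"
proof (induction n arbitrary: f x i)
 case 0
 then show ?case by (simp add: Phi_def)
next
 case (Suc n)
 define e where "e = i mod 2"
 have i: "2 * of_int (i div 2) + of_int e = (of_int i :: real)"
  unfolding e_def by (metis mult_div_mod_eq of_int_add of_int_mult of_int_numeral)
 have "(x + of_int i) / 2 ^ Suc n = ((x + of_int e) / 2 + of_int (i div 2)) / 2 ^ n"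
  by (simp add: field_simps flip: i)
 then have "(R ^^ Suc n) f l ((x + of_int i) / 2 ^ Suc n) = (R ^^ n) (R f) l (((x + of_int e) / 2 + of_int (i div 2)) / 2 ^ n)"
  by (simp only: funpow_Suc_right o_def)
 also have "... = 2 ^ n * C n (Phi (R f) ((x + of_int e) / 2)) (i div 2) l" by (rule Suc)
 also have "Phi (R f) ((x + of_int e) / 2) = (\<lambda>k l. 2 * T e (Phi f x) k l)"
  by (intro ext Phi_R)
 finally show ?case by (simp add: C_scale e_def)
qed

lemma R_iterate_bound:
 assumes "!!x. x \<in> {0..1} ==> bounded_by K (C n (Phi f x))" "l < r"
 shows "cmod ((R ^^ n) f l y) \<le> 2 ^ n * K"
proof -
 have "y = (frac (2 ^ n * y) + of_int \<lfloor>2 ^ n * y\<rfloor>) / 2 ^ n" by (simp add: frac_def)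
 then have "(R ^^ n) f l y = 2 ^ n * C n (Phi f (frac (2 ^ n * y))) \<lfloor>2 ^ n * y\<rfloor> l"
  using R_iterate by metis
 moreover have "cmod (C n (Phi f (frac (2 ^ n * y))) \<lfloor>2 ^ n * y\<rfloor> l) \<le> K"
  using assms(1)[of "frac (2 ^ n * y)"] assms(2) frac_lt_1[of "2 ^ n * y"]
  by (auto simp: bounded_by_def)
 ultimately show ?thesis by (simp add: norm_mult norm_power)
qed

lemma C_Phi: "C n (Phi f x) i l = (R ^^ n) f l ((x + of_int i) / 2 ^ n) / 2 ^ n"
 by (simp add: R_iterate)

lemma R_cong: "(!!j x. j < r ==> f j x = g j x) ==> R f = R g"
 unfolding R_def by (intro ext) simp

lemma R_lincomb: "R (\<lambda>l x. \<alpha> * f l x + \<beta> * g l x) = (\<lambda>l x. \<alpha> * R f l x + \<beta> * R g l x)"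
 by (intro ext) (simp add: R_def sum_distrib_left sum.distrib algebra_simps)

lemma R_iterate_lincomb: "(R ^^ n) (\<lambda>l x. \<alpha> * f l x + \<beta> * g l x) = (\<lambda>l x. \<alpha> * (R ^^ n) f l x + \<beta> * (R ^^ n) g l x)"
 by (induction n) (simp_all add: R_lincomb)

lemma R_scale: "R (\<lambda>l x. \<alpha> * f l x) = (\<lambda>l x. \<alpha> * R f l x)"
 using R_lincomb[of \<alpha> f 0 f] by simp

lemma
 assumes "!!l. l < r ==> C_k m (f l)"
 shows C_k_R: "C_k m (R f l)"
  and nderiv_R: "j \<le> m ==> nderiv j (R f l) = (\<lambda>x. 2 ^ j * R (\<lambda>l. nderiv j (f l)) l x)"
proof -
 define X where "X = {-N..N} \<times> {..<r}"
 have *: "R g l = (\<lambda>x. \<Sum>y\<in>X. (2 * a (fst y) l (snd y)) * g (snd y) (2 * x + - of_int (fst y)))" for g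
  by (intro ext) (simp add: R_def X_def sum_distrib_left sum_pairs mult.assoc)
 have **: "C_k m (f (snd y))" if "y \<in> X" for y using assms that by (auto simp: X_def)
 show "C_k m (R f l)" unfolding * by (rule C_k_affine_sum) (rule **)
 show "nderiv j (R f l) = (\<lambda>x. 2 ^ j * R (\<lambda>l. nderiv j (f l)) l x)" if "j \<le> m"
  unfolding * using nderiv_affine_sum[of X m "\<lambda>y. f (snd y)" j "\<lambda>y. 2 * a (fst y) l (snd y)" 2 "\<lambda>y. - of_int (fst y)"] ** that
  by simp
qed

lemma
 assumes "!!l. l < r ==> C_k m (f l)" "l < r"
 shows C_k_R_iterate: "C_k m ((R ^^ n) f l)"
  and nderiv_R_iterate: "j \<le> m ==> nderiv j ((R ^^ n) f l) = (\<lambda>x. 2 ^ (n * j) * (R ^^ n) (\<lambda>l. nderiv j (f l)) l x)"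
proof -
 have "(\<forall>l<r. C_k m ((R ^^ n) f l)) \<and> (\<forall>j\<le>m. \<forall>l<r. nderiv j ((R ^^ n) f l) = (\<lambda>x. 2 ^ (n * j) * (R ^^ n) (\<lambda>l. nderiv j (f l)) l x))"
 proof (induction n)
  case 0
  then show ?case using assms by simp
 next
  case (Suc n)
  have C: "C_k m ((R ^^ n) f l)" if "l < r" for l using Suc that by simp
  have "nderiv j (R ((R ^^ n) f) l) = (\<lambda>x. 2 ^ (Suc n * j) * (R ^^ Suc n) (\<lambda>l. nderiv j (f l)) l x)" if "j \<le> m" "l < r" for j l
  proof -
   have "R (\<lambda>l. nderiv j ((R ^^ n) f l)) = R (\<lambda>l x. 2 ^ (n * j) * (R ^^ n) (\<lambda>l. nderiv j (f l)) l x)"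
    by (rule R_cong) (use Suc that in simp)
   moreover have "nderiv j (R ((R ^^ n) f) l) = (\<lambda>x. 2 ^ j * R (\<lambda>l. nderiv j ((R ^^ n) f l)) l x)"
    by (rule nderiv_R[OF C that(1)])
   ultimately show ?thesis
    by (simp add: R_scale power_add mult.assoc)
  qed
  then show ?case using C_k_R[OF C] by simp
 qed
 then show "C_k m ((R ^^ n) f l)" "j \<le> m ==> nderiv j ((R ^^ n) f l) = (\<lambda>x. 2 ^ (n * j) * (R ^^ n) (\<lambda>l. nderiv j (f l)) l x)"
  using assms(2) by auto
qed

lemma csupp_mono: "csupp L f ==> L \<le> L' ==> csupp L' f"
 by (auto simp: csupp_def)

lemma csupp_R:
 assumes "csupp L f" "of_int N \<le> L" shows "csupp L (R f)"
 unfolding csupp_def R_def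
proof (intro allI impI)
 fix l and x :: real assume "l < r" "L < \<bar>x\<bar>"
 then have "L < \<bar>2 * x - of_int i\<bar>" if "i \<in> {-N..N}" for i
  using assms(2) that by auto
 then show "2 * (\<Sum>i\<in>{-N..N}. \<Sum>j<r. a i l j * f j (2 * x - of_int i)) = 0"
  using assms(1) by (auto simp: csupp_def intro!: sum.neutral)
qed

lemma csupp_R_iterate: "csupp L f ==> of_int N \<le> L ==> csupp L ((R ^^ n) f)"
 by (induction n) (auto intro: csupp_R)

lemma supp_in_Phi:
 assumes "csupp L f" "L + \<bar>x\<bar> \<le> of_int K" shows "supp_in K (Phi f x)"
 unfolding supp_in_def Phi_def
proof (intro allI impI)
 fix k l assume *: "l < r" "K < \<bar>k\<bar>"
 then have "of_int K < (of_int \<bar>k\<bar> :: real)" by simp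
 then have "L < \<bar>x + of_int k\<bar>" using assms(2) by (simp add: abs_if split: if_splits)
 then show "f l (x + of_int k) = 0" using assms(1) * by (auto simp: csupp_def)
qed

lemma fsupp_Phi: "csupp L f ==> fsupp (Phi f x)"
 using supp_in_Phi[of L f x "\<lceil>L + \<bar>x\<bar>\<rceil>"] by (auto simp: fsupp_def)

lemma csupp_derivative:
 assumes "csupp L f" "!!l x. l < r ==> (f l has_vector_derivative f' l x) (at x)"
 shows "csupp L f'"
 unfolding csupp_def
proof (intro allI impI)
 fix l and x :: real assume *: "l < r" "L < \<bar>x\<bar>"
 show "f' l x = 0"
  by (rule vector_derivative_zero_outside[OF assms(2)[OF *(1)] _ *(2)]) (use assms(1) * in \<open>auto simp: csupp_def\<close>)
qed

lemma csupp_nderiv: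
 assumes "csupp L f" "!!l. l < r ==> C_k m (f l)" "j \<le> m"
 shows "csupp L (\<lambda>l. nderiv j (f l))"
 unfolding csupp_def
proof (intro allI impI)
 fix l and x :: real assume "l < r" "L < \<bar>x\<bar>"
 then show "nderiv j (f l) x = 0"
  using assms(1) by (intro nderiv_zero_outside[OF assms(2) _ assms(3)]) (auto simp: csupp_def)
qed

end

section \<open>Moments of sampled functions and the limit of the cascade\<close>

context sum_rule_mask
begin

text \<open>The frame of a window is finite, so one rate and one constant serve all sequences
  supported there, with the sup norm as a factor. Uniformity is needed because the sampling offset
  \<open>x\<close> runs through a continuum.\<close>

lemma uniform_decay:
 assumes "decays n"
 shows "\<exists>q K. 0 \<le> q \<and> q < (1 / 2) ^ n \<and> 0 \<le> K \<and>
  (\<forall>u B k. V n u --> supp_in L u --> 0 \<le> B --> bounded_by B u --> bounded_by (K * B * q ^ k) (C k u))"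
proof -
 define X where "X = {-L..L} \<times> {..<r}"
 have fin: "finite X" by (simp add: X_def)
 have "\<forall>x. \<exists>q K. 0 \<le> q \<and> q < (1 / 2) ^ n \<and> (\<forall>k. bounded_by (K * q ^ k) (C k (frame n (fst x) (snd x))))"
  using assms V_frame by (auto simp: decays_def decays_at_def)
 then obtain q K where qK: "!!x. 0 \<le> q x" "!!x. q x < (1 / 2) ^ n"
  "!!x k. bounded_by (K x * q x ^ k) (C k (frame n (fst x) (snd x)))" by metis
 define Q where "Q = Max (insert 0 (q ` X))"
 have Q: "0 \<le> Q" "Q < (1 / 2) ^ n" "!!x. x \<in> X ==> q x \<le> Q"
  using fin qK(2) by (auto simp: Q_def)
 define K' where "K' = (\<Sum>x\<in>X. \<bar>K x\<bar>)"
 have "bounded_by (K' * B * Q ^ k) (C k u)"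
  if u: "V n u" "supp_in L u" "0 \<le> B" "bounded_by B u" for u B k
  unfolding bounded_by_def
 proof (intro allI impI)
  fix j l assume l: "l < r"
  have "C k u j l = C k (\<lambda>k l. \<Sum>x\<in>X. u (fst x) (snd x) * frame n (fst x) (snd x) k l) j l"
   unfolding X_def by (rule C_cong[OF frame_expansion[OF u(1,2)] l])
  also have "... = (\<Sum>x\<in>X. u (fst x) (snd x) * C k (frame n (fst x) (snd x)) j l)"
   by (simp add: C_sum)
  also have "cmod ... \<le> (\<Sum>x\<in>X. B * (\<bar>K x\<bar> * Q ^ k))"
  proof (rule sum_norm_le)
   fix x assume x: "x \<in> X"
   have "cmod (C k (frame n (fst x) (snd x)) j l) \<le> K x * q x ^ k"
    using qK(3)[of x k] l by (auto simp: bounded_by_def)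
   also have "... \<le> \<bar>K x\<bar> * Q ^ k"
    using Q(3)[OF x] qK(1)[of x] by (intro mult_mono power_mono) auto
   finally show "cmod (u (fst x) (snd x) * C k (frame n (fst x) (snd x)) j l) \<le> B * (\<bar>K x\<bar> * Q ^ k)"
    unfolding norm_mult using u(3,4) x by (intro mult_mono) (auto simp: bounded_by_def X_def)
  qed
  also have "... = K' * B * Q ^ k" by (simp add: K'_def sum_distrib_left sum_distrib_right mult_ac)
  finally show "cmod (C k u j l) \<le> K' * B * Q ^ k" .
 qed
 moreover have "0 \<le> K'" by (simp add: K'_def sum_nonneg)
 ultimately show ?thesis using Q(1,2) by blast
qed

lemma M_Phi_window:
 assumes "csupp L f" "L + \<bar>x\<bar> \<le> of_int K"
 shows "M p c (Phi f x) = (\<Sum>j\<in>{-N..N}. \<Sum>l<r. v j l * (\<Sum>k\<in>{-K..K}. (of_int j + of_int k + c) ^ p * f l (x + of_int k)))"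
proof -
 have "zsum (\<lambda>k. (of_int j + of_int k + c) ^ p * Phi f x k l) = (\<Sum>k\<in>{-K..K}. (of_int j + of_int k + c) ^ p * Phi f x k l)" if "l < r" for j l
  using supp_in_Phi[OF assms] that by (intro zsum_eq) (auto simp: supp_in_def)
 then show ?thesis by (simp add: M_def Phi_def)
qed

lemma continuous_M_Phi:
 assumes "csupp L f" "!!l. l < r ==> continuous_on UNIV (f l)" "continuous_on UNIV c"
 shows "continuous_on {-B..B} (\<lambda>x. M p (c x) (Phi f x))"
proof -
 define K where "K = \<lceil>L + \<bar>B\<bar>\<rceil>"
 have f: "continuous_on {-B..B} (\<lambda>x. f l (x + of_int k))" if "l < r" for l k
  by (rule continuous_on_compose2[OF assms(2)[OF that]]) (auto intro!: continuous_intros)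
 have c: "continuous_on {-B..B} c" by (rule continuous_on_subset[OF assms(3)]) simp
 have "continuous_on {-B..B} (\<lambda>x. \<Sum>j\<in>{-N..N}. \<Sum>l<r. v j l * (\<Sum>k\<in>{-K..K}. (of_int j + of_int k + c x) ^ p * f l (x + of_int k)))"
  by (intro continuous_on_sum continuous_on_mult continuous_on_power continuous_on_add continuous_on_const f c) simp
 then show ?thesis
 proof (rule continuous_on_eq)
  fix x assume "x \<in> {-B..B}"
  then have "\<bar>x\<bar> \<le> \<bar>B\<bar>" by auto
  moreover have "L + \<bar>B\<bar> \<le> of_int K" by (simp add: K_def)
  ultimately have "L + \<bar>x\<bar> \<le> of_int K" by linarith
  from M_Phi_window[OF assms(1) this]
  show "(\<Sum>j\<in>{-N..N}. \<Sum>l<r. v j l * (\<Sum>k\<in>{-K..K}. (of_int j + of_int k + c x) ^ p * f l (x + of_int k))) = M p (c x) (Phi f x)" ..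
 qed
qed

lemma has_vector_derivative_M_Phi:
 assumes "csupp L f" "!!l x. l < r ==> (f l has_vector_derivative f' l x) (at x)"
 shows "((\<lambda>x. M p c (Phi f x)) has_vector_derivative M p c (Phi f' x)) (at x)"
proof -
 define K where "K = \<lceil>L + \<bar>x\<bar> + 1\<rceil>"
 have K: "L + \<bar>y\<bar> \<le> of_int K" if "y \<in> ball x 1" for y
 proof -
  have "\<bar>y\<bar> \<le> \<bar>x\<bar> + 1" using that by (auto simp: dist_real_def)
  then show ?thesis unfolding K_def by linarith
 qed
 have "(f l has_vector_derivative f' l (x + of_int k)) (at (1 * x + of_int k))" if "l < r" for l k
  using assms(2)[OF that, of "x + of_int k"] by simp
 from has_vector_derivative_affine[OF this]
 have "((\<lambda>x. f l (x + of_int k)) has_vector_derivative f' l (x + of_int k)) (at x)" if "l < r" for l k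
  using that by simp
 then have D: "((\<lambda>x. \<Sum>j\<in>{-N..N}. \<Sum>l<r. v j l * (\<Sum>k\<in>{-K..K}. (of_int j + of_int k + c) ^ p * f l (x + of_int k)))
   has_vector_derivative (\<Sum>j\<in>{-N..N}. \<Sum>l<r. v j l * (\<Sum>k\<in>{-K..K}. (of_int j + of_int k + c) ^ p * f' l (x + of_int k)))) (at x)"
  by (intro has_vector_derivative_sum has_vector_derivative_mult_right) auto
 have "x \<in> ball x 1" by simp
 from has_vector_derivative_transform_within_open[OF D open_ball this M_Phi_window[OF assms(1) K, symmetric]]
 show ?thesis
  using M_Phi_window[OF csupp_derivative[OF assms] K, of x] by simp
qed

lemma nderiv_M_Phi:
 assumes "csupp L f" "!!l. l < r ==> C_k n (f l)" "j \<le> n"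
 shows "nderiv j (\<lambda>x. M p c (Phi f x)) = (\<lambda>x. M p c (Phi (\<lambda>l. nderiv j (f l)) x))"
proof -
 have "nderiv j ((\<lambda>j x. M p c (Phi (\<lambda>l. nderiv j (f l)) x)) 0) = (\<lambda>x. M p c (Phi (\<lambda>l. nderiv j (f l)) x))"
 proof (rule nderiv_chain[where m = n])
  fix j x assume j: "j < n"
  show "((\<lambda>x. M p c (Phi (\<lambda>l. nderiv j (f l)) x)) has_vector_derivative M p c (Phi (\<lambda>l. nderiv (Suc j) (f l)) x)) (at x)"
   by (rule has_vector_derivative_M_Phi[OF csupp_nderiv[OF assms(1,2)]])
    (use j C_k_has_vector_derivative[OF assms(2)] in auto)
 qed (rule assms(3))
 then show ?thesis by simp
qed

text \<open>The moment form of the Strang--Fix conditions: \<open>M p x (Phi f x)\<close> is the periodisation of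
 \<open>\<Sum>\<^sub>j \<upsilon>(j) f(x) (x + j)^p\<close>.\<close>

definition admissible :: "(nat => real => complex) => bool" where
 "admissible f \<longleftrightarrow> (\<exists>h. h 0 = 1 \<and> (\<forall>p\<le>m. \<forall>x. M p (of_real x) (Phi f x) = h p))"

lemma M_Phi_R:
 assumes "csupp L f" "p \<le> m"
 shows "M p c (Phi (R f) x) = (1 / 2) ^ p * M p (2 * c) (Phi f (2 * x))"
proof -
 have f: "fsupp (T 0 (Phi f (2 * x)))" by (rule fsupp_T[OF fsupp_Phi[OF assms(1)]]) simp
 have "Phi (R f) x k l = 2 * T 0 (Phi f (2 * x)) k l + 0 * T 0 (Phi f (2 * x)) k l" for k l
  using Phi_R[of f "2 * x" 0 k l] by simp
 then have "M p c (Phi (R f) x) = M p c (\<lambda>k l. 2 * T 0 (Phi f (2 * x)) k l + 0 * T 0 (Phi f (2 * x)) k l)"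
  by (intro M_cong)
 also have "... = 2 * M p c (T 0 (Phi f (2 * x)))"
  using M_lincomb[OF f f, of p c 2 0] by simp
 also have "... = (1 / 2) ^ p * M p (2 * c) (Phi f (2 * x))"
  by (subst M_T[OF fsupp_Phi[OF assms(1)] assms(2)]) simp
 finally show ?thesis .
qed

lemma M_0_Phi:
 assumes "csupp L f" "!!s. s \<le> p ==> M s (of_real x) (Phi f x) = h s"
 shows "M p 0 (Phi f x) = (\<Sum>s\<le>p. of_nat (p choose s) * (- of_real x) ^ (p - s) * h s)"
 using M_binomial_add[OF fsupp_Phi[OF assms(1)], of p "of_real x" "- of_real x" x] assms(2) by simp

text \<open>As a function of \<open>x\<close>, the p-th moment of the samples is a polynomial of
  degree p whose coefficients come from the constants \<open>h s\<close>. Refinement replaces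
  \<open>h s\<close> by 2^(-s) \<open>h s\<close>, so the leading terms cancel in the difference and
  the degree drops below p. For p <= j, the j-fold derivative is therefore 0.\<close>

lemma V_Phi_difference:
 assumes f: "!!l. l < r ==> C_k m (f l)" "csupp L f" "admissible f" "of_int N \<le> L" and j: "j \<le> m"
 shows "V (Suc j) (Phi (\<lambda>l x. nderiv j (R f l) x - nderiv j (f l) x) x)"
proof -
 obtain h where h: "h 0 = 1" "!!p x. p \<le> m ==> M p (of_real x) (Phi f x) = h p"
  using assms(3) by (auto simp: admissible_def)
 define g where "g l x = 1 * R f l x + (-1) * f l x" for l x
 have Cg: "C_k m (g l)" if "l < r" for l
  unfolding g_def by (rule C_k_lincomb[OF C_k_R[OF f(1)] f(1)]) (use that in auto)
 have sg: "csupp L g" using csupp_R[OF f(2) assms(4)] f(2) by (auto simp: csupp_def g_def)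
 have gj: "nderiv j (R f l) x - nderiv j (f l) x = nderiv j (g l) x" if "l < r" for l x
 proof -
  have "C_k m (R f l)" "C_k m (f l)" using C_k_R[OF f(1)] f(1)[OF that] by auto
  from nderiv_lincomb[OF this, where j = j and \<alpha> = 1 and \<beta> = "-1"] show ?thesis
   using j by (simp add: g_def[abs_def])
 qed
 have "V (Suc j) (Phi (\<lambda>l. nderiv j (g l)) x)"
  unfolding V_def
 proof (intro conjI allI impI)
  show "fsupp (Phi (\<lambda>l. nderiv j (g l)) x)" using fsupp_Phi csupp_nderiv[OF sg Cg j] by blast
  fix p assume "p < Suc j"
  then have p: "p \<le> j" "p \<le> m" using j by auto
  define Q where "Q = (\<Sum>s\<in>{1..p}. monom (of_nat (p choose s) * (-1) ^ (p - s) * ((1 / 2) ^ s - 1) * h s) (p - s))"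
  have MQ: "(\<lambda>x. M p 0 (Phi g x)) = (\<lambda>x. poly Q (of_real x))"
  proof
   fix x
   have "M p 0 (Phi g x) = M p 0 (\<lambda>k l. 1 * Phi (R f) x k l + (-1) * Phi f x k l)"
    by (rule M_cong) (simp add: Phi_def g_def)
   also have "... = M p 0 (Phi (R f) x) - M p 0 (Phi f x)"
    using M_lincomb[of "Phi (R f) x" "Phi f x" p 0 1 "-1"] fsupp_Phi[OF csupp_R[OF f(2) assms(4)]] fsupp_Phi[OF f(2)] by simp
   also have "... = (1 / 2) ^ p * (\<Sum>s\<le>p. of_nat (p choose s) * (- of_real (2 * x)) ^ (p - s) * h s)
     - (\<Sum>s\<le>p. of_nat (p choose s) * (- of_real x) ^ (p - s) * h s)"
    using M_0_Phi[OF f(2) h(2)] p M_Phi_R[OF f(2) p(2), of 0 x] by simp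
   also have "... = (\<Sum>s\<le>p. of_nat (p choose s) * (- of_real x) ^ (p - s) * ((1 / 2) ^ s - 1) * h s)"
    unfolding sum_distrib_left sum_subtractf[symmetric]
   proof (rule sum.cong[OF refl])
    fix s assume "s \<in> {..p}"
    then have s: "s + (p - s) = p" by simp
    have "(1 / 2 :: complex) ^ p * (- of_real (2 * x)) ^ (p - s) = (1 / 2) ^ s * ((1 / 2) * (- of_real (2 * x))) ^ (p - s)"
     unfolding power_mult_distrib mult.assoc[symmetric] power_add[symmetric] s by simp
    also have "(1 / 2) * (- of_real (2 * x)) = (- of_real x :: complex)" by simp
    finally show "(1 / 2) ^ p * (of_nat (p choose s) * (- of_real (2 * x)) ^ (p - s) * h s) - of_nat (p choose s) * (- of_real x) ^ (p - s) * h s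
     = of_nat (p choose s) * (- of_real x) ^ (p - s) * ((1 / 2) ^ s - 1) * h s"
     by (simp add: algebra_simps)
   qed
   also have "... = (\<Sum>s\<in>{1..p}. of_nat (p choose s) * (- of_real x) ^ (p - s) * ((1 / 2) ^ s - 1) * h s)"
    by (intro sum.mono_neutral_right) (auto simp: not_less_eq_eq)
   also have "... = poly Q (of_real x)"
    unfolding Q_def poly_sum
    by (intro sum.cong refl) (simp add: poly_monom power_minus[of "of_real x"] mult_ac)
   finally show "M p 0 (Phi g x) = poly Q (of_real x)" .
  qed
  have "M p 0 (Phi (\<lambda>l. nderiv j (g l)) x) = nderiv j (\<lambda>x. M p 0 (Phi g x)) x"
   using fun_cong[OF nderiv_M_Phi[OF sg Cg j, of p 0], of x] by (rule sym)
  also have "... = poly ((pderiv ^^ j) Q) (of_real x)"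
   unfolding MQ nderiv_poly ..
  also have "(pderiv ^^ j) Q = 0"
  proof (cases "p = 0")
   case True
   have "(pderiv ^^ k) (0 :: complex poly) = 0" for k by (induction k) auto
   then show ?thesis using True by (simp add: Q_def)
  next
   case False
   have "degree Q \<le> p - 1"
    unfolding Q_def by (rule degree_sum_le) (auto intro: order_trans[OF degree_monom_le])
   then show ?thesis using False p by (intro pderiv_iter_degree) simp
  qed
  finally show "M p 0 (Phi (\<lambda>l. nderiv j (g l)) x) = 0" by simp
 qed
 then show ?thesis by (rule V_cong) (simp add: Phi_def gj)
qed

lemma bounded_continuous_csupp:
 assumes "csupp L f" "!!l. l < r ==> continuous_on UNIV (f l)"
 shows "\<exists>B\<ge>0. \<forall>l<r. \<forall>x. cmod (f l x) \<le> B"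
proof -
 have "\<exists>B. \<forall>x\<in>{-L..L}. cmod (f l x) \<le> B" if "l < r" for l
  using compact_imp_bounded[OF compact_continuous_image[OF continuous_on_subset[OF assms(2)[OF that]] compact_Icc[of "-L" L]]]
  by (auto simp: bounded_iff)
 then obtain B where B: "!!l x. l < r ==> x \<in> {-L..L} ==> cmod (f l x) \<le> B l" by metis
 have "cmod (f l x) \<le> (\<Sum>l<r. \<bar>B l\<bar>)" if "l < r" for l x
 proof (cases "\<bar>x\<bar> \<le> L")
  case True
  then have "x \<in> {-L..L}" by (auto simp: abs_le_iff)
  with B[OF that] have "cmod (f l x) \<le> \<bar>B l\<bar>" by (meson abs_ge_self order_trans)
  also have "... \<le> (\<Sum>l<r. \<bar>B l\<bar>)" using that by (intro member_le_sum) auto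
  finally show ?thesis .
 next
  case False
  then show ?thesis using assms(1) that by (auto simp: csupp_def intro!: sum_nonneg)
 qed
 then show ?thesis by (intro exI[of _ "\<Sum>l<r. \<bar>B l\<bar>"]) (auto intro: sum_nonneg)
qed

text \<open>The j-th derivative of two consecutive iterates differs by 2^(nj) times the n-th iterate
  of \<open>D j\<close>, whose samples have j + 1 vanishing moments. The factors 2^(nj) and 2^n,
  from differentiation and from \<open>R_iterate\<close>, are beaten by a rate below 2^(-j-1), so
  every order up to \<open>m\<close> converges geometrically.\<close>

lemma cascade_limit:
 assumes dec: "decays (Suc m)" and f: "!!l. l < r ==> C_k m (f l)" "csupp L f" "admissible f" "of_int N \<le> L"
 obtains g K \<theta> where "!!l. l < r ==> C_k m (g l)" "csupp L g" "!!l x. l < r ==> g l x = R g l x"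
  "!!x. M 0 0 (Phi g x) = 1" "0 \<le> \<theta>" "\<theta> < 1"
  "!!l j n x. l < r ==> j \<le> m ==> cmod (nderiv j ((R ^^ n) f l) x - nderiv j (g l) x) \<le> K * \<theta> ^ n"
proof -
 define D where "D j l x = nderiv j (R f l) x - nderiv j (f l) x" for j l x
 define W where "W = \<lceil>L + 1\<rceil>"
 have sD: "csupp L (D j)" if "j \<le> m" for j
  using csupp_nderiv[OF f(2,1) that] csupp_nderiv[OF csupp_R[OF f(2,4)] C_k_R[OF f(1)] that]
  by (auto simp: csupp_def D_def)
 have cD: "continuous_on UNIV (D j l)" if "j \<le> m" "l < r" for j l
  unfolding D_def
  by (intro continuous_intros C_k_continuous_nderiv[of m] C_k_R f(1) that) (auto intro: f(1))
 have "\<exists>\<theta> K. 0 \<le> \<theta> \<and> \<theta> < 1 \<and> 0 \<le> K \<and> (\<forall>n l x. l < r --> 2 ^ (n * j) * cmod ((R ^^ n) (D j) l x) \<le> K * \<theta> ^ n)" if j: "j \<le> m" for j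
 proof -
  obtain B where B: "0 \<le> B" "!!l x. l < r ==> cmod (D j l x) \<le> B"
   using bounded_continuous_csupp[OF sD[OF j] cD[OF j]] by blast
  have "decays (Suc j)" using decays_antimono[OF dec, of "Suc j"] j by simp
  from uniform_decay[OF this, of W] obtain q K where qK: "0 \<le> q" "q < (1 / 2) ^ Suc j" "0 \<le> K"
   "!!u B k. V (Suc j) u ==> supp_in W u ==> 0 \<le> B ==> bounded_by B u ==> bounded_by (K * B * q ^ k) (C k u)"
   by metis
  have "2 ^ (n * j) * cmod ((R ^^ n) (D j) l x) \<le> (K * B) * (2 ^ Suc j * q) ^ n" if "l < r" for n l x
  proof -
   have "cmod ((R ^^ n) (D j) l x) \<le> 2 ^ n * (K * B * q ^ n)"
   proof (rule R_iterate_bound[OF _ that])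
    fix x :: real assume x: "x \<in> {0..1}"
    have V: "V (Suc j) (Phi (D j) x)"
     unfolding D_def by (rule V_Phi_difference[OF f(1,2,3,4) j])
    have S: "supp_in W (Phi (D j) x)"
     using sD[OF j] x by (intro supp_in_Phi[of L]) (auto simp: W_def, linarith)
    have "bounded_by B (Phi (D j) x)" using B(2) by (simp add: bounded_by_def Phi_def)
    then show "bounded_by (K * B * q ^ n) (C n (Phi (D j) x))" using qK(4)[OF V S B(1)] by simp
   qed
   then have "2 ^ (n * j) * cmod ((R ^^ n) (D j) l x) \<le> 2 ^ (n * j) * (2 ^ n * (K * B * q ^ n))"
    by (rule mult_left_mono) simp
   also have "... = (K * B) * (2 ^ Suc j * q) ^ n"
    by (simp add: power_mult_distrib power_mult[symmetric] power_add mult_ac)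
   finally show ?thesis .
  qed
  moreover have "2 ^ Suc j * q < 1" using qK(2) by (simp add: field_simps power_divide)
  moreover have "0 \<le> 2 ^ Suc j * q" "0 \<le> K * B" using qK B by auto
  ultimately show ?thesis by blast
 qed
 then obtain th KK where th: "!!j. j \<le> m ==> 0 \<le> th j" "!!j. j \<le> m ==> th j < 1" "!!j. j \<le> m ==> 0 \<le> KK j"
  "!!j n l x. j \<le> m ==> l < r ==> 2 ^ (n * j) * cmod ((R ^^ n) (D j) l x) \<le> KK j * th j ^ n"
  by metis
 define \<theta> where "\<theta> = Max (th ` {..m})"
 define K where "K = (\<Sum>j\<le>m. KK j)"
 have \<theta>: "0 \<le> \<theta>" "\<theta> < 1" "!!j. j \<le> m ==> th j \<le> \<theta>"
  using th(1)[of 0] th(2) by (auto simp: \<theta>_def Max_ge_iff intro!: bexI[of _ 0])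
 have st: "cmod (nderiv j ((R ^^ Suc n) f l) x - nderiv j ((R ^^ n) f l) x) \<le> K * \<theta> ^ n" if "j \<le> m" "l < r" for j l n x
 proof -
  have "nderiv j ((R ^^ Suc n) f l) x = 2 ^ (n * j) * (R ^^ n) (\<lambda>l. nderiv j (R f l)) l x"
   unfolding funpow_Suc_right o_def using nderiv_R_iterate[of m "R f" l j n, OF C_k_R[OF f(1)] that(2,1)] by simp
  moreover have "nderiv j ((R ^^ n) f l) x = 2 ^ (n * j) * (R ^^ n) (\<lambda>l. nderiv j (f l)) l x"
   using nderiv_R_iterate[OF f(1) that(2,1)] by simp
  moreover have "(R ^^ n) (D j) l x = (R ^^ n) (\<lambda>l. nderiv j (R f l)) l x - (R ^^ n) (\<lambda>l. nderiv j (f l)) l x"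
   using R_iterate_lincomb[of n 1 "\<lambda>l. nderiv j (R f l)" "-1" "\<lambda>l. nderiv j (f l)"] unfolding D_def[abs_def] by simp
  ultimately have "nderiv j ((R ^^ Suc n) f l) x - nderiv j ((R ^^ n) f l) x = 2 ^ (n * j) * (R ^^ n) (D j) l x"
   by (simp only: right_diff_distrib)
  then have "cmod (nderiv j ((R ^^ Suc n) f l) x - nderiv j ((R ^^ n) f l) x) = 2 ^ (n * j) * cmod ((R ^^ n) (D j) l x)"
   by (simp add: norm_mult norm_power)
  also have "... \<le> KK j * th j ^ n" using th(4) that by simp
  also have "... \<le> K * \<theta> ^ n"
  proof (rule mult_mono)
   show "KK j \<le> K" unfolding K_def using that th(3) by (intro member_le_sum) auto
   show "th j ^ n \<le> \<theta> ^ n" using \<theta>(3) th(1) that by (intro power_mono) auto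
   show "0 \<le> K" unfolding K_def using th(3) by (intro sum_nonneg) auto
   show "0 \<le> th j ^ n" using th(1) that by simp
  qed
  finally show ?thesis .
 qed
 have "\<exists>G. C_k m G \<and> (\<forall>j\<le>m. \<forall>n x. cmod (nderiv j ((R ^^ n) f l) x - nderiv j G x) \<le> K / (1 - \<theta>) * \<theta> ^ n)" if "l < r" for l
  by (rule C_k_geometric_limit[of m "\<lambda>n. (R ^^ n) f l"])
   (use C_k_R_iterate[OF f(1) that] \<theta> st[OF _ that] in auto)
 then obtain g where g: "!!l. l < r ==> C_k m (g l)"
  "!!l j n x. l < r ==> j \<le> m ==> cmod (nderiv j ((R ^^ n) f l) x - nderiv j (g l) x) \<le> K / (1 - \<theta>) * \<theta> ^ n"
  by metis
 have lim: "(\<lambda>n. (R ^^ n) f l x) \<longlonglongrightarrow> g l x" if "l < r" for l x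
 proof (rule LIM_zero_cancel, rule tendsto_norm_zero_cancel, rule tendsto_sandwich[where f = "\<lambda>_. 0"])
  show "(\<lambda>n. K / (1 - \<theta>) * \<theta> ^ n) \<longlonglongrightarrow> 0"
   using \<theta> by (intro tendsto_mult_right_zero LIMSEQ_power_zero) simp
  show "\<forall>\<^sub>F n in sequentially. cmod ((R ^^ n) f l x - g l x) \<le> K / (1 - \<theta>) * \<theta> ^ n"
   using g(2)[OF that, of 0] by simp
 qed auto
 have sg: "csupp L g"
  unfolding csupp_def
 proof (intro allI impI)
  fix l and x :: real assume "l < r" "L < \<bar>x\<bar>"
  then have "(\<lambda>n. (R ^^ n) f l x) = (\<lambda>_. 0)"
   using csupp_R_iterate[OF f(2,4)] by (auto simp: csupp_def)
  then show "g l x = 0" using lim[OF \<open>l < r\<close>, of x] by (simp add: LIMSEQ_const_iff)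
 qed
 have ref: "g l x = R g l x" if "l < r" for l x
 proof -
  have "(\<lambda>n. 2 * (\<Sum>i\<in>{-N..N}. \<Sum>j<r. a i l j * (R ^^ n) f j (2 * x - of_int i)))
    \<longlonglongrightarrow> 2 * (\<Sum>i\<in>{-N..N}. \<Sum>j<r. a i l j * g j (2 * x - of_int i))"
   by (intro tendsto_intros lim) auto
  then have "(\<lambda>n. R ((R ^^ n) f) l x) \<longlonglongrightarrow> R g l x"
   by (simp only: R_def[of g] R_def[of "(R ^^ n) f" for n])
  moreover have "(\<lambda>n. R ((R ^^ n) f) l x) \<longlonglongrightarrow> g l x"
   using LIMSEQ_Suc[OF lim[OF that]] by simp
  ultimately show ?thesis using LIMSEQ_unique by blast
 qed
 have M: "M 0 0 (Phi g x) = 1" for x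
 proof -
  have M1: "M 0 0 (Phi ((R ^^ n) f) x) = 1" for n x
  proof (induction n arbitrary: x)
   case 0
   obtain h where "h 0 = 1" "!!p x. p \<le> m ==> M p (of_real x) (Phi f x) = h p"
    using f(3) by (auto simp: admissible_def)
   then show ?case using M_0_Phi[OF f(2), of 0 x h] by simp
  next
   case (Suc n)
   show ?case using M_Phi_R[OF csupp_R_iterate[OF f(2,4), of n], of 0 0 x] Suc by simp
  qed
  define W where "W = \<lceil>L + \<bar>x\<bar>\<rceil>"
  have W: "L + \<bar>x\<bar> \<le> of_int W" by (simp add: W_def)
  have "(\<lambda>n. M 0 0 (Phi ((R ^^ n) f) x)) \<longlonglongrightarrow> M 0 0 (Phi g x)"
   unfolding M_Phi_window[OF sg W] M_Phi_window[OF csupp_R_iterate[OF f(2,4)] W]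
   by (intro tendsto_intros lim) auto
  then show ?thesis unfolding M1 using LIMSEQ_unique tendsto_const by blast
 qed
 show ?thesis by (rule that[OF g(1) sg ref M \<theta>(1,2) g(2)])
qed

text \<open>A refinable function reproduces polynomials: the periodisations \<open>H p\<close> satisfy
 \<open>H p (x / 2) = 2^(-p) H p x\<close>, hence are constant.\<close>

lemma refinable_admissible:
 assumes g: "csupp L g" "!!l. l < r ==> continuous_on UNIV (g l)" "!!l x. l < r ==> g l x = R g l x"
  and M0: "M 0 0 (Phi g 0) = 1" and p: "p \<le> m"
 shows "M p (of_real x) (Phi g x) = (if p = 0 then 1 else 0)"
proof -
 define H where "H x = M p (of_real x) (Phi g x)" for x
 have half: "H x = (1 / 2) ^ p * H (2 * x)" for x
 proof -
  have "H x = M p (of_real x) (Phi (R g) x)"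
   unfolding H_def by (rule M_cong) (use g(3) in \<open>simp add: Phi_def\<close>)
  also have "... = (1 / 2) ^ p * H (2 * x)"
   using M_Phi_R[OF g(1) p, of "of_real x" x] by (simp add: H_def)
  finally show ?thesis .
 qed
 have half': "H x = ((1 / 2) ^ p) ^ n * H (2 ^ n * x)" for x n
 proof (induction n)
  case (Suc n)
  have "H (2 ^ n * x) = (1 / 2) ^ p * H (2 ^ Suc n * x)"
   using half[of "2 ^ n * x"] by (simp only: power_Suc mult.assoc)
  with Suc show ?case by simp
 qed simp
 have per1: "H (x + 1) = H x" for x
 proof -
  have "Phi g (x + 1) = (\<lambda>k. Phi g x (k - (-1)))" by (auto simp: Phi_def fun_eq_iff add_ac)
  then show ?thesis unfolding H_def by (simp only: M_shift) simp
 qed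
 have per: "H (x + of_int k) = H x" for x k
 proof (induction k rule: int_induct[of _ 0])
  case (step1 i)
  then show ?case using per1[of "x + of_int i"] by (simp add: add_ac)
 next
  case (step2 i)
  then show ?case using per1[of "x + of_int (i - 1)"] by simp
 qed simp
 have cont: "continuous_on {-1..1} H"
  unfolding H_def by (rule continuous_M_Phi[OF g(1,2)]) (auto intro!: continuous_intros)
 \<comment> \<open>For p = 0 invariance under halving and continuity reduce every value to the one
   at 0. For p > 0 periodicity bounds \<open>H\<close>, and the factor 2^(-pn) forces it to
   vanish.\<close>
 show ?thesis
 proof (cases "p = 0")
  case True
  have "H x = 1" for x
  proof -
   have "H (frac x) = H x" using per[of "frac x" "\<lfloor>x\<rfloor>"] by (simp add: frac_def)
   moreover have "(\<lambda>n. H (frac x / 2 ^ n)) \<longlonglongrightarrow> H 0"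
   proof (rule continuous_on_tendsto_compose[OF cont])
    have "(\<lambda>n. frac x * (1 / 2) ^ n) \<longlonglongrightarrow> 0" by (intro tendsto_mult_right_zero LIMSEQ_power_zero) simp
    then show "(\<lambda>n. frac x / 2 ^ n) \<longlonglongrightarrow> 0" by (simp add: power_divide)
    have "frac x / 2 ^ n \<in> {-1..1}" for n
    proof -
     have "frac x / 2 ^ n \<le> frac x / 1" by (rule divide_left_mono) auto
     moreover have "0 \<le> frac x / 2 ^ n" by simp
     ultimately show ?thesis using frac_lt_1[of x] unfolding atLeastAtMost_iff by linarith
    qed
    then show "\<forall>\<^sub>F n in sequentially. frac x / 2 ^ n \<in> {-1..1}" by simp
   qed auto
   moreover have "H (frac x / 2 ^ n) = H (frac x)" for n using half'[of "frac x / 2 ^ n" n] True by simp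
   ultimately have "H x = H 0" by (simp add: LIMSEQ_const_iff)
   then show ?thesis using M0 True by (simp add: H_def)
  qed
  then show ?thesis using True by (simp add: H_def)
 next
  case False
  have "bounded (H ` {-1..1})"
   by (rule compact_imp_bounded[OF compact_continuous_image[OF cont compact_Icc]])
  then obtain B where "\<forall>y\<in>H ` {-1..1}. cmod y \<le> B" unfolding bounded_iff by (rule exE)
  then have B: "cmod (H x) \<le> B" if "x \<in> {-1..1}" for x using that by (rule_tac bspec) auto
  have B': "cmod (H x) \<le> B" for x
  proof -
   have "frac x \<in> {-1..1}" using frac_lt_1[of x] frac_ge_0[of x] unfolding atLeastAtMost_iff by linarith
   moreover have "H (frac x) = H x" using per[of "frac x" "\<lfloor>x\<rfloor>"] by (simp add: frac_def)
   ultimately show ?thesis using B[of "frac x"] by simp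
  qed
  have "(\<lambda>n. ((1 / 2) ^ p) ^ n * B) \<longlonglongrightarrow> 0"
   using False by (intro tendsto_mult_left_zero LIMSEQ_power_zero) (simp add: power_less_one_iff)
  moreover have "cmod (H x) \<le> ((1 / 2) ^ p) ^ n * B" for n
  proof -
   have "cmod (H x) = ((1 / 2) ^ p) ^ n * cmod (H (2 ^ n * x))"
    by (subst half'[of x n]) (simp add: norm_mult norm_power norm_divide)
   also have "... \<le> ((1 / 2) ^ p) ^ n * B" by (intro mult_left_mono B') simp
   finally show ?thesis .
  qed
  ultimately have "cmod (H x) \<le> 0" by (intro LIMSEQ_le_const) auto
  then show ?thesis using False by (simp add: H_def)
 qed
qed

end

section \<open>Finite differences of smooth functions\<close>

definition poly_action :: "complex poly => (int => complex) => int => complex" where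
 "poly_action p c = fold_coeffs (\<lambda>b f k. b * c k + f (k - 1)) p (\<lambda>_. 0)"

lemma poly_action_0 [simp]: "poly_action 0 c = (\<lambda>_. 0)"
 by (simp add: poly_action_def)

lemma poly_action_pCons [simp]: "poly_action (pCons b p) c = (\<lambda>k. b * c k + poly_action p c (k - 1))"
 by (cases "p = 0 \<and> b = 0") (auto simp: poly_action_def)

lemma poly_action_add: "poly_action (p + q) c k = poly_action p c k + poly_action q c k"
 by (induction p q arbitrary: k rule: poly_induct2) (auto simp: algebra_simps)

lemma poly_action_smult: "poly_action (Polynomial.smult b p) c k = b * poly_action p c k"
 by (induction p arbitrary: k) (auto simp: algebra_simps)

text \<open>Multiplicativity is what allows matrices of symbols, with their determinants and
  adjugates, to act on sequences.\<close>

lemma poly_action_mult: "poly_action (p * q) c k = poly_action p (poly_action q c) k"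
 by (induction p arbitrary: k) (auto simp: poly_action_add poly_action_smult)

lemma poly_action_sum: "poly_action (\<Sum>i\<in>I. p i) c k = (\<Sum>i\<in>I. poly_action (p i) c k)"
 by (induction I rule: infinite_finite_induct) (auto simp: poly_action_add)

lemma poly_action_monom: "poly_action (monom b n) c k = b * c (k - int n)"
 by (induction n arbitrary: k) (auto simp: monom_0 monom_Suc algebra_simps)

lemma poly_action_sum_right: "poly_action p (\<lambda>k. \<Sum>i\<in>I. c i k) k = (\<Sum>i\<in>I. poly_action p (c i) k)"
 by (induction p arbitrary: k) (auto simp: sum_distrib_left sum.distrib)

lemma poly_action_bounded:
 assumes "!!k. cmod (c k) \<le> B"
 shows "\<exists>B'. \<forall>k. cmod (poly_action p c k) \<le> B'"
proof (induction p)
 case (pCons b p)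
 then obtain B' where "!!k. cmod (poly_action p c k) \<le> B'" by blast
 then have "cmod (poly_action (pCons b p) c k) \<le> cmod b * B + B'" for k
  using assms by (simp add: norm_triangle_le add_mono mult_left_mono norm_mult)
 then show ?case by blast
qed (auto intro: exI[of _ 0])

text \<open>The action is c(k - 1) - z c(k). Its first term dominates for |z| < 1 and its second for
  |z| > 1, so the triangle inequality bounds the supremum of c. The a priori bound \<open>B\<close>
  makes that supremum finite but does not enter the estimate.\<close>

lemma linear_factor_action_lower_bound:
 assumes B: "!!k. cmod (c k) \<le> B" and K: "!!k. cmod (poly_action [:-z, 1:] c k) \<le> K" and z: "cmod z ~= 1"
 shows "cmod (c k) \<le> K / \<bar>cmod z - 1\<bar>"
proof -
 define s where "s = (SUP k. cmod (c k))"
 have bdd: "bdd_above (range (\<lambda>k. cmod (c k)))" using B by (auto simp: bdd_above_def)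
 have le: "cmod (c k) \<le> s" for k unfolding s_def by (rule cSUP_upper[OF _ bdd]) simp
 have e: "cmod (c (k - 1) - z * c k) \<le> K" for k using K[of k] by simp
 have "s * \<bar>cmod z - 1\<bar> \<le> K"
 proof (cases "cmod z < 1")
  case True
  have "s \<le> K + cmod z * s"
   unfolding s_def
  proof (rule cSUP_least)
   fix k
   have "cmod (c k) \<le> cmod (c k - z * c (k + 1)) + cmod (z * c (k + 1))"
    by (metis diff_add_cancel norm_triangle_ineq)
   also have "... \<le> K + cmod z * s"
    using e[of "k + 1"] le[of "k + 1"] by (simp add: norm_mult add_mono mult_left_mono)
   finally show "cmod (c k) \<le> K + cmod z * (SUP k. cmod (c k))" by (simp add: s_def)
  qed simp
  then show ?thesis using True by (simp add: algebra_simps)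
 next
  case False
  then have z1: "1 < cmod z" "0 < cmod z" using z by linarith+
  have "s \<le> (K + s) / cmod z"
   unfolding s_def
  proof (rule cSUP_least)
   fix k
   have "cmod (z * c k) \<le> cmod (c (k - 1) - z * c k) + cmod (c (k - 1))"
    by (metis add.commute diff_add_cancel norm_minus_commute norm_triangle_ineq)
   also have "... \<le> K + s" using e[of k] le[of "k - 1"] by simp
   finally show "cmod (c k) \<le> (K + (SUP k. cmod (c k))) / cmod z"
    using z1 by (simp add: s_def norm_mult pos_le_divide_eq mult.commute)
  qed simp
  then have "s * cmod z \<le> K + s" using z1 by (simp add: pos_le_divide_eq)
  then show ?thesis using z1 by (simp add: algebra_simps)
 qed
 then have "s \<le> K / \<bar>cmod z - 1\<bar>" using z by (simp add: pos_le_divide_eq)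
 with le show ?thesis by (rule order_trans)
qed

text \<open>An elementary form of Wiener inversion: over the complex numbers the symbol splits into
  linear factors with roots off the unit circle, and each factor is bounded below on bounded
  sequences.\<close>

lemma poly_action_lower_bound:
 assumes "!!z. cmod z = 1 ==> poly d z ~= 0"
 shows "\<exists>\<kappa>>0. \<forall>c B K. (\<forall>k. cmod (c k) \<le> B) --> (\<forall>k. cmod (poly_action d c k) \<le> K) --> (\<forall>k. cmod (c k) \<le> \<kappa> * K)"
 using assms
proof (induction "degree d" arbitrary: d rule: less_induct)
 case less
 show ?case
 proof (cases "degree d = 0")
  case True
  then obtain b where d: "d = [:b:]" using degree_eq_zeroE by blast
  then have "b ~= 0" using less.prems[of 1] by simp
  then show ?thesis
   by (intro exI[of _ "1 / cmod b"]) (simp add: d norm_mult pos_le_divide_eq mult.commute)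
 next
  case False
  then obtain z where z: "poly d z = 0"
   using fundamental_theorem_of_algebra[of d] constant_degree[of d] by auto
  then obtain q where q: "d = [:-z, 1:] * q" by (auto simp: poly_eq_0_iff_dvd)
  then have "q ~= 0" using False by auto
  then have "degree q < degree d" unfolding q by (subst degree_mult_eq) auto
  moreover have "poly q w ~= 0" if "cmod w = 1" for w using less.prems[OF that] q by auto
  ultimately obtain \<kappa> where \<kappa>: "\<kappa> > 0"
   "!!c B K. (\<forall>k. cmod (c k) \<le> B) ==> (\<forall>k. cmod (poly_action q c k) \<le> K) ==> (\<forall>k. cmod (c k) \<le> \<kappa> * K)"
   using less.hyps by blast
  have z1: "cmod z ~= 1" using less.prems z by blast
  have "cmod (c k) \<le> \<kappa> / \<bar>cmod z - 1\<bar> * K"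
   if c: "\<forall>k. cmod (c k) \<le> B" and K: "\<forall>k. cmod (poly_action d c k) \<le> K" for c B K k
  proof -
   obtain B' where B': "!!k. cmod (poly_action q c k) \<le> B'" using poly_action_bounded[of c B q] c by blast
   have "cmod (poly_action [:-z, 1:] (poly_action q c) k) \<le> K" for k
    using spec[OF K, of k] unfolding q poly_action_mult .
   from linear_factor_action_lower_bound[OF B' this z1]
   have "\<forall>k. cmod (poly_action q c k) \<le> K / \<bar>cmod z - 1\<bar>" by blast
   from \<kappa>(2)[OF c this] show ?thesis by simp
  qed
  moreover have "\<kappa> / \<bar>cmod z - 1\<bar> > 0" using \<kappa>(1) z1 by simp
  ultimately show ?thesis by blast
 qed
qed

text \<open>Gaussian elimination, one coordinate at a time. It serves to replace the continuum of
  sampling offsets in [0, 1] by finitely many.\<close>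

lemma finite_spanning_subfamily:
 fixes f :: "'x => 'i => complex"
 assumes "finite I"
 shows "\<exists>Y\<subseteq>X. finite Y \<and> (\<forall>x\<in>X. \<exists>c. \<forall>i\<in>I. f x i = (\<Sum>y\<in>Y. c y * f y i))"
 using assms
proof (induction I arbitrary: f rule: finite_induct)
 case empty
 show ?case by (intro exI[of _ "{}"]) auto
next
 case (insert i I)
 show ?case
 proof (cases "\<forall>x\<in>X. f x i = 0")
  case True
  obtain Y where Y: "Y \<subseteq> X" "finite Y" "!!x. x \<in> X ==> \<exists>c. \<forall>i\<in>I. f x i = (\<Sum>y\<in>Y. c y * f y i)"
   using insert.IH[of f] by blast
  have "\<exists>c. \<forall>j\<in>insert i I. f x j = (\<Sum>y\<in>Y. c y * f y j)" if "x \<in> X" for x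
  proof -
   obtain c where "\<forall>i\<in>I. f x i = (\<Sum>y\<in>Y. c y * f y i)" using Y(3)[OF \<open>x \<in> X\<close>] by blast
   moreover have "(\<Sum>y\<in>Y. c y * f y i) = 0" using True Y(1) by (intro sum.neutral) auto
   ultimately show ?thesis using True that by (intro exI[of _ c]) auto
  qed
  then show ?thesis using Y(1,2) by blast
 next
  case False
  then obtain x0' where x0: "x0' \<in> X" "f x0' i ~= 0" by blast
  define f' where "f' x j = f x j - f x i / f x0' i * f x0' j" for x j
  obtain Y where Y: "Y \<subseteq> X" "finite Y" "!!x. x \<in> X ==> \<exists>c. \<forall>i\<in>I. f' x i = (\<Sum>y\<in>Y. c y * f' y i)"
   using insert.IH[of f'] by blast
  have "\<exists>c. \<forall>j\<in>insert i I. f x j = (\<Sum>y\<in>insert x0' Y. c y * f y j)" if "x \<in> X" for x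
  proof -
   obtain c where c: "!!j. j \<in> I ==> f' x j = (\<Sum>y\<in>Y. c y * f' y j)" using Y(3)[OF \<open>x \<in> X\<close>] by blast
   define b where "b = f x i / f x0' i - (\<Sum>y\<in>Y. c y * (f y i / f x0' i))"
   have eq: "f x j = b * f x0' j + (\<Sum>y\<in>Y. c y * f y j)" if "j \<in> insert i I" for j
   proof -
    have "f' x j = (\<Sum>y\<in>Y. c y * f' y j)"
    proof (cases "j = i")
     case True
     then show ?thesis using x0(2) by (simp add: f'_def)
    qed (use c \<open>j \<in> insert i I\<close> in auto)
    also have "... = (\<Sum>y\<in>Y. c y * f y j) - (\<Sum>y\<in>Y. c y * (f y i / f x0' i)) * f x0' j"
     unfolding f'_def sum_distrib_right sum_subtractf[symmetric]
     by (intro sum.cong refl) (simp add: algebra_simps)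
    finally show ?thesis by (simp add: f'_def b_def algebra_simps)
   qed
   define c' where "c' y = (if y \<in> Y then c y else 0) + (if y = x0' then b else 0)" for y
   have "(\<Sum>y\<in>insert x0' Y. c' y * f y j) = b * f x0' j + (\<Sum>y\<in>Y. c y * f y j)" for j
   proof -
    have "(\<Sum>y\<in>insert x0' Y. c' y * f y j)
      = (\<Sum>y\<in>insert x0' Y. if y \<in> Y then c y * f y j else 0) + (\<Sum>y\<in>insert x0' Y. if y = x0' then b * f y j else 0)"
     unfolding sum.distrib[symmetric] by (intro sum.cong refl) (simp add: c'_def algebra_simps)
    also have "(\<Sum>y\<in>insert x0' Y. if y \<in> Y then c y * f y j else 0) = (\<Sum>y\<in>Y. c y * f y j)"
     using Y(2) by (intro sum.mono_neutral_cong_right) auto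
    also have "(\<Sum>y\<in>insert x0' Y. if y = x0' then b * f y j else 0) = b * f x0' j"
     using Y(2) by (subst sum.delta) auto
    finally show ?thesis by simp
   qed
   then show ?thesis using eq by (intro exI[of _ c']) simp
  qed
  moreover have "insert x0' Y \<subseteq> X" "finite (insert x0' Y)" using Y x0 by auto
  ultimately show ?thesis by blast
 qed
qed

section \<open>Taylor remainders controlled by a modulus of continuity\<close>

lemma uniformly_continuous_compact_support:
 fixes h :: "real => complex"
 assumes "continuous_on UNIV h" "!!x. L < \<bar>x\<bar> ==> h x = 0" "0 < e"
 shows "\<exists>\<delta>>0. \<forall>x y. \<bar>x - y\<bar> < \<delta> --> cmod (h x - h y) < e"
proof -
 have "uniformly_continuous_on {-\<bar>L\<bar>-1..\<bar>L\<bar>+1} h"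
  by (intro compact_uniformly_continuous continuous_on_subset[OF assms(1)]) auto
 from this[unfolded uniformly_continuous_on_def dist_real_def dist_norm, rule_format, OF assms(3)]
 obtain \<delta> where \<delta>: "\<delta> > 0" "!!x y. x \<in> {-\<bar>L\<bar>-1..\<bar>L\<bar>+1} ==> y \<in> {-\<bar>L\<bar>-1..\<bar>L\<bar>+1} ==> \<bar>y - x\<bar> < \<delta> ==> cmod (h y - h x) < e"
  by auto
 have "cmod (h x - h y) < e" if "\<bar>x - y\<bar> < min \<delta> 1" for x y
 proof (cases "\<bar>x\<bar> \<le> \<bar>L\<bar> + 1 \<and> \<bar>y\<bar> \<le> \<bar>L\<bar> + 1")
  case True
  then have "x \<in> {-\<bar>L\<bar>-1..\<bar>L\<bar>+1}" "y \<in> {-\<bar>L\<bar>-1..\<bar>L\<bar>+1}" by auto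
  from \<delta>(2)[OF this(2,1)] show ?thesis using that by simp
 next
  case False
  then have "L < \<bar>x\<bar>" "L < \<bar>y\<bar>" using that by linarith+
  then show ?thesis using assms(2,3) by simp
 qed
 then show ?thesis using \<delta>(1) by (intro exI[of _ "min \<delta> 1"]) auto
qed

text \<open>The remainder is measured by the oscillation \<open>\<omega>\<close> of the m-th
  derivative itself, since no further derivative is available. The induction bounds the derivative
  of the remainder and integrates by the mean value inequality.\<close>

lemma C_k_taylor:
 assumes "C_k m f" "!!s. \<bar>s\<bar> \<le> \<rho> ==> cmod (nderiv m f (x + s) - nderiv m f x) \<le> \<omega>" "\<bar>t\<bar> \<le> \<rho>"
 shows "cmod (f (x + t) - (\<Sum>p\<le>m. nderiv p f x * of_real t ^ p / fact p)) \<le> \<omega> * \<bar>t\<bar> ^ m"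
 using assms
proof (induction m arbitrary: f t)
 case 0
 then show ?case by simp
next
 case (Suc m)
 define \<psi> where "\<psi> t = f (x + t) - (\<Sum>p\<le>Suc m. nderiv p f x * of_real t ^ p / fact p)" for t
 define \<psi>' where "\<psi>' t = nderiv 1 f (x + t) - (\<Sum>p\<le>m. nderiv p (nderiv 1 f) x * of_real t ^ p / fact p)" for t
 have shift: "nderiv p (nderiv 1 f) = nderiv (Suc p) f" for p
  using nderiv_Suc_shift[of 0 f] nderiv_Suc_shift[of p f] by simp
 obtain f' where f': "!!x. (f has_vector_derivative f' x) (at x)" "C_k m f'" "f' = nderiv 1 f"
  using C_k_SucE[OF Suc.prems(1)] by metis
 have \<omega>: "0 \<le> \<omega>" using Suc.prems(2)[of 0] Suc.prems(3) by simp
 have D: "(\<psi> has_vector_derivative \<psi>' t) (at t)" for t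
 proof -
  have 1: "((\<lambda>t. f (x + t)) has_vector_derivative nderiv 1 f (x + t)) (at t)"
   using has_vector_derivative_affine[of f "f' (x + t)" 1 t x] f' by (simp add: add.commute)
  have 2: "((\<lambda>t. nderiv p f x * of_real t ^ p / fact p) has_vector_derivative
    (nderiv p f x / fact p) * (of_nat p * of_real t ^ (p - 1))) (at t)" for p
  proof -
   have "((\<lambda>z. (nderiv p f x / fact p) * z ^ p) has_field_derivative (nderiv p f x / fact p) * (of_nat p * (of_real t) ^ (p - 1))) (at (of_real t))"
    by (auto intro!: derivative_eq_intros)
   from has_vector_derivative_real_field[OF this] show ?thesis by simp
  qed
  have "(\<psi> has_vector_derivative nderiv 1 f (x + t) - (\<Sum>p\<le>Suc m. (nderiv p f x / fact p) * (of_nat p * of_real t ^ (p - 1)))) (at t)"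
   unfolding \<psi>_def by (intro has_vector_derivative_diff has_vector_derivative_sum 1 2)
  moreover have "(\<Sum>p\<le>Suc m. (nderiv p f x / fact p) * (of_nat p * of_real t ^ (p - 1)))
    = (\<Sum>p\<le>m. nderiv p (nderiv 1 f) x * of_real t ^ p / fact p)"
   unfolding sum.atMost_Suc_shift shift
   by (simp add: fact_Suc del: of_nat_Suc)
  ultimately show ?thesis by (simp add: \<psi>'_def)
 qed
 have b: "cmod (\<psi>' s) \<le> \<omega> * \<bar>t\<bar> ^ m" if "s \<in> closed_segment 0 t" for s
 proof -
  have st: "\<bar>s\<bar> \<le> \<bar>t\<bar>" using that by (auto simp: closed_segment_eq_real_ivl split: if_splits)
  have "cmod (\<psi>' s) \<le> \<omega> * \<bar>s\<bar> ^ m"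
   unfolding \<psi>'_def using Suc.prems(2,3) f'(2,3) st by (intro Suc.IH) (auto simp: shift simp del: One_nat_def)
  also have "... \<le> \<omega> * \<bar>t\<bar> ^ m" using st \<omega> by (intro mult_left_mono power_mono) auto
  finally show ?thesis .
 qed
 have "norm (\<psi> t - \<psi> 0) \<le> (\<omega> * \<bar>t\<bar> ^ m) * norm (t - 0)"
 proof (rule differentiable_bound[of "closed_segment 0 t" \<psi> "\<lambda>t h. h *\<^sub>R \<psi>' t"])
  fix s assume s: "s \<in> closed_segment 0 t"
  show "(\<psi> has_derivative (\<lambda>h. h *\<^sub>R \<psi>' s)) (at s within closed_segment 0 t)"
   using has_vector_derivative_at_within[OF D] by (simp add: has_vector_derivative_def)
  show "onorm (\<lambda>h. h *\<^sub>R \<psi>' s) \<le> \<omega> * \<bar>t\<bar> ^ m"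
  proof (rule onorm_le)
   fix h :: real
   have "\<bar>h\<bar> * cmod (\<psi>' s) \<le> \<bar>h\<bar> * (\<omega> * \<bar>t\<bar> ^ m)" by (intro mult_left_mono b s) simp
   then show "norm (h *\<^sub>R \<psi>' s) \<le> \<omega> * \<bar>t\<bar> ^ m * norm h" by (simp add: mult.commute)
  qed
 qed auto
 moreover have "\<psi> 0 = 0" unfolding \<psi>_def by (subst sum.atMost_Suc_shift) simp
 ultimately show ?case by (simp add: \<psi>_def mult_ac)
qed

text \<open>A combination of point evaluations that annihilates polynomials of degree at most
  \<open>m\<close> sees only the Taylor remainder, which is o(h^m), uniformly in \<open>x\<close> by
  compact support. This is the source of the little-o in \<open>decays_weakly\<close>.\<close>

lemma C_k_difference_functional:
 assumes f: "C_k m f" "!!x. L < \<bar>x\<bar> ==> f x = 0"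
  and S: "finite S" "!!p. p \<le> m ==> (\<Sum>s\<in>S. c s * of_real (\<tau> s) ^ p) = 0" and e: "0 < e"
 shows "\<exists>\<delta>>0. \<forall>h x. 0 < h --> h < \<delta> --> cmod (\<Sum>s\<in>S. c s * f (x + h * \<tau> s)) \<le> e * h ^ m"
proof -
 define Z where "Z = (\<Sum>s\<in>S. cmod (c s) * \<bar>\<tau> s\<bar> ^ m) + 1"
 have Z: "Z > 0" unfolding Z_def by (intro add_nonneg_pos sum_nonneg) auto
 have "L < \<bar>x\<bar> ==> nderiv m f x = 0" for x by (rule nderiv_zero_outside[OF f order_refl])
 from uniformly_continuous_compact_support[OF C_k_continuous_nderiv[OF f(1) order_refl] this, of L "e / Z"] Z e
 obtain \<delta> where \<delta>: "\<delta> > 0" "!!x y. \<bar>x - y\<bar> < \<delta> ==> cmod (nderiv m f x - nderiv m f y) < e / Z" by auto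
 define T where "T = (\<Sum>s\<in>S. \<bar>\<tau> s\<bar>) + 1"
 have T: "T > 0" "!!s. s \<in> S ==> \<bar>\<tau> s\<bar> \<le> T"
 proof -
  show "T > 0" unfolding T_def by (intro add_nonneg_pos sum_nonneg) auto
  fix s assume "s \<in> S"
  then have "\<bar>\<tau> s\<bar> \<le> (\<Sum>s\<in>S. \<bar>\<tau> s\<bar>)" using S(1) by (intro member_le_sum) auto
  then show "\<bar>\<tau> s\<bar> \<le> T" by (simp add: T_def)
 qed
 have "cmod (\<Sum>s\<in>S. c s * f (x + h * \<tau> s)) \<le> e * h ^ m" if h: "0 < h" "h < \<delta> / T" for h x
 proof -
  have hT: "h * T < \<delta>" using h(2) T(1) by (simp add: pos_less_divide_eq)
  define P where "P t = (\<Sum>p\<le>m. nderiv p f x * of_real t ^ p / fact p)" for t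
  have "(\<Sum>s\<in>S. c s * P (h * \<tau> s)) = (\<Sum>s\<in>S. \<Sum>p\<le>m. nderiv p f x * of_real h ^ p / fact p * (c s * of_real (\<tau> s) ^ p))"
   unfolding P_def sum_distrib_left by (intro sum.cong refl) (simp add: power_mult_distrib)
  also have "... = (\<Sum>p\<le>m. nderiv p f x * of_real h ^ p / fact p * (\<Sum>s\<in>S. c s * of_real (\<tau> s) ^ p))"
   unfolding sum_distrib_left by (rule sum.swap)
  also have "... = 0" using S(2) by (intro sum.neutral) simp
  finally have "(\<Sum>s\<in>S. c s * f (x + h * \<tau> s)) = (\<Sum>s\<in>S. c s * (f (x + h * \<tau> s) - P (h * \<tau> s)))"
   by (simp add: right_diff_distrib sum_subtractf)
  also have "cmod ... \<le> (\<Sum>s\<in>S. e / Z * h ^ m * (cmod (c s) * \<bar>\<tau> s\<bar> ^ m))"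
  proof (rule sum_norm_le)
   fix s assume s: "s \<in> S"
   have "\<bar>h * \<tau> s\<bar> \<le> h * T" using T(2)[OF s] h by (simp add: abs_mult)
   moreover have "cmod (nderiv m f (x + y) - nderiv m f x) \<le> e / Z" if "\<bar>y\<bar> \<le> h * T" for y
    using \<delta>(2)[of "x + y" x] that hT by (intro less_imp_le) auto
   ultimately have "cmod (f (x + h * \<tau> s) - P (h * \<tau> s)) \<le> e / Z * \<bar>h * \<tau> s\<bar> ^ m"
    unfolding P_def using C_k_taylor[OF f(1)] by blast
   then have "cmod (c s) * cmod (f (x + h * \<tau> s) - P (h * \<tau> s)) \<le> cmod (c s) * (e / Z * \<bar>h * \<tau> s\<bar> ^ m)"
    by (rule mult_left_mono) simp
   then show "cmod (c s * (f (x + h * \<tau> s) - P (h * \<tau> s))) \<le> e / Z * h ^ m * (cmod (c s) * \<bar>\<tau> s\<bar> ^ m)"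
    using h by (simp add: norm_mult abs_mult power_mult_distrib mult_ac)
  qed
  also have "... = e / Z * h ^ m * (Z - 1)" by (simp add: Z_def sum_distrib_left)
  also have "... \<le> e / Z * h ^ m * Z" using e Z h by (intro mult_left_mono) auto
  also have "... = e * h ^ m" using Z by simp
  finally show ?thesis .
 qed
 moreover have "\<delta> / T > 0" using \<delta>(1) T(1) by simp
 ultimately show ?thesis by blast
qed

context mask
begin

lemma C_poly_action:
 "C n (\<lambda>k l. poly_action p (\<lambda>k. u k l) k) j l = poly_action p (\<lambda>j. C n u j l) j"
proof (induction p arbitrary: j)
 case 0
 then show ?case using C_lincomb[of n 0 u 0 u j l] by simp
next
 case (pCons b p)
 have "C n (\<lambda>k l. poly_action (pCons b p) (\<lambda>k. u k l) k) j l
   = C n (\<lambda>k l. b * u k l + 1 * poly_action p (\<lambda>k. u k l) (k - 1)) j l" by simp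
 also have "... = b * C n u j l + 1 * C n (\<lambda>k l. poly_action p (\<lambda>k. u k l) (k - 1)) j l"
  by (rule C_lincomb)
 also have "C n (\<lambda>k l. poly_action p (\<lambda>k. u k l) (k - 1)) j l = poly_action p (\<lambda>j. C n u j l) (j - 1)"
  using C_shift[of n "\<lambda>k l. poly_action p (\<lambda>k. u k l) k" 1 j] pCons.IH by simp
 finally show ?case by simp
qed

lemma fsupp_poly_action: "fsupp u ==> fsupp (\<lambda>k l. poly_action p (\<lambda>k. u k l) k)"
proof (induction p)
 case (pCons b p)
 have "fsupp (\<lambda>k l. b * u k l + 1 * poly_action p (\<lambda>k. u k l) (k - 1))"
  using fsupp_shift[OF pCons.IH[OF pCons.prems], of 1] by (intro fsupp_lincomb pCons.prems) simp
 then show ?case by simp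
qed (simp add: fsupp_def supp_in_def)

end

context sum_rule_mask
begin

lemma V_poly_action: "V n u ==> V n (\<lambda>k l. poly_action p (\<lambda>k. u k l) k)"
proof (induction p)
 case 0
 then show ?case using V_lincomb[of n u u 0 0] by simp
next
 case (pCons b p)
 have "V n (\<lambda>k l. b * u k l + 1 * poly_action p (\<lambda>k. u k l) (k - 1))"
  using V_shift[OF pCons.IH[OF pCons.prems], of 1] by (intro V_lincomb pCons.prems) simp
 then show ?case by simp
qed

end

section \<open>Stability\<close>

lemma det_poly_mat:
 "Determinant.det (map_mat (\<lambda>p. poly p z) A) = poly (Determinant.det A) (z :: complex)"
 by (rule comm_ring_hom.hom_det) (unfold_locales, auto)

context sum_rule_mask
begin

text \<open>Stability makes the Gram matrix \<open>G(z)\<close> of the shifts of \<open>g\<close>, sampled at finitely many points, invertible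
 on the unit circle. By Cramer's rule \<open>det G\<close> maps \<open>u\<close> into the module generated by the sequences
 \<open>Phi g y\<close>, on which the subdivision process just samples \<open>g\<close>; there the moment conditions turn \<open>a\<^sub>n * u\<close>
 into finite differences of \<open>g\<close> of order \<open>m + 1\<close>. Finally \<open>det G\<close>, having no zeros on the circle, can be cancelled.\<close>

lemma stable_refinable_decays_weakly:
 assumes g: "csupp L g" "!!l. l < r ==> C_k m (g l)" "!!l x. l < r ==> g l x = R g l x"
  and M0: "M 0 0 (Phi g 0) = 1" and K: "L + 1 \<le> of_int K"
  and stable: "!!z \<gamma> l. cmod z = 1 ==>
   (!!x. x \<in> {0..1} ==> (\<Sum>l<r. \<gamma> l * (\<Sum>k\<in>{-K..K}. g l (x + of_int k) * z powi k)) = 0) ==> l < r ==> \<gamma> l = 0"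
 shows "decays_weakly (Suc m)"
proof -
 define I where "I = {-K..K} \<times> {..<r}"
 obtain Y where Y: "Y \<subseteq> {0..1}" "finite Y"
  and span: "!!x. x \<in> {0..1} ==> \<exists>c. \<forall>i\<in>I. g (snd i) (x + of_int (fst i)) = (\<Sum>y\<in>Y. c y * g (snd i) (y + of_int (fst i)))"
  using finite_spanning_subfamily[of I "{0..1}" "\<lambda>x i. g (snd i) (x + of_int (fst i))"] by (auto simp: I_def)
 \<comment> \<open>The shift by \<open>K\<close> turns Laurent polynomials into polynomials. On the
   unit circle \<open>P'\<close> is z^(2K) times the conjugate of \<open>P\<close>, so that
   \<open>det G\<close> is a polynomial and yet \<open>G\<close> is there a unimodular multiple of a
   Gram matrix.\<close>
 define P where "P y l = (\<Sum>k\<in>{-K..K}. monom (g l (y + of_int k)) (nat (k + K)))" for y l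
 define P' where "P' y l = (\<Sum>k\<in>{-K..K}. monom (cnj (g l (y + of_int k))) (nat (K - k)))" for y l
 define G where "G = Matrix.mat r r (\<lambda>(l, l'). \<Sum>y\<in>Y. P y l * P' y l')"
 define d where "d = Determinant.det G"
 have G: "G \<in> carrier_mat r r" by (simp add: G_def)
 have Pz: "poly (P y l) z = z powi K * (\<Sum>k\<in>{-K..K}. g l (y + of_int k) * z powi k)" if "cmod z = 1" for z y l
 proof -
  have z: "z ~= 0" using that by auto
  have "z ^ nat (k + K) = z powi K * z powi k" if "k \<in> {-K..K}" for k
  proof -
   have "z ^ nat (k + K) = z powi (k + K)" using that by (simp add: power_int_def)
   then show ?thesis using z by (simp add: power_int_add mult.commute)
  qed
  then show ?thesis unfolding P_def poly_sum sum_distrib_left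
   by (intro sum.cong refl) (simp add: poly_monom mult_ac)
 qed
 have P'z: "poly (P' y l) z = z powi (2 * K) * cnj (poly (P y l) z)" if "cmod z = 1" for z y l
 proof -
  have z: "z ~= 0" using that by auto
  have "z * cnj z = 1" using complex_norm_square[of z] that by simp
  then have cz: "cnj z = inverse z" by (rule inverse_unique[symmetric])
  have "z ^ nat (K - k) = z powi (2 * K) * cnj (z ^ nat (k + K))" if "k \<in> {-K..K}" for k
  proof -
   have "z ^ nat (K - k) = z powi (K - k)" using that by (simp add: power_int_def)
   also have "... = z powi (2 * K) * z powi (- (k + K))"
    using z by (simp add: power_int_add[symmetric])
   also have "z powi (- (k + K)) = inverse z ^ nat (k + K)"
    using that by (auto simp: power_int_def power_inverse add.commute)
   finally show ?thesis by (simp add: cz)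
  qed
  then show ?thesis unfolding P_def P'_def poly_sum sum_distrib_left cnj_sum
   by (intro sum.cong refl) (simp add: poly_monom mult_ac)
 qed
 have d1: "poly d z ~= 0" if z: "cmod z = 1" for z
 proof
  assume "poly d z = 0"
  define Gz where "Gz = map_mat (\<lambda>p. poly p z) G"
  have "Determinant.det Gz = 0" using \<open>poly d z = 0\<close> by (simp add: Gz_def det_poly_mat d_def)
  moreover have "Gz \<in> carrier_mat r r" using G by (simp add: Gz_def)
  ultimately obtain w where w: "w \<in> carrier_vec r" "w ~= 0\<^sub>v r" "Gz *\<^sub>v w = 0\<^sub>v r"
   using det_0_iff_vec_prod_zero by blast
  define W where "W l = vec_index w l" for l
  define s where "s y = (\<Sum>l<r. cnj (W l) * poly (P y l) z)" for y
  have row: "(\<Sum>l'<r. poly (\<Sum>y\<in>Y. P y l * P' y l') z * W l') = 0" if "l < r" for l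
  proof -
   have "vec_index (Gz *\<^sub>v w) l = (\<Sum>l'<r. poly (\<Sum>y\<in>Y. P y l * P' y l') z * W l')"
    using that w(1) by (simp add: Gz_def G_def W_def scalar_prod_def atLeast0LessThan)
   then show ?thesis using w(3) that by simp
  qed
  \<comment> \<open>Pairing a kernel vector with itself through \<open>G\<close> gives z^(2K) times
    the sum of the squares |s y|^2, so every \<open>s y\<close> vanishes.\<close>
  have "0 = (\<Sum>l<r. cnj (W l) * (\<Sum>l'<r. poly (\<Sum>y\<in>Y. P y l * P' y l') z * W l'))"
   using row by simp
  also have "... = (\<Sum>l<r. \<Sum>l'<r. \<Sum>y\<in>Y. cnj (W l) * poly (P y l) z * (poly (P' y l') z * W l'))"
   unfolding poly_sum poly_mult sum_distrib_left sum_distrib_right by (intro sum.cong refl) (simp add: mult_ac)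
  also have "... = (\<Sum>l<r. \<Sum>y\<in>Y. \<Sum>l'<r. cnj (W l) * poly (P y l) z * (poly (P' y l') z * W l'))"
   by (intro sum.cong refl sum.swap)
  also have "... = (\<Sum>y\<in>Y. \<Sum>l<r. \<Sum>l'<r. cnj (W l) * poly (P y l) z * (poly (P' y l') z * W l'))"
   by (rule sum.swap)
  also have "... = (\<Sum>y\<in>Y. s y * (\<Sum>l'<r. poly (P' y l') z * W l'))"
   unfolding s_def sum_product ..
  also have "... = z powi (2 * K) * (\<Sum>y\<in>Y. s y * cnj (s y))"
   unfolding P'z[OF z] s_def cnj_sum sum_distrib_left by (intro sum.cong refl) (simp add: mult_ac)
  also have "(\<Sum>y\<in>Y. s y * cnj (s y)) = of_real (\<Sum>y\<in>Y. (cmod (s y))\<^sup>2)"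
   unfolding of_real_sum complex_norm_square ..
  finally have "z powi (2 * K) * of_real (\<Sum>y\<in>Y. (cmod (s y))\<^sup>2) = 0" by (rule sym)
  moreover have "z powi (2 * K) ~= 0" using z by (auto simp: power_int_eq_0_iff)
  ultimately have "(\<Sum>y\<in>Y. (cmod (s y))\<^sup>2) = 0" by (simp only: mult_eq_0_iff of_real_eq_0_iff simp_thms)
  then have s0: "s y = 0" if "y \<in> Y" for y using Y(2) that by (simp add: sum_nonneg_eq_0_iff)
  \<comment> \<open>The linear relation holds at the points of \<open>Y\<close>. Since their sample
    vectors span those of all x in [0, 1], it holds there as well, which is what
    \<open>stable\<close> asks for.\<close>
  have "cnj (W l) = 0" if "l < r" for l
  proof (rule stable[OF z _ that])
   fix x :: real assume "x \<in> {0..1}"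
   then obtain c where "\<forall>i\<in>I. g (snd i) (x + of_int (fst i)) = (\<Sum>y\<in>Y. c y * g (snd i) (y + of_int (fst i)))"
    using span by blast
   then have c: "g l (x + of_int k) = (\<Sum>y\<in>Y. c y * g l (y + of_int k))" if "l < r" "k \<in> {-K..K}" for l k
    using that unfolding I_def by (metis (mono_tags, lifting) SigmaI fst_conv lessThan_iff snd_conv sum.cong)
   have "(\<Sum>l<r. cnj (W l) * (\<Sum>k\<in>{-K..K}. g l (x + of_int k) * z powi k))
     = (\<Sum>l<r. \<Sum>k\<in>{-K..K}. \<Sum>y\<in>Y. c y * (cnj (W l) * (g l (y + of_int k) * z powi k)))"
    unfolding sum_distrib_left using c by (intro sum.cong refl) (simp add: sum_distrib_left sum_distrib_right mult_ac)
   also have "... = (\<Sum>l<r. \<Sum>y\<in>Y. \<Sum>k\<in>{-K..K}. c y * (cnj (W l) * (g l (y + of_int k) * z powi k)))"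
    by (intro sum.cong refl sum.swap)
   also have "... = (\<Sum>y\<in>Y. \<Sum>l<r. \<Sum>k\<in>{-K..K}. c y * (cnj (W l) * (g l (y + of_int k) * z powi k)))"
    by (rule sum.swap)
   also have "... = (\<Sum>y\<in>Y. c y * (inverse (z powi K) * s y))"
   proof (intro sum.cong refl)
    fix y
    have "z powi K ~= 0" using z by (auto simp: power_int_eq_0_iff)
    then have "inverse (z powi K) * s y = (\<Sum>l<r. cnj (W l) * (\<Sum>k\<in>{-K..K}. g l (y + of_int k) * z powi k))"
     unfolding s_def Pz[OF z] sum_distrib_left[of "inverse (z powi K)"]
     by (intro sum.cong refl) (simp add: field_simps)
    then show "(\<Sum>l<r. \<Sum>k\<in>{-K..K}. c y * (cnj (W l) * (g l (y + of_int k) * z powi k))) = c y * (inverse (z powi K) * s y)"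
     by (simp add: sum_distrib_left)
   qed
   also have "... = 0" using s0 by simp
   finally show "(\<Sum>l<r. cnj (W l) * (\<Sum>k\<in>{-K..K}. g l (x + of_int k) * z powi k)) = 0" .
  qed
  then have "w = 0\<^sub>v r" using w(1) by (intro eq_vecI) (auto simp: W_def)
  then show False using w(2) by simp
 qed
 obtain \<kappa> where \<kappa>: "\<kappa> > 0"
  "!!c B K. (\<forall>k. cmod (c k) \<le> B) ==> (\<forall>k. cmod (poly_action d c k) \<le> K) ==> (\<forall>k. cmod (c k) \<le> \<kappa> * K)"
  using poly_action_lower_bound[OF d1] by blast
 have H: "M p (of_real x) (Phi g x) = (if p = 0 then 1 else 0)" if "p \<le> m" for p x
  by (rule refinable_admissible[OF g(1) C_k_continuous[OF g(2)] g(3) M0 that])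
 have Rg: "(R ^^ n) g l = g l" if "l < r" for n l
  using that
 proof (induction n arbitrary: l)
  case (Suc n)
  have "R ((R ^^ n) g) = R g" by (rule R_cong) (simp add: Suc.IH)
  then show ?case using g(3)[OF Suc.prems] by (simp add: fun_eq_iff)
 qed simp
 show ?thesis
  unfolding decays_weakly_def
 proof (intro allI impI)
  fix u \<epsilon> assume u: "V (Suc m) u" and \<epsilon>: "(0 :: real) < \<epsilon>"
  \<comment> \<open>By Cramer's rule G A = det(G) times the identity. Hence \<open>det G\<close>
    applied to \<open>u\<close> equals the sum over y of \<open>P y\<close> acting on scalar
    sequences \<open>q y\<close>, that is, a finite combination of sampled shifts of
    \<open>g\<close>.\<close>
  define A where "A = adj_mat G"
  define W where "W y l' = (\<Sum>j<r. P' y j * A $$ (j, l'))" for y l'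
  define q where "q y k = (\<Sum>l'<r. poly_action (W y l') (\<lambda>k. u k l') k)" for y k
  define w where "w k l = poly_action d (\<lambda>k. u k l) k" for k l
  have GA: "(\<Sum>y\<in>Y. P y l * W y l') = (if l = l' then d else 0)" if "l < r" "l' < r" for l l'
  proof -
   have "(\<Sum>y\<in>Y. P y l * W y l') = (\<Sum>y\<in>Y. \<Sum>j<r. P y l * P' y j * A $$ (j, l'))"
    by (simp add: W_def sum_distrib_left mult.assoc)
   also have "... = (\<Sum>j<r. (\<Sum>y\<in>Y. P y l * P' y j) * A $$ (j, l'))"
    unfolding sum_distrib_right by (rule sum.swap)
   also have "... = (G * A) $$ (l, l')"
    using that adj_mat(1)[OF G] by (simp add: A_def G_def scalar_prod_def atLeast0LessThan)
   also have "... = (if l = l' then d else 0)"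
    using that unfolding A_def adj_mat(2)[OF G] by (simp add: d_def)
   finally show ?thesis .
  qed
  have finq: "finite {k. q y k ~= 0}" for y
  proof -
   have "finite {k. poly_action (W y l') (\<lambda>k. u k l') k ~= 0}" if "l' < r" for l'
    using fsupp_finite[OF fsupp_poly_action[OF V_fsupp[OF u]] that, of "\<lambda>_. 1"] by simp
   then have "finite (\<Union>l'<r. {k. poly_action (W y l') (\<lambda>k. u k l') k ~= 0})" by blast
   then show ?thesis
    by (rule finite_subset[rotated]) (auto simp: q_def intro: ccontr sum.neutral)
  qed
  define S where "S = Sigma Y (\<lambda>y. {k. q y k ~= 0})"
  define c where "c s = q (fst s) (snd s)" for s
  define \<tau> where "\<tau> s = fst s - of_int (snd s) - of_int K" for s :: "real \<times> int"
  have S: "finite S" using finq Y(2) by (auto simp: S_def)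
  have weq: "w k l = (\<Sum>s\<in>S. c s * Phi g (\<tau> s) k l)" if l: "l < r" for k l
  proof -
   have "w k l = (\<Sum>l'<r. if l = l' then poly_action d (\<lambda>k. u k l') k else 0)"
    using l by (simp add: w_def)
   also have "... = (\<Sum>l'<r. poly_action (\<Sum>y\<in>Y. P y l * W y l') (\<lambda>k. u k l') k)"
    using GA[OF l] by (intro sum.cong refl) simp
   also have "... = (\<Sum>y\<in>Y. \<Sum>l'<r. poly_action (P y l) (poly_action (W y l') (\<lambda>k. u k l')) k)"
    unfolding poly_action_sum poly_action_mult by (rule sum.swap)
   also have "... = (\<Sum>y\<in>Y. poly_action (P y l) (q y) k)"
    unfolding q_def[abs_def] poly_action_sum_right ..
   also have "... = (\<Sum>y\<in>Y. \<Sum>n | q y n ~= 0. q y n * g l (y - of_int n - of_int K + of_int k))"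
   proof (rule sum.cong[OF refl])
    fix y assume y: "y \<in> Y"
    define f where "f \<kappa> = g l (y + of_int \<kappa>) * q y (k - (\<kappa> + K))" for \<kappa> :: int
    have "poly_action (P y l) (q y) k = (\<Sum>\<kappa>\<in>{-K..K}. f \<kappa>)"
     unfolding P_def poly_action_sum poly_action_monom f_def by (intro sum.cong refl) auto
    also have "... = zsum f"
    proof (rule zsum_eq[symmetric])
     fix \<kappa> assume "\<kappa> \<notin> {-K..K}"
     then have "K + 1 \<le> \<bar>\<kappa>\<bar>" by auto
     then have "of_int (K + 1) \<le> (of_int \<bar>\<kappa>\<bar> :: real)" by (simp only: of_int_le_iff)
     then have "of_int K + 1 \<le> \<bar>of_int \<kappa> :: real\<bar>" by simp
     moreover have "0 \<le> y" "y \<le> 1" using Y(1) y by auto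
     ultimately have "L < \<bar>y + of_int \<kappa>\<bar>" using K by (simp add: abs_if split: if_splits)
     then show "f \<kappa> = 0" using g(1) l by (simp add: csupp_def f_def)
    qed simp
    also have "... = zsum (\<lambda>n. f ((k - K) - n))" by (rule zsum_reflect[symmetric])
    also have "... = (\<Sum>n | q y n ~= 0. f ((k - K) - n))"
     by (rule zsum_eq[OF finq]) (simp add: f_def)
    also have "... = (\<Sum>n | q y n ~= 0. q y n * g l (y - of_int n - of_int K + of_int k))"
     by (intro sum.cong refl) (simp add: f_def algebra_simps)
    finally show "poly_action (P y l) (q y) k = (\<Sum>n | q y n ~= 0. q y n * g l (y - of_int n - of_int K + of_int k))" .
   qed
   also have "... = (\<Sum>(y, n)\<in>S. q y n * g l (y - of_int n - of_int K + of_int k))"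
    unfolding S_def by (rule sum.Sigma[OF Y(2)]) (simp add: finq)
   also have "... = (\<Sum>s\<in>S. c s * Phi g (\<tau> s) k l)"
    by (intro sum.cong refl) (simp add: c_def \<tau>_def Phi_def case_prod_beta)
   finally show ?thesis .
  qed
  \<comment> \<open>The moments of \<open>Phi g x\<close> are the powers of -x, so the vanishing
    moments of \<open>w\<close> say that the weights \<open>c s\<close> at the points
    \<open>\<tau> s\<close> annihilate all polynomials of degree at most \<open>m\<close>.\<close>
  have mom: "(\<Sum>s\<in>S. c s * of_real (\<tau> s) ^ p) = 0" if p: "p \<le> m" for p
  proof -
   have MP: "M p 0 (Phi g x) = (- 1) ^ p * of_real x ^ p" for x
   proof -
    have "M p 0 (Phi g x) = (\<Sum>s\<le>p. of_nat (p choose s) * (- of_real x) ^ (p - s) * (if s = 0 then 1 else 0))"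
     by (rule M_0_Phi[OF g(1)]) (use H p in simp)
    also have "... = (\<Sum>s\<le>p. if s = 0 then (- of_real x) ^ p else 0)" by (intro sum.cong) auto
    finally show ?thesis by (simp add: power_minus[of "of_real x"])
   qed
   have "V (Suc m) w" unfolding w_def by (rule V_poly_action[OF u])
   then have "0 = M p 0 w" using p by (simp add: V_def)
   also have "... = M p 0 (\<lambda>k l. \<Sum>s\<in>S. c s * Phi g (\<tau> s) k l)" by (rule M_cong) (rule weq)
   also have "... = (\<Sum>s\<in>S. c s * M p 0 (Phi g (\<tau> s)))" by (rule M_sum[OF S fsupp_Phi[OF g(1)]])
   also have "... = (- 1) ^ p * (\<Sum>s\<in>S. c s * of_real (\<tau> s) ^ p)"
    unfolding MP sum_distrib_left by (intro sum.cong refl) (simp add: mult_ac)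
   finally show ?thesis by simp
  qed
  have "\<forall>\<^sub>F n in sequentially. \<forall>l\<in>{..<r}. \<forall>x. cmod (\<Sum>s\<in>S. c s * g l (x + (1 / 2) ^ n * \<tau> s)) \<le> \<epsilon> / \<kappa> * ((1 / 2) ^ n) ^ m"
  proof (intro eventually_ball_finite ballI)
   fix l assume l: "l \<in> {..<r}"
   have z: "g l x = 0" if "L < \<bar>x\<bar>" for x using g(1) l that by (simp add: csupp_def)
   have Cl: "C_k m (g l)" using g(2) l by simp
   have "0 < \<epsilon> / \<kappa>" using \<epsilon> \<kappa>(1) by simp
   from C_k_difference_functional[OF Cl z S mom this]
   obtain \<delta> where "\<delta> > 0 \<and> (\<forall>h x. 0 < h --> h < \<delta> --> cmod (\<Sum>s\<in>S. c s * g l (x + h * \<tau> s)) \<le> \<epsilon> / \<kappa> * h ^ m)"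
    by (rule exE)
   then have \<delta>: "\<delta> > 0" "!!h x. 0 < h ==> h < \<delta> ==> cmod (\<Sum>s\<in>S. c s * g l (x + h * \<tau> s)) \<le> \<epsilon> / \<kappa> * h ^ m"
    by simp_all
   have "(\<lambda>n. (1 / 2 :: real) ^ n) \<longlonglongrightarrow> 0" by (rule LIMSEQ_power_zero) simp
   then have "\<forall>\<^sub>F n in sequentially. (1 / 2 :: real) ^ n < \<delta>" by (rule order_tendstoD(2)) (rule \<delta>(1))
   then show "\<forall>\<^sub>F n in sequentially. \<forall>x. cmod (\<Sum>s\<in>S. c s * g l (x + (1 / 2) ^ n * \<tau> s)) \<le> \<epsilon> / \<kappa> * ((1 / 2) ^ n) ^ m"
    by eventually_elim (use \<delta>(2) in simp)
  qed simp
  then show "\<forall>\<^sub>F n in sequentially. bounded_by (\<epsilon> * (1 / 2) ^ (Suc m * n)) (C n u)"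
  proof eventually_elim
   case (elim n)
   show ?case
    unfolding bounded_by_def
   proof (intro allI impI)
    fix j l assume l: "l < r"
    have "cmod (poly_action d (\<lambda>j. C n u j l) j) \<le> \<epsilon> / \<kappa> * (1 / 2) ^ (Suc m * n)" for j
    proof -
     have "poly_action d (\<lambda>j. C n u j l) j = C n w j l"
      unfolding w_def by (rule C_poly_action[symmetric])
     also have "... = C n (\<lambda>k l. \<Sum>s\<in>S. c s * Phi g (\<tau> s) k l) j l"
      by (rule C_cong[OF weq l])
     also have "... = (\<Sum>s\<in>S. c s * C n (Phi g (\<tau> s)) j l)" by (simp add: C_sum)
     also have "... = (1 / 2) ^ n * (\<Sum>s\<in>S. c s * g l (of_int j / 2 ^ n + (1 / 2) ^ n * \<tau> s))"
      unfolding C_Phi Rg[OF l] sum_distrib_left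
      by (intro sum.cong refl) (simp add: power_divide add_divide_distrib add.commute)
     finally have "cmod (poly_action d (\<lambda>j. C n u j l) j) = (1 / 2) ^ n * cmod (\<Sum>s\<in>S. c s * g l (of_int j / 2 ^ n + (1 / 2) ^ n * \<tau> s))"
      by (simp add: norm_mult norm_power norm_divide)
     also have "... \<le> (1 / 2) ^ n * (\<epsilon> / \<kappa> * ((1 / 2) ^ n) ^ m)"
      using elim l by (intro mult_left_mono) auto
     also have "... = \<epsilon> / \<kappa> * (1 / 2) ^ (Suc m * n)"
      by (simp add: power_mult[symmetric] power_add mult.commute)
     finally show ?thesis .
    qed
    moreover obtain B where "\<forall>j. cmod (C n u j l) \<le> B"
     using ex_bounded_by[OF V_fsupp[OF u], of n] l by (auto simp: bounded_by_def)
    \<comment> \<open>Here \<open>det G\<close> is cancelled; the bound \<open>B\<close> may depend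
      on \<open>n\<close>, but \<open>\<kappa>\<close> does not.\<close>
    ultimately have "cmod (C n u j l) \<le> \<kappa> * (\<epsilon> / \<kappa> * (1 / 2) ^ (Suc m * n))"
     using \<kappa>(2)[of "\<lambda>j. C n u j l" B "\<epsilon> / \<kappa> * (1 / 2) ^ (Suc m * n)"] by blast
    then show "cmod (C n u j l) \<le> \<epsilon> * (1 / 2) ^ (Suc m * n)" using \<kappa>(1) by simp
   qed
  qed
 qed
qed

end

section \<open>Bump functions, periodisation and splines\<close>

lemma poly_growth: "\<exists>K n. \<forall>t\<ge>1. cmod (poly P (of_real t)) \<le> K * t ^ n"
proof (induction P)
 case (pCons b P)
 then obtain K n where K: "!!t. t \<ge> 1 ==> cmod (poly P (of_real t)) \<le> K * t ^ n" by blast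
 have "cmod (poly (pCons b P) (of_real t)) \<le> (cmod b + K) * t ^ Suc n" if "t \<ge> 1" for t
 proof -
  have "cmod (poly (pCons b P) (of_real t)) \<le> cmod b + t * cmod (poly P (of_real t))"
   using that norm_triangle_ineq[of b "of_real t * poly P (of_real t)"] by (simp add: norm_mult)
  also have "... \<le> cmod b * t ^ Suc n + t * (K * t ^ n)"
  proof (intro add_mono mult_left_mono K that)
   show "cmod b \<le> cmod b * t ^ Suc n"
    using one_le_power[OF that, of "Suc n"] by (simp add: mult_le_cancel_left1 del: power_Suc)
  qed (use that in auto)
  also have "... = (cmod b + K) * t ^ Suc n" by (simp add: algebra_simps)
  finally show ?thesis .
 qed
 then show ?case by blast
qed (auto intro: exI[of _ 0])

text \<open>The functions \<open>P(1/x) e\<^bsup>-1/x\<^esup>\<close>, extended by \<open>0\<close>, are closed under differentiation.\<close>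

definition flat :: "complex poly => real => complex" where
 "flat P x = (if 0 < x then poly P (of_real (1 / x)) * of_real (exp (- (1 / x))) else 0)"

text \<open>With t = 1/x, the exponential beats t^(n + 2) for a polynomial of growth t^n, which
  leaves the factor x^2. Quadratic smallness is enough for derivative 0 at the origin, for all
  members of the family at once.\<close>

lemma flat_quadratic_bound: "\<exists>K. \<forall>x. \<bar>x\<bar> \<le> 1 --> cmod (flat P x) \<le> K * x\<^sup>2"
proof -
 obtain K n where K: "!!t. t \<ge> 1 ==> cmod (poly P (of_real t)) \<le> K * t ^ n" using poly_growth by blast
 define k where "k = n + 2"
 have "cmod (flat P x) \<le> \<bar>K\<bar> * real k ^ k * x\<^sup>2" if "\<bar>x\<bar> \<le> 1" for x
 proof (cases "0 < x")
  case True
  define t where "t = 1 / x"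
  have t: "1 \<le> t" using True that by (simp add: t_def)
  have k: "0 < real k ^ k" by (simp add: k_def)
  have "(t / real k) ^ k \<le> (1 + t / real k) ^ k" using t by (intro power_mono) auto
  also have "... \<le> exp t" using t by (intro exp_ge_one_plus_x_over_n_power_n) (auto simp: k_def)
  finally have "t ^ k \<le> exp t * real k ^ k" using k by (simp add: power_divide pos_divide_le_eq)
  then have "t ^ k * exp (- t) \<le> exp t * real k ^ k * exp (- t)" by (rule mult_right_mono) simp
  also have "... = real k ^ k" by (simp add: exp_minus)
  finally have "t ^ k * exp (- t) \<le> real k ^ k" .
  moreover have "t ^ k = t ^ n * t\<^sup>2" by (simp add: k_def power_add power2_eq_square)
  ultimately have "t ^ n * exp (- t) * t\<^sup>2 \<le> real k ^ k" by (simp add: mult_ac)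
  then have e: "t ^ n * exp (- t) \<le> real k ^ k * x\<^sup>2"
   using True by (simp add: t_def power_divide pos_divide_le_eq mult_ac)
  have "cmod (flat P x) = cmod (poly P (of_real t)) * exp (- t)"
   using True by (simp add: flat_def t_def norm_mult)
  also have "... \<le> (\<bar>K\<bar> * t ^ n) * exp (- t)"
   using K[OF t] t by (intro mult_right_mono order_trans[OF K[OF t]]) auto
  also have "... \<le> \<bar>K\<bar> * (real k ^ k * x\<^sup>2)"
   using mult_left_mono[OF e, of "\<bar>K\<bar>"] by (simp add: mult_ac)
  finally show ?thesis by (simp add: mult_ac)
 qed (simp add: flat_def)
 then show ?thesis by blast
qed

lemma has_vector_derivative_flat:
 "(flat P has_vector_derivative flat ([:0, 0, 1:] * (P - pderiv P)) x) (at x)"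
proof -
 consider "x < 0" | "x = 0" | "0 < x" by linarith
 then show ?thesis
 proof cases
  case 1
  have "(flat P has_vector_derivative 0) (at x)"
   by (rule has_vector_derivative_transform_within_open[OF has_vector_derivative_const open_lessThan[of 0]])
    (use 1 in \<open>auto simp: flat_def\<close>)
  then show ?thesis using 1 by (simp add: flat_def)
 next
  case 2
  obtain K where K: "!!x. \<bar>x\<bar> \<le> 1 ==> cmod (flat P x) \<le> K * x\<^sup>2" using flat_quadratic_bound by blast
  have "(\<lambda>h. norm (flat P (0 + h) - flat P 0 - h *\<^sub>R 0) / norm h) \<midarrow>0\<rightarrow> 0"
  proof (rule Lim_null_comparison)
   show "\<forall>\<^sub>F h in at 0. norm (norm (flat P (0 + h) - flat P 0 - h *\<^sub>R 0) / norm h) \<le> K * \<bar>h\<bar>"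
    unfolding eventually_at
   proof (intro exI[of _ 1] conjI ballI impI)
    fix h :: real assume h: "h ~= 0 \<and> dist h 0 < 1"
    then have "cmod (flat P h) / \<bar>h\<bar> \<le> K * h\<^sup>2 / \<bar>h\<bar>" by (intro divide_right_mono K) auto
    also have "... = K * \<bar>h\<bar>" using h by (simp add: power2_eq_square abs_if)
    finally show "norm (norm (flat P (0 + h) - flat P 0 - h *\<^sub>R 0) / norm h) \<le> K * \<bar>h\<bar>"
     by (simp add: flat_def[of P 0])
   qed simp
   show "(\<lambda>h. K * \<bar>h\<bar>) \<midarrow>0\<rightarrow> 0" by (auto intro!: tendsto_eq_intros)
  qed
  then have "(flat P has_vector_derivative 0) (at 0)"
   unfolding has_vector_derivative_def has_derivative_at by simp
  then show ?thesis using 2 by (simp add: flat_def)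
 next
  case 3
  have "((\<lambda>z. poly P (inverse z) * exp (- inverse z)) has_field_derivative
    poly (pderiv P) (inverse (of_real x)) * (- (inverse (of_real x) * 1 * inverse (of_real x))) * exp (- inverse (of_real x))
    + (exp (- inverse (of_real x)) * (inverse (of_real x) * 1 * inverse (of_real x))) * poly P (inverse (of_real x))) (at (of_real x))"
   using 3 by (intro DERIV_mult DERIV_chain2[where f = "poly P"] DERIV_chain2[where f = exp] poly_DERIV DERIV_exp)
    (auto intro!: derivative_eq_intros)
  moreover have "poly (pderiv P) (inverse (of_real x)) * (- (inverse (of_real x) * 1 * inverse (of_real x))) * exp (- inverse (of_real x))
    + (exp (- inverse (of_real x)) * (inverse (of_real x) * 1 * inverse (of_real x))) * poly P (inverse (of_real x))
    = flat ([:0, 0, 1:] * (P - pderiv P)) x"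
   using 3 by (simp add: flat_def exp_of_real[symmetric] inverse_eq_divide algebra_simps)
  ultimately have "((\<lambda>z. poly P (inverse z) * exp (- inverse z)) has_field_derivative flat ([:0, 0, 1:] * (P - pderiv P)) x) (at (of_real x))"
   by (simp only:)
  from has_vector_derivative_real_field[OF this, of UNIV]
  have "((\<lambda>x. poly P (inverse (of_real x)) * exp (- inverse (of_real x))) has_vector_derivative
    flat ([:0, 0, 1:] * (P - pderiv P)) x) (at x)" .
  then show ?thesis
   by (rule has_vector_derivative_transform_within_open[OF _ open_greaterThan[of 0]])
    (use 3 in \<open>auto simp: flat_def exp_of_real[symmetric] inverse_eq_divide\<close>)
 qed
qed

lemma C_k_flat: "C_k n (flat P)"
proof (induction n arbitrary: P)
 case 0
 show ?case unfolding C_k_0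
  by (intro continuous_at_imp_continuous_on ballI has_vector_derivative_continuous[OF has_vector_derivative_flat])
qed (rule C_k_Suc[OF has_vector_derivative_flat])

definition bump :: "real => real => real => real" where
 "bump \<alpha> \<beta> x = (if \<alpha> < x \<and> x < \<beta> then exp (- (1 / (x - \<alpha>))) * exp (- (1 / (\<beta> - x))) else 0)"

lemma bump_nonneg: "0 \<le> bump \<alpha> \<beta> x"
 and bump_pos: "\<alpha> < x ==> x < \<beta> ==> 0 < bump \<alpha> \<beta> x"
 and bump_zero: "x \<le> \<alpha> \<or> \<beta> \<le> x ==> bump \<alpha> \<beta> x = 0"
 by (auto simp: bump_def)

lemma C_k_bump: "C_k n (\<lambda>x. of_real (bump \<alpha> \<beta> x))"
proof -
 have "of_real (bump \<alpha> \<beta> x) = flat 1 (1 * x + - \<alpha>) * flat 1 ((-1) * x + \<beta>)" for x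
  by (simp add: bump_def flat_def)
 then show ?thesis
  by (simp only:) (intro C_k_mult C_k_affine C_k_flat)
qed

lemma smooth_bump: "smooth_fun (\<lambda>x. of_real (bump \<alpha> \<beta> x))"
 by (simp add: smooth_fun_def C_k_bump)

text \<open>Integrating down one order at a time, each constant of integration is 0 by compact
  support. It ensures that the m-th derivative of a bump is not identically zero.\<close>

lemma nderiv_eq_0_imp_eq_0:
 assumes "C_k m f" "!!x. L < \<bar>x\<bar> ==> f x = 0" "!!x. nderiv m f x = 0"
 shows "f x = 0"
proof -
 have "\<forall>x. nderiv (m - i) f x = 0" if "i \<le> m" for i
  using that
 proof (induction i)
  case 0
  then show ?case using assms(3) by simp
 next
  case (Suc i)
  define j where "j = m - Suc i"
  have j: "j < m" "Suc j = m - i" using Suc.prems by (auto simp: j_def)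
  have "\<exists>c. \<forall>x\<in>UNIV. nderiv j f x = c"
  proof (rule has_derivative_zero_constant)
   fix x :: real
   have "(nderiv j f has_vector_derivative 0) (at x)"
    using C_k_has_vector_derivative[OF assms(1) j(1), of x] Suc j(2) by simp
   then show "(nderiv j f has_derivative (\<lambda>h. 0)) (at x within UNIV)" by (simp add: has_vector_derivative_def)
  qed simp
  then obtain c where c: "!!x. nderiv j f x = c" by auto
  have "nderiv j f (\<bar>L\<bar> + 1) = 0"
   by (rule nderiv_zero_outside[OF assms(1,2)]) (use j in auto)
  then show ?case using c by (simp add: j_def)
 qed
 from this[of m] show ?thesis by simp
qed

section \<open>Periodisation of compactly supported functions\<close>

definition Per :: "(real => complex) => real => complex" where
 "Per g x = zsum (\<lambda>k. g (x + of_int k))"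

lemma Per_window:
 assumes "!!x. L < \<bar>x\<bar> ==> g x = 0" "L + \<bar>x\<bar> \<le> of_int K"
 shows "Per g x = (\<Sum>k\<in>{-K..K}. g (x + of_int k))"
 unfolding Per_def
proof (rule zsum_eq)
 fix k assume "k \<notin> {-K..K}"
 then have "K < \<bar>k\<bar>" by auto
 then have "of_int K < (of_int \<bar>k\<bar> :: real)" by (simp only: of_int_less_iff)
 then have "L < \<bar>x + of_int k\<bar>" using assms(2) by (simp add: abs_if split: if_splits)
 then show "g (x + of_int k) = 0" by (rule assms(1))
qed simp

lemma Per_periodic: "Per g (x + of_int k) = Per g x"
 unfolding Per_def using zsum_shift[of "\<lambda>i. g (x + of_int i)" k] by (simp add: add_ac)

lemma Per_translate: "Per (\<lambda>x. g (x + of_int k)) x = Per g x"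
 unfolding Per_def using zsum_shift[of "\<lambda>i. g (x + of_int i)" k] by (simp add: add_ac)

lemma finite_Per_support:
 fixes g :: "real => complex"
 assumes "!!x. L < \<bar>x\<bar> ==> g x = 0"
 shows "finite {k. g (x + of_int k) ~= 0}"
proof (rule finite_subset)
 define K where "K = \<lceil>L + \<bar>x\<bar>\<rceil>"
 show "{k. g (x + of_int k) ~= 0} \<subseteq> {-K..K}"
 proof
  fix k assume "k \<in> {k. g (x + of_int k) ~= 0}"
  then have "\<bar>x + of_int k\<bar> \<le> L" using assms[of "x + of_int k"] by (auto simp: not_less[symmetric])
  then have "of_int \<bar>k\<bar> \<le> L + \<bar>x\<bar>" by simp
  then have "\<bar>k\<bar> \<le> K" unfolding K_def by linarith
  then show "k \<in> {-K..K}" by auto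
 qed
qed simp

lemma Per_sum:
 assumes "finite A" "!!i x. i \<in> A ==> L < \<bar>x\<bar> ==> g i x = 0"
 shows "Per (\<lambda>x. \<Sum>i\<in>A. c i * g i x) x = (\<Sum>i\<in>A. c i * Per (g i) x)"
proof -
 have "finite {k. c i * g i (x + of_int k) ~= 0}" if "i \<in> A" for i
  by (rule finite_subset[OF _ finite_Per_support[of L "g i" x]]) (use assms that in auto)
 then show ?thesis unfolding Per_def by (simp add: zsum_sum[OF assms(1)] zsum_cmult)
qed

lemma has_vector_derivative_Per:
 assumes "!!x. L < \<bar>x\<bar> ==> g x = 0" "!!x. (g has_vector_derivative g' x) (at x)"
 shows "(Per g has_vector_derivative Per g' x) (at x)"
proof -
 define K where "K = \<lceil>L + \<bar>x\<bar> + 1\<rceil>"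
 have K: "L + \<bar>y\<bar> \<le> of_int K" if "y \<in> ball x 1" for y
 proof -
  have "\<bar>y\<bar> \<le> \<bar>x\<bar> + 1" using that by (auto simp: dist_real_def)
  then show ?thesis unfolding K_def by linarith
 qed
 have z: "g' y = 0" if "L < \<bar>y\<bar>" for y
  by (rule vector_derivative_zero_outside[OF assms(2,1) that])
 have "((\<lambda>x. g (1 * x + of_int k)) has_vector_derivative of_real 1 * g' (x + of_int k)) (at x)" for k
  by (rule has_vector_derivative_affine) (use assms(2)[of "x + of_int k"] in simp)
 then have D: "((\<lambda>x. \<Sum>k\<in>{-K..K}. g (x + of_int k)) has_vector_derivative (\<Sum>k\<in>{-K..K}. g' (x + of_int k))) (at x)"
  by (intro has_vector_derivative_sum) simp
 have "x \<in> ball x 1" by simp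
 from has_vector_derivative_transform_within_open[OF D open_ball this Per_window[OF assms(1) K, symmetric]]
 show ?thesis using Per_window[OF z K[OF \<open>x \<in> ball x 1\<close>]] by simp
qed

text \<open>A function with constant derivative is affine, and a periodic affine function is
  constant.\<close>

lemma Per_constant_derivative:
 assumes "!!x. (Per g has_vector_derivative D) (at x)"
 shows "Per g x = Per g 0"
proof -
 have "\<exists>c. \<forall>x\<in>UNIV. Per g x - of_real x * D = c"
 proof (rule has_derivative_zero_constant)
  fix x :: real
  have "((\<lambda>x. Per g x - of_real x * D) has_vector_derivative D - 1 * D) (at x)"
   using has_vector_derivative_real_field[of "\<lambda>z. z * D" "1 * D" x UNIV]
   by (intro has_vector_derivative_diff assms) (auto intro!: derivative_eq_intros)
  then show "((\<lambda>x. Per g x - of_real x * D) has_derivative (\<lambda>h. 0)) (at x within UNIV)"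
   by (simp add: has_vector_derivative_def)
 qed simp
 then obtain c where c: "!!x. Per g x - of_real x * D = c" by auto
 from c[of 0] c[of 1] Per_periodic[of g 0 1] have "D = 0" by simp
 then show ?thesis using c[of x] c[of 0] by simp
qed

definition average :: "(real => real) => real => real" where
 "average b x = integral {x - 1..x} b"

text \<open>Here \<open>average\<close> is convolution with the indicator of [0, 1], the step from
  one B-spline to the next; differentiation turns it into a backward difference.\<close>

lemma has_derivative_average:
 assumes "continuous_on UNIV b"
 shows "(average b has_real_derivative b x - b (x - 1)) (at x)"
proof -
 have c: "continuous_on S b" for S using continuous_on_subset[OF assms] by auto
 define F where "F y = integral {x - 3..y} b" for y
 have F: "(F has_real_derivative b y) (at y)" if "y \<in> {x - 3<..<x + 3}" for y
 proof -
  have "(F has_real_derivative b y) (at y within {x - 3..x + 3})"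
   unfolding F_def[abs_def] by (rule integral_has_real_derivative[OF c]) (use that in auto)
  moreover have "at y within {x - 3..x + 3} = at y" using that by (intro at_within_interior) auto
  ultimately show ?thesis by simp
 qed
 have "((\<lambda>y. F y - F (y - 1)) has_real_derivative b x - b (x - 1) * (1 - 0)) (at x)"
  by (intro DERIV_diff F DERIV_chain2[of F "b (x - 1)" "\<lambda>y. y - 1"]) (auto intro!: derivative_eq_intros)
 then have "((\<lambda>y. F y - F (y - 1)) has_real_derivative b x - b (x - 1)) (at x)" by simp
 then show ?thesis
 proof (rule has_field_derivative_transform_within[where d = 1])
  fix y :: real assume "y \<in> UNIV" "dist y x < 1"
  then have "x - 3 \<le> y - 1" "y - 1 \<le> y" by (auto simp: dist_real_def)
  then have "integral {x - 3..y - 1} b + integral {y - 1..y} b = integral {x - 3..y} b"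
   by (intro Henstock_Kurzweil_Integration.integral_combine integrable_continuous_real c)
  then show "F y - F (y - 1) = average b y" by (simp add: F_def average_def)
 qed simp_all
qed

text \<open>A B-spline mollified by a bump. Each averaging gains one order of polynomial
  reproduction, expressed by constant periodised moments. Nonnegativity is carried along because it
  later keeps the periodised mass away from 0.\<close>

lemma spline_exists:
 "\<exists>b L. (\<forall>n. C_k n (\<lambda>x. of_real (b x))) \<and> (\<forall>x. 0 \<le> b x) \<and> (\<exists>x. b x ~= 0) \<and> (\<forall>x. L < \<bar>x\<bar> --> b x = 0) \<and>
  (\<forall>p<P. \<forall>x. Per (\<lambda>x. of_real (b x) * of_real x ^ p) x = Per (\<lambda>x. of_real (b x) * of_real x ^ p) 0)"
proof (induction P)
 case 0
 have "\<exists>x. bump 0 1 x ~= 0" using bump_pos[of 0 "1 / 2" 1] by (intro exI[of _ "1 / 2"]) simp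
 then show ?case
  by (intro exI[of _ "bump 0 1"] exI[of _ 1]) (auto simp: C_k_bump bump_nonneg intro!: bump_zero)
next
 case (Suc P)
 then obtain b L where "(\<forall>n. C_k n (\<lambda>x. of_real (b x))) \<and> (\<forall>x. 0 \<le> b x) \<and> (\<exists>x. b x ~= 0) \<and> (\<forall>x. L < \<bar>x\<bar> --> b x = 0) \<and>
  (\<forall>p<P. \<forall>x. Per (\<lambda>x. of_real (b x) * of_real x ^ p) x = Per (\<lambda>x. of_real (b x) * of_real x ^ p) 0)"
  by (elim exE)
 note * = this
 note b = *[THEN conjunct1, rule_format] *[THEN conjunct2, THEN conjunct1, rule_format]
  *[THEN conjunct2, THEN conjunct2, THEN conjunct1] *[THEN conjunct2, THEN conjunct2, THEN conjunct2, THEN conjunct1, rule_format]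
  *[THEN conjunct2, THEN conjunct2, THEN conjunct2, THEN conjunct2, rule_format]
 define c where "c = average b"
 have "continuous_on UNIV (\<lambda>x. Re (of_real (b x)))" by (intro continuous_intros C_k_continuous[OF b(1)[of 0]])
 then have cb: "continuous_on UNIV b" by simp
 have Dr: "(c has_real_derivative b x - b (x - 1)) (at x)" for x
  unfolding c_def by (rule has_derivative_average[OF cb])
 have Dc: "((\<lambda>x. of_real (c x)) has_vector_derivative of_real (b x) - of_real (b (x - 1))) (at x)" for x
  using has_vector_derivative_of_real[OF Dr[of x]] by simp
 have Cb: "C_k n (\<lambda>x. of_real (b x) - of_real (b (x - 1)))" for n
  using C_k_diff[OF b(1)[of n] C_k_affine[OF b(1)[of n], of 1 "-1"]] by simp
 have Cc: "C_k n (\<lambda>x. of_real (c x))" for n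
  by (rule C_k_mono[OF C_k_Suc[OF Dc Cb[of n]]]) simp
 have c0: "c x = 0" if "L + 1 < \<bar>x\<bar>" for x
 proof -
  have "integral {x - 1..x} b = integral {x - 1..x} (\<lambda>_. 0)"
   by (rule integral_cong) (use that in \<open>auto intro!: b(4)\<close>)
  then show ?thesis by (simp add: c_def average_def)
 qed
 have cn: "0 \<le> c x" for x
  unfolding c_def average_def
  by (intro integral_nonneg integrable_continuous_real continuous_on_subset[OF cb] b(2)) auto
 have "\<exists>x. c x ~= 0"
 proof (rule ccontr)
  assume "\<not> (\<exists>x. c x ~= 0)"
  then have c0': "c = (\<lambda>_. 0)" by auto
  \<comment> \<open>If the average vanished identically, its derivative b(x) - b(x - 1) would as
    well; \<open>b\<close> would be periodic with compact support, hence zero.\<close>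
  have eq: "b x = b (x - 1)" for x
  proof -
   have "((\<lambda>_. 0 :: real) has_real_derivative b x - b (x - 1)) (at x)" using Dr[of x] by (simp only: c0')
   from DERIV_unique[OF this DERIV_const] show ?thesis by simp
  qed
  have shift: "b x = b (x + real n)" for x n
  proof (induction n)
   case (Suc n)
   have "b (x + real (Suc n)) = b (x + real (Suc n) - 1)" by (rule eq)
   also have "x + real (Suc n) - 1 = x + real n" by simp
   finally show ?case using Suc by simp
  qed simp
  obtain x where x: "b x ~= 0" using b(3) by blast
  obtain n where "L + \<bar>x\<bar> < real n" using reals_Archimedean2 by blast
  then have "L < \<bar>x + real n\<bar>" by linarith
  then show False using b(4)[of "x + real n"] shift[of x n] x by simp
 qed
 moreover have "Per (\<lambda>x. of_real (c x) * of_real x ^ p) x = Per (\<lambda>x. of_real (c x) * of_real x ^ p) 0" if "p < Suc P" for p x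
  using that
 proof (induction p arbitrary: x rule: less_induct)
  case (less p)
  define L' where "L' = \<bar>L\<bar> + 1"
  define B where "B s = Per (\<lambda>x. of_real (b x) * of_real x ^ s) 0" for s
  have B: "Per (\<lambda>x. of_real (b x) * of_real x ^ s) x = B s" if "s < p" for s x
   unfolding B_def by (rule b(5)) (use that less.prems in simp)
  define g' :: "real => complex" where "g' x = (of_real (b x) - of_real (b (x - 1))) * of_real x ^ p + of_real (c x) * (of_nat p * of_real x ^ (p - 1))" for x
  have z: "b x = 0" "c x = 0" "b (x - 1) = 0" if "L' < \<bar>x\<bar>" for x
   using that by (auto simp: L'_def intro!: b(4) c0)
  have D: "((\<lambda>x. of_real (c x) * of_real x ^ p) has_vector_derivative g' x) (at x)" for x
  proof -
   have 1: "((\<lambda>x. of_real x ^ p :: complex) has_vector_derivative of_nat p * of_real x ^ (p - 1)) (at x)"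
   proof -
    have "((\<lambda>z. z ^ p) has_field_derivative of_nat p * (of_real x :: complex) ^ (p - 1)) (at (of_real x))"
     by (auto intro!: derivative_eq_intros)
    from has_vector_derivative_real_field[OF this] show ?thesis .
   qed
   show ?thesis
    using has_vector_derivative_mult[OF Dc[of x] 1] by (simp add: g'_def add.commute)
  qed
  \<comment> \<open>For p = P the periodised moment of order p of \<open>b\<close> is not known to
    be constant. It occurs once from \<open>b\<close> and once from the expansion of the translate,
    and cancels.\<close>
  have "Per g' x = (\<Sum>s<p. - of_nat (p choose s) * B s) + of_nat p * (if p = 0 then 0 else Per (\<lambda>x. of_real (c x) * of_real x ^ (p - 1)) 0)" for x
  proof -
   define h :: "nat => real => complex" where "h i x = (if i = 0 then of_real (b x) * of_real x ^ p else if i = 1 then of_real (b (x - 1)) * of_real x ^ p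
     else of_real (c x) * of_real x ^ (p - 1))" for i :: nat and x :: real
   define d where "d i = (if i = 0 then 1 else if i = 1 then - 1 else (of_nat p :: complex))" for i :: nat
   have "g' = (\<lambda>x. \<Sum>i\<in>{0, 1, 2}. d i * h i x)"
    by (simp add: g'_def h_def d_def fun_eq_iff algebra_simps)
   then have "Per g' x = (\<Sum>i\<in>{0, 1, 2}. d i * Per (h i) x)"
    by (simp only:) (rule Per_sum[of _ L'], use z in \<open>auto simp: h_def\<close>)
   moreover have h01: "Per (h 0) x = Per (\<lambda>x. of_real (b x) * of_real x ^ p) x"
    "Per (h 2) x = Per (\<lambda>x. of_real (c x) * of_real x ^ (p - 1)) x"
    by (simp_all add: h_def[abs_def])
   moreover have h1: "Per (h 1) x = Per (\<lambda>x. of_real (b x) * of_real (x + 1) ^ p) x"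
    using Per_translate[of "\<lambda>x. of_real (b x) * of_real (x + 1) ^ p" "-1" x] by (simp add: h_def[abs_def])
   ultimately have "Per g' x = Per (\<lambda>x. of_real (b x) * of_real x ^ p) x - Per (\<lambda>x. of_real (b x) * of_real (x + 1) ^ p) x
     + of_nat p * Per (\<lambda>x. of_real (c x) * of_real x ^ (p - 1)) x"
    by (simp add: d_def)
   moreover have "Per (\<lambda>x. of_real (b x) * of_real (x + 1) ^ p) x = (\<Sum>s\<le>p. of_nat (p choose s) * Per (\<lambda>x. of_real (b x) * of_real x ^ s) x)"
   proof -
    have "of_real (b x) * of_real (x + 1) ^ p = (\<Sum>s\<le>p. of_nat (p choose s) * (of_real (b x) * of_real x ^ s :: complex))" for x
     unfolding of_real_add by (subst binomial_ring) (simp add: sum_distrib_left mult_ac)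
    then show ?thesis by (simp only:) (rule Per_sum[of _ L'], use z in auto)
   qed
   moreover have "Per (\<lambda>x. of_real (c x) * of_real x ^ (p - 1)) x = Per (\<lambda>x. of_real (c x) * of_real x ^ (p - 1)) 0" if "p ~= 0"
    by (rule less.IH) (use that less.prems in auto)
   moreover have "(\<Sum>s\<le>p. of_nat (p choose s) * Per (\<lambda>x. of_real (b x) * of_real x ^ s) x)
     = (\<Sum>s<p. of_nat (p choose s) * B s) + Per (\<lambda>x. of_real (b x) * of_real x ^ p) x"
    by (simp add: lessThan_Suc_atMost[symmetric] B)
   ultimately show ?thesis by (auto simp: sum_negf)
  qed
  moreover have "((Per (\<lambda>x. of_real (c x) * of_real x ^ p)) has_vector_derivative Per g' x) (at x)" for x
   by (rule has_vector_derivative_Per[of L', OF _ D]) (use z in simp)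
  ultimately have "((Per (\<lambda>x. of_real (c x) * of_real x ^ p)) has_vector_derivative
   (\<Sum>s<p. - of_nat (p choose s) * B s) + of_nat p * (if p = 0 then 0 else Per (\<lambda>x. of_real (c x) * of_real x ^ (p - 1)) 0)) (at x)" for x
   by (simp only:)
  then show ?case by (rule Per_constant_derivative)
 qed
 ultimately show ?case using Cc cn c0 by (intro exI[of _ c] exI[of _ "L + 1"]) blast
qed

section \<open>Convergence of the cascade algorithm\<close>

lemma dyadic_dense_eq:
 fixes f g :: "real => complex"
 assumes "continuous_on UNIV f" "continuous_on UNIV g"
  and "!!(i :: int) n :: nat. f (of_int i / 2 ^ n) = g (of_int i / 2 ^ n)"
 shows "f x = g x"
proof -
 define d where "d n = of_int \<lfloor>2 ^ n * x\<rfloor> / (2 :: real) ^ n" for n :: nat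
 have "(\<lambda>n. x - frac (2 ^ n * x) * (1 / 2) ^ n) \<longlonglongrightarrow> x - 0"
 proof (intro tendsto_diff tendsto_const Lim_null_comparison[of "\<lambda>n. frac (2 ^ n * x) * (1 / 2) ^ n"])
  show "\<forall>\<^sub>F n in sequentially. norm (frac (2 ^ n * x) * (1 / 2) ^ n) \<le> (1 / 2) ^ n"
   by (intro always_eventually allI) (simp add: abs_mult mult_le_cancel_right2 less_imp_le[OF frac_lt_1])
  show "(\<lambda>n. (1 / 2 :: real) ^ n) \<longlonglongrightarrow> 0" by (rule LIMSEQ_power_zero) simp
 qed
 moreover have "x - frac (2 ^ n * x) * (1 / 2) ^ n = d n" for n
  by (simp add: d_def frac_def field_simps power_divide)
 ultimately have d: "d \<longlonglongrightarrow> x" by simp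
 have "(\<lambda>n. f (d n)) \<longlonglongrightarrow> f x" "(\<lambda>n. g (d n)) \<longlonglongrightarrow> g x"
  using continuous_on_tendsto_compose[OF assms(1) d] continuous_on_tendsto_compose[OF assms(2) d] by auto
 then show ?thesis using assms(3) LIMSEQ_unique by (simp add: d_def)
qed

context sum_rule_mask
begin

definition mom :: "nat => (nat => real => complex) => real => complex" where
 "mom p f x = (\<Sum>j\<in>{-N..N}. \<Sum>l<r. v j l * (of_int j + of_real x) ^ p * f l x)"

lemma M_eq_Per:
 assumes "csupp L f"
 shows "M p (of_real x) (Phi f x) = Per (mom p f) x"
proof -
 have fin: "finite {k. c k * f l (x + of_int k) ~= 0}" if "l < r" for l c
  by (rule finite_subset[OF _ finite_Per_support[of L "f l" x]]) (use assms that in \<open>auto simp: csupp_def\<close>)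
 have "Per (mom p f) x = zsum (\<lambda>k. \<Sum>y\<in>{-N..N}\<times>{..<r}. v (fst y) (snd y) * (of_int (fst y) + of_int k + of_real x) ^ p * f (snd y) (x + of_int k))"
  by (simp add: Per_def mom_def sum_pairs add_ac)
 also have "... = (\<Sum>y\<in>{-N..N}\<times>{..<r}. zsum (\<lambda>k. v (fst y) (snd y) * (of_int (fst y) + of_int k + of_real x) ^ p * f (snd y) (x + of_int k)))"
 proof (rule zsum_sum)
  fix y assume "y \<in> {-N..N} \<times> {..<r}"
  then show "finite {k. v (fst y) (snd y) * (of_int (fst y) + of_int k + of_real x) ^ p * f (snd y) (x + of_int k) ~= 0}"
   by (intro fin) auto
 qed simp
 also have "... = M p (of_real x) (Phi f x)"
  by (simp add: M_def Phi_def sum_pairs zsum_cmult mult.assoc)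
 finally show ?thesis ..
qed

text \<open>A spline in the first component, scaled to periodised mass 1, suffices because the
  symbol of \<open>v\<close> at the origin is the first unit vector. The translations in
  \<open>v\<close> only mix in lower powers, whose periodised moments are constant too.\<close>

lemma admissible_exists:
 "\<exists>f L. (\<forall>l n. C_k n (f l)) \<and> csupp L f \<and> admissible f"
proof -
 obtain b L where "(\<forall>n. C_k n (\<lambda>x. of_real (b x))) \<and> (\<forall>x. 0 \<le> b x) \<and> (\<exists>x. b x ~= 0) \<and> (\<forall>x. L < \<bar>x\<bar> --> b x = 0) \<and>
  (\<forall>p<Suc m. \<forall>x. Per (\<lambda>x. of_real (b x) * of_real x ^ p) x = Per (\<lambda>x. of_real (b x) * of_real x ^ p) 0)"
  using spline_exists[of "Suc m"] by (elim exE)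
 note * = this
 note b = *[THEN conjunct1, rule_format] *[THEN conjunct2, THEN conjunct1, rule_format]
  *[THEN conjunct2, THEN conjunct2, THEN conjunct1] *[THEN conjunct2, THEN conjunct2, THEN conjunct2, THEN conjunct1, rule_format]
  *[THEN conjunct2, THEN conjunct2, THEN conjunct2, THEN conjunct2, rule_format]
 define \<kappa> where "\<kappa> = Per (\<lambda>x. of_real (b x)) 0"
 have \<kappa>: "Per (\<lambda>x. of_real (b x)) x = \<kappa>" for x
  using b(5)[of 0 x] by (simp add: \<kappa>_def)
 have "\<kappa> ~= 0"
 proof
  assume 0: "\<kappa> = 0"
  obtain x where x: "b x ~= 0" using b(3) by blast
  define K where "K = \<lceil>\<bar>L\<bar> + \<bar>x\<bar>\<rceil>"
  have K: "L + \<bar>x\<bar> \<le> of_int K" "0 \<le> K" unfolding K_def by linarith+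
  have "0 = Per (\<lambda>x. of_real (b x)) x" using \<kappa> 0 by simp
  also have "... = of_real (\<Sum>k\<in>{-K..K}. b (x + of_int k))"
   using Per_window[of L "\<lambda>x. of_real (b x)" x K] b(4) K by simp
  finally have "(\<Sum>k\<in>{-K..K}. b (x + of_int k)) = 0" by (metis of_real_eq_0_iff)
  then have "\<forall>k\<in>{-K..K}. b (x + of_int k) = 0" using b(2) by (subst (asm) sum_nonneg_eq_0_iff) auto
  then have "b (x + of_int 0) = 0" by (rule bspec) (use K(2) in simp)
  then show False using x by simp
 qed
 define f where "f l x = (if l = 0 then of_real (b x) / \<kappa> else 0)" for l :: nat and x
 have Cf: "C_k n (f l)" for n l
 proof -
  have "C_k n (\<lambda>x. (if l = 0 then 1 / \<kappa> else 0) * of_real (b x) + 0 * of_real (b x))"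
   by (intro C_k_lincomb b(1))
  moreover have "f l = (\<lambda>x. (if l = 0 then 1 / \<kappa> else 0) * of_real (b x) + 0 * of_real (b x))"
   by (auto simp: f_def fun_eq_iff)
  ultimately show ?thesis by (simp only:)
 qed
 have sf: "csupp L f" by (auto simp: csupp_def f_def b(4))
 have "M p (of_real x) (Phi f x) = (\<Sum>j\<in>{-N..N}. v j 0 * (\<Sum>s\<le>p. of_nat (p choose s) * of_int j ^ (p - s) / \<kappa> * Per (\<lambda>x. of_real (b x) * of_real x ^ s) x))" for p x
 proof -
  have 1: "zsum (\<lambda>k. (of_int j + of_int k + of_real x) ^ p * Phi f x k 0) = (\<Sum>s\<le>p. of_nat (p choose s) * of_int j ^ (p - s) / \<kappa> * Per (\<lambda>x. of_real (b x) * of_real x ^ s) x)" for j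
  proof -
   have "(of_real y + of_int j) ^ p * f 0 y = (\<Sum>s\<le>p. of_nat (p choose s) * of_int j ^ (p - s) / \<kappa> * (of_real (b y) * of_real y ^ s))" for y
    by (subst binomial_ring) (simp add: f_def sum_distrib_left sum_distrib_right sum_divide_distrib mult_ac)
   then have "Per (\<lambda>y. (of_real y + of_int j) ^ p * f 0 y) x = (\<Sum>s\<le>p. of_nat (p choose s) * of_int j ^ (p - s) / \<kappa> * Per (\<lambda>x. of_real (b x) * of_real x ^ s) x)"
    by (simp only:) (rule Per_sum[of _ L], auto simp: b(4))
   then show ?thesis by (simp add: Per_def Phi_def add_ac)
  qed
  have "M p (of_real x) (Phi f x) = (\<Sum>j\<in>{-N..N}. \<Sum>l<r. if l = 0 then v j 0 * zsum (\<lambda>k. (of_int j + of_int k + of_real x) ^ p * Phi f x k 0) else 0)"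
   unfolding M_def by (intro sum.cong refl) (auto simp: Phi_def f_def zsum_def)
  also have "... = (\<Sum>j\<in>{-N..N}. v j 0 * zsum (\<lambda>k. (of_int j + of_int k + of_real x) ^ p * Phi f x k 0))"
   using r by (simp add: sum.delta)
  finally show ?thesis by (simp only: 1)
 qed
 note Mf = this
 define h where "h p = M p (of_real 0) (Phi f 0)" for p
 have "M p (of_real x) (Phi f x) = h p" if "p \<le> m" for p x
  unfolding h_def Mf by (intro sum.cong refl arg_cong2[of _ _ _ _ times]) (use that in \<open>auto intro: b(5)\<close>)
 moreover have "h 0 = 1"
  unfolding h_def Mf using \<kappa> \<open>\<kappa> ~= 0\<close> v_hat[OF r] by (simp flip: sum_distrib_right)
 ultimately have "admissible f" unfolding admissible_def by blast
 then show ?thesis using Cf sf by blast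
qed

text \<open>The bump lives on [0, 1], so on the coset of x in [0, 1) the m-th derivative of the
  perturbation \<open>h\<close> has samples \<open>\<beta> x\<close> times \<open>u\<close>. After
  \<open>n\<close> steps this becomes 2^((m+1)n) \<open>\<beta> x\<close> \<open>C n u\<close>. If
  it tends to 0 at one offset with nonzero \<open>\<beta>\<close>, the little-o bound
  follows.\<close>

lemma cascade_convergence_imp_decays_weakly:
 assumes conv: "!!f L. (!!l. l < r ==> C_k m (f l)) ==> csupp L f ==> admissible f ==>
  \<exists>g. (\<forall>l<r. C_k m (g l)) \<and> (\<forall>\<epsilon>>0. \<forall>\<^sub>F n in sequentially. \<forall>l<r. \<forall>x. cmod (nderiv m ((R ^^ n) f l) x - nderiv m (g l) x) \<le> \<epsilon>)"
 shows "decays_weakly (Suc m)"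
 unfolding decays_weakly_def
proof (intro allI impI)
 fix u \<epsilon> assume u: "V (Suc m) u" and \<epsilon>: "(0 :: real) < \<epsilon>"
 obtain f L where f: "!!l n. C_k n (f l)" "csupp L f" "admissible f" using admissible_exists by blast
 obtain Lu where Lu: "0 \<le> Lu" "supp_in Lu u" using fsupp_large[OF V_fsupp[OF u], of 0] by auto
 define b where "b x = (of_real (bump 0 1 x) :: complex)" for x
 have Cb: "C_k n b" for n unfolding b_def[abs_def] by (rule C_k_bump)
 have b0: "b x = 0" if "x \<le> 0 \<or> 1 \<le> x" for x using bump_zero[of x 0 1] that by (auto simp: b_def)
 define \<beta> where "\<beta> = nderiv m b"
 have cont_\<beta>: "continuous_on UNIV \<beta>" unfolding \<beta>_def by (rule C_k_continuous_nderiv[OF Cb order_refl])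
 \<comment> \<open>Continuity extends the vanishing to the end points; the value at 0 is used at
   dyadic points below.\<close>
 have \<beta>0: "\<beta> x = 0" if "x \<le> 0 \<or> 1 \<le> x" for x
 proof -
  have out: "\<beta> x = 0" if "\<bar>x - 1 / 2\<bar> > 1 / 2" for x
  proof -
   have C: "C_k m (\<lambda>y. b (1 * y + 1 / 2))" by (rule C_k_affine[OF Cb])
   have "nderiv m (\<lambda>y. b (1 * y + 1 / 2)) (x - 1 / 2) = 0"
    by (rule nderiv_zero_outside[OF C _ order_refl that]) (auto intro!: b0 simp: abs_if split: if_splits)
   then show ?thesis using nderiv_affine[OF Cb[of m] order_refl, of 1 "1 / 2"] by (simp add: \<beta>_def)
  qed
  have lim: "\<beta> y = 0" if "(\<lambda>n. y + c / real (Suc n)) \<longlonglongrightarrow> y" "!!n. \<beta> (y + c / real (Suc n)) = 0" for y c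
  proof -
   have "(\<lambda>n. \<beta> (y + c / real (Suc n))) \<longlonglongrightarrow> \<beta> y"
    by (rule continuous_on_tendsto_compose[OF cont_\<beta> that(1)]) auto
   then show ?thesis using that(2) by (simp add: LIMSEQ_const_iff)
  qed
  have l: "(\<lambda>n. y + c / real (Suc n)) \<longlonglongrightarrow> y" for y c
  proof -
   have "(\<lambda>n. y + c * inverse (real (Suc n))) \<longlonglongrightarrow> y + c * 0"
    by (intro tendsto_intros LIMSEQ_inverse_real_of_nat)
   then show ?thesis by (simp add: divide_inverse)
  qed
  have "\<beta> 0 = 0" by (rule lim[OF l[of 0 "-1"]], rule out) (simp add: abs_if field_simps)
  moreover have "\<beta> 1 = 0" by (rule lim[OF l[of 1 1]], rule out) (simp add: abs_if field_simps)
  moreover have "\<beta> x = 0" if "x < 0 \<or> 1 < x" using that by (intro out) (auto simp: abs_if)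
  ultimately show ?thesis using that by (cases "x = 0 \<or> x = 1") auto
 qed
 have "\<exists>y. 0 < y \<and> y < 1 \<and> \<beta> y ~= 0"
 proof (rule ccontr)
  assume "\<not> ?thesis"
  then have "\<beta> y = 0" for y using \<beta>0[of y] by (cases "0 < y \<and> y < 1") auto
  then have "b (1 / 2) = 0"
   unfolding \<beta>_def by (rule_tac nderiv_eq_0_imp_eq_0[where L = 1, OF Cb[of m]]) (auto intro!: b0)
  then show False using bump_pos[of 0 "1 / 2" 1] by (simp add: b_def)
 qed
 then obtain y where y: "0 < y" "y < 1" "\<beta> y ~= 0" by blast
 have locate: "(\<Sum>k\<in>{-Lu..Lu}. u k l * c (x - of_int k)) = c (frac x) * u \<lfloor>x\<rfloor> l"
  if c: "!!x. x \<le> 0 \<or> 1 \<le> x ==> c x = 0" and l: "l < r" for c :: "real => complex" and x l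
 proof -
  have "c (x - of_int k) = 0" if "k ~= \<lfloor>x\<rfloor>" for k
  proof (rule c)
   have "k < \<lfloor>x\<rfloor> \<or> \<lfloor>x\<rfloor> < k" using that by auto
   then show "x - of_int k \<le> 0 \<or> 1 \<le> x - of_int k" by linarith
  qed
  then have "(\<Sum>k\<in>{-Lu..Lu}. u k l * c (x - of_int k)) = (\<Sum>k\<in>{-Lu..Lu}. if k = \<lfloor>x\<rfloor> then u \<lfloor>x\<rfloor> l * c (frac x) else 0)"
   by (intro sum.cong refl) (auto simp: frac_def)
  also have "... = c (frac x) * u \<lfloor>x\<rfloor> l"
   using Lu(2) l by (auto simp: supp_in_def)
  finally show ?thesis .
 qed
 define h where "h l x = (\<Sum>k\<in>{-Lu..Lu}. u k l * b (1 * x + - of_int k))" for l x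
 have Ch: "C_k m (h l)" for l unfolding h_def by (rule C_k_affine_sum[OF Cb])
 have hm: "nderiv m (h l) x = \<beta> (frac x) * u \<lfloor>x\<rfloor> l" if "l < r" for l x
  using nderiv_affine_sum[of "{-Lu..Lu}" m "\<lambda>_. b" m "\<lambda>k. u k l" 1 "\<lambda>k. - of_int k"] Cb locate[OF \<beta>0 that, where x = x]
  by (simp add: h_def[abs_def] \<beta>_def)
 have h_eq: "h l x = b (frac x) * u \<lfloor>x\<rfloor> l" if "l < r" for l x
  using locate[OF b0 that, where x = x] by (simp add: h_def)
 have sh: "csupp (of_int Lu + 1) h"
  unfolding csupp_def
 proof (intro allI impI)
  fix l and x :: real assume l: "l < r" and "of_int Lu + 1 < \<bar>x\<bar>"
  then have "Lu < \<bar>\<lfloor>x\<rfloor>\<bar>" by (simp add: abs_if split: if_splits) linarith+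
  then show "h l x = 0" using Lu(2) l by (simp add: h_eq supp_in_def)
 qed
 define L' where "L' = max L (of_int Lu + 1)"
 define f' where "f' l x = 1 * f l x + 1 * h l x" for l x
 have Cf': "C_k m (f' l)" for l unfolding f'_def by (intro C_k_lincomb f(1) Ch)
 have sL: "csupp L' f" "csupp L' h" "csupp L' f'"
  using csupp_mono[OF f(2), of L'] csupp_mono[OF sh, of L'] by (auto simp: L'_def csupp_def f'_def)
 have "admissible f'"
 proof -
  have "M p (of_real x) (Phi f' x) = M p (of_real x) (Phi f x)" if "p \<le> m" for p x
  proof -
   have "M p (of_real x) (Phi f' x) = M p (of_real x) (\<lambda>k l. 1 * Phi f x k l + b (frac x) * u (k - (- \<lfloor>x\<rfloor>)) l)"
    by (rule M_cong) (simp add: Phi_def f'_def h_eq frac_def add_ac)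
   also have "... = M p (of_real x) (Phi f x) + b (frac x) * M p (of_real x) (\<lambda>k. u (k - (- \<lfloor>x\<rfloor>)))"
    using M_lincomb[OF fsupp_Phi[OF f(2)] fsupp_shift[OF V_fsupp[OF u]], of p "of_real x" 1 x "b (frac x)" "- \<lfloor>x\<rfloor>"] by simp
   also have "M p (of_real x) (\<lambda>k. u (k - (- \<lfloor>x\<rfloor>))) = 0"
    by (rule M_V_lower[OF V_shift[OF u]]) (use that in simp)
   finally show ?thesis by simp
  qed
  then show ?thesis using f(3) by (auto simp: admissible_def)
 qed
 obtain g where g: "!!l. l < r ==> C_k m (g l)"
  "!!\<epsilon>. \<epsilon> > 0 ==> \<forall>\<^sub>F n in sequentially. \<forall>l<r. \<forall>x. cmod (nderiv m ((R ^^ n) f l) x - nderiv m (g l) x) \<le> \<epsilon>"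
  using conv[OF f(1) sL(1) f(3)] by blast
 obtain g' where g': "!!l. l < r ==> C_k m (g' l)"
  "!!\<epsilon>. \<epsilon> > 0 ==> \<forall>\<^sub>F n in sequentially. \<forall>l<r. \<forall>x. cmod (nderiv m ((R ^^ n) f' l) x - nderiv m (g' l) x) \<le> \<epsilon>"
  using conv[OF Cf' sL(3) \<open>admissible f'\<close>] by blast
 define d where "d l x = nderiv m (g' l) x - nderiv m (g l) x" for l x
 define H where "H n l x = 2 ^ (n * m) * (R ^^ n) (\<lambda>l. nderiv m (h l)) l x" for n l x
 have H: "H n l x = nderiv m ((R ^^ n) f' l) x - nderiv m ((R ^^ n) f l) x" if "l < r" for n l x
 proof -
  have "nderiv m ((R ^^ n) f' l) x - nderiv m ((R ^^ n) f l) x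
   = 2 ^ (n * m) * ((R ^^ n) (\<lambda>l. nderiv m (f' l)) l x - (R ^^ n) (\<lambda>l. nderiv m (f l)) l x)"
   using nderiv_R_iterate[of m f' l m n, OF Cf' that order_refl] nderiv_R_iterate[of m f l m n, OF f(1) that order_refl]
   by (simp add: algebra_simps)
  also have "(\<lambda>l. nderiv m (f' l)) = (\<lambda>l x. 1 * nderiv m (f l) x + 1 * nderiv m (h l) x)"
   unfolding f'_def using nderiv_lincomb[OF f(1) Ch order_refl, where \<alpha> = 1 and \<beta> = 1] by (intro ext) (simp add: fun_eq_iff)
  also have "(R ^^ n) (\<lambda>l x. 1 * nderiv m (f l) x + 1 * nderiv m (h l) x) l x - (R ^^ n) (\<lambda>l. nderiv m (f l)) l x
    = (R ^^ n) (\<lambda>l. nderiv m (h l)) l x"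
   unfolding R_iterate_lincomb by simp
  finally show ?thesis by (simp add: H_def)
 qed
 have Hd: "\<forall>\<^sub>F n in sequentially. \<forall>l<r. \<forall>x. cmod (H n l x - d l x) \<le> e" if "e > 0" for e
 proof -
  have "e / 2 > 0" using that by simp
  from g(2)[OF this] g'(2)[OF this] show ?thesis
  proof eventually_elim
   case (elim n)
   show ?case
   proof (intro allI impI)
    fix l x assume l: "l < r"
    have "H n l x - d l x = (nderiv m ((R ^^ n) f' l) x - nderiv m (g' l) x) - (nderiv m ((R ^^ n) f l) x - nderiv m (g l) x)"
     using l by (simp add: H d_def)
    also have "cmod ... \<le> e / 2 + e / 2"
     by (rule order_trans[OF norm_triangle_ineq4 add_mono]) (use elim l in blast)+
    finally show "cmod (H n l x - d l x) \<le> e" by simp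
   qed
  qed
 qed
 have Hval: "H n l ((x + of_int i) / 2 ^ n) = 2 ^ (n * m) * 2 ^ n * \<beta> x * C n u i l" if "0 \<le> x" "x < 1" "l < r" for n l x i
 proof -
  have "\<lfloor>x + of_int k\<rfloor> = k" "frac (x + of_int k) = x" for k
   using that by (auto simp: frac_unique_iff floor_eq_iff)
  then have "C n (Phi (\<lambda>l. nderiv m (h l)) x) i l = C n (\<lambda>k l. \<beta> x * u k l) i l"
   by (intro C_cong) (simp_all add: Phi_def hm that)
  then show ?thesis by (simp add: H_def R_iterate C_scale)
 qed
 \<comment> \<open>The assumption provides separate limits for \<open>f\<close> and
   \<open>f'\<close>, not known to coincide. At a dyadic point \<open>H n\<close> is eventually 0,
   since \<open>\<beta>\<close> vanishes at 0, so the m-th derivatives of the two limits agree on a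
   dense set.\<close>
 have d0: "d l x = 0" if l: "l < r" for l x
 proof (rule dyadic_dense_eq[of "d l" "\<lambda>_. 0"])
  show "continuous_on UNIV (d l)" unfolding d_def
   by (intro continuous_intros C_k_continuous_nderiv[OF g(1)[OF l] order_refl] C_k_continuous_nderiv[OF g'(1)[OF l] order_refl])
  fix i :: int and k :: nat
  have "cmod (d l (of_int i / 2 ^ k)) \<le> e" if "e > 0" for e
  proof -
   from Hd[OF that] eventually_ge_at_top[of k]
   have "\<forall>\<^sub>F n in sequentially. cmod (d l (of_int i / 2 ^ k)) \<le> e"
   proof eventually_elim
    case (elim n)
    have "of_int i / 2 ^ k = (0 + of_int (i * 2 ^ (n - k))) / (2 :: real) ^ n"
    proof -
     have "(2 :: real) ^ n = 2 ^ k * 2 ^ (n - k)" using elim(2) by (simp flip: power_add)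
     then show ?thesis by simp
    qed
    then have "H n l (of_int i / 2 ^ k) = 0"
     using Hval[of 0 l n "i * 2 ^ (n - k)"] l \<beta>0[of 0] by (simp only:) simp
    then show ?case using elim(1) l by (metis diff_0 norm_minus_cancel)
   qed
   then show ?thesis by simp
  qed
  then show "d l (of_int i / 2 ^ k) = 0" by (metis dense_ge norm_le_zero_iff)
 qed simp
 define e where "e = \<epsilon> * cmod (\<beta> y)"
 have e: "e > 0" using \<epsilon> y(3) by (simp add: e_def)
 from Hd[OF e] show "\<forall>\<^sub>F n in sequentially. bounded_by (\<epsilon> * (1 / 2) ^ (Suc m * n)) (C n u)"
 proof eventually_elim
  case (elim n)
  show ?case
   unfolding bounded_by_def
  proof (intro allI impI)
   fix i l assume l: "l < r"
   have "cmod (H n l ((y + of_int i) / 2 ^ n) - d l ((y + of_int i) / 2 ^ n)) \<le> e" using elim l by blast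
   then have "cmod (H n l ((y + of_int i) / 2 ^ n)) \<le> e" by (simp add: d0[OF l])
   then have "2 ^ (Suc m * n) * cmod (\<beta> y) * cmod (C n u i l) \<le> \<epsilon> * cmod (\<beta> y)"
    using Hval[of y l n i] y l by (simp add: norm_mult norm_power e_def power_add mult_ac)
   then have "2 ^ (Suc m * n) * cmod (C n u i l) \<le> \<epsilon>" using y(3) by (simp add: mult_ac)
   then show "cmod (C n u i l) \<le> \<epsilon> * (1 / 2) ^ (Suc m * n)"
    by (simp add: power_divide pos_le_divide_eq mult_ac del: power_Suc mult_Suc)
  qed
 qed
qed

end

section \<open>Fourier coefficients of periodisations\<close>

definition ef :: "int => real => complex" where
 "ef n t = exp (\<i> * of_real (2 * pi * of_int n * t))"

lemma continuous_ef [continuous_intros]: "continuous_on S f ==> continuous_on S (\<lambda>t. ef n (f t))"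
 unfolding ef_def by (intro continuous_intros)

lemma ef_add: "ef (n + k) t = ef n t * ef k t"
 by (simp add: ef_def exp_add[symmetric] algebra_simps)

lemma ef_0 [simp]: "ef 0 t = 1"
 by (simp add: ef_def)

lemma ef_translate: "ef n (t + of_int k) = ef n t"
proof -
 have "exp (\<i> * of_real (2 * pi * of_int (n * k))) = 1"
  using exp_integer_2pi[of "of_int (n * k)"] by (simp add: mult_ac)
 moreover have "\<i> * of_real (2 * pi * of_int n * (t + of_int k)) = \<i> * of_real (2 * pi * of_int n * t) + \<i> * of_real (2 * pi * of_int (n * k))"
  by (simp add: algebra_simps)
 ultimately show ?thesis by (simp only: ef_def exp_add) simp
qed

lemma integral_ef: "integral {0..1} (ef n) = (if n = 0 then 1 else 0)"
proof (cases "n = 0")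
 case True
 have "ef 0 = (\<lambda>_. 1)" by (simp add: fun_eq_iff)
 then show ?thesis using True by simp
next
 case False
 have "(ef n has_integral ef n 1 / (2 * pi * \<i> * of_int n) - ef n 0 / (2 * pi * \<i> * of_int n)) {0..1}"
 proof (rule fundamental_theorem_of_calculus)
  fix x :: real
  have "((\<lambda>x. exp ((\<i> * 2 * pi * of_int n) * of_real x)) has_vector_derivative (\<i> * 2 * pi * of_int n) * exp ((\<i> * 2 * pi * of_int n) * of_real x)) (at x within {0..1})"
   by (rule has_vector_derivative_at_within[OF has_vector_derivative_exp_real])
  from has_vector_derivative_divide[OF this, of "2 * pi * \<i> * of_int n"]
  show "((\<lambda>x. ef n x / (2 * pi * \<i> * of_int n)) has_vector_derivative ef n x) (at x within {0..1})"
   using False by (simp add: ef_def mult_ac)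
 qed simp
 moreover have "ef n 1 = ef n 0" using ef_translate[of n 0 1] by simp
 ultimately show ?thesis using False by (simp add: integral_unique)
qed

inductive trig :: "(real => complex) => bool" where
 basis: "trig (ef n)"
| lincomb: "trig F ==> trig G ==> trig (\<lambda>t. \<alpha> * F t + \<beta> * G t)"

lemma trig_mult: "trig F ==> trig G ==> trig (\<lambda>t. F t * G t)"
proof (induction rule: trig.induct)
 case (basis n)
 from this show ?case
 proof (induction rule: trig.induct)
  case (basis k)
  have "(\<lambda>t. ef n t * ef k t) = ef (n + k)" by (simp add: ef_add fun_eq_iff)
  then show ?case by (simp only: trig.basis)
 next
  case (lincomb F G \<alpha> \<beta>)
  have "(\<lambda>t. ef n t * (\<alpha> * F t + \<beta> * G t)) = (\<lambda>t. \<alpha> * (ef n t * F t) + \<beta> * (ef n t * G t))"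
   by (simp add: fun_eq_iff algebra_simps)
  then show ?case using trig.lincomb[OF lincomb.IH] by simp
 qed
next
 case (lincomb F F' \<alpha> \<beta>)
 have "(\<lambda>t. (\<alpha> * F t + \<beta> * F' t) * G t) = (\<lambda>t. \<alpha> * (F t * G t) + \<beta> * (F' t * G t))"
  by (simp add: fun_eq_iff algebra_simps)
 then show ?case using trig.lincomb[OF lincomb.IH(1)[OF lincomb.prems] lincomb.IH(2)[OF lincomb.prems], of \<alpha> \<beta>] by simp
qed

lemma trig_real_polynomial: "real_polynomial_function g ==> trig (\<lambda>t. of_real (g (ef 1 t)))"
proof (induction rule: real_polynomial_function.induct)
 case (linear f)
 interpret bounded_linear f by (rule linear)
 have "of_real (f (ef 1 t)) = ((of_real (f 1) - \<i> * of_real (f \<i>)) / 2) * ef 1 t + ((of_real (f 1) + \<i> * of_real (f \<i>)) / 2) * ef (-1) t" for t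
 proof -
  define \<theta> where "\<theta> = 2 * pi * t"
  have "ef 1 t = cis \<theta>" by (simp add: ef_def \<theta>_def cis_conv_exp mult_ac)
  moreover have "ef (-1) t = cis (- \<theta>)" by (simp add: ef_def \<theta>_def cis_conv_exp mult_ac)
  ultimately have e: "ef 1 t = of_real (cos \<theta>) + \<i> * of_real (sin \<theta>)" "ef (-1) t = of_real (cos \<theta>) - \<i> * of_real (sin \<theta>)"
   by (simp_all add: complex_eq_iff)
  have "f (ef 1 t) = f (cos \<theta> *\<^sub>R 1 + sin \<theta> *\<^sub>R \<i>)" by (simp add: e scaleR_conv_of_real mult.commute)
  also have "... = cos \<theta> * f 1 + sin \<theta> * f \<i>" by (simp only: add scaleR real_scaleR_def)
  finally show ?thesis unfolding e by (simp add: complex_eq_iff algebra_simps) (simp add: field_simps)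
 qed
 then have "(\<lambda>t. of_real (f (ef 1 t))) = (\<lambda>t. ((of_real (f 1) - \<i> * of_real (f \<i>)) / 2) * ef 1 t + ((of_real (f 1) + \<i> * of_real (f \<i>)) / 2) * ef (-1) t)"
  by (rule ext)
 then show ?case by (simp only: trig.lincomb[OF trig.basis trig.basis])
next
 case (const c)
 have "trig (\<lambda>t. of_real c * ef 0 t + 0 * ef 0 t)" by (intro trig.intros)
 then show ?case by simp
next
 case (add f g)
 have "trig (\<lambda>t. 1 * of_real (f (ef 1 t)) + 1 * of_real (g (ef 1 t)))" by (intro trig.lincomb add.IH)
 then show ?case by simp
next
 case (mult f g)
 then show ?case using trig_mult by simp
qed

text \<open>Stone-Weierstrass on the unit circle: polynomials in the two real coordinates restrict
  to trigonometric polynomials. Continuity of the transported function across the cut of the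
  argument is obtained from the trivial homotopy of a loop with itself.\<close>

lemma trig_approximation:
 fixes w :: "real => real"
 assumes "continuous_on {0..1} w" "w 0 = w 1" "0 < e"
 shows "\<exists>F. trig F \<and> (\<forall>t\<in>{0..1}. cmod (of_real (w t) - F t) < e)"
proof -
 define p where "p = (\<lambda>t. complex_of_real (w t))"
 have "path p" unfolding path_def p_def by (intro continuous_intros assms(1))
 moreover have "pathfinish p = pathstart p" using assms(2) by (simp add: pathfinish_def pathstart_def p_def)
 ultimately have "homotopic_loops UNIV p p" by (simp only: homotopic_loops_refl subset_UNIV simp_thms)
 then have "homotopic_with_canon (\<lambda>h. True) (sphere 0 1) UNIV (p \<circ> (\<lambda>z. Arg2pi z / (2 * pi))) (p \<circ> (\<lambda>z. Arg2pi z / (2 * pi)))"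
  by (rule homotopic_loops_imp_homotopic_circlemaps)
 then have "continuous_on (sphere 0 1) (p \<circ> (\<lambda>z. Arg2pi z / (2 * pi)))"
  using homotopic_with_imp_continuous by blast
 then have "continuous_on (sphere 0 1) (\<lambda>z. Re ((p \<circ> (\<lambda>z. Arg2pi z / (2 * pi))) z))"
  by (rule continuous_on_Re)
 then have c: "continuous_on (sphere 0 1) (\<lambda>z. w (Arg2pi z / (2 * pi)))" by (simp add: p_def)
 obtain g where g: "real_polynomial_function g" "!!z. z \<in> sphere 0 1 ==> \<bar>w (Arg2pi z / (2 * pi)) - g z\<bar> < e"
  using Stone_Weierstrass_real_polynomial_function[OF compact_sphere c assms(3)] by metis
 have val: "w (Arg2pi (ef 1 t) / (2 * pi)) = w t" if "t \<in> {0..1}" for t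
 proof (cases "t = 1")
  case True
  have "ef 1 t = 1" using ef_translate[of 1 0 1] True by (simp add: ef_def)
  then show ?thesis using True assms(2) by (simp add: Arg2pi_of_real[of 1, simplified])
 next
  case False
  then have "Arg2pi (exp (\<i> * of_real (2 * pi * t))) = Im (\<i> * of_real (2 * pi * t))"
   using that by (intro Arg2pi_exp) auto
  then show ?thesis by (simp add: ef_def)
 qed
 have "cmod (of_real (w t) - of_real (g (ef 1 t))) < e" if "t \<in> {0..1}" for t
 proof -
  have "ef 1 t \<in> sphere 0 1" by (simp add: ef_def)
  from g(2)[OF this] val[OF that] show ?thesis by (simp flip: of_real_diff)
 qed
 then show ?thesis using trig_real_polynomial[OF g(1)] by blast
qed

lemma continuous_trig: "trig F ==> continuous_on S F"
 by (induction rule: trig.induct) (auto intro!: continuous_intros)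

text \<open>After subtraction of its mean, the function is orthogonal to all trigonometric
  polynomials. Approximating its conjugate by them shows that its L2 norm is 0, and continuity does
  the rest.\<close>

lemma fourier_uniqueness:
 fixes h :: "real => complex"
 assumes h: "continuous_on {0..1} h" "h 0 = h 1" and coeff: "!!n. n ~= 0 ==> integral {0..1} (\<lambda>t. h t * ef n t) = 0"
  and t: "t \<in> {0..1}"
 shows "h t = integral {0..1} h"
proof -
 define k where "k t = h t - integral {0..1} h" for t
 have ck: "continuous_on {0..1} k" unfolding k_def by (intro continuous_intros h)
 have int: "f integrable_on {0..1}" if "continuous_on {0..1} f" for f :: "real => complex"
  using integrable_continuous_real[OF that] .
 have ef_int: "integral {0..1} (ef n) = 0" if "n ~= 0" for n using integral_ef[of n] that by simp
 have k0: "integral {0..1} (\<lambda>t. k t * ef n t) = 0" for n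
 proof -
  have "integral {0..1} (\<lambda>t. k t * ef n t) = integral {0..1} (\<lambda>t. h t * ef n t) - integral {0..1} h * integral {0..1} (ef n)"
   unfolding k_def left_diff_distrib
   by (subst Henstock_Kurzweil_Integration.integral_diff) (simp_all add: int continuous_on_mult h continuous_ef continuous_on_id)
  then show ?thesis using coeff[of n] ef_int[of n] integral_ef[of 0] by (cases "n = 0") simp_all
 qed
 have kF: "integral {0..1} (\<lambda>t. k t * F t) = 0" if "trig F" for F
  using that
 proof (induction rule: trig.induct)
  case (lincomb F G \<alpha> \<beta>)
  have "integral {0..1} (\<lambda>t. k t * (\<alpha> * F t + \<beta> * G t)) = integral {0..1} (\<lambda>t. \<alpha> * (k t * F t) + \<beta> * (k t * G t))"
   by (simp add: algebra_simps)
  also have "... = \<alpha> * integral {0..1} (\<lambda>t. k t * F t) + \<beta> * integral {0..1} (\<lambda>t. k t * G t)"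
   using lincomb.hyps
   by (subst Henstock_Kurzweil_Integration.integral_add) (simp_all add: int continuous_on_mult ck continuous_trig)
  finally show ?case using lincomb.IH by simp
 qed (rule k0)
 obtain B where B: "!!t. t \<in> {0..1} ==> cmod (k t) \<le> B" "0 \<le> B"
 proof -
  have "bounded (k ` {0..1})" by (rule compact_imp_bounded[OF compact_continuous_image[OF ck compact_Icc]])
  then obtain b where b: "\<forall>y\<in>k ` {0..1}. cmod y \<le> b" unfolding bounded_iff by (rule exE)
  show ?thesis by (rule that[of "\<bar>b\<bar>"]) (use b in \<open>auto intro: order_trans[OF _ abs_ge_self]\<close>)
 qed
 define q where "q t = (cmod (k t))\<^sup>2" for t
 have cq: "continuous_on {0..1} q" unfolding q_def by (intro continuous_intros ck)
 have small: "integral {0..1} q \<le> B * (2 * e)" if e: "e > 0" for e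
 proof -
  have k01: "k 0 = k 1" using h(2) by (simp add: k_def)
  obtain F where F: "trig F" "!!t. t \<in> {0..1} ==> cmod (of_real (Re (k t)) - F t) < e"
   using trig_approximation[OF continuous_on_Re[OF ck] _ e] k01 by auto
  obtain G where G: "trig G" "!!t. t \<in> {0..1} ==> cmod (of_real (Im (k t)) - G t) < e"
   using trig_approximation[OF continuous_on_Im[OF ck] _ e] k01 by auto
  define P where "P t = 1 * F t + (- \<i>) * G t" for t
  have P: "trig P" unfolding P_def by (rule trig.lincomb[OF F(1) G(1)])
  have cP: "continuous_on {0..1} P" by (rule continuous_trig[OF P])
  have app: "cmod (cnj (k t) - P t) \<le> 2 * e" if "t \<in> {0..1}" for t
  proof -
   have "cnj (k t) - P t = (of_real (Re (k t)) - F t) - \<i> * (of_real (Im (k t)) - G t)"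
    by (simp add: P_def complex_eq_iff)
   also have "cmod ... \<le> cmod (of_real (Re (k t)) - F t) + cmod (of_real (Im (k t)) - G t)"
    using norm_triangle_ineq4[of "of_real (Re (k t)) - F t" "\<i> * (of_real (Im (k t)) - G t)"] by (simp add: norm_mult)
   also have "... \<le> 2 * e" using F(2)[OF that] G(2)[OF that] by simp
   finally show ?thesis .
  qed
  have cc: "continuous_on {0..1} (\<lambda>t. k t * (cnj (k t) - P t))" by (intro continuous_intros ck cP)
  have "of_real (integral {0..1} q) = integral {0..1} (\<lambda>t. of_real (q t) :: complex)"
   using integral_linear[OF integrable_continuous_real[OF cq] bounded_linear_of_real[where 'a = complex]] by (simp add: o_def)
  also have "... = integral {0..1} (\<lambda>t. k t * (cnj (k t) - P t) + k t * P t)"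
   by (intro integral_cong) (simp add: q_def complex_norm_square algebra_simps flip: of_real_power)
  also have "... = integral {0..1} (\<lambda>t. k t * (cnj (k t) - P t))"
   using kF[OF P] by (subst Henstock_Kurzweil_Integration.integral_add) (simp_all add: int cc continuous_on_mult ck cP)
  finally have "cmod (of_real (integral {0..1} q)) = cmod (integral {0..1} (\<lambda>t. k t * (cnj (k t) - P t)))" by simp
  also have "... \<le> B * (2 * e) * (1 - 0)"
  proof (rule integral_bound[OF _ cc])
   fix t :: real assume "t \<in> {0..1}"
   then show "cmod (k t * (cnj (k t) - P t)) \<le> B * (2 * e)"
    unfolding norm_mult using B app by (intro mult_mono) auto
  qed simp
  finally show ?thesis by (simp add: abs_le_iff)
 qed
 have "integral {0..1} q \<le> 0"
 proof (rule field_le_epsilon)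
  fix e :: real assume e: "e > 0"
  define e' where "e' = e / (2 * (B + 1))"
  have "e' > 0" using e B(2) by (simp add: e'_def)
  from small[OF this] have "integral {0..1} q \<le> B * (2 * e')" .
  also have "... \<le> (B + 1) * (2 * e')" using \<open>e' > 0\<close> by (intro mult_right_mono) auto
  also have "... = e" using B(2) by (simp add: e'_def field_simps)
  finally show "integral {0..1} q \<le> 0 + e" by simp
 qed
 moreover have "0 \<le> integral {0..1} q"
  by (intro integral_nonneg integrable_continuous_real cq) (simp add: q_def)
 ultimately have "q t = 0"
  using integral_eq_0_iff[OF cq, of] t by (auto simp: q_def)
 then show ?thesis by (simp add: q_def k_def)
qed

section \<open>Integrals of compactly supported functions and of their periodisations\<close>

lemma
 fixes F :: "real => complex"
 assumes "continuous_on UNIV F" "!!x. L < \<bar>x\<bar> ==> F x = 0"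
 shows integrable_compact_support: "integrable lborel F"
  and lborel_integral_compact_support: "(LINT x|lborel. F x) = integral {-L..L} F"
proof -
 have s: "set_integrable lborel {-L..L} F"
  by (rule borel_integrable_atLeastAtMost'[OF continuous_on_subset[OF assms(1)]]) simp
 have e: "(\<lambda>x. indicator {-L..L} x *\<^sub>R F x) = F"
  using assms(2) by (auto simp: indicator_def fun_eq_iff abs_le_iff not_le[symmetric])
 show "integrable lborel F" using s unfolding set_integrable_def e .
 show "(LINT x|lborel. F x) = integral {-L..L} F"
  using set_borel_integral_eq_integral(2)[OF s] unfolding set_lebesgue_integral_def e .
qed

lemma sum_telescope_int: "a \<le> b ==> (\<Sum>k\<in>{a..b::int}. f (k + 1) - f k) = (f (b + 1) - f a :: complex)"
proof (induction b rule: int_ge_induct)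
 case (step i)
 have "{a..i + 1} = insert (i + 1) {a..i}" using step by auto
 then show ?case using step by simp
qed simp

text \<open>Unfolding over unit intervals, carried out as a telescoping sum of increments of an
  antiderivative.\<close>

lemma integral_Per:
 fixes F :: "real => complex"
 assumes F: "continuous_on UNIV F" "!!x. L < \<bar>x\<bar> ==> F x = 0"
 shows "(LINT x|lborel. F x) = integral {0..1} (Per F)"
proof -
 define K where "K = \<lceil>\<bar>L\<bar>\<rceil> + 1"
 have K: "\<bar>L\<bar> + 1 \<le> of_int K" "0 \<le> K" unfolding K_def by linarith+
 obtain G where G: "!!x. x \<in> {- of_int K - 1..of_int K + 2} ==> (G has_vector_derivative F x) (at x within {- of_int K - 1..of_int K + 2})"
  using antiderivative_continuous[OF continuous_on_subset[OF F(1)]] by blast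
 have "(LINT x|lborel. F x) = integral {- of_int (K + 1)..of_int (K + 1)} F"
  by (rule lborel_integral_compact_support[OF F(1)]) (use F(2) K in auto)
 also have "... = G (of_int (K + 1)) - G (- of_int (K + 1))"
  by (rule integral_unique, rule fundamental_theorem_of_calculus)
   (use K in \<open>auto intro!: has_vector_derivative_within_subset[OF G]\<close>)
 also have "... = (\<Sum>k\<in>{-(K + 1)..K}. G (of_int (k + 1)) - G (of_int k))"
  using K(2) by (subst sum_telescope_int) auto
 also have "... = (\<Sum>k\<in>{-(K + 1)..K}. integral {0..1} (\<lambda>x. F (x + of_int k)))"
 proof (rule sum.cong[OF refl])
  fix k assume k: "k \<in> {-(K + 1)..K}"
  have "((\<lambda>x. F (x + of_int k)) has_integral (G (1 + of_int k) - G (0 + of_int k))) {0..1}"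
  proof (rule fundamental_theorem_of_calculus)
   fix x :: real assume x: "x \<in> {0..1}"
   have k': "- of_int K - 1 \<le> (of_int k :: real)" "of_int k \<le> (of_int K :: real)" using k by auto
   have s: "((\<lambda>x. x + of_int k) has_vector_derivative 1) (at x within {0..1})"
    by (auto intro!: derivative_eq_intros simp: has_vector_derivative_def)
   have "(G has_vector_derivative F (x + of_int k)) (at (x + of_int k) within (\<lambda>x. x + of_int k) ` {0..1})"
    by (rule has_vector_derivative_within_subset[OF G]) (use x k' in auto)
   from vector_diff_chain_within[OF s this]
   show "((\<lambda>x. G (x + of_int k)) has_vector_derivative F (x + of_int k)) (at x within {0..1})" by (simp add: o_def)
  qed simp
  then show "G (of_int (k + 1)) - G (of_int k) = integral {0..1} (\<lambda>x. F (x + of_int k))"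
   by (simp add: integral_unique add.commute)
 qed
 also have "... = integral {0..1} (\<lambda>x. \<Sum>k\<in>{-(K + 1)..K}. F (x + of_int k))"
  by (rule integral_sum[symmetric])
   (auto intro!: integrable_continuous_real continuous_on_compose2[OF F(1)] continuous_intros)
 also have "... = integral {0..1} (Per F)"
 proof (rule integral_cong)
  fix x :: real assume "x \<in> {0..1}"
  then show "(\<Sum>k\<in>{-(K + 1)..K}. F (x + of_int k)) = Per F x"
   unfolding Per_def
  proof (intro zsum_eq[symmetric])
   fix k assume "k \<notin> {-(K + 1)..K}"
   then consider "k \<le> -(K + 2)" | "K + 1 \<le> k" by force
   then have "L < \<bar>x + of_int k\<bar>"
   proof cases
    case 1
    then have "of_int k \<le> (of_int (-(K + 2)) :: real)" by (simp only: of_int_le_iff)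
    then show ?thesis using \<open>x \<in> {0..1}\<close> K by auto
   next
    case 2
    then have "(of_int (K + 1) :: real) \<le> of_int k" by (simp only: of_int_le_iff)
    then show ?thesis using \<open>x \<in> {0..1}\<close> K by auto
   qed
   then show "F (x + of_int k) = 0" by (rule F(2))
  qed simp
 qed
 finally show ?thesis .
qed

lemma continuous_Per:
 fixes F :: "real => complex"
 assumes F: "continuous_on UNIV F" "!!x. L < \<bar>x\<bar> ==> F x = 0"
 shows "continuous_on {0..1} (Per F)"
proof -
 define K where "K = \<lceil>\<bar>L\<bar> + 1\<rceil>"
 have K: "L + \<bar>x\<bar> \<le> of_int K" if "x \<in> {0..1}" for x
  using that unfolding K_def atLeastAtMost_iff by linarith
 have "continuous_on {0..1} (\<lambda>x. \<Sum>k\<in>{-K..K}. F (x + of_int k))"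
  by (intro continuous_on_sum continuous_on_compose2[OF F(1)] continuous_intros) auto
 then show ?thesis
  by (rule continuous_on_eq) (rule Per_window[OF F(2) K, symmetric])
qed

text \<open>The Fourier coefficients of the periodisation are the integrals of \<open>F\<close>
  against the same exponentials, because these have period 1. This is the Poisson summation argument
  behind the Strang-Fix conditions.\<close>

lemma Per_constant_iff:
 fixes F :: "real => complex"
 assumes F: "continuous_on UNIV F" "!!x. L < \<bar>x\<bar> ==> F x = 0"
 shows "(\<forall>x. Per F x = c) \<longleftrightarrow> (\<forall>n. (LINT x|lborel. F x * ef n x) = (if n = 0 then c else 0))"
proof -
 have coeff: "(LINT x|lborel. F x * ef n x) = integral {0..1} (\<lambda>x. Per F x * ef n x)" for n
 proof -
  have "Per (\<lambda>x. F x * ef n x) x = Per F x * ef n x" for x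
   using zsum_cmult[of "ef n x" "\<lambda>k. F (x + of_int k)"] by (simp add: Per_def ef_translate mult.commute)
  moreover have "(LINT x|lborel. F x * ef n x) = integral {0..1} (Per (\<lambda>x. F x * ef n x))"
   by (rule integral_Per[of _ L]) (auto intro!: continuous_intros F)
  ultimately show ?thesis by (simp add: fun_eq_iff[symmetric]) (metis (no_types, lifting) integral_cong)
 qed
 show ?thesis
 proof
  assume c: "\<forall>x. Per F x = c"
  have "Per F = (\<lambda>_. c)" using c by (simp add: fun_eq_iff)
  then show "\<forall>n. (LINT x|lborel. F x * ef n x) = (if n = 0 then c else 0)"
   unfolding coeff by (simp add: integral_ef)
 next
  assume z: "\<forall>n. (LINT x|lborel. F x * ef n x) = (if n = 0 then c else 0)"
  have c: "integral {0..1} (Per F) = c" using z[rule_format, of 0] coeff[of 0] by simp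
  have P: "Per F x = c" if "x \<in> {0..1}" for x
   using fourier_uniqueness[OF continuous_Per[OF F] _ _ that] c z coeff Per_periodic[of F 0 1] by simp
  show "\<forall>x. Per F x = c"
  proof
   fix x
   have "Per F (frac x) = Per F x" using Per_periodic[of F "frac x" "\<lfloor>x\<rfloor>"] by (simp add: frac_def)
   moreover have "frac x \<in> {0..1}" using frac_lt_1[of x] by auto
   ultimately show "Per F x = c" using P by simp
  qed
 qed
qed

text \<open>Differentiation under the integral sign. The frequency is the second argument of the
  symmetric kernel \<open>wave\<close>, since that is the argument in which its derivative is
  available.\<close>

lemma nderiv_exponential_integral:
 fixes w :: "'s => real => complex" and \<theta> :: "'s => real"
 assumes w: "!!s. s \<in> S ==> continuous_on {a..b} (w s)"
 shows "nderiv p (\<lambda>\<xi>. \<Sum>s\<in>S. integral {a..b} (\<lambda>x. w s x * wave (x + \<theta> s) \<xi>))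
  = (\<lambda>\<xi>. \<Sum>s\<in>S. integral {a..b} (\<lambda>x. w s x * (- \<i> * of_real (x + \<theta> s)) ^ p * wave (x + \<theta> s) \<xi>))"
proof -
 define F where "F p \<xi> = (\<Sum>s\<in>S. integral {a..b} (\<lambda>x. w s x * (- \<i> * of_real (x + \<theta> s)) ^ p * wave (x + \<theta> s) \<xi>))" for p \<xi>
 have "nderiv p (F 0) = F p"
 proof (rule nderiv_chain[where m = p])
  fix p \<xi>
  show "(F p has_vector_derivative F (Suc p) \<xi>) (at \<xi>)"
   unfolding F_def
  proof (rule has_vector_derivative_sum)
   fix s assume s: "s \<in> S"
   have ws: "continuous_on (UNIV \<times> {a..b}) (\<lambda>y. w s (snd y))"
    by (rule continuous_on_compose2[OF w[OF s]]) (auto intro!: continuous_intros)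
   have "((\<lambda>\<xi>. integral (cbox a b) (\<lambda>x. w s x * (- \<i> * of_real (x + \<theta> s)) ^ p * wave (x + \<theta> s) \<xi>))
    has_vector_derivative integral (cbox a b) (\<lambda>x. w s x * (- \<i> * of_real (x + \<theta> s)) ^ p * ((- \<i> * of_real (x + \<theta> s)) * wave (x + \<theta> s) \<xi>))) (at \<xi> within UNIV)"
   proof (rule leibniz_rule_vector_derivative)
    show "((\<lambda>\<xi>. w s x * (- \<i> * of_real (x + \<theta> s)) ^ p * wave (x + \<theta> s) \<xi>) has_vector_derivative
     w s x * (- \<i> * of_real (x + \<theta> s)) ^ p * ((- \<i> * of_real (x + \<theta> s)) * wave (x + \<theta> s) \<xi>)) (at \<xi> within UNIV)" for x \<xi>
     by (intro has_vector_derivative_mult_right has_vector_derivative_exp_real)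
    show "(\<lambda>x. w s x * (- \<i> * of_real (x + \<theta> s)) ^ p * wave (x + \<theta> s) \<xi>) integrable_on cbox a b" for \<xi>
     unfolding cbox_interval by (intro integrable_continuous_real continuous_intros w[OF s])
    show "continuous_on (UNIV \<times> cbox a b) (\<lambda>(\<xi>, x). w s x * (- \<i> * of_real (x + \<theta> s)) ^ p * ((- \<i> * of_real (x + \<theta> s)) * wave (x + \<theta> s) \<xi>))"
     unfolding cbox_interval case_prod_beta by (intro continuous_intros ws)
   qed auto
   then show "((\<lambda>\<xi>. integral {a..b} (\<lambda>x. w s x * (- \<i> * of_real (x + \<theta> s)) ^ p * wave (x + \<theta> s) \<xi>))
    has_vector_derivative integral {a..b} (\<lambda>x. w s x * (- \<i> * of_real (x + \<theta> s)) ^ Suc p * wave (x + \<theta> s) \<xi>)) (at \<xi>)"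
    by (simp add: mult_ac)
  qed
 qed simp
 then show ?thesis by (simp add: F_def[abs_def])
qed

section \<open>Compactly supported distributions\<close>

lemma antiderivative_poly: "\<exists>P :: complex poly. pderiv P = Q"
proof
 have "pderiv (\<Sum>i\<le>degree Q. monom (coeff Q i / of_nat (Suc i)) (Suc i)) = (\<Sum>i\<le>degree Q. monom (coeff Q i) i)"
  using higher_pderiv_sum[of 1 "\<lambda>i. monom (coeff Q i / of_nat (Suc i)) (Suc i)" "{..degree Q}"]
  by (simp add: pderiv_monom del: of_nat_Suc)
 then show "pderiv (\<Sum>i\<le>degree Q. monom (coeff Q i / of_nat (Suc i)) (Suc i)) = Q"
  by (simp only: poly_as_sum_of_monoms)
qed

lemma continuous_poly_approximation:
 fixes \<psi> :: "real => complex"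
 assumes "continuous_on {-\<rho>..\<rho>} \<psi>" "0 < e"
 shows "\<exists>P. \<forall>x\<in>{-\<rho>..\<rho>}. cmod (\<psi> x - poly P (of_real x)) \<le> e"
proof -
 have *: "\<exists>P. \<forall>x\<in>{-\<rho>..\<rho>}. cmod (of_real (w x) - poly P (of_real x)) \<le> e / 2" if c0: "continuous_on {-\<rho>..\<rho>} w" for w :: "real => real"
 proof -
  obtain g where g: "real_polynomial_function g" "!!x. x \<in> {-\<rho>..\<rho>} ==> \<bar>w x - g x\<bar> < e / 2"
   using Stone_Weierstrass_real_polynomial_function[OF compact_Icc c0, of "e / 2"] assms(2) by auto
  obtain c n where c: "g = (\<lambda>x. \<Sum>i\<le>n. c i * x ^ i)" using g(1) real_polynomial_function_iff_sum by blast
  define P where "P = (\<Sum>i\<le>n. monom (complex_of_real (c i)) i)"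
  have "poly P (of_real x) = of_real (g x)" for x by (simp add: P_def c poly_sum poly_monom)
  then have "cmod (of_real (w x) - poly P (of_real x)) \<le> e / 2" if "x \<in> {-\<rho>..\<rho>}" for x
   using g(2)[OF that] by (simp flip: of_real_diff)
  then show ?thesis by blast
 qed
 obtain P where P: "!!x. x \<in> {-\<rho>..\<rho>} ==> cmod (of_real (Re (\<psi> x)) - poly P (of_real x)) \<le> e / 2"
  using *[OF continuous_on_Re[OF assms(1)]] by blast
 obtain Q where Q: "!!x. x \<in> {-\<rho>..\<rho>} ==> cmod (of_real (Im (\<psi> x)) - poly Q (of_real x)) \<le> e / 2"
  using *[OF continuous_on_Im[OF assms(1)]] by blast
 have "cmod (\<psi> x - poly (P + Polynomial.smult \<i> Q) (of_real x)) \<le> e" if "x \<in> {-\<rho>..\<rho>}" for x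
 proof -
  have "\<psi> x - poly (P + Polynomial.smult \<i> Q) (of_real x) = (of_real (Re (\<psi> x)) - poly P (of_real x)) + \<i> * (of_real (Im (\<psi> x)) - poly Q (of_real x))"
   by (simp add: algebra_simps) (simp add: complex_eq_iff)
  also have "cmod ... \<le> cmod (of_real (Re (\<psi> x)) - poly P (of_real x)) + cmod (of_real (Im (\<psi> x)) - poly Q (of_real x))"
   using norm_triangle_ineq[of "of_real (Re (\<psi> x)) - poly P (of_real x)" "\<i> * (of_real (Im (\<psi> x)) - poly Q (of_real x))"] by (simp add: norm_mult)
  finally show ?thesis using P[OF that] Q[OF that] by simp
 qed
 then show ?thesis by blast
qed

text \<open>The derivative is approximated first and then integrated, with the constant of
  integration matching the values at 0. The choice of \<open>\<delta>\<close> pays for integration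
  over a length of at most \<open>\<rho>\<close>.\<close>

lemma C_k_poly_approximation:
 assumes "C_k n \<psi>" "0 < e" "0 \<le> \<rho>"
 shows "\<exists>P. \<forall>j\<le>n. \<forall>x\<in>{-\<rho>..\<rho>}. cmod (nderiv j \<psi> x - nderiv j (\<lambda>x. poly P (of_real x)) x) \<le> e"
 using assms
proof (induction n arbitrary: \<psi> e)
 case 0
 then have "continuous_on {-\<rho>..\<rho>} \<psi>" using continuous_on_subset by (auto simp: C_k_0)
 from continuous_poly_approximation[OF this 0(2)] show ?case by simp
next
 case (Suc n)
 obtain \<psi>' where \<psi>': "!!x. (\<psi> has_vector_derivative \<psi>' x) (at x)" "C_k n \<psi>'"
  using C_k_SucE[OF Suc.prems(1)] by metis
 define \<delta> where "\<delta> = e / (1 + \<rho>)"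
 have \<delta>: "0 < \<delta>" "\<delta> * \<rho> \<le> e" "\<delta> \<le> e" using Suc.prems by (auto simp: \<delta>_def field_simps)
 obtain Q where Q: "\<forall>j\<le>n. \<forall>x\<in>{-\<rho>..\<rho>}. cmod (nderiv j \<psi>' x - nderiv j (\<lambda>x. poly Q (of_real x)) x) \<le> \<delta>"
  using Suc.IH[OF \<psi>'(2) \<delta>(1) Suc.prems(3)] by (elim exE)
 obtain P0 where P0: "pderiv P0 = Q" using antiderivative_poly[of Q] by blast
 define P where "P = P0 + [:\<psi> 0 - poly P0 0:]"
 have P: "((\<lambda>x. poly P (of_real x)) has_vector_derivative poly Q (of_real x)) (at x)" for x
  using has_vector_derivative_real_field[OF poly_DERIV[of P "of_real x"]] by (simp add: P_def pderiv_add pderiv_pCons P0)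
 have shift: "nderiv (Suc j) f = nderiv j f'" if "!!x. (f has_vector_derivative f' x) (at x)" for j f f'
  unfolding nderiv_Suc_shift by (intro arg_cong[where f = "nderiv j"] ext vector_derivative_at that)
 have "cmod (nderiv j \<psi> x - nderiv j (\<lambda>x. poly P (of_real x)) x) \<le> e" if j: "j \<le> Suc n" and x: "x \<in> {-\<rho>..\<rho>}" for j x
 proof (cases j)
  case (Suc i)
  then show ?thesis
   using Q[rule_format, of i x] j x \<delta>(3) by (simp only: shift[OF \<psi>'(1)] shift[OF P]) simp
 next
  case 0
  define h where "h x = \<psi> x - poly P (of_real x)" for x
  have hd: "(h has_vector_derivative \<psi>' x - poly Q (of_real x)) (at x within {-\<rho>..\<rho>})" for x
   unfolding h_def by (intro has_vector_derivative_diff has_vector_derivative_at_within[OF \<psi>'(1)] has_vector_derivative_at_within[OF P])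
  have "norm (h x - h 0) \<le> \<delta> * norm (x - 0)"
  proof (rule differentiable_bound[of "{-\<rho>..\<rho>}"])
   fix y assume y: "y \<in> {-\<rho>..\<rho>}"
   show "(h has_derivative (\<lambda>t. t *\<^sub>R (\<psi>' y - poly Q (of_real y)))) (at y within {-\<rho>..\<rho>})"
    using hd unfolding has_vector_derivative_def .
   have dQ: "cmod (\<psi>' y - poly Q (of_real y)) \<le> \<delta>" using Q[rule_format, of 0 y] y by simp
   then show "onorm (\<lambda>t. t *\<^sub>R (\<psi>' y - poly Q (of_real y))) \<le> \<delta>"
    using mult_left_mono[OF dQ abs_ge_zero] by (intro onorm_le) (simp add: mult.commute[of \<delta>])
  qed (use x Suc.prems in auto)
  also have "... \<le> \<delta> * \<rho>" using x \<delta> by (intro mult_left_mono) auto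
  also have "... \<le> e" by (rule \<delta>(2))
  finally show ?thesis using 0 by (simp add: h_def P_def)
 qed
 then show ?case by blast
qed

lemma smooth_exp: "smooth_fun (\<lambda>x. wave \<xi> x)"
 unfolding smooth_fun_def by (intro allI C_k_exp)

lemma smooth_poly: "smooth_fun (\<lambda>x. poly P (of_real x))"
 unfolding smooth_fun_def by (intro allI C_k_poly)

lemma smooth_power: "smooth_fun (\<lambda>x. of_real x ^ k)"
 using smooth_poly[of "monom 1 k"] by (simp add: poly_monom)

lemma smooth_lincomb: "smooth_fun f ==> smooth_fun g ==> smooth_fun (\<lambda>x. \<alpha> * f x + \<beta> * g x)"
 unfolding smooth_fun_def by (intro allI C_k_lincomb) auto

lemma smooth_zero: "smooth_fun (\<lambda>x. 0)"
 using smooth_lincomb[OF smooth_power[of 0] smooth_power[of 0], of 0 0] by simp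

text \<open>The continuity estimate is stated with an arbitrary common bound \<open>B\<close> in
  place of suprema, so that no boundedness side conditions arise when it is applied.\<close>

locale compact_functional =
 fixes S :: "(real => complex) => complex" and \<rho> :: real and d :: nat and c :: real
 assumes lin: "!!f g \<alpha> \<beta>. smooth_fun f ==> smooth_fun g ==> S (\<lambda>x. \<alpha> * f x + \<beta> * g x) = \<alpha> * S f + \<beta> * S g"
  and radius: "0 \<le> \<rho>" and const: "0 \<le> c"
  and bound: "!!f B. smooth_fun f ==> (!!j x. j \<le> d ==> x \<in> {-\<rho>..\<rho>} ==> cmod (nderiv j f x) \<le> B) ==> cmod (S f) \<le> c * B"
begin

lemma functional_zero: "S (\<lambda>x. 0) = 0"
 using lin[OF smooth_zero smooth_zero, of 0 0] by simp

lemma functional_sum: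
 assumes "finite I" "!!i. i \<in> I ==> smooth_fun (f i)"
 shows "smooth_fun (\<lambda>x. \<Sum>i\<in>I. \<alpha> i * f i x) \<and> S (\<lambda>x. \<Sum>i\<in>I. \<alpha> i * f i x) = (\<Sum>i\<in>I. \<alpha> i * S (f i))"
 using assms
proof (induction I rule: finite_induct)
 case (insert i I)
 have "smooth_fun (\<lambda>x. \<alpha> i * f i x + 1 * (\<Sum>i\<in>I. \<alpha> i * f i x))"
  by (rule smooth_lincomb) (use insert in auto)
 moreover have "S (\<lambda>x. \<alpha> i * f i x + 1 * (\<Sum>i\<in>I. \<alpha> i * f i x)) = \<alpha> i * S (f i) + 1 * S (\<lambda>x. \<Sum>i\<in>I. \<alpha> i * f i x)"
  by (rule lin) (use insert in auto)
 ultimately show ?case using insert by simp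
qed (simp add: functional_zero smooth_zero)

text \<open>Polynomials are dense in the topology of uniform convergence of finitely many
  derivatives on a compact interval, so the moments determine the functional.\<close>

lemma functional_eq_0:
 assumes mom: "!!k. S (\<lambda>x. of_real x ^ k) = 0" and \<psi>: "smooth_fun \<psi>"
 shows "S \<psi> = 0"
proof -
 have "cmod (S \<psi>) \<le> 0 + e" if e: "0 < e" for e
 proof -
  have "0 < e / (c + 1)" using e const by simp
  then obtain P where P: "\<forall>j\<le>d. \<forall>x\<in>{-\<rho>..\<rho>}. cmod (nderiv j \<psi> x - nderiv j (\<lambda>x. poly P (of_real x)) x) \<le> e / (c + 1)"
   using C_k_poly_approximation[of d \<psi> "e / (c + 1)" \<rho>] \<psi> radius unfolding smooth_fun_def by blast
  have P0: "S (\<lambda>x. poly P (of_real x)) = 0"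
  proof -
   have "S (\<lambda>x. \<Sum>i\<le>degree P. coeff P i * of_real x ^ i) = 0"
    using functional_sum[of "{..degree P}" "\<lambda>i x. of_real x ^ i" "coeff P"] by (simp add: smooth_power mom)
   then show ?thesis by (simp add: poly_altdef)
  qed
  have s: "smooth_fun (\<lambda>x. 1 * \<psi> x + (-1) * poly P (of_real x))" by (rule smooth_lincomb[OF \<psi> smooth_poly])
  have "cmod (S (\<lambda>x. 1 * \<psi> x + (-1) * poly P (of_real x))) \<le> c * (e / (c + 1))"
  proof (rule bound[OF s])
   fix j x assume "j \<le> d" "x \<in> {-\<rho>..\<rho>}"
   then show "cmod (nderiv j (\<lambda>x. 1 * \<psi> x + (-1) * poly P (of_real x)) x) \<le> e / (c + 1)"
    using P[rule_format, of j x] nderiv_lincomb[of j \<psi> "\<lambda>x. poly P (of_real x)" j 1 "-1"] \<psi> C_k_poly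
    by (simp add: smooth_fun_def)
  qed
  also have "... \<le> e" using const e by (simp add: field_simps)
  finally show ?thesis unfolding lin[OF \<psi> smooth_poly] P0 by simp
 qed
 then have "cmod (S \<psi>) \<le> 0" by (rule field_le_epsilon)
 then show ?thesis by simp
qed

text \<open>When the moments below \<open>k\<close> vanish, this is the leading Taylor coefficient
  of the Fourier transform at 0. A limit of quotients is enough for the refinement argument and
  avoids differentiating the transform.\<close>

lemma functional_exp_expansion:
 assumes mom: "!!j. j < k ==> S (\<lambda>x. of_real x ^ j) = 0"
 shows "((\<lambda>\<xi>. S (\<lambda>x. wave \<xi> x) / of_real \<xi> ^ k) \<longlongrightarrow> (- \<i>) ^ k / fact k * S (\<lambda>x. of_real x ^ k)) (at (0 :: real))"
proof -
 define E where "E n \<xi> x = wave \<xi> x - (\<Sum>j<n. (- \<i> * of_real \<xi> * of_real x) ^ j / fact j)" for n and \<xi> x :: real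
 \<comment> \<open>More than \<open>k\<close>, so that the remainder is negligible against the k-th
   power of \<open>\<xi>\<close>; at least \<open>d\<close>, so that each of the \<open>d\<close>
   derivatives trades one order of the remainder for one factor \<open>\<xi>\<close>.\<close>
 define n where "n = k + 1 + d"
 define b where "b j = (- \<i>) ^ j / fact j * S (\<lambda>x. of_real x ^ j)" for j
 have E_bound: "cmod (E n \<xi> x) \<le> (\<bar>\<xi>\<bar> * \<bar>x\<bar>) ^ n" for n \<xi> x
 proof (cases n)
  case 0
  then show ?thesis by (simp add: E_def)
 next
  case (Suc n')
  have "cmod (E n \<xi> x) \<le> (\<bar>\<xi>\<bar> * \<bar>x\<bar>) ^ n / fact n'"
   using Taylor_exp[of "- \<i> * of_real \<xi> * of_real x" n'] by (simp add: E_def Suc lessThan_Suc_atMost norm_mult del: power_Suc)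
  also have "... \<le> (\<bar>\<xi>\<bar> * \<bar>x\<bar>) ^ n / 1"
   by (intro divide_left_mono) (auto simp: fact_ge_1)
  finally show ?thesis by simp
 qed
 have E_deriv: "(E n \<xi> has_vector_derivative (- \<i> * of_real \<xi>) * E (n - 1) \<xi> x) (at x)" for n \<xi> x
 proof -
  have sum: "((\<lambda>x. \<Sum>j<n. (- \<i> * of_real \<xi> * of_real x) ^ j / fact j) has_vector_derivative (- \<i> * of_real \<xi>) * (\<Sum>j<n - 1. (- \<i> * of_real \<xi> * of_real x) ^ j / fact j)) (at x)"
  proof (induction n)
   case (Suc n)
   show ?case
   proof (cases n)
    case (Suc n')
    have f: "((\<lambda>z. (- \<i> * of_real \<xi> * z) ^ n / fact n) has_field_derivative (- \<i> * of_real \<xi>) * ((- \<i> * of_real \<xi> * of_real x) ^ n' / fact n')) (at (of_real x))"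
    proof -
     have "of_nat (Suc n') ~= (0 :: complex)" by (simp only: of_nat_eq_0_iff)
     then have n': "1 + of_nat n' ~= (0 :: complex)" by simp
     have "((\<lambda>z. - \<i> * of_real \<xi> * z) has_field_derivative - \<i> * of_real \<xi>) (at (of_real x))"
      by (rule DERIV_cmult_Id)
     from DERIV_cdivide[OF DERIV_power_Suc[OF this], of n' "fact (Suc n')"]
     show ?thesis unfolding Suc by (simp add: n')
    qed
    show ?thesis
     using has_vector_derivative_add[OF Suc.IH has_vector_derivative_real_field[OF f]] by (simp add: Suc distrib_left)
   qed simp
  qed simp
  show ?thesis
   unfolding E_def[abs_def] right_diff_distrib by (rule has_vector_derivative_diff[OF has_vector_derivative_exp_real sum])
 qed
 have E_nderiv: "nderiv j (E n \<xi>) x = (- \<i> * of_real \<xi>) ^ j * E (n - j) \<xi> x" for j n \<xi> x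
 proof -
  have "nderiv j (\<lambda>x. (- \<i> * of_real \<xi>) ^ 0 * E (n - 0) \<xi> x) = (\<lambda>x. (- \<i> * of_real \<xi>) ^ j * E (n - j) \<xi> x)"
  proof (rule nderiv_chain[where m = j])
   fix i x
   show "((\<lambda>x. (- \<i> * of_real \<xi>) ^ i * E (n - i) \<xi> x) has_vector_derivative (- \<i> * of_real \<xi>) ^ Suc i * E (n - Suc i) \<xi> x) (at x)"
    using has_vector_derivative_mult_right[OF E_deriv[of "n - i" \<xi> x], of "(- \<i> * of_real \<xi>) ^ i"] by (simp add: mult_ac)
  qed simp
  then show ?thesis by (simp add: fun_eq_iff)
 qed
 have E_split: "smooth_fun (E n \<xi>) \<and> S (\<lambda>x. wave \<xi> x) = S (E n \<xi>) + (\<Sum>j<n. b j * of_real \<xi> ^ j)" for \<xi>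
 proof -
  define G where "G x = (\<Sum>j<n. ((- \<i>) ^ j / fact j * of_real \<xi> ^ j) * of_real x ^ j)" for x :: real
  have G: "smooth_fun G" "S G = (\<Sum>j<n. b j * of_real \<xi> ^ j)"
   using functional_sum[of "{..<n}" "\<lambda>j x. of_real x ^ j" "\<lambda>j. (- \<i>) ^ j / fact j * of_real \<xi> ^ j"]
   by (simp_all add: smooth_power G_def[abs_def] b_def mult_ac)
  have e: "E n \<xi> = (\<lambda>x. 1 * wave \<xi> x + (-1) * G x)"
   unfolding E_def[abs_def] G_def power_mult_distrib by simp
  show ?thesis unfolding e lin[OF smooth_exp G(1)] G(2) using smooth_lincomb[OF smooth_exp G(1), where \<alpha> = 1 and \<beta> = "-1"]
   by (intro conjI) simp_all
 qed
 have SE: "cmod (S (E n \<xi>)) \<le> c * (\<bar>\<xi>\<bar> ^ n * (1 + \<rho>) ^ n)" for \<xi>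
 proof (rule bound)
  show "smooth_fun (E n \<xi>)" using E_split by simp
  fix j x assume j: "j \<le> d" and x: "x \<in> {-\<rho>..\<rho>}"
  have "cmod (nderiv j (E n \<xi>) x) \<le> \<bar>\<xi>\<bar> ^ j * (\<bar>\<xi>\<bar> * \<bar>x\<bar>) ^ (n - j)"
   unfolding E_nderiv norm_mult norm_power using E_bound[of "n - j" \<xi> x] by (simp add: mult_left_mono)
  also have "... = (\<bar>\<xi>\<bar> ^ j * \<bar>\<xi>\<bar> ^ (n - j)) * \<bar>x\<bar> ^ (n - j)" by (simp add: power_mult_distrib)
  also have "... = \<bar>\<xi>\<bar> ^ n * \<bar>x\<bar> ^ (n - j)" using j by (simp add: n_def flip: power_add)
  also have "\<bar>x\<bar> ^ (n - j) \<le> (1 + \<rho>) ^ (n - j)" using x by (intro power_mono) auto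
  also have "(1 + \<rho>) ^ (n - j) \<le> (1 + \<rho>) ^ n" using radius by (intro power_increasing) auto
  finally show "cmod (nderiv j (E n \<xi>) x) \<le> \<bar>\<xi>\<bar> ^ n * (1 + \<rho>) ^ n" by (simp add: mult_left_mono)
 qed
 have lim1: "((\<lambda>\<xi>. S (E n \<xi>) / of_real \<xi> ^ k) \<longlongrightarrow> 0) (at (0 :: real))"
 proof (rule Lim_null_comparison)
  show "\<forall>\<^sub>F \<xi> in at 0. norm (S (E n \<xi>) / of_real \<xi> ^ k) \<le> c * (1 + \<rho>) ^ n * \<bar>\<xi>\<bar> ^ (1 + d)"
  proof (rule eventually_mono[OF eventually_at_ball'[of 1]])
   fix \<xi> :: real assume "\<xi> \<in> ball 0 1 \<and> \<xi> ~= 0 \<and> \<xi> \<in> UNIV"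
   then have "\<bar>\<xi>\<bar> ^ k > 0" by simp
   moreover have "\<bar>\<xi>\<bar> ^ n = \<bar>\<xi>\<bar> ^ k * \<bar>\<xi>\<bar> ^ (1 + d)" by (simp add: n_def power_add)
   ultimately show "norm (S (E n \<xi>) / of_real \<xi> ^ k) \<le> c * (1 + \<rho>) ^ n * \<bar>\<xi>\<bar> ^ (1 + d)"
    using SE[of \<xi>] by (simp add: norm_divide norm_power pos_divide_le_eq mult_ac)
  qed simp
  have "((\<lambda>\<xi>. c * (1 + \<rho>) ^ n * \<bar>\<xi>\<bar> ^ (1 + d)) \<longlongrightarrow> c * (1 + \<rho>) ^ n * \<bar>0\<bar> ^ (1 + d)) (at (0 :: real))"
   by (intro tendsto_intros)
  then show "((\<lambda>\<xi>. c * (1 + \<rho>) ^ n * \<bar>\<xi>\<bar> ^ (1 + d)) \<longlongrightarrow> 0) (at (0 :: real))" by simp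
 qed
 have lim2: "((\<lambda>\<xi>. \<Sum>j<n. b j * (if j < k then 0 else of_real \<xi> ^ (j - k))) \<longlongrightarrow> b k) (at (0 :: real))"
 proof -
  have "((\<lambda>\<xi>. b j * (if j < k then 0 else of_real \<xi> ^ (j - k))) \<longlongrightarrow> (if j = k then b k else 0)) (at (0 :: real))" for j
  proof (cases "j < k")
   case False
   have "((\<lambda>\<xi>. b j * of_real \<xi> ^ (j - k)) \<longlongrightarrow> b j * of_real 0 ^ (j - k)) (at (0 :: real))"
    by (intro tendsto_intros)
   then show ?thesis using False by (cases "j = k") (auto simp: power_0_left)
  qed simp
  then have "((\<lambda>\<xi>. \<Sum>j<n. b j * (if j < k then 0 else of_real \<xi> ^ (j - k))) \<longlongrightarrow> (\<Sum>j<n. if j = k then b k else 0)) (at (0 :: real))"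
   by (intro tendsto_sum)
  moreover have "(\<Sum>j<n. if j = k then b k else 0) = b k" by (subst sum.delta) (auto simp: n_def)
  ultimately show ?thesis by (simp only:)
 qed
 have "((\<lambda>\<xi>. S (E n \<xi>) / of_real \<xi> ^ k + (\<Sum>j<n. b j * (if j < k then 0 else of_real \<xi> ^ (j - k)))) \<longlongrightarrow> 0 + b k) (at (0 :: real))"
  by (rule tendsto_add[OF lim1 lim2])
 then have "((\<lambda>\<xi>. S (\<lambda>x. wave \<xi> x) / of_real \<xi> ^ k) \<longlongrightarrow> 0 + b k) (at (0 :: real))"
 proof (rule Lim_transform_eventually)
  show "\<forall>\<^sub>F \<xi> in at 0. S (E n \<xi>) / of_real \<xi> ^ k + (\<Sum>j<n. b j * (if j < k then 0 else of_real \<xi> ^ (j - k))) = S (\<lambda>x. wave \<xi> x) / of_real \<xi> ^ k"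
  proof (rule eventually_mono[OF eventually_at_ball'[of 1]])
   fix \<xi> :: real assume "\<xi> \<in> ball 0 1 \<and> \<xi> ~= 0 \<and> \<xi> \<in> UNIV"
   then have \<xi>: "\<xi> ~= 0" by simp
   have "(\<Sum>j<n. b j * of_real \<xi> ^ j) / of_real \<xi> ^ k = (\<Sum>j<n. b j * (if j < k then 0 else of_real \<xi> ^ (j - k)))"
    unfolding sum_divide_distrib
    by (intro sum.cong refl) (use \<xi> mom in \<open>auto simp: b_def power_diff not_less\<close>)
   then show "S (E n \<xi>) / of_real \<xi> ^ k + (\<Sum>j<n. b j * (if j < k then 0 else of_real \<xi> ^ (j - k))) = S (\<lambda>x. wave \<xi> x) / of_real \<xi> ^ k"
    using E_split[of \<xi>] by (simp add: add_divide_distrib)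
  qed simp
 qed
 then show ?thesis by (simp add: b_def)
qed

end

lemma compact_distribution_functional:
 assumes "compact_distribution T"
 shows "\<exists>\<rho> d c. compact_functional T \<rho> d c"
proof -
 obtain \<rho> d C where \<rho>: "\<rho> \<ge> 0" and b: "\<forall>f. smooth_fun f --> cmod (T f) \<le> C * (\<Sum>j\<le>d. SUP x\<in>{-\<rho>..\<rho>}. cmod (nderiv j f x))"
  and lin: "\<forall>f g \<alpha> \<beta>. smooth_fun f \<and> smooth_fun g --> T (\<lambda>x. \<alpha> * f x + \<beta> * g x) = \<alpha> * T f + \<beta> * T g"
  using assms unfolding compact_distribution_def by (elim conjE exE) (rule that)
 have "compact_functional T \<rho> d (\<bar>C\<bar> * (real d + 1))"
 proof
  fix f B assume f: "smooth_fun f" and B: "!!j x. j \<le> d ==> x \<in> {-\<rho>..\<rho>} ==> cmod (nderiv j f x) \<le> B"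
  have sup: "(SUP x\<in>{-\<rho>..\<rho>}. cmod (nderiv j f x)) \<le> B" "0 \<le> (SUP x\<in>{-\<rho>..\<rho>}. cmod (nderiv j f x))" if "j \<le> d" for j
  proof -
   show "(SUP x\<in>{-\<rho>..\<rho>}. cmod (nderiv j f x)) \<le> B" by (rule cSUP_least) (use \<rho> B that in auto)
   have "bdd_above ((\<lambda>x. cmod (nderiv j f x)) ` {-\<rho>..\<rho>})" using B that by (intro bdd_aboveI2) auto
   then have "cmod (nderiv j f 0) \<le> (SUP x\<in>{-\<rho>..\<rho>}. cmod (nderiv j f x))" by (rule cSUP_upper2[of _ _ 0]) (use \<rho> in auto)
   then show "0 \<le> (SUP x\<in>{-\<rho>..\<rho>}. cmod (nderiv j f x))" using norm_ge_zero order_trans by blast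
  qed
  have "cmod (T f) \<le> C * (\<Sum>j\<le>d. SUP x\<in>{-\<rho>..\<rho>}. cmod (nderiv j f x))" using b f by simp
  also have "... \<le> \<bar>C\<bar> * (\<Sum>j\<le>d. SUP x\<in>{-\<rho>..\<rho>}. cmod (nderiv j f x))"
   by (intro mult_right_mono sum_nonneg) (use sup in auto)
  also have "... \<le> \<bar>C\<bar> * (\<Sum>j\<le>d. B)" by (intro mult_left_mono sum_mono) (use sup in auto)
  finally show "cmod (T f) \<le> \<bar>C\<bar> * (real d + 1) * B" by (simp add: algebra_simps)
 qed (use lin \<rho> in auto)
 then show ?thesis by blast
qed

lemma functional_minus_integral:
 fixes g :: "real => complex"
 assumes "compact_functional S \<rho> d c" and g: "continuous_on UNIV g" "!!x. L < \<bar>x\<bar> ==> g x = 0"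
 shows "\<exists>\<rho> d c. compact_functional (\<lambda>\<psi>. S \<psi> - (LINT x|lborel. g x * \<psi> x)) \<rho> d c"
proof -
 interpret compact_functional S \<rho> d c by (rule assms(1))
 define \<rho>' where "\<rho>' = max \<rho> \<bar>L\<bar>"
 have g': "g x = 0" if "\<rho>' < \<bar>x\<bar>" for x using g(2)[of x] that by (auto simp: \<rho>'_def)
 have cont: "continuous_on UNIV f" if "smooth_fun f" for f using C_k_continuous that by (auto simp: smooth_fun_def)
 have eq: "(LINT x|lborel. g x * f x) = integral {-\<rho>'..\<rho>'} (\<lambda>x. g x * f x)" if "smooth_fun f" for f
  by (rule lborel_integral_compact_support) (use cont[OF that] g g' in \<open>auto intro!: continuous_intros\<close>)
 have "bounded (g ` {-\<rho>'..\<rho>'})"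
  by (rule compact_imp_bounded[OF compact_continuous_image[OF continuous_on_subset[OF g(1)] compact_Icc]]) auto
 then obtain K where K: "\<forall>y\<in>g ` {-\<rho>'..\<rho>'}. cmod y \<le> K" unfolding bounded_iff by (rule exE)
 have "0 \<in> {-\<rho>'..\<rho>'}" using radius by (auto simp: \<rho>'_def)
 then have K0: "0 \<le> K" using K norm_ge_zero order_trans by blast
 have "compact_functional (\<lambda>\<psi>. S \<psi> - (LINT x|lborel. g x * \<psi> x)) \<rho>' d (c + K * (2 * \<rho>'))"
 proof
  fix f h \<alpha> \<beta> assume s: "smooth_fun f" "smooth_fun h"
  have int: "integrable lborel (\<lambda>x. g x * f x)" if "smooth_fun f" for f
   by (rule integrable_compact_support[of _ L]) (use cont[OF that] g in \<open>auto intro!: continuous_intros\<close>)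
  have "(LINT x|lborel. g x * (\<alpha> * f x + \<beta> * h x)) = (LINT x|lborel. \<alpha> * (g x * f x) + \<beta> * (g x * h x))"
   by (simp add: algebra_simps)
  also have "... = \<alpha> * (LINT x|lborel. g x * f x) + \<beta> * (LINT x|lborel. g x * h x)"
   by (subst Bochner_Integration.integral_add) (use int s in auto)
  finally show "S (\<lambda>x. \<alpha> * f x + \<beta> * h x) - (LINT x|lborel. g x * (\<alpha> * f x + \<beta> * h x)) =
   \<alpha> * (S f - (LINT x|lborel. g x * f x)) + \<beta> * (S h - (LINT x|lborel. g x * h x))"
   using lin[OF s] by (simp add: algebra_simps)
 next
  show "0 \<le> \<rho>'" using radius by (simp add: \<rho>'_def)
  then show "0 \<le> c + K * (2 * \<rho>')" using const K0 by simp
  fix f B assume f: "smooth_fun f" and B: "!!j x. j \<le> d ==> x \<in> {-\<rho>'..\<rho>'} ==> cmod (nderiv j f x) \<le> B"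
  have "cmod (S f) \<le> c * B" by (rule bound[OF f]) (rule B, auto simp: \<rho>'_def)
  moreover have "cmod (LINT x|lborel. g x * f x) \<le> K * B * (\<rho>' - (-\<rho>'))"
   unfolding eq[OF f]
  proof (rule integral_bound)
   show "continuous_on {-\<rho>'..\<rho>'} (\<lambda>x. g x * f x)"
    by (rule continuous_on_subset[of UNIV]) (use cont[OF f] g in \<open>auto intro!: continuous_intros\<close>)
   fix t assume t: "t \<in> {-\<rho>'..\<rho>'}"
   show "cmod (g t * f t) \<le> K * B"
    unfolding norm_mult using K K0 t B[of 0 t] by (intro mult_mono) auto
  qed (use \<open>0 \<le> \<rho>'\<close> in auto)
  ultimately show "cmod (S f - (LINT x|lborel. g x * f x)) \<le> (c + K * (2 * \<rho>')) * B"
   using norm_triangle_ineq4[of "S f" "LINT x|lborel. g x * f x"] by (simp add: algebra_simps)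
 qed
 then show ?thesis by blast
qed

section \<open>Refinable functions and distributions\<close>

context mask
begin

definition A :: "real => nat => nat => complex" where
 "A \<xi> l j = (\<Sum>i\<in>{-N..N}. a i l j * exp (- \<i> * of_real \<xi> * of_int i))"

text \<open>By induction on \<open>k\<close>: if the moments below \<open>k\<close> vanish,
  comparing leading coefficients at 0 in the refinement equation makes the k-th moments an
  eigenvector of the symbol at 0 for 2^k. The spectral hypothesis annihilates it, where for k = 0
  the vanishing mass \<open>S0\<close> is used.\<close>

lemma refinable_functionals_eq_0:
 assumes S: "!!l. l < r ==> compact_functional (S l) (\<rho> l) (d l) (c l)"
  and refinable: "!!\<xi> l. l < r ==> S l (\<lambda>x. wave (2 * \<xi>) x) = (\<Sum>j<r. A \<xi> l j * S j (\<lambda>x. wave \<xi> x))"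
  and spectrum: "!!k w l. (!!l. l < r ==> (\<Sum>j<r. A 0 l j * w j) = 2 ^ k * w l) ==> (k = 0 ==> w 0 = 0) ==> l < r ==> w l = 0"
  and S0: "S 0 (\<lambda>x. 1) = 0" and \<psi>: "smooth_fun \<psi>" and l: "l < r"
 shows "S l \<psi> = 0"
proof -
 have "\<forall>l<r. S l (\<lambda>x. of_real x ^ k) = 0" for k
 proof (induction k rule: less_induct)
  case (less k)
  define b where "b l = (- \<i>) ^ k / fact k * S l (\<lambda>x. of_real x ^ k)" for l
  define H where "H l \<xi> = S l (\<lambda>x. wave \<xi> x)" for l and \<xi> :: real
  have lim: "((\<lambda>\<xi>. H l \<xi> / of_real \<xi> ^ k) \<longlongrightarrow> b l) (at (0 :: real))" if "l < r" for l
   unfolding H_def b_def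
   by (rule compact_functional.functional_exp_expansion[OF S[OF that]]) (use less that in auto)
  have "(\<Sum>j<r. A 0 l j * b j) = 2 ^ k * b l" if l: "l < r" for l
  proof -
   have "filterlim (\<lambda>\<xi> :: real. 2 * \<xi>) (at 0) (at 0)"
    by (rule filterlim_atI) (auto intro!: tendsto_eq_intros simp: eventually_at_filter)
   from filterlim_compose[OF lim[OF l] this]
   have "((\<lambda>\<xi>. H l (2 * \<xi>) / of_real (2 * \<xi>) ^ k) \<longlongrightarrow> b l) (at 0)" .
   then have "((\<lambda>\<xi>. 2 ^ k * (H l (2 * \<xi>) / of_real (2 * \<xi>) ^ k)) \<longlongrightarrow> 2 ^ k * b l) (at 0)"
    by (intro tendsto_mult tendsto_const)
   moreover have "2 ^ k * (H l (2 * \<xi>) / of_real (2 * \<xi>) ^ k) = (\<Sum>j<r. A \<xi> l j * (H j \<xi> / of_real \<xi> ^ k))" for \<xi>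
   proof -
    have "2 ^ k * (H l (2 * \<xi>) / of_real (2 * \<xi>) ^ k) = H l (2 * \<xi>) / of_real \<xi> ^ k"
     by (simp add: power_mult_distrib)
    also have "... = (\<Sum>j<r. A \<xi> l j * (H j \<xi> / of_real \<xi> ^ k))"
     using refinable[OF l, of \<xi>] by (simp add: H_def sum_divide_distrib)
    finally show ?thesis .
   qed
   ultimately have 1: "((\<lambda>\<xi>. \<Sum>j<r. A \<xi> l j * (H j \<xi> / of_real \<xi> ^ k)) \<longlongrightarrow> 2 ^ k * b l) (at 0)" by (simp only:)
   have "((\<lambda>\<xi>. A \<xi> l j) \<longlongrightarrow> A 0 l j) (at 0)" for j
    unfolding A_def by (intro tendsto_intros)
   then have "((\<lambda>\<xi>. \<Sum>j<r. A \<xi> l j * (H j \<xi> / of_real \<xi> ^ k)) \<longlongrightarrow> (\<Sum>j<r. A 0 l j * b j)) (at 0)"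
    by (intro tendsto_sum tendsto_mult lim) auto
   from tendsto_unique[OF _ this 1] show ?thesis by simp
  qed
  moreover have "b 0 = 0" if "k = 0" using S0 that by (simp add: b_def)
  ultimately have "b l = 0" if "l < r" for l using spectrum[of b k l] that by blast
  then show ?case by (simp add: b_def)
 qed
 then show ?thesis using compact_functional.functional_eq_0[OF S[OF l] _ \<psi>] l by blast
qed

lemma refinable_hat:
 assumes g: "csupp L g" "!!l. l < r ==> continuous_on UNIV (g l)" "!!l x. l < r ==> g l x = R g l x" and l: "l < r"
 shows "(LINT x|lborel. g l x * wave (2 * \<xi>) x) = (\<Sum>j<r. A \<xi> l j * (LINT x|lborel. g j x * wave \<xi> x))"
proof -
 define X where "X = {-N..N} \<times> {..<r}"
 define G where "G y x = g (snd y) (2 * x - of_int (fst y)) * wave (2 * \<xi>) x" for y x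
 have cont: "continuous_on UNIV (G y)" if "y \<in> X" for y
  unfolding G_def using that by (intro continuous_intros continuous_on_compose2[OF g(2)]) (auto simp: X_def)
 have supp: "G y x = 0" if "y \<in> X" "\<bar>L\<bar> + of_int N < \<bar>x\<bar>" for y x
 proof -
  have "\<bar>of_int (fst y)\<bar> \<le> (of_int N :: real)" using that(1) by (auto simp: X_def abs_le_iff)
  then have "L < \<bar>2 * x - of_int (fst y)\<bar>" using that(2) by linarith
  then show ?thesis using g(1) that(1) by (auto simp: G_def csupp_def X_def)
 qed
 have int: "integrable lborel (G y)" if "y \<in> X" for y
  by (rule integrable_compact_support[OF cont supp]) (use that in auto)
 have G: "2 * (LINT x|lborel. G y x) = exp (- \<i> * of_real \<xi> * of_int (fst y)) * (LINT x|lborel. g (snd y) x * wave \<xi> x)" if "y \<in> X" for y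
 proof -
  define F where "F x = g (snd y) x * wave \<xi> x" for x
  have "exp (- \<i> * of_real \<xi> * of_int (fst y)) * F (- of_int (fst y) + 2 * x) = G y x" for x
   by (simp add: F_def G_def algebra_simps flip: exp_add)
  then have "(LINT x|lborel. G y x) = exp (- \<i> * of_real \<xi> * of_int (fst y)) * (LINT x|lborel. F (- of_int (fst y) + 2 * x))"
   by (simp flip: integral_mult_right_zero)
  moreover have "(LINT x|lborel. F x) = 2 * (LINT x|lborel. F (- of_int (fst y) + 2 * x))"
   using lborel_integral_real_affine[of 2 F "- of_int (fst y)"] by (simp add: scaleR_conv_of_real)
  ultimately show ?thesis by (simp add: F_def)
 qed
 have "g l x * wave (2 * \<xi>) x = (\<Sum>y\<in>X. a (fst y) l (snd y) * (2 * G y x))" for x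
 proof -
  have "g l x = (\<Sum>y\<in>X. a (fst y) l (snd y) * (2 * g (snd y) (2 * x - of_int (fst y))))"
   by (subst g(3)[OF l]) (simp add: R_def X_def sum_pairs sum_distrib_left mult_ac)
  then show ?thesis by (simp add: G_def sum_distrib_right mult.assoc)
 qed
 then have "(LINT x|lborel. g l x * wave (2 * \<xi>) x) = (LINT x|lborel. (\<Sum>y\<in>X. a (fst y) l (snd y) * (2 * G y x)))"
  by simp
 also have "... = (\<Sum>y\<in>X. a (fst y) l (snd y) * (2 * (LINT x|lborel. G y x)))"
  by (subst Bochner_Integration.integral_sum) (use int in auto)
 also have "... = (\<Sum>y\<in>X. a (fst y) l (snd y) * (exp (- \<i> * of_real \<xi> * of_int (fst y)) * (LINT x|lborel. g (snd y) x * wave \<xi> x)))"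
  by (intro sum.cong refl) (simp only: G)
 also have "... = (\<Sum>j<r. A \<xi> l j * (LINT x|lborel. g j x * wave \<xi> x))"
  unfolding A_def sum_distrib_right X_def
  by (subst sum.swap) (simp add: sum_pairs mult_ac)
 finally show ?thesis .
qed

end

text \<open>In the convergence of the cascade the limit is tied to the distribution only by testing
  against compactly supported functions. This recovers its compact support, which estimates by
  \<open>C_norm\<close> require.\<close>

lemma functional_represented_support:
 assumes T: "compact_functional T \<rho> d c" and g: "continuous_on UNIV g"
  and rep: "!!\<psi>. smooth_fun \<psi> ==> compact_supp \<psi> ==> T \<psi> = (LINT x|lborel. g x * \<psi> x)" and t: "\<rho> < \<bar>t\<bar>"
 shows "g t = 0"
proof (rule ccontr)
 assume nz: "g t ~= 0"
 interpret compact_functional T \<rho> d c by (rule T)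
 \<comment> \<open>Rotating by the conjugate of the value at \<open>t\<close> makes the real part
   positive near \<open>t\<close>, so a nonnegative bump there detects it.\<close>
 define h where "h x = Re (cnj (g t) * g x)" for x
 have ch: "continuous_on UNIV h" unfolding h_def by (intro continuous_intros g)
 have ht: "0 < h t" using nz by (simp add: h_def cmod_power2[symmetric] flip: power2_eq_square)
 have "open {x. 0 < h x}" using open_Collect_less[OF continuous_on_const ch, of 0] by simp
 moreover have "open {x. \<rho> < \<bar>x\<bar>}"
  by (rule open_Collect_less) (intro continuous_intros)+
 ultimately have "open ({x. 0 < h x} \<inter> {x. \<rho> < \<bar>x\<bar>})" by (rule open_Int)
 then obtain e where e: "0 < e" "ball t e \<subseteq> {x. 0 < h x} \<inter> {x. \<rho> < \<bar>x\<bar>}"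
  by (rule openE[of _ t]) (use ht t in auto)
 define \<alpha> where "\<alpha> = t - e / 2"
 define \<beta> where "\<beta> = t + e / 2"
 have \<alpha>\<beta>: "\<alpha> < t" "t < \<beta>" using e by (auto simp: \<alpha>_def \<beta>_def)
 have in_ball: "0 < h x" "\<rho> < \<bar>x\<bar>" if "x \<in> {\<alpha>..\<beta>}" for x
 proof -
  have "x \<in> ball t e" using that e(1) by (auto simp: \<alpha>_def \<beta>_def dist_real_def)
  then show "0 < h x" "\<rho> < \<bar>x\<bar>" using e(2) by auto
 qed
 define \<psi> where "\<psi> x = complex_of_real (bump \<alpha> \<beta> x)" for x
 have s: "smooth_fun \<psi>" unfolding \<psi>_def[abs_def] by (rule smooth_bump)
 have zero: "\<psi> x = 0" if "x \<notin> {\<alpha>..\<beta>}" for x using that bump_zero[of x \<alpha> \<beta>] by (auto simp: \<psi>_def)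
 have "closure {x. \<psi> x ~= 0} \<subseteq> {\<alpha>..\<beta>}" by (rule closure_minimal) (use zero in blast, simp)
 then have cs: "compact_supp \<psi>" unfolding compact_supp_def
  using compact_Icc closed_closure by (metis compact_Int_closed inf.absorb_iff2)
 have "cmod (T \<psi>) \<le> c * 0"
 proof (rule bound[OF s])
  fix j x assume x: "x \<in> {-\<rho>..\<rho>}"
  have "open (- {\<alpha>..\<beta>})" by auto
  moreover have "x \<notin> {\<alpha>..\<beta>}" using in_ball(2)[of x] x by (auto simp: abs_less_iff)
  ultimately obtain \<epsilon> where \<epsilon>: "0 < \<epsilon>" "ball x \<epsilon> \<subseteq> - {\<alpha>..\<beta>}" using openE[of "- {\<alpha>..\<beta>}" x] by blast
  have "\<forall>y\<in>ball x \<epsilon>. nderiv j \<psi> y = 0"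
  proof (induction j)
   case 0
   then show ?case using \<epsilon>(2) zero by auto
  next
   case (Suc j)
   show ?case
   proof
    fix y assume y: "y \<in> ball x \<epsilon>"
    have "((\<lambda>_. 0 :: complex) has_vector_derivative 0) (at y)" by (rule has_vector_derivative_const)
    then have "(nderiv j \<psi> has_vector_derivative 0) (at y)"
     by (rule has_vector_derivative_transform_within_open[OF _ open_ball y]) (use Suc in auto)
    then show "nderiv (Suc j) \<psi> y = 0" unfolding nderiv_Suc by (rule vector_derivative_at)
   qed
  qed
  then show "cmod (nderiv j \<psi> x) \<le> 0" using \<epsilon>(1) by simp
 qed
 then have "(LINT x|lborel. g x * \<psi> x) = 0" using rep[OF s cs] by simp
 moreover have far: "\<psi> x = 0" if "\<bar>\<alpha>\<bar> + \<bar>\<beta>\<bar> < \<bar>x\<bar>" for x by (rule zero) (use that in auto)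
 have "(LINT x|lborel. g x * \<psi> x) = integral {-(\<bar>\<alpha>\<bar> + \<bar>\<beta>\<bar>)..\<bar>\<alpha>\<bar> + \<bar>\<beta>\<bar>} (\<lambda>x. g x * \<psi> x)"
  by (rule lborel_integral_compact_support)
   (use C_k_continuous s g far in \<open>auto intro!: continuous_intros simp: smooth_fun_def\<close>)
 ultimately have 0: "integral {-(\<bar>\<alpha>\<bar> + \<bar>\<beta>\<bar>)..\<bar>\<alpha>\<bar> + \<bar>\<beta>\<bar>} (\<lambda>x. g x * \<psi> x) = 0" by simp
 have cg: "continuous_on S (\<lambda>x. g x * \<psi> x)" for S
  by (rule continuous_on_subset[of UNIV]) (use C_k_continuous s g in \<open>auto intro!: continuous_intros simp: smooth_fun_def\<close>)
 have bl: "bounded_linear (\<lambda>z. Re (cnj (g t) * z))"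
  by (rule bounded_linear_compose[OF bounded_linear_Re bounded_linear_mult_right])
 define q where "q x = h x * bump \<alpha> \<beta> x" for x
 have q: "q x = Re (cnj (g t) * (g x * \<psi> x))" for x by (simp add: q_def h_def \<psi>_def algebra_simps)
 have cq: "continuous_on {-(\<bar>\<alpha>\<bar> + \<bar>\<beta>\<bar>)..\<bar>\<alpha>\<bar> + \<bar>\<beta>\<bar>} q" unfolding q by (intro continuous_intros cg)
 have iq: "integral {-(\<bar>\<alpha>\<bar> + \<bar>\<beta>\<bar>)..\<bar>\<alpha>\<bar> + \<bar>\<beta>\<bar>} q = Re (cnj (g t) * 0)"
  using integral_linear[OF integrable_continuous_real[OF cg] bl] 0 by (simp add: o_def q[abs_def])
 have qp: "0 \<le> q x" for x
 proof (cases "x \<in> {\<alpha>..\<beta>}")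
  case True
  then show ?thesis using in_ball(1)[OF True] bump_nonneg[of \<alpha> \<beta> x] by (simp add: q_def)
 next
  case False
  then show ?thesis using bump_zero[of x \<alpha> \<beta>] by (auto simp: q_def)
 qed
 have "q t = 0"
 proof -
  have "-(\<bar>\<alpha>\<bar> + \<bar>\<beta>\<bar>) < \<bar>\<alpha>\<bar> + \<bar>\<beta>\<bar>" "t \<in> {-(\<bar>\<alpha>\<bar> + \<bar>\<beta>\<bar>)..\<bar>\<alpha>\<bar> + \<bar>\<beta>\<bar>}" using \<alpha>\<beta> by auto
  then show ?thesis using integral_eq_0_iff[OF cq _ qp] iq by simp
 qed
 then show False using ht bump_pos[OF \<alpha>\<beta>] by (simp add: q_def)
qed

context sum_rule_mask
begin

text \<open>The difference of distribution and function is again a refinable family of compact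
  functionals, so it vanishes once the first masses agree. The integral of the first component of
  \<open>g\<close> is 1: the total masses of \<open>v\<close> are (1, 0, ..., 0) and the periodised
  0-th moment is constantly 1.\<close>

lemma refinable_functional_represented:
 assumes \<Theta>: "!!l. l < r ==> compact_functional (\<Theta> l) (\<rho> l) (d l) (c l)"
  and \<Theta>_refinable: "!!\<xi> l. l < r ==> \<Theta> l (\<lambda>x. wave (2 * \<xi>) x) = (\<Sum>j<r. A \<xi> l j * \<Theta> j (\<lambda>x. wave \<xi> x))"
  and spectrum: "!!k w l. (!!l. l < r ==> (\<Sum>j<r. A 0 l j * w j) = 2 ^ k * w l) ==> (k = 0 ==> w 0 = 0) ==> l < r ==> w l = 0"
  and \<Theta>0: "\<Theta> 0 (\<lambda>x. 1) = 1"
  and g: "csupp L g" "!!l. l < r ==> continuous_on UNIV (g l)" "!!l x. l < r ==> g l x = R g l x"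
  and M0: "M 0 0 (Phi g 0) = 1" and \<psi>: "smooth_fun \<psi>" and l: "l < r"
 shows "\<Theta> l \<psi> = (LINT x|lborel. g l x * \<psi> x)"
proof -
 define S where "S l \<psi> = \<Theta> l \<psi> - (LINT x|lborel. g l x * \<psi> x)" for l \<psi>
 have gz: "g l x = 0" if "l < r" "L < \<bar>x\<bar>" for l x using g(1) that by (auto simp: csupp_def)
 have "\<exists>\<rho> d c. compact_functional (S l) \<rho> d c" if "l < r" for l
  unfolding S_def[abs_def] by (rule functional_minus_integral[OF \<Theta>[OF that] g(2)[OF that] gz[OF that]])
 then obtain \<rho>' d' c' where S: "!!l. l < r ==> compact_functional (S l) (\<rho>' l) (d' l) (c' l)" by metis
 have int: "integrable lborel (\<lambda>x. v j l * g l x)" if "l < r" for j l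
  by (rule integrable_compact_support[of _ L]) (use g(2) gz that in \<open>auto intro!: continuous_intros\<close>)
 have "(LINT x|lborel. mom 0 g x) = (\<Sum>j\<in>{-N..N}. \<Sum>l<r. v j l * (LINT x|lborel. g l x))"
 proof -
  have "mom 0 g x = (\<Sum>y\<in>{-N..N} \<times> {..<r}. v (fst y) (snd y) * g (snd y) x)" for x
   by (simp add: mom_def sum_pairs)
  then have "(LINT x|lborel. mom 0 g x) = (\<Sum>y\<in>{-N..N} \<times> {..<r}. LINT x|lborel. v (fst y) (snd y) * g (snd y) x)"
   by (simp only:) (rule Bochner_Integration.integral_sum, use int in auto)
  then show ?thesis by (simp add: sum_pairs)
 qed
 also have "... = (\<Sum>l<r. (\<Sum>j\<in>{-N..N}. v j l) * (LINT x|lborel. g l x))"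
  by (subst sum.swap) (simp add: sum_distrib_right)
 also have "... = (\<Sum>l<r. if l = 0 then (LINT x|lborel. g 0 x) else 0)"
  by (intro sum.cong refl) (simp add: v_hat)
 also have "... = (LINT x|lborel. g 0 x)" using r by (simp add: sum.delta)
 finally have "(LINT x|lborel. mom 0 g x) = (LINT x|lborel. g 0 x)" .
 moreover have "(LINT x|lborel. mom 0 g x) = integral {0..1} (Per (mom 0 g))"
 proof (rule integral_Per)
  show "continuous_on UNIV (mom 0 g)" unfolding mom_def[abs_def] by (intro continuous_intros g(2)) auto
  show "mom 0 g x = 0" if "L < \<bar>x\<bar>" for x using gz that by (simp add: mom_def)
 qed
 ultimately have "(LINT x|lborel. g 0 x) = integral {0..1} (Per (mom 0 g))" by simp
 also have "Per (mom 0 g) = (\<lambda>_. 1)"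
  using refinable_admissible[OF g M0, of 0] M_eq_Per[OF g(1), of 0] by (simp add: fun_eq_iff)
 finally have g0: "(LINT x|lborel. g 0 x) = 1" by simp
 have "S l \<psi> = 0"
 proof (rule refinable_functionals_eq_0[where S = S and \<rho> = \<rho>' and d = d' and c = c'])
  show "compact_functional (S l) (\<rho>' l) (d' l) (c' l)" if "l < r" for l by (rule S[OF that])
  show "S l (\<lambda>x. wave (2 * \<xi>) x) = (\<Sum>j<r. A \<xi> l j * S j (\<lambda>x. wave \<xi> x))" if "l < r" for l \<xi>
  proof -
   have "(LINT x|lborel. g l x * wave (2 * \<xi>) x) = (\<Sum>j<r. A \<xi> l j * (LINT x|lborel. g j x * wave \<xi> x))"
    by (rule refinable_hat[OF g that])
   then show ?thesis by (simp only: S_def right_diff_distrib sum_subtractf \<Theta>_refinable[OF that])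
  qed
  show "S 0 (\<lambda>x. 1) = 0" using \<Theta>0 g0 by (simp add: S_def)
  show "!!k w l. (!!l. l < r ==> (\<Sum>j<r. A 0 l j * w j) = 2 ^ k * w l) ==> (k = 0 ==> w 0 = 0) ==> l < r ==> w l = 0"
   by (rule spectrum)
 qed (use \<psi> l in auto)
 then show ?thesis by (simp add: S_def)
qed

text \<open>For z = e^(-i xi), a vector annihilating the sums over k of g(x + k) z^k for all x in
  [0, 1] annihilates the periodisation of g(x) e^(-i xi x). Its Fourier coefficients are the
  transforms at xi + 2 pi k, where stability applies.\<close>

lemma stable_hat_decays_weakly:
 assumes g: "csupp L g" "!!l. l < r ==> C_k m (g l)" "!!l x. l < r ==> g l x = R g l x"
  and M0: "M 0 0 (Phi g 0) = 1"
  and stable: "!!\<xi> \<gamma> l. (!!k :: int. (\<Sum>l<r. \<gamma> l * (LINT x|lborel. g l x * wave (\<xi> + 2 * pi * of_int k) x)) = 0) ==> l < r ==> \<gamma> l = 0"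
 shows "decays_weakly (Suc m)"
proof -
 define K where "K = \<lceil>\<bar>L\<bar> + 1\<rceil>"
 have K: "L + 1 \<le> of_int K" unfolding K_def by linarith
 show ?thesis
 proof (rule stable_refinable_decays_weakly[OF g M0 K])
  fix z \<gamma> l assume z: "cmod z = 1" and l: "l < r"
   and zero: "!!x. x \<in> {0..1} ==> (\<Sum>l<r. \<gamma> l * (\<Sum>k\<in>{-K..K}. g l (x + of_int k) * z powi k)) = 0"
  define \<xi> where "\<xi> = - Arg z"
  have z_eq: "z = exp (- \<i> * of_real \<xi>)"
   using Arg_eq[of z] z by (cases "z = 0") (simp_all add: \<xi>_def)
  have zk: "z powi k = exp (- \<i> * of_real \<xi> * of_int k)" for k
   unfolding z_eq exp_power_int by (simp add: mult_ac)
  define F where "F x = (\<Sum>l<r. \<gamma> l * (g l x * wave \<xi> x))" for x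
  have cont: "continuous_on UNIV (g l)" if "l < r" for l by (rule C_k_continuous[OF g(2)[OF that]])
  have gz: "g l x = 0" if "l < r" "L < \<bar>x\<bar>" for l x using g(1) that by (auto simp: csupp_def)
  have cF: "continuous_on UNIV F" unfolding F_def by (intro continuous_intros cont) auto
  have Fz: "F x = 0" if "L < \<bar>x\<bar>" for x using gz that by (simp add: F_def)
  have "Per F x = 0" if x: "x \<in> {0..1}" for x
  proof -
   have "Per F x = (\<Sum>k\<in>{-K..K}. F (x + of_int k))"
    by (rule Per_window[OF Fz]) (use K x in auto)
   also have "... = (\<Sum>k\<in>{-K..K}. \<Sum>l<r. wave \<xi> x * (\<gamma> l * (g l (x + of_int k) * z powi k)))"
    unfolding F_def zk by (intro sum.cong refl) (simp add: algebra_simps flip: exp_add)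
   also have "... = wave \<xi> x * (\<Sum>l<r. \<gamma> l * (\<Sum>k\<in>{-K..K}. g l (x + of_int k) * z powi k))"
    by (subst sum.swap) (simp add: sum_distrib_left)
   finally show ?thesis using zero[OF x] by simp
  qed
  then have "Per F x = 0" for x
  proof -
   have "Per F (frac x) = Per F x" using Per_periodic[of F "frac x" "\<lfloor>x\<rfloor>"] by (simp add: frac_def)
   moreover have "frac x \<in> {0..1}" using frac_lt_1[of x] by auto
   ultimately show ?thesis using \<open>!!x. x \<in> {0..1} ==> Per F x = 0\<close> by simp
  qed
  then have F0: "(LINT x|lborel. F x * ef n x) = 0" for n
   using Per_constant_iff[where F = F and L = L and c = 0] cF Fz by simp
  show "\<gamma> l = 0"
  proof (rule stable[of \<gamma> \<xi>, OF _ l])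
   fix k :: int
   have int: "integrable lborel (\<lambda>x. g l x * wave (\<xi> + 2 * pi * of_int k) x)" if "l < r" for l
    by (rule integrable_compact_support[of _ L]) (use cont gz that in \<open>auto intro!: continuous_intros\<close>)
   have "(\<Sum>l<r. \<gamma> l * (LINT x|lborel. g l x * wave (\<xi> + 2 * pi * of_int k) x)) =
    (LINT x|lborel. (\<Sum>l<r. \<gamma> l * (g l x * wave (\<xi> + 2 * pi * of_int k) x)))"
    by (subst Bochner_Integration.integral_sum) (use int in auto)
   also have "... = (LINT x|lborel. F x * ef (- k) x)"
    unfolding F_def ef_def sum_distrib_right
    by (intro Bochner_Integration.integral_cong sum.cong refl) (simp add: algebra_simps flip: exp_add)
   finally show "(\<Sum>l<r. \<gamma> l * (LINT x|lborel. g l x * wave (\<xi> + 2 * pi * of_int k) x)) = 0"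
    using F0 by simp
  qed
 qed
qed

end

section \<open>Hermite subdivision\<close>

lemma zsum_swap:
 assumes "finite S" "finite S'" and "!!k k'. F k k' ~= 0 ==> k \<in> S \<and> k' \<in> S'"
 shows "zsum (\<lambda>k. zsum (\<lambda>k'. F k k')) = zsum (\<lambda>k'. zsum (\<lambda>k. F k k'))"
proof -
 have 1: "zsum (\<lambda>k'. F k k') = (\<Sum>k'\<in>S'. F k k')" for k by (rule zsum_eq) (use assms in blast)+
 have 2: "zsum (\<lambda>k. F k k') = (\<Sum>k\<in>S. F k k')" for k' by (rule zsum_eq) (use assms in blast)+
 have "zsum (\<lambda>k. \<Sum>k'\<in>S'. F k k') = (\<Sum>k\<in>S. \<Sum>k'\<in>S'. F k k')"
  by (rule zsum_eq[OF assms(1)]) (use assms(3) in \<open>blast intro: sum.neutral\<close>)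
 moreover have "zsum (\<lambda>k'. \<Sum>k\<in>S. F k k') = (\<Sum>k'\<in>S'. \<Sum>k\<in>S. F k k')"
  by (rule zsum_eq[OF assms(2)]) (use assms(3) in \<open>blast intro: sum.neutral\<close>)
 ultimately show ?thesis unfolding 1 2 by (simp add: sum.swap[of _ S'])
qed

context mask
begin

text \<open>The recursion of \<open>C\<close> splits off the factor of the symbol product that acts
  first on \<open>u\<close>; this one splits off the most dilated factor, at frequency 2^n xi. It is
  the form matching subdivision and the refinement equation.\<close>

lemma C_Suc_outer: "l < r ==> C (Suc n) u i l = (\<Sum>k\<in>{-N..N}. \<Sum>j<r. a k l j * C n u (i - 2 ^ n * k) j)"
proof (induction n arbitrary: u i)
 case 0
 then show ?case by (simp add: T_def minus_mod_eq_div_mult[symmetric])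
next
 case (Suc n)
 have "i - 2 ^ Suc n * k = i + (- (2 ^ n * k)) * 2" for k by simp
 then have "(i - 2 ^ Suc n * k) mod 2 = i mod 2" "(i - 2 ^ Suc n * k) div 2 = i div 2 - 2 ^ n * k" for k
  by (simp_all only: mod_mult_self1 div_mult_self1 zero_neq_numeral[symmetric] not_False_eq_True)
 then show ?case using Suc.IH[OF Suc.prems, of "T (i mod 2) u" "i div 2"] by simp
qed

definition Sub :: "(int => nat => complex) => int => nat => complex" where
 "Sub w j q = 2 * zsum (\<lambda>k. \<Sum>l<r. w k l * a (j - 2 * k) l q)"

lemma C_window:
 assumes "supp_in L u" "N \<le> L" "l < r" "C n u (j - 2 ^ n * k) l ~= 0"
 shows "k \<in> {j div 2 ^ n - L..j div 2 ^ n + L}"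
proof -
 have "(j - 2 ^ n * k) div 2 ^ n = j div 2 ^ n - k"
  using div_mult_self1[of "2 ^ n :: int" j "- k"] by (simp add: mult.commute)
 then have "\<not> L < \<bar>j div 2 ^ n - k\<bar>" using supp_in_C[OF assms(1,2) _ assms(3)] assms(4) by metis
 then show ?thesis by auto
qed

text \<open>\<open>C n (delta 0 q)\<close> is column q of the iterated mask a_n, so this is the
  usual formula for n subdivision steps. The data \<open>w\<close> may have infinite support; the
  sums are finite because a_n is finitely supported.\<close>

lemma Sub_iterate:
 assumes "q < r"
 shows "(Sub ^^ n) w j q = 2 ^ n * zsum (\<lambda>k. \<Sum>l<r. w k l * C n (delta 0 q) (j - 2 ^ n * k) l)"
proof (induction n arbitrary: w)
 case 0
 have "(\<Sum>l<r. w k l * delta 0 q (j - k) l) = (if k = j then w j q else 0)" for k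
 proof -
  have "(\<Sum>l<r. w k l * delta 0 q (j - k) l) = (\<Sum>l<r. if l = q then (if k = j then w j q else 0) else 0)"
   by (intro sum.cong refl) (simp add: delta_def)
  then show ?thesis using assms by (simp add: sum.delta)
 qed
 then have "zsum (\<lambda>k. \<Sum>l<r. w k l * delta 0 q (j - k) l) = zsum (\<lambda>k. if k = j then w j q else 0)" by simp
 also have "... = (\<Sum>k\<in>{j}. if k = j then w j q else 0)" by (rule zsum_eq) auto
 finally show ?case by simp
next
 case (Suc n)
 define u where "u = delta 0 q"
 have u: "supp_in N u" using N by (auto simp: supp_in_def u_def delta_def)
 define F where "F k k' = (\<Sum>l'<r. C n u (j - 2 ^ n * k) l' * (\<Sum>l<r. w k' l * a (k - 2 * k') l l'))" for k k'
 define J where "J = j div 2 ^ n"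
 have a_fin: "finite {k'. f ~= 0 \<and> (\<Sum>l<r. w k' l * a (k - 2 * k') l l') ~= 0}" for k l' and f :: complex
 proof (rule finite_subset[of _ "{-(\<bar>k\<bar> + N)..\<bar>k\<bar> + N}"])
  have "a (k - 2 * k') l l' = 0" if "k' \<notin> {-(\<bar>k\<bar> + N)..\<bar>k\<bar> + N}" for k' l
   by (rule a_supp) (use that N in auto)
  then show "{k'. f ~= 0 \<and> (\<Sum>l<r. w k' l * a (k - 2 * k') l l') ~= 0} \<subseteq> {-(\<bar>k\<bar> + N)..\<bar>k\<bar> + N}"
   by (auto intro: ccontr)
 qed simp
 have "(Sub ^^ Suc n) w j q = (Sub ^^ n) (Sub w) j q" by (simp add: funpow_swap1)
 also have "... = 2 ^ n * zsum (\<lambda>k. \<Sum>l'<r. Sub w k l' * C n u (j - 2 ^ n * k) l')" by (simp add: Suc.IH u_def)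
 also have "... = 2 ^ n * zsum (\<lambda>k. 2 * zsum (\<lambda>k'. F k k'))"
 proof -
  have "(\<Sum>l'<r. Sub w k l' * C n u (j - 2 ^ n * k) l') = 2 * zsum (\<lambda>k'. F k k')" for k
  proof -
   have "Sub w k l' * C n u (j - 2 ^ n * k) l' = 2 * zsum (\<lambda>k'. C n u (j - 2 ^ n * k) l' * (\<Sum>l<r. w k' l * a (k - 2 * k') l l'))" for l'
    by (simp add: Sub_def zsum_cmult)
   then have "(\<Sum>l'<r. Sub w k l' * C n u (j - 2 ^ n * k) l') = 2 * (\<Sum>l'<r. zsum (\<lambda>k'. C n u (j - 2 ^ n * k) l' * (\<Sum>l<r. w k' l * a (k - 2 * k') l l')))"
    by (simp add: sum_distrib_left)
   also have "... = 2 * zsum (\<lambda>k'. F k k')"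
    unfolding F_def by (subst zsum_sum[symmetric]) (use a_fin in simp_all)
   finally show ?thesis .
  qed
  then show ?thesis by simp
 qed
 also have "... = 2 ^ Suc n * zsum (\<lambda>k. zsum (\<lambda>k'. F k k'))" by (simp add: zsum_cmult)
 also have "zsum (\<lambda>k. zsum (\<lambda>k'. F k k')) = zsum (\<lambda>k'. zsum (\<lambda>k. F k k'))"
 proof (rule zsum_swap[of "{J - N..J + N}" "{-(\<bar>J\<bar> + 2 * N)..\<bar>J\<bar> + 2 * N}"])
  fix k k' assume "F k k' ~= 0"
  then obtain l' where l': "l' < r" "C n u (j - 2 ^ n * k) l' * (\<Sum>l<r. w k' l * a (k - 2 * k') l l') ~= 0"
   unfolding F_def by (metis (no_types, lifting) lessThan_iff sum.neutral)
  then obtain l where "w k' l * a (k - 2 * k') l l' ~= 0"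
   by (metis (no_types, lifting) mult_eq_0_iff sum.neutral)
  then have "\<not> N < \<bar>k - 2 * k'\<bar>" using a_supp by auto
  moreover have "k \<in> {J - N..J + N}" unfolding J_def by (rule C_window[OF u order_refl l'(1)]) (use l'(2) in auto)
  ultimately show "k \<in> {J - N..J + N} \<and> k' \<in> {-(\<bar>J\<bar> + 2 * N)..\<bar>J\<bar> + 2 * N}" by auto
 qed simp_all
 also have "zsum (\<lambda>k'. zsum (\<lambda>k. F k k')) = zsum (\<lambda>k'. \<Sum>l<r. w k' l * C (Suc n) u (j - 2 ^ Suc n * k') l)"
 proof -
  have "zsum (\<lambda>k. F k k') = (\<Sum>l<r. w k' l * C (Suc n) u (j - 2 ^ Suc n * k') l)" for k'
  proof -
   have "zsum (\<lambda>k. F k k') = zsum (\<lambda>k. F (k + 2 * k') k')" using zsum_shift[of "\<lambda>k. F k k'" "2 * k'"] by simp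
   also have "... = (\<Sum>k\<in>{-N..N}. F (k + 2 * k') k')"
   proof (rule zsum_eq)
    fix k assume "k \<notin> {-N..N}"
    then have "a k l l' = 0" for l l' using a_supp[of k] by auto
    then show "F (k + 2 * k') k' = 0" by (simp add: F_def)
   qed simp
   also have "... = (\<Sum>k\<in>{-N..N}. \<Sum>l<r. w k' l * (\<Sum>l'<r. a k l l' * C n u ((j - 2 ^ Suc n * k') - 2 ^ n * k) l'))"
   proof (rule sum.cong[OF refl])
    fix k
    have "j - 2 ^ n * (k + 2 * k') = (j - 2 ^ Suc n * k') - 2 ^ n * k" by (simp add: algebra_simps)
    then have "F (k + 2 * k') k' = (\<Sum>l'<r. \<Sum>l<r. w k' l * (a k l l' * C n u ((j - 2 ^ Suc n * k') - 2 ^ n * k) l'))"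
     unfolding F_def by (simp only: sum_distrib_left add_diff_cancel_right') (simp only: mult_ac)
    then show "F (k + 2 * k') k' = (\<Sum>l<r. w k' l * (\<Sum>l'<r. a k l l' * C n u ((j - 2 ^ Suc n * k') - 2 ^ n * k) l'))"
     by (subst (asm) sum.swap) (simp only: sum_distrib_left)
   qed
   also have "... = (\<Sum>l<r. w k' l * (\<Sum>k\<in>{-N..N}. \<Sum>l'<r. a k l l' * C n u ((j - 2 ^ Suc n * k') - 2 ^ n * k) l'))"
    by (subst sum.swap) (simp only: sum_distrib_left)
   also have "... = (\<Sum>l<r. w k' l * C (Suc n) u (j - 2 ^ Suc n * k') l)"
    by (intro sum.cong refl) (simp only: C_Suc_outer lessThan_iff)
   finally show ?thesis .
  qed
  then show ?thesis by simp
 qed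
 finally show ?case by (simp add: u_def)
qed

lemma Sub_iterate_delta:
 assumes "q < r" "l < r"
 shows "(Sub ^^ n) (delta 0 l) j q = 2 ^ n * C n (delta 0 q) j l"
proof -
 have "(\<Sum>l'<r. delta 0 l k l' * C n (delta 0 q) (j - 2 ^ n * k) l') = (if k = 0 then C n (delta 0 q) j l else 0)" for k
 proof -
  have "(\<Sum>l'<r. delta 0 l k l' * C n (delta 0 q) (j - 2 ^ n * k) l') = (\<Sum>l'<r. if l' = l then (if k = 0 then C n (delta 0 q) j l else 0) else 0)"
   by (intro sum.cong refl) (simp add: delta_def)
  then show ?thesis using assms by (simp add: sum.delta)
 qed
 then have "zsum (\<lambda>k. \<Sum>l'<r. delta 0 l k l' * C n (delta 0 q) (j - 2 ^ n * k) l') = zsum (\<lambda>k. if k = 0 then C n (delta 0 q) j l else 0)"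
  by simp
 also have "... = (\<Sum>k\<in>{0 :: int}. if k = 0 then C n (delta 0 q) j l else 0)" by (rule zsum_eq) auto
 also have "... = C n (delta 0 q) j l" by simp
 finally show ?thesis by (simp add: Sub_iterate[OF assms(1)])
qed

lemma C_delta_expansion:
 assumes "supp_in L u" "l < r"
 shows "C n u j l = (\<Sum>k\<in>{-L..L}. \<Sum>q<r. C n (delta 0 q) (j - k) l * u k q)"
proof -
 let ?X = "{-L..L} \<times> {..<r}"
 have "C n u j l = C n (\<lambda>k l. \<Sum>x\<in>?X. u (fst x) (snd x) * delta (fst x) (snd x) k l) j l"
  by (rule C_cong[OF _ assms(2)]) (simp only: delta_expansion[OF assms(1)])
 also have "... = (\<Sum>x\<in>?X. u (fst x) (snd x) * C n (delta (fst x) (snd x)) j l)" by (simp only: C_sum)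
 also have "... = (\<Sum>x\<in>?X. C n (delta 0 (snd x)) (j - fst x) l * u (fst x) (snd x))"
 proof (intro sum.cong refl)
  fix x
  have "delta (fst x) (snd x) = (\<lambda>k. delta 0 (snd x) (k - fst x))" by (auto simp: delta_def fun_eq_iff)
  then show "u (fst x) (snd x) * C n (delta (fst x) (snd x)) j l = C n (delta 0 (snd x)) (j - fst x) l * u (fst x) (snd x)"
   by (simp add: C_shift mult.commute)
 qed
 finally show ?thesis by (simp add: sum_pairs)
qed

end

text \<open>Near each point only finitely many terms are nonzero. This covers limit functions of
  Hermite data that neither decay nor stay bounded.\<close>

lemma C_k_locally_finite:
 assumes G: "!!k :: int. C_k m (G k)" and supp: "!!k x. L + \<bar>x\<bar> < \<bar>of_int k\<bar> ==> G k x = 0"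
 shows "C_k m (\<lambda>x. zsum (\<lambda>k. G k x))"
  and "j \<le> m ==> nderiv j (\<lambda>x. zsum (\<lambda>k. G k x)) = (\<lambda>x. zsum (\<lambda>k. nderiv j (G k) x))"
proof -
 define F where "F j x = zsum (\<lambda>k. nderiv j (G k) x)" for j x
 have nz: "nderiv j (G k) x = 0" if j: "j \<le> m" and x: "L + \<bar>x\<bar> < \<bar>of_int k\<bar>" for j k x
  using j x
 proof (induction j arbitrary: x)
  case (Suc j)
  have op: "open {x. L + \<bar>x\<bar> < \<bar>of_int k\<bar>}" by (rule open_Collect_less) (intro continuous_intros)+
  have "((\<lambda>_. 0 :: complex) has_vector_derivative 0) (at x)" by (rule has_vector_derivative_const)
  then have "(nderiv j (G k) has_vector_derivative 0) (at x)"
   by (rule has_vector_derivative_transform_within_open[OF _ op]) (use Suc in auto)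
  then show ?case unfolding nderiv_Suc by (rule vector_derivative_at)
 qed (simp add: supp)
 define K where "K B = \<lceil>\<bar>L\<bar> + B\<rceil>" for B
 have K: "F j x = (\<Sum>k\<in>{-K B..K B}. nderiv j (G k) x)" if "j \<le> m" "\<bar>x\<bar> < B" for j x B
  unfolding F_def
 proof (rule zsum_eq)
  fix k assume "k \<notin> {-K B..K B}"
  then have "K B + 1 \<le> \<bar>k\<bar>" by auto
  then have "of_int (K B) + 1 \<le> (\<bar>of_int k\<bar> :: real)" by (metis of_int_1 of_int_abs of_int_add of_int_le_iff)
  then show "nderiv j (G k) x = 0" using that unfolding K_def by (intro nz) linarith+
 qed simp
 have op: "open {x :: real. \<bar>x\<bar> < B}" for B by (rule open_Collect_less) (intro continuous_intros)+
 have d: "(F j has_vector_derivative F (Suc j) x) (at x)" if j: "j < m" for j x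
 proof (rule has_vector_derivative_transform_within_open[OF _ op[of "\<bar>x\<bar> + 1"]])
  have "((\<lambda>x. \<Sum>k\<in>{-K (\<bar>t\<bar> + 1)..K (\<bar>t\<bar> + 1)}. nderiv j (G k) x) has_vector_derivative (\<Sum>k\<in>{-K (\<bar>t\<bar> + 1)..K (\<bar>t\<bar> + 1)}. nderiv (Suc j) (G k) x)) (at x)" for t :: real
   by (intro has_vector_derivative_sum C_k_has_vector_derivative[OF G j])
  from this[of x]
  show "((\<lambda>y. \<Sum>k\<in>{-K (\<bar>x\<bar> + 1)..K (\<bar>x\<bar> + 1)}. nderiv j (G k) y) has_vector_derivative F (Suc j) x) (at x)"
   using K[of "Suc j" x "\<bar>x\<bar> + 1"] j by simp
 qed (use K[of j _ "\<bar>x\<bar> + 1"] j in auto)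
 have "continuous_on UNIV (F m)"
 proof (rule continuous_at_imp_continuous_on, rule ballI)
  fix x
  have "continuous_on {y. \<bar>y\<bar> < \<bar>x\<bar> + 1} (F m)"
  proof (rule continuous_on_eq)
   show "continuous_on {y. \<bar>y\<bar> < \<bar>x\<bar> + 1} (\<lambda>y. \<Sum>k\<in>{-K (\<bar>x\<bar> + 1)..K (\<bar>x\<bar> + 1)}. nderiv m (G k) y)"
    by (intro continuous_on_sum continuous_on_subset[OF C_k_continuous_nderiv[OF G order_refl]]) auto
  qed (use K[of m _ "\<bar>x\<bar> + 1"] in auto)
  then show "isCont (F m) x" by (rule continuous_on_interior) (simp add: interior_open[OF op])
 qed
 from C_k_chain[of m F, OF d this] nderiv_chain[of m F j, OF d]
 show "C_k m (\<lambda>x. zsum (\<lambda>k. G k x))" "j \<le> m ==> nderiv j (\<lambda>x. zsum (\<lambda>k. G k x)) = (\<lambda>x. zsum (\<lambda>k. nderiv j (G k) x))"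
  by (simp_all add: F_def[abs_def])
qed

text \<open>Component q of the filter behaves like (i xi)^q at the origin: its moments below order q
  vanish and the q-th is i^q q! / (-i)^q = (-1)^q q!. The bound \<open>order\<close> guarantees that
  every derivative read off by the scheme has order at most \<open>m\<close>.\<close>

locale hermite_mask = sum_rule_mask +
 assumes order: "r \<le> m + 1"
  and hermite: "!!p q. q < r ==> p \<le> q ==> (\<Sum>j\<in>{-N..N}. v j q * of_int j ^ p) = (if p = q then (-1) ^ q * fact q else 0)"
begin

text \<open>The p-th moment of the samples of \<open>g\<close> at offset x is (-x)^p. Its q-th
  derivative at x = 0 is, for p <= q, exactly the p-th moment of component q of the filter, which is
  what the delta contributes.\<close>

lemma V_delta_minus_Phi:
 assumes g: "csupp L g" "!!l. l < r ==> C_k m (g l)" "!!l x. l < r ==> g l x = R g l x"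
  and M0: "M 0 0 (Phi g 0) = 1" and q: "q < r"
 shows "V (Suc q) (\<lambda>k l. 1 * delta 0 q k l + (-1) * Phi (\<lambda>l. nderiv q (g l)) 0 k l)"
 unfolding V_def
proof (intro conjI allI impI)
 have qm: "q \<le> m" using q order by simp
 have fs: "fsupp (Phi (\<lambda>l. nderiv q (g l)) 0)" by (rule fsupp_Phi[OF csupp_nderiv[OF g(1,2) qm]])
 show "fsupp (\<lambda>k l. 1 * delta 0 q k l + (-1) * Phi (\<lambda>l. nderiv q (g l)) 0 k l)"
  by (rule fsupp_lincomb[OF fsupp_delta fs])
 fix p assume p: "p < Suc q"
 have cont: "continuous_on UNIV (g l)" if "l < r" for l by (rule C_k_continuous[OF g(2)[OF that]])
 have "M p 0 (Phi g x) = (- of_real x) ^ p" for x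
 proof -
  have "M p 0 (Phi g x) = (\<Sum>s\<le>p. of_nat (p choose s) * (- of_real x) ^ (p - s) * (if s = 0 then 1 else 0))"
   by (rule M_0_Phi[OF g(1)]) (use refinable_admissible[OF g(1) cont g(3) M0] p qm in auto)
  also have "... = (\<Sum>s\<le>p. if s = 0 then (- of_real x) ^ p else 0)" by (intro sum.cong) auto
  finally show ?thesis by (simp add: sum.delta)
 qed
 then have "M p 0 (Phi (\<lambda>l. nderiv q (g l)) 0) = nderiv q (\<lambda>x. poly (monom ((-1) ^ p) p) (of_real x)) 0"
  using nderiv_M_Phi[OF g(1,2) qm, of p 0] by (simp add: poly_monom power_minus[of "of_real _"])
 also have "... = (if p = q then (-1) ^ q * fact q else 0)"
 proof (cases "p = q")
  case True
  then show ?thesis by (simp add: nderiv_poly pderiv_iter_monom)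
 next
  case False
  then have "(pderiv ^^ q) (monom ((-1) ^ p) p :: complex poly) = 0"
   using p degree_monom_le[of "(-1 :: complex) ^ p" p] by (intro pderiv_iter_degree) linarith
  then show ?thesis using False by (simp add: nderiv_poly)
 qed
 also have "... = M p 0 (delta 0 q)"
 proof -
  have "zsum (\<lambda>k. (of_int j + of_int k + 0) ^ p * delta 0 q k l) = (if l = q then of_int j ^ p else 0)" for j l
  proof -
   have "zsum (\<lambda>k. (of_int j + of_int k + 0) ^ p * delta 0 q k l) = (\<Sum>k\<in>{0}. (of_int j + of_int k + 0) ^ p * delta 0 q k l)"
    by (rule zsum_eq) (auto simp: delta_def)
   then show ?thesis by (simp add: delta_def)
  qed
  then have "M p 0 (delta 0 q) = (\<Sum>j\<in>{-N..N}. \<Sum>l<r. if l = q then v j q * of_int j ^ p else 0)"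
   unfolding M_def by (intro sum.cong refl) auto
  then show ?thesis using hermite[OF q, of p] p q by (simp add: sum.delta)
 qed
 finally show "M p 0 (\<lambda>k l. 1 * delta 0 q k l + (-1) * Phi (\<lambda>l. nderiv q (g l)) 0 k l) = 0"
  unfolding M_lincomb[OF fsupp_delta fs] by simp
qed

text \<open>The limit is the sum of w(k) g(x - k). Component q of the error is 2^(nq) 2^n times
  \<open>C n\<close> of a sequence with q + 1 vanishing moments, whose rate below 2^(-q-1) beats
  both factors.\<close>

lemma decays_imp_hermite_convergence:
 assumes dec: "decays (Suc m)"
 shows "\<exists>\<eta>. C_k m \<eta> \<and> (\<forall>q<r. \<forall>K>0. \<forall>\<epsilon>>0. \<forall>\<^sub>F n in sequentially. \<forall>j. \<bar>of_int j\<bar> \<le> 2 ^ n * (K :: real) -->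
  cmod (2 ^ (n * q) * (Sub ^^ n) w j q - nderiv q \<eta> (of_int j / 2 ^ n)) \<le> \<epsilon>)"
proof -
 obtain f L where f: "!!l n. C_k n (f l)" "csupp L f" "admissible f" using admissible_exists by blast
 define L' where "L' = max L (of_int N)"
 have L': "csupp L' f" "of_int N \<le> L'" using csupp_mono[OF f(2)] by (auto simp: L'_def)
 obtain g K \<theta> where g: "!!l. l < r ==> C_k m (g l)" "csupp L' g" "!!l x. l < r ==> g l x = R g l x"
  and M0: "!!x. M 0 0 (Phi g x) = 1"
  using cascade_limit[OF dec f(1) L'(1) f(3) L'(2)] by metis
 define G where "G k x = (\<Sum>l<r. w k l * g l (1 * x + - of_int k))" for k x
 have CG: "C_k m (G k)" for k
  unfolding G_def[abs_def] by (rule C_k_affine_sum) (use g(1) in auto)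
 have nG: "nderiv q (G k) x = (\<Sum>l<r. w k l * nderiv q (g l) (x - of_int k))" if "q \<le> m" for q k x
  unfolding G_def[abs_def] by (subst nderiv_affine_sum[OF _ that]) (use g(1) in auto)
 have G0: "G k x = 0" if "L' + \<bar>x\<bar> < \<bar>of_int k\<bar>" for k x
 proof -
  have "L' < \<bar>1 * x + - of_int k\<bar>" using that by linarith
  then show ?thesis unfolding G_def using g(2) by (intro sum.neutral) (auto simp: csupp_def)
 qed
 define \<eta> where "\<eta> x = zsum (\<lambda>k. G k x)" for x
 have C\<eta>: "C_k m \<eta>" unfolding \<eta>_def[abs_def] by (rule C_k_locally_finite(1)[OF CG G0])
 have n\<eta>: "nderiv q \<eta> x = zsum (\<lambda>k. \<Sum>l<r. w k l * nderiv q (g l) (x - of_int k))" if "q \<le> m" for q x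
 proof -
  have "nderiv q \<eta> = (\<lambda>x. zsum (\<lambda>k. nderiv q (G k) x))"
   unfolding \<eta>_def[abs_def] by (rule C_k_locally_finite(2)[OF CG G0 that])
  then show ?thesis by (simp add: nG[OF that])
 qed
 have gR: "(R ^^ n) g l = g l" if "l < r" for n l
  using that
 proof (induction n arbitrary: l)
  case (Suc n)
  have "(R ^^ Suc n) g l = R ((R ^^ n) g) l" by simp
  also have "R ((R ^^ n) g) = R g" by (rule R_cong) (simp add: Suc.IH)
  also have "R g l = g l" using g(3)[OF Suc.prems] by (simp add: fun_eq_iff)
  finally show ?case .
 qed simp
 have "\<forall>\<^sub>F n in sequentially. \<forall>j. \<bar>of_int j\<bar> \<le> 2 ^ n * K --> cmod (2 ^ (n * q) * (Sub ^^ n) w j q - nderiv q \<eta> (of_int j / 2 ^ n)) \<le> \<epsilon>"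
  if q: "q < r" and K: "0 < K" and \<epsilon>: "0 < \<epsilon>" for q and K \<epsilon> :: real
 proof -
  have qm: "q \<le> m" using q order by simp
  define P where "P = Phi (\<lambda>l. nderiv q (g l)) 0"
  define u where "u = (\<lambda>k l. 1 * delta 0 q k l + (-1) * P k l)"
  have Vu: "V (Suc q) u" unfolding u_def P_def by (rule V_delta_minus_Phi[OF g(2,1,3) M0 q])
  have "decays (Suc q)" by (rule decays_antimono[OF dec]) (use qm in auto)
  then obtain \<rho> c where \<rho>: "0 \<le> \<rho>" "\<rho> < (1 / 2) ^ Suc q" and c: "!!n. bounded_by (c * \<rho> ^ n) (C n u)"
   unfolding decays_def decays_at_def using Vu by metis
  obtain W where W: "N \<le> W" "supp_in W P"
   using fsupp_large[OF fsupp_Phi[OF csupp_nderiv[OF g(2,1) qm]], of N] unfolding P_def by metis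
  have Wd: "supp_in W (delta 0 q)" using W(1) N by (auto simp: supp_in_def delta_def)
  have W0: "0 \<le> W" using W(1) N by simp
  \<comment> \<open>Positions j with |j| <= 2^n K see only data with index in [-H, H]: 1 allows for
    rounding j / 2^n down and \<open>W\<close> for the window. The data are bounded there, though
    not in general.\<close>
  define H where "H = \<lceil>K\<rceil> + 1 + W"
  define b where "b = (\<Sum>k\<in>{-H..H}. \<Sum>l<r. cmod (w k l))"
  have b0: "0 \<le> b" unfolding b_def by (intro sum_nonneg) auto
  have b: "cmod (w k l) \<le> b" if "k \<in> {-H..H}" "l < r" for k l
  proof -
   have "cmod (w k l) \<le> (\<Sum>l<r. cmod (w k l))" by (rule member_le_sum) (use that in auto)
   also have "... \<le> b" unfolding b_def by (rule member_le_sum[where f = "\<lambda>k. \<Sum>l<r. cmod (w k l)"]) (use that in \<open>auto intro: sum_nonneg\<close>)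
   finally show ?thesis .
  qed
  define B where "B = of_int (2 * W + 1) * (real r * (b * c))"
  have c0: "0 \<le> c"
   using c[of 0] r norm_ge_zero order_trans unfolding bounded_by_def by (metis mult.right_neutral power_0)
  have err: "cmod (2 ^ (n * q) * (Sub ^^ n) w j q - nderiv q \<eta> (of_int j / 2 ^ n)) \<le> B * (2 ^ Suc q * \<rho>) ^ n"
   if j: "\<bar>of_int j\<bar> \<le> 2 ^ n * K" for n j
  proof -
   define J where "J = j div 2 ^ n"
   define S where "S = {J - W..J + W}"
   have Jb: "\<bar>of_int J\<bar> \<le> K + 1"
   proof -
    have "J = \<lfloor>of_int j / (2 :: real) ^ n\<rfloor>" unfolding J_def using floor_divide_of_int_eq[of j "2 ^ n", where 'a = real] by simp
    moreover have "\<bar>of_int j / (2 :: real) ^ n\<bar> \<le> K" using j by (simp add: field_simps)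
    ultimately show ?thesis by linarith
   qed
   have SH: "k \<in> {-H..H}" if "k \<in> S" for k
    using that Jb unfolding S_def H_def atLeastAtMost_iff by linarith
   have gP: "nderiv q (g l) (of_int j / 2 ^ n - of_int k) = 2 ^ (n * q) * 2 ^ n * C n P (j - 2 ^ n * k) l" if "l < r" for k l
   proof -
    have "nderiv q (g l) = nderiv q ((R ^^ n) g l)" by (simp add: gR[OF that])
    also have "... = (\<lambda>x. 2 ^ (n * q) * (R ^^ n) (\<lambda>l. nderiv q (g l)) l x)" by (rule nderiv_R_iterate[OF g(1) that qm])
    finally have "nderiv q (g l) (of_int j / 2 ^ n - of_int k) = 2 ^ (n * q) * (R ^^ n) (\<lambda>l. nderiv q (g l)) l ((0 + of_int (j - 2 ^ n * k)) / 2 ^ n)"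
     by (simp add: field_simps)
    then show ?thesis unfolding R_iterate P_def by (simp only: mult.assoc)
   qed
   have z1: "zsum (\<lambda>k. \<Sum>l<r. w k l * C n u' (j - 2 ^ n * k) l) = (\<Sum>k\<in>S. \<Sum>l<r. w k l * C n u' (j - 2 ^ n * k) l)" if "supp_in W u'" for u'
    by (rule zsum_eq) (use C_window[OF that W(1)] in \<open>auto simp: S_def J_def intro!: sum.neutral\<close>)
   have "nderiv q \<eta> (of_int j / 2 ^ n) = zsum (\<lambda>k. 2 ^ (n * q) * 2 ^ n * (\<Sum>l<r. w k l * C n P (j - 2 ^ n * k) l))"
    unfolding n\<eta>[OF qm] sum_distrib_left by (intro arg_cong[where f = zsum] ext sum.cong refl) (simp add: gP)
   also have "... = 2 ^ (n * q) * 2 ^ n * (\<Sum>k\<in>S. \<Sum>l<r. w k l * C n P (j - 2 ^ n * k) l)"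
    by (simp only: zsum_cmult z1[OF W(2)])
   finally have "2 ^ (n * q) * (Sub ^^ n) w j q - nderiv q \<eta> (of_int j / 2 ^ n) =
    2 ^ (n * q) * 2 ^ n * ((\<Sum>k\<in>S. \<Sum>l<r. w k l * C n (delta 0 q) (j - 2 ^ n * k) l) - (\<Sum>k\<in>S. \<Sum>l<r. w k l * C n P (j - 2 ^ n * k) l))"
    unfolding Sub_iterate[OF q] z1[OF Wd] by (simp add: algebra_simps)
   also have "... = 2 ^ (n * q) * 2 ^ n * (\<Sum>k\<in>S. \<Sum>l<r. w k l * C n u (j - 2 ^ n * k) l)"
    unfolding u_def C_lincomb by (simp add: sum_subtractf[symmetric] right_diff_distrib)
   finally have "cmod (2 ^ (n * q) * (Sub ^^ n) w j q - nderiv q \<eta> (of_int j / 2 ^ n)) = 2 ^ (n * q) * 2 ^ n * cmod (\<Sum>k\<in>S. \<Sum>l<r. w k l * C n u (j - 2 ^ n * k) l)"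
    by (simp add: norm_mult norm_power)
   also have "... \<le> 2 ^ (n * q) * 2 ^ n * (\<Sum>k\<in>S. \<Sum>l<r. b * (c * \<rho> ^ n))"
   proof (intro mult_left_mono order_trans[OF norm_sum] sum_mono)
    fix k l assume "k \<in> S" "l \<in> {..<r}"
    then show "cmod (w k l * C n u (j - 2 ^ n * k) l) \<le> b * (c * \<rho> ^ n)"
     unfolding norm_mult using b[OF SH] c[of n] b0 by (intro mult_mono) (auto simp: bounded_by_def)
   qed simp
   also have "... = 2 ^ (n * q) * 2 ^ n * (of_int (2 * W + 1) * (real r * (b * (c * \<rho> ^ n))))"
    using W0 by (simp add: S_def)
   also have "... = B * (2 ^ Suc q * \<rho>) ^ n"
    by (simp add: B_def power_mult_distrib power_mult[symmetric] mult.commute[of q] mult_ac)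
   finally show ?thesis .
  qed
  have "(2 ^ Suc q * \<rho>) < 2 ^ Suc q * (1 / 2) ^ Suc q" using \<rho>(2) by (intro mult_strict_left_mono) auto
  then have "2 ^ Suc q * \<rho> < 1" by (simp flip: power_mult_distrib del: power_Suc)
  then have "(\<lambda>n. B * (2 ^ Suc q * \<rho>) ^ n) \<longlonglongrightarrow> B * 0"
   using \<rho>(1) by (intro tendsto_mult tendsto_const LIMSEQ_power_zero) (simp add: abs_mult)
  then have "\<forall>\<^sub>F n in sequentially. B * (2 ^ Suc q * \<rho>) ^ n < \<epsilon>" by (rule order_tendstoD(2)) (use \<epsilon> in simp)
  then show ?thesis by (rule eventually_mono) (use err in fastforce)
 qed
 then show ?thesis using C\<eta> by blast
qed

end

section \<open>From a convergent Hermite scheme back to a refinable function\<close>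

context sum_rule_mask
begin

text \<open>Started from the l-th unit vector, the first entry of the scheme is 2^n times entry (l,
  0) of a_n. Thus the limits form the vector obtained from the first columns of the iterated masks,
  and the outer recursion passes to the refinement equation. Convergence of function values alone is
  used.\<close>

lemma hermite_convergence_imp_refinable:
 assumes conv: "!!l. l < r ==> \<exists>\<eta>. C_k m \<eta> \<and> (\<forall>K>0. \<forall>\<epsilon>>0. \<forall>\<^sub>F n in sequentially. \<forall>j. \<bar>of_int j\<bar> \<le> 2 ^ n * (K :: real) -->
   cmod ((Sub ^^ n) (delta 0 l) j 0 - \<eta> (of_int j / 2 ^ n)) \<le> \<epsilon>)"
 shows "\<exists>g L. csupp L g \<and> (\<forall>l<r. C_k m (g l)) \<and> (\<forall>l<r. \<forall>x. g l x = R g l x) \<and> M 0 0 (Phi g 0) = 1"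
proof -
 define Q where "Q l \<eta> \<longleftrightarrow> C_k m \<eta> \<and> (\<forall>K>0. \<forall>\<epsilon>>0. \<forall>\<^sub>F n in sequentially. \<forall>j. \<bar>of_int j\<bar> \<le> 2 ^ n * (K :: real) -->
   cmod ((Sub ^^ n) (delta 0 l) j 0 - \<eta> (of_int j / 2 ^ n)) \<le> \<epsilon>)" for l \<eta>
 have "\<exists>\<eta>. Q l \<eta>" if "l < r" for l unfolding Q_def by (rule conv[OF that])
 then have "\<forall>l. \<exists>\<eta>. l < r --> Q l \<eta>" by blast
 then obtain g where g: "\<forall>l. l < r --> Q l (g l)" by (rule exE[OF choice])
 note * = g[unfolded Q_def]
 have Cg: "C_k m (g l)" if "l < r" for l using *[rule_format, OF that] by (rule conjunct1)
 have cont: "continuous_on UNIV (g l)" if "l < r" for l by (rule C_k_continuous[OF Cg[OF that]])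
 define \<delta> where "\<delta> = delta 0 0"
 have \<delta>: "supp_in N \<delta>" using N by (auto simp: supp_in_def \<delta>_def delta_def)
 \<comment> \<open>Index 2^n i at level p + n is the fixed dyadic point i / 2^p seen at ever finer
   levels.\<close>
 have lim: "(\<lambda>n. 2 ^ (p + n) * C (p + n) \<delta> (2 ^ n * i) l) \<longlonglongrightarrow> g l (of_int i / 2 ^ p)" if l: "l < r" for i p l
 proof (rule LIMSEQ_I)
  fix e :: real assume e: "0 < e"
  have "\<forall>\<^sub>F n in sequentially. \<forall>j. \<bar>of_int j\<bar> \<le> 2 ^ n * (\<bar>of_int i\<bar> + 1 :: real) --> cmod ((Sub ^^ n) (delta 0 l) j 0 - g l (of_int j / 2 ^ n)) \<le> e / 2"
   using *[rule_format, OF l, THEN conjunct2, rule_format, of "\<bar>of_int i\<bar> + 1" "e / 2"] e by simp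
  then obtain n0 where n0: "!!n j. n0 \<le> n ==> \<bar>of_int j\<bar> \<le> 2 ^ n * (\<bar>of_int i\<bar> + 1 :: real) ==> cmod ((Sub ^^ n) (delta 0 l) j 0 - g l (of_int j / 2 ^ n)) \<le> e / 2"
   unfolding eventually_sequentially by blast
  have "norm (2 ^ (p + n) * C (p + n) \<delta> (2 ^ n * i) l - g l (of_int i / 2 ^ p)) < e" if n: "n0 \<le> n" for n
  proof -
   have "\<bar>of_int (2 ^ n * i)\<bar> \<le> (2 ^ (p + n) * (\<bar>of_int i\<bar> + 1) :: real)"
    by (simp add: abs_mult) (intro mult_mono, simp_all)
   from n0[OF _ this] n
   have "cmod ((Sub ^^ (p + n)) (delta 0 l) (2 ^ n * i) 0 - g l (of_int (2 ^ n * i) / 2 ^ (p + n))) \<le> e / 2" by simp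
   moreover have "of_int (2 ^ n * i) / 2 ^ (p + n) = (of_int i / 2 ^ p :: real)" by (simp add: power_add)
   ultimately show ?thesis using e Sub_iterate_delta[OF r l, of "p + n" "2 ^ n * i"] by (simp add: \<delta>_def)
  qed
  then show "\<exists>n0. \<forall>n\<ge>n0. norm (2 ^ (p + n) * C (p + n) \<delta> (2 ^ n * i) l - g l (of_int i / 2 ^ p)) < e" by blast
 qed
 have supp: "csupp (of_int N + 1) g"
  unfolding csupp_def
 proof (intro allI impI)
  fix l and x :: real assume l: "l < r" and x: "of_int N + 1 < \<bar>x\<bar>"
  \<comment> \<open>The cut-off factor is positive exactly outside the expected support. It makes
    the product vanish at every dyadic point, so density applies.\<close>
  have "g l x * of_real (max (\<bar>x\<bar> - (of_int N + 1)) 0) = 0"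
  proof (rule dyadic_dense_eq[of "\<lambda>x. g l x * of_real (max (\<bar>x\<bar> - (of_int N + 1)) 0)" "\<lambda>_. 0" x])
   show "continuous_on UNIV (\<lambda>x. g l x * of_real (max (\<bar>x\<bar> - (of_int N + 1)) 0))"
    by (intro continuous_intros cont[OF l])
   fix i :: int and p :: nat
   have "g l (of_int i / 2 ^ p) = 0" if big: "of_int N + 1 < \<bar>of_int i / (2 :: real) ^ p\<bar>"
   proof -
    have "i div 2 ^ p = \<lfloor>of_int i / (2 :: real) ^ p\<rfloor>" using floor_divide_of_int_eq[of i "2 ^ p", where 'a = real] by simp
    then have "N < \<bar>i div 2 ^ p\<bar>" using big by linarith
    moreover have "2 ^ n * i div 2 ^ (p + n) = i div 2 ^ p" for n by (simp add: power_add mult.commute[of "2 ^ p"])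
    ultimately have "C (p + n) \<delta> (2 ^ n * i) l = 0" for n
     by (intro supp_in_C[OF \<delta> order_refl _ l]) simp
    then show ?thesis using lim[OF l, of p i] by (simp add: LIMSEQ_const_iff)
   qed
   then show "g l (of_int i / 2 ^ p) * of_real (max (\<bar>of_int i / 2 ^ p\<bar> - (of_int N + 1)) 0) = 0"
    by (cases "of_int N + 1 < \<bar>of_int i / (2 :: real) ^ p\<bar>") auto
  qed simp
  moreover have "max (\<bar>x\<bar> - (of_int N + 1)) 0 ~= 0" using x by simp
  ultimately show "g l x = 0" by (metis mult_eq_0_iff of_real_eq_0_iff)
 qed
 have ref: "g l x = R g l x" if l: "l < r" for l x
 proof (rule dyadic_dense_eq[of "g l" "R g l" x])
  show "continuous_on UNIV (g l)" by (rule cont[OF l])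
  show "continuous_on UNIV (R g l)" by (rule C_k_continuous[OF C_k_R[OF Cg]])
  fix i :: int and p :: nat
  have "(\<lambda>n. 2 ^ (p + Suc n) * C (p + Suc n) \<delta> (2 ^ Suc n * i) l) \<longlonglongrightarrow> g l (of_int i / 2 ^ p)"
   using LIMSEQ_Suc[OF lim[OF l, of p i]] .
  moreover have "2 ^ (p + Suc n) * C (p + Suc n) \<delta> (2 ^ Suc n * i) l =
   2 * (\<Sum>k\<in>{-N..N}. \<Sum>j<r. a k l j * (2 ^ (p + n) * C (p + n) \<delta> (2 ^ n * (2 * i - 2 ^ p * k)) j))" for n
  proof -
   have "2 ^ Suc n * i - 2 ^ (p + n) * k = 2 ^ n * (2 * i - 2 ^ p * k)" for k by (simp add: algebra_simps power_add)
   then have "C (Suc (p + n)) \<delta> (2 ^ Suc n * i) l = (\<Sum>k\<in>{-N..N}. \<Sum>j<r. a k l j * C (p + n) \<delta> (2 ^ n * (2 * i - 2 ^ p * k)) j)"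
    by (simp only: C_Suc_outer[OF l])
   then show ?thesis by (simp add: sum_distrib_left mult_ac del: C.simps)
  qed
  moreover have "(\<lambda>n. 2 * (\<Sum>k\<in>{-N..N}. \<Sum>j<r. a k l j * (2 ^ (p + n) * C (p + n) \<delta> (2 ^ n * (2 * i - 2 ^ p * k)) j))) \<longlonglongrightarrow>
   2 * (\<Sum>k\<in>{-N..N}. \<Sum>j<r. a k l j * g j (of_int (2 * i - 2 ^ p * k) / 2 ^ p))"
   by (intro tendsto_mult tendsto_const tendsto_sum lim) auto
  ultimately have "g l (of_int i / 2 ^ p) = 2 * (\<Sum>k\<in>{-N..N}. \<Sum>j<r. a k l j * g j (of_int (2 * i - 2 ^ p * k) / 2 ^ p))"
   using LIMSEQ_unique by (simp only:) blast
  moreover have "of_int (2 * i - 2 ^ p * k) / 2 ^ p = 2 * (of_int i / 2 ^ p) - (of_int k :: real)" for k by (simp add: field_simps)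
  ultimately show "g l (of_int i / 2 ^ p) = R g l (of_int i / 2 ^ p)" by (simp only: R_def)
 qed
 have M0: "M 0 0 (Phi g 0) = 1"
 proof -
  \<comment> \<open>At multiples of 2^n the last n digits are 0. The 0-th moment is halved by each
    \<open>T 0\<close>, which the factor 2^n compensates.\<close>
  have iter: "C n u (2 ^ n * k) = ((T 0) ^^ n) u k" for n u k
   by (induction n arbitrary: u) (simp_all add: funpow_swap1 mult.assoc del: funpow.simps(2), simp_all add: funpow_swap1)
  have supp_iter: "supp_in N (((T 0) ^^ n) \<delta>)" for n by (induction n) (auto simp: \<delta> supp_in_T)
  have fs: "fsupp (((T 0) ^^ n) \<delta>)" for n unfolding fsupp_def using supp_iter by blast
  have M_iter: "M 0 0 (((T 0) ^^ n) \<delta>) = (1 / 2) ^ n * M 0 0 \<delta>" for n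
   by (induction n) (simp_all add: M_T[OF fs le0])
  have M_win: "M 0 0 u = (\<Sum>j\<in>{-N..N}. \<Sum>l<r. v j l * (\<Sum>k\<in>{-W..W}. u k l))" if "supp_in W u" for u W
  proof -
   have "zsum (\<lambda>k. (of_int j + of_int k + 0) ^ 0 * u k l) = (\<Sum>k\<in>{-W..W}. u k l)" if "l < r" for j l
    by (subst zsum_eq[of "{-W..W}"]) (use \<open>supp_in W u\<close> that in \<open>auto simp: supp_in_def\<close>)
   then show ?thesis unfolding M_def by (intro sum.cong refl) simp
  qed
  have "M 0 0 \<delta> = (\<Sum>j\<in>{-N..N}. \<Sum>l<r. if l = 0 then v j 0 else 0)"
   unfolding M_win[OF \<delta>]
  proof (intro sum.cong refl)
   fix j l
   have "(\<Sum>k\<in>{-N..N}. \<delta> k l) = (\<Sum>k\<in>{-N..N}. if k = 0 then (if l = 0 then 1 else 0) else 0)"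
    by (intro sum.cong refl) (simp add: \<delta>_def delta_def)
   then have "(\<Sum>k\<in>{-N..N}. \<delta> k l) = (if l = 0 then 1 else 0)" using N by (simp add: sum.delta)
   then show "v j l * (\<Sum>k\<in>{-N..N}. \<delta> k l) = (if l = 0 then v j 0 else 0)" by simp
  qed
  also have "... = 1" using r v_hat[OF r] by (simp add: sum.delta)
  finally have M\<delta>: "M 0 0 \<delta> = 1" .
  define W where "W = N + 1"
  have sW: "supp_in W (((T 0) ^^ n) \<delta>)" for n by (rule supp_in_mono[OF supp_iter]) (simp add: W_def)
  have sP: "supp_in W (Phi g 0)" by (rule supp_in_Phi[OF supp]) (simp add: W_def)
  have "(\<lambda>n. \<Sum>j\<in>{-N..N}. \<Sum>l<r. v j l * (\<Sum>k\<in>{-W..W}. 2 ^ (0 + n) * C (0 + n) \<delta> (2 ^ n * k) l)) \<longlonglongrightarrow>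
   (\<Sum>j\<in>{-N..N}. \<Sum>l<r. v j l * (\<Sum>k\<in>{-W..W}. g l (of_int k / 2 ^ 0)))"
   by (intro tendsto_sum tendsto_mult tendsto_const lim) auto
  moreover have "(\<Sum>j\<in>{-N..N}. \<Sum>l<r. v j l * (\<Sum>k\<in>{-W..W}. 2 ^ (0 + n) * C (0 + n) \<delta> (2 ^ n * k) l)) = 1" for n
  proof -
   have "(\<Sum>j\<in>{-N..N}. \<Sum>l<r. v j l * (\<Sum>k\<in>{-W..W}. 2 ^ (0 + n) * C (0 + n) \<delta> (2 ^ n * k) l)) = 2 ^ n * M 0 0 (((T 0) ^^ n) \<delta>)"
    unfolding M_win[OF sW] add_0 iter sum_distrib_left[symmetric]
    by (simp add: sum_distrib_left mult_ac)
   then show ?thesis by (simp add: M_iter M\<delta> power_one_over)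
  qed
  ultimately have "(\<Sum>j\<in>{-N..N}. \<Sum>l<r. v j l * (\<Sum>k\<in>{-W..W}. g l (of_int k / 2 ^ 0))) = 1"
   by (simp add: LIMSEQ_const_iff)
  then show ?thesis unfolding M_win[OF sP] by (simp add: Phi_def)
 qed
 show ?thesis using supp Cg ref M0 by blast
qed

end

section \<open>Matrix-valued sequences\<close>

context sum_rule_mask
begin

lemma continuous_mom:
 assumes "!!l. l < r ==> continuous_on UNIV (f l)"
 shows "continuous_on UNIV (mom p f)"
 unfolding mom_def[abs_def] by (intro continuous_intros assms) auto

lemma mom_outside: "csupp L f ==> L < \<bar>x\<bar> ==> mom p f x = 0"
 by (simp add: mom_def csupp_def)

lemma admissible_iff_fourier:
 assumes f: "csupp L f" "!!l. l < r ==> continuous_on UNIV (f l)"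
 shows "admissible f \<longleftrightarrow> (LINT x|lborel. mom 0 f x) = 1 \<and> (\<forall>p\<le>m. \<forall>n. n ~= 0 --> (LINT x|lborel. mom p f x * ef n x) = 0)"
proof -
 have const: "(\<forall>x. Per (mom p f) x = c) \<longleftrightarrow> (\<forall>n. (LINT x|lborel. mom p f x * ef n x) = (if n = 0 then c else 0))" for p c
  by (rule Per_constant_iff[OF continuous_mom[OF f(2)] mom_outside[OF f(1)]])
 note M = M_eq_Per[OF f(1)]
 show ?thesis
 proof
  assume "admissible f"
  then obtain h where h: "h 0 = 1" "!!p x. p \<le> m ==> Per (mom p f) x = h p" unfolding admissible_def M by blast
  have c: "(LINT x|lborel. mom p f x * ef n x) = (if n = 0 then h p else 0)" if "p \<le> m" for p n
   using const[where p = p and c = "h p"] h(2)[OF that] by blast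
  show "(LINT x|lborel. mom 0 f x) = 1 \<and> (\<forall>p\<le>m. \<forall>n. n ~= 0 --> (LINT x|lborel. mom p f x * ef n x) = 0)"
   using c c[of 0 0] h(1) by simp
 next
  assume z: "(LINT x|lborel. mom 0 f x) = 1 \<and> (\<forall>p\<le>m. \<forall>n. n ~= 0 --> (LINT x|lborel. mom p f x * ef n x) = 0)"
  have "\<forall>x. Per (mom p f) x = (LINT x|lborel. mom p f x)" if "p \<le> m" for p
  proof -
   have "\<forall>n. (LINT x|lborel. mom p f x * ef n x) = (if n = 0 then (LINT x|lborel. mom p f x) else 0)" using z that by simp
   then show ?thesis using const[where p = p and c = "LINT x|lborel. mom p f x"] by blast
  qed
  then show "admissible f" unfolding admissible_def M using z by (intro exI[of _ "\<lambda>p. LINT x|lborel. mom p f x"]) blast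
 qed
qed

end

section \<open>Eigenvectors at excluded and at simple eigenvalues\<close>

lemma eigenvalue_transpose:
 fixes X :: "complex mat"
 assumes "X \<in> carrier_mat n n"
 shows "eigenvalue (transpose_mat X) \<kappa> \<longleftrightarrow> eigenvalue X \<kappa>"
 using assms eigenvalue_root_char_poly[OF assms] eigenvalue_root_char_poly[of "transpose_mat X" n] by simp

lemma right_eigenvector_eq_0:
 fixes X :: "complex mat"
 assumes X: "X \<in> carrier_mat n n" and "\<not> eigenvalue X \<kappa>"
  and w: "!!l. l < n ==> (\<Sum>j<n. X $$ (l, j) * w j) = \<kappa> * w l" and l: "l < n"
 shows "w l = 0"
proof (rule ccontr)
 assume "w l ~= 0"
 then have "vec_index (Matrix.vec n w) l ~= vec_index (0\<^sub>v n) l" using l by simp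
 then have nz: "Matrix.vec n w ~= 0\<^sub>v n" by auto
 have "X *\<^sub>v Matrix.vec n w = \<kappa> \<cdot>\<^sub>v Matrix.vec n w"
  by (rule eq_vecI) (use X w in \<open>auto simp: scalar_prod_def atLeast0LessThan\<close>)
 then have "eigenvalue X \<kappa>" using X nz unfolding eigenvalue_def eigenvector_def by (intro exI[of _ "Matrix.vec n w"]) auto
 then show False using assms(2) by simp
qed

lemma left_eigenvector_eq_0:
 fixes X :: "complex mat"
 assumes X: "X \<in> carrier_mat n n" and "\<not> eigenvalue X \<kappa>"
  and w: "!!j. j < n ==> (\<Sum>l<n. w l * X $$ (l, j)) = \<kappa> * w j" and l: "l < n"
 shows "w l = 0"
 by (rule right_eigenvector_eq_0[of "transpose_mat X" n \<kappa> w])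
  (use assms in \<open>auto simp: eigenvalue_transpose mult.commute\<close>)

context
 fixes X :: "complex mat" and n :: nat
 assumes X: "X \<in> carrier_mat (Suc n) (Suc n)" and ord: "Polynomial.order 1 (char_poly X) = 1"
  and row: "!!j. j < Suc n ==> X $$ (0, j) = (if j = 0 then 1 else 0)"
begin

text \<open>The transpose is block triangular with a corner entry 1, so the characteristic
  polynomial is that of the minor times (x - 1). A further root at 1 would contradict
  simplicity.\<close>

lemma minor_no_eigenvalue: "\<not> eigenvalue (Matrix.mat n n (\<lambda>(i, j). X $$ (Suc i, Suc j))) 1"
proof
 define Y where "Y = Matrix.mat n n (\<lambda>(i, j). X $$ (Suc i, Suc j))"
 assume "eigenvalue (Matrix.mat n n (\<lambda>(i, j). X $$ (Suc i, Suc j))) 1"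
 then have "poly (char_poly Y) 1 = 0" using eigenvalue_root_char_poly[of Y n] by (simp add: Y_def)
 have Y: "Y \<in> carrier_mat n n" by (simp add: Y_def)
 define c where "c = Matrix.mat 1 n (\<lambda>(i, j). X $$ (Suc j, 0))"
 have "transpose_mat X = four_block_mat (1\<^sub>m 1) c (0\<^sub>m n 1) (transpose_mat Y)"
 proof (rule eq_matI)
  fix i j assume "i < dim_row (four_block_mat (1\<^sub>m 1) c (0\<^sub>m n 1) (transpose_mat Y))" "j < dim_col (four_block_mat (1\<^sub>m 1) c (0\<^sub>m n 1) (transpose_mat Y))"
  then have ij: "i < Suc n" "j < Suc n" by (simp_all add: Y_def)
  then show "transpose_mat X $$ (i, j) = four_block_mat (1\<^sub>m 1) c (0\<^sub>m n 1) (transpose_mat Y) $$ (i, j)"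
   using X row[of i] row[of j] by (cases i; cases j) (auto simp: c_def Y_def)
 qed (use X in \<open>simp_all add: Y_def\<close>)
 then have "char_poly X = char_poly (1\<^sub>m 1 :: complex mat) * char_poly Y"
  using char_poly_four_block_zeros_col[of "1\<^sub>m 1" c n "transpose_mat Y"] X Y by (metis c_def char_poly_transpose_mat mat_carrier one_carrier_mat transpose_carrier_mat)
 moreover have "poly (char_poly (1\<^sub>m 1 :: complex mat)) 1 = 0"
  using eigenvalue_root_char_poly[of "1\<^sub>m 1 :: complex mat" 1 1] right_eigenvector_eq_0[of "1\<^sub>m 1 :: complex mat" 1 1 "\<lambda>_. 1" 0] by auto
 moreover note \<open>poly (char_poly Y) 1 = 0\<close>
 ultimately have "[:-1, 1:] ^ 2 dvd char_poly X"
  unfolding power2_eq_square using mult_dvd_mono poly_eq_0_iff_dvd by metis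
 moreover have "char_poly X ~= 0" using degree_monic_char_poly[OF X] by auto
 ultimately have "2 \<le> Polynomial.order 1 (char_poly X)" using order_max by blast
 then show False using ord by simp
qed

lemma simple_right_eigenvector_eq_0:
 assumes w: "!!l. l < Suc n ==> (\<Sum>j<Suc n. X $$ (l, j) * w j) = w l" "w 0 = 0" and l: "l < Suc n"
 shows "w l = 0"
proof (cases l)
 case (Suc l')
 have "w (Suc l') = 0"
 proof (rule right_eigenvector_eq_0[where w = "\<lambda>j. w (Suc j)" and l = l' and n = n and \<kappa> = 1, OF _ minor_no_eigenvalue])
  fix i assume i: "i < n"
  have "(\<Sum>j<Suc n. X $$ (Suc i, j) * w j) = X $$ (Suc i, 0) * w 0 + (\<Sum>j<n. X $$ (Suc i, Suc j) * w (Suc j))"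
   by (rule sum.lessThan_Suc_shift)
  then show "(\<Sum>j<n. Matrix.mat n n (\<lambda>(i, j). X $$ (Suc i, Suc j)) $$ (i, j) * w (Suc j)) = 1 * w (Suc i)"
   using w i by simp
 qed (use l Suc in auto)
 then show ?thesis using Suc by simp
qed (use w in simp)

lemma simple_left_eigenvector_eq_0:
 assumes w: "!!j. j < Suc n ==> (\<Sum>l<Suc n. w l * X $$ (l, j)) = w j" "w 0 = 0" and l: "l < Suc n"
 shows "w l = 0"
proof (cases l)
 case (Suc l')
 have "w (Suc l') = 0"
 proof (rule left_eigenvector_eq_0[where w = "\<lambda>j. w (Suc j)" and l = l' and n = n and \<kappa> = 1, OF _ minor_no_eigenvalue])
  fix i assume i: "i < n"
  have "(\<Sum>l<Suc n. w l * X $$ (l, Suc i)) = w 0 * X $$ (0, Suc i) + (\<Sum>l<n. w (Suc l) * X $$ (Suc l, Suc i))"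
   by (rule sum.lessThan_Suc_shift)
  then show "(\<Sum>l<n. w (Suc l) * Matrix.mat n n (\<lambda>(i, j). X $$ (Suc i, Suc j)) $$ (l, i)) = 1 * w (Suc i)"
   using w i by simp
 qed (use l Suc in auto)
 then show ?thesis using Suc by simp
qed (use w in simp)

end

text \<open>Extension by zero beyond the dimensions, since the support conditions of the
  \<open>mask\<close> locale range over all row and column indices.\<close>

definition entries :: "(int => complex mat) => int => nat => nat => complex" where
 "entries u k i j = (if i < dim_row (u k) \<and> j < dim_col (u k) then u k $$ (i, j) else 0)"

definition supported :: "int => (int => complex mat) => bool" where
 "supported N u \<longleftrightarrow> (\<forall>k. N < \<bar>k\<bar> --> k \<notin> seq_supp u)"

lemma l0_supported:
 assumes "u \<in> l0 s t" shows "\<exists>N0. \<forall>N\<ge>N0. supported N u"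
proof -
 have "finite (seq_supp u)" using assms by (simp add: l0_def)
 then obtain B where B: "\<forall>k\<in>seq_supp u. \<bar>k\<bar> \<le> B" using finite_imageI[of "seq_supp u" abs] by (metis bdd_above_def bdd_above_finite image_eqI)
 show ?thesis by (rule exI[of _ B]) (use B in \<open>force simp: supported_def\<close>)
qed

lemma entries_outside:
 assumes "supported N u" "N < \<bar>k\<bar>" shows "entries u k i j = 0"
proof -
 have "u k = 0\<^sub>m (dim_row (u k)) (dim_col (u k))" using assms by (simp add: supported_def seq_supp_def)
 then have "u k $$ (i, j) = 0" if "i < dim_row (u k)" "j < dim_col (u k)" using that by (metis index_zero_mat(1))
 then show ?thesis by (simp add: entries_def)
qed

lemma lZ_carrier: "u \<in> lZ s t ==> u k \<in> carrier_mat s t"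
 by (simp add: lZ_def)

lemma entries_nth: "u \<in> lZ s t ==> i < s ==> j < t ==> entries u k i j = u k $$ (i, j)"
 using lZ_carrier[of u s t k] by (simp add: entries_def)

lemma l0_lZ: "u \<in> l0 s t ==> u \<in> lZ s t"
 by (simp add: l0_def)

lemma seq_hat_carrier: "u \<in> lZ s t ==> seq_hat u \<xi> \<in> carrier_mat s t"
 using lZ_carrier[of u s t 0] by (simp add: seq_hat_def)

lemma seq_hat_nth:
 assumes "u \<in> lZ s t" "supported N u" "i < s" "j < t"
 shows "seq_hat u \<xi> $$ (i, j) = (\<Sum>k\<in>{-N..N}. entries u k i j * intwave k \<xi>)"
proof -
 have d: "dim_row (u 0) = s" "dim_col (u 0) = t" using lZ_carrier[OF assms(1), of 0] by auto
 have "seq_hat u \<xi> $$ (i, j) = (\<Sum>k | entries u k i j ~= 0. entries u k i j * intwave k \<xi>)"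
  using assms d by (simp add: seq_hat_def scalar_hat_def entries_nth)
 also have "... = (\<Sum>k\<in>{-N..N}. entries u k i j * intwave k \<xi>)"
 proof (rule sum.mono_neutral_left)
  show "{k. entries u k i j ~= 0} \<subseteq> {-N..N}"
  proof
   fix k assume "k \<in> {k. entries u k i j ~= 0}"
   then have "\<not> N < \<bar>k\<bar>" using entries_outside[OF assms(2)] by auto
   then show "k \<in> {-N..N}" by auto
  qed
 qed auto
 finally show ?thesis .
qed

lemma exp_pi_int: "intwave k pi = (-1) powi k"
proof -
 have "exp (- \<i> * of_real pi) = (-1 :: complex)"
  using exp_pi_i' by (simp add: exp_minus mult.commute)
 then have "(-1 :: complex) powi k = exp (of_int k * (- \<i> * of_real pi))"
  using exp_power_int[of "- \<i> * of_real pi" k] by simp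
 then show ?thesis by (simp add: mult_ac)
qed

text \<open>Translates every order condition at the origin into power moments; the factor (-i)^p is
  common to both sides and cancels.\<close>

lemma nderiv_exp_moment:
 "nderiv p (\<lambda>\<xi>. \<Sum>s\<in>S. c s * intwave (\<theta> s) \<xi>) 0 = (- \<i>) ^ p * (\<Sum>s\<in>S. c s * of_int (\<theta> s) ^ p)"
 unfolding nderiv_exp_sum power_mult_distrib[of "- \<i>"] by (simp add: sum_distrib_left mult.left_commute)

lemma nderiv_const: "nderiv p (\<lambda>_. c) 0 = (if p = 0 then c else 0)"
proof -
 have "nderiv p (\<lambda>\<xi>. \<Sum>s\<in>{()}. c * intwave 0 \<xi>) 0 = (- \<i>) ^ p * (\<Sum>s\<in>{()}. c * of_int 0 ^ p)"
  by (rule nderiv_exp_moment)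
 then show ?thesis by (cases p) auto
qed

context
 fixes r :: nat and N :: int and a \<upsilon> :: "int => complex mat"
 assumes a: "a \<in> lZ r r" "supported N a" and \<upsilon>: "\<upsilon> \<in> lZ 1 r" "supported N \<upsilon>"
begin

lemma nderiv_seq_hat:
 assumes "l < r"
 shows "nderiv p (\<lambda>\<xi>. seq_hat \<upsilon> \<xi> $$ (0, l)) 0 = (- \<i>) ^ p * (\<Sum>j\<in>{-N..N}. entries \<upsilon> j 0 l * of_int j ^ p)"
 using nderiv_exp_moment[of p "\<lambda>j. entries \<upsilon> j 0 l" "\<lambda>j. j" "{-N..N}"] seq_hat_nth[OF \<upsilon> _ assms] by simp

lemma seq_hat_product:
 assumes "l' < r"
 shows "(seq_hat \<upsilon> (2 * \<xi>) * seq_hat a (\<xi> + \<tau>)) $$ (0, l') =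
  (\<Sum>y\<in>{-N..N} \<times> {-N..N} \<times> {..<r}. (entries \<upsilon> (fst y) 0 (snd (snd y)) * entries a (fst (snd y)) (snd (snd y)) l' * intwave (fst (snd y)) \<tau>)
   * intwave (2 * fst y + fst (snd y)) \<xi>)"
proof -
 have "(seq_hat \<upsilon> (2 * \<xi>) * seq_hat a (\<xi> + \<tau>)) $$ (0, l') = (\<Sum>l<r. seq_hat \<upsilon> (2 * \<xi>) $$ (0, l) * seq_hat a (\<xi> + \<tau>) $$ (l, l'))"
  using seq_hat_carrier[OF a(1), of "\<xi> + \<tau>"] seq_hat_carrier[OF \<upsilon>(1), of "2 * \<xi>"] assms
  by (simp add: scalar_prod_def atLeast0LessThan)
 also have "... = (\<Sum>l<r. \<Sum>j\<in>{-N..N}. \<Sum>i\<in>{-N..N}. (entries \<upsilon> j 0 l * entries a i l l' * intwave i \<tau>) * intwave (2 * j + i) \<xi>)"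
 proof (intro sum.cong refl)
  fix l assume "l \<in> {..<r}"
  then show "seq_hat \<upsilon> (2 * \<xi>) $$ (0, l) * seq_hat a (\<xi> + \<tau>) $$ (l, l') = (\<Sum>j\<in>{-N..N}. \<Sum>i\<in>{-N..N}. (entries \<upsilon> j 0 l * entries a i l l' * intwave i \<tau>) * intwave (2 * j + i) \<xi>)"
   using assms by (simp add: seq_hat_nth[OF a] seq_hat_nth[OF \<upsilon>] sum_product) (intro sum.cong refl, simp add: algebra_simps flip: exp_add)
 qed
 also have "... = (\<Sum>j\<in>{-N..N}. \<Sum>i\<in>{-N..N}. \<Sum>l<r. (entries \<upsilon> j 0 l * entries a i l l' * intwave i \<tau>) * intwave (2 * j + i) \<xi>)"
  by (subst sum.swap) (intro sum.cong refl sum.swap)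
 finally show ?thesis by (simp add: sum_pairs)
qed

lemma nderiv_seq_hat_product:
 assumes "l' < r"
 shows "nderiv p (\<lambda>\<xi>. (seq_hat \<upsilon> (2 * \<xi>) * seq_hat a (\<xi> + \<tau>)) $$ (0, l')) 0 =
  (- \<i>) ^ p * (\<Sum>j\<in>{-N..N}. \<Sum>i\<in>{-N..N}. \<Sum>l<r. entries \<upsilon> j 0 l * entries a i l l' * intwave i \<tau> * (2 * of_int j + of_int i) ^ p)"
 unfolding seq_hat_product[OF assms] nderiv_exp_moment
 by (simp add: sum_pairs)

lemma sum_rules_moments:
 assumes "sum_rules r a \<upsilon> (n + 1)" "p \<le> n" "l' < r"
 shows "(\<Sum>j\<in>{-N..N}. \<Sum>i\<in>{-N..N}. \<Sum>l<r. entries \<upsilon> j 0 l * entries a i l l' * (2 * of_int j + of_int i) ^ p) = (\<Sum>j\<in>{-N..N}. entries \<upsilon> j 0 l' * of_int j ^ p)"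
  and "(\<Sum>j\<in>{-N..N}. \<Sum>i\<in>{-N..N}. \<Sum>l<r. entries \<upsilon> j 0 l * entries a i l l' * (-1) powi i * (2 * of_int j + of_int i) ^ p) = 0"
proof -
 have d: "dim_row (seq_hat \<upsilon> x * seq_hat a y) = 1" "dim_col (seq_hat \<upsilon> x * seq_hat a y) = r" for x y
  using seq_hat_carrier[OF a(1), of y] seq_hat_carrier[OF \<upsilon>(1), of x] by auto
 have "nderiv p (\<lambda>\<xi>. (seq_hat \<upsilon> (2 * \<xi>) * seq_hat a \<xi>) $$ (0, l')) 0 = nderiv p (\<lambda>\<xi>. seq_hat \<upsilon> \<xi> $$ (0, l')) 0"
  using assms d unfolding sum_rules_def eq_upto_O_def by simp
 then show "(\<Sum>j\<in>{-N..N}. \<Sum>i\<in>{-N..N}. \<Sum>l<r. entries \<upsilon> j 0 l * entries a i l l' * (2 * of_int j + of_int i) ^ p) = (\<Sum>j\<in>{-N..N}. entries \<upsilon> j 0 l' * of_int j ^ p)"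
  using nderiv_seq_hat_product[OF assms(3), of p 0] nderiv_seq_hat[OF assms(3), of p] by simp
 have "nderiv p (\<lambda>\<xi>. (seq_hat \<upsilon> (2 * \<xi>) * seq_hat a (\<xi> + pi)) $$ (0, l')) 0 = nderiv p (\<lambda>\<xi>. (0\<^sub>m 1 r :: complex mat) $$ (0, l')) 0"
  using assms d unfolding sum_rules_def eq_upto_O_def by simp
 also have "... = 0" using assms(3) nderiv_const[of p 0] by simp
 finally show "(\<Sum>j\<in>{-N..N}. \<Sum>i\<in>{-N..N}. \<Sum>l<r. entries \<upsilon> j 0 l * entries a i l l' * (-1) powi i * (2 * of_int j + of_int i) ^ p) = 0"
  unfolding nderiv_seq_hat_product[OF assms(3)] exp_pi_int by simp
qed

lemma sum_rule_mask_entries: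
 assumes "0 < r" "0 \<le> N" "sum_rules r a \<upsilon> (n + 1)"
  and "!!l. l < r ==> seq_hat \<upsilon> 0 $$ (0, l) = (if l = 0 then 1 else 0)"
 shows "sum_rule_mask r N (entries a) (\<lambda>j. entries \<upsilon> j 0) n"
proof unfold_locales
 show "(\<Sum>j\<in>{-N..N}. entries \<upsilon> j 0 l) = (if l = 0 then 1 else 0)" if "l < r" for l
  using assms(4)[OF that] seq_hat_nth[OF \<upsilon>, of 0 l 0] that by simp
qed (use assms entries_outside[OF a(2)] entries_outside[OF \<upsilon>(2)] sum_rules_moments[OF assms(3)] in auto)

end

lemma hermite_filter_moments:
 assumes h: "hermite_filter r \<upsilon> (n + 1)" and \<upsilon>: "\<upsilon> \<in> lZ 1 r" "supported N \<upsilon>" and q: "q < r" "q \<le> n" "p \<le> q"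
 shows "(\<Sum>j\<in>{-N..N}. entries \<upsilon> j 0 q * of_int j ^ p) = (if p = q then (-1) ^ q * fact q else 0)"
proof -
 obtain c :: "nat => int => complex" where c: "\<forall>l<r. finite {k. c l k ~= 0} \<and> scalar_hat (c l) 0 = 1"
  "eq_upto_O (n + 1) (seq_hat \<upsilon>) (\<lambda>\<xi>. Matrix.mat 1 r (\<lambda>(_, l). (\<i> * of_real \<xi>) ^ l * scalar_hat (c l) \<xi>))"
  using h unfolding hermite_filter_def by blast
 define S where "S = {k. c q k ~= 0}"
 have "nderiv p (\<lambda>\<xi>. seq_hat \<upsilon> \<xi> $$ (0, q)) 0 = nderiv p (\<lambda>\<xi>. Matrix.mat 1 r (\<lambda>(_, l). (\<i> * of_real \<xi>) ^ l * scalar_hat (c l) \<xi>) $$ (0, q)) 0"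
  using c(2) seq_hat_carrier[OF \<upsilon>(1), of 0] q unfolding eq_upto_O_def by auto
 also have "... = nderiv p (\<lambda>\<xi>. of_real \<xi> ^ q * (\<Sum>k\<in>S. (\<i> ^ q * c q k) * exp ((- \<i> * of_int k) * of_real \<xi>))) 0"
  using q by (simp add: scalar_hat_def S_def power_mult_distrib sum_distrib_left mult_ac)
 also have "... = (if p = q then fact q * (\<Sum>k\<in>S. \<i> ^ q * c q k) else 0)"
  by (rule nderiv_power_exp_sum[OF q(3)])
 also have "(\<Sum>k\<in>S. \<i> ^ q * c q k) = \<i> ^ q"
  using c(1) q(1) by (auto simp: scalar_hat_def S_def simp flip: sum_distrib_left)
 finally have "nderiv p (\<lambda>\<xi>. seq_hat \<upsilon> \<xi> $$ (0, q)) 0 = (if p = q then fact q * \<i> ^ q else 0)" .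
 moreover have "nderiv p (\<lambda>\<xi>. seq_hat \<upsilon> \<xi> $$ (0, q)) 0 = (- \<i>) ^ p * (\<Sum>j\<in>{-N..N}. entries \<upsilon> j 0 q * of_int j ^ p)"
  using nderiv_exp_moment[of p "\<lambda>j. entries \<upsilon> j 0 q" "\<lambda>j. j" "{-N..N}"] seq_hat_nth[OF \<upsilon> _ q(1)] by simp
 ultimately have "(- \<i>) ^ p * (\<Sum>j\<in>{-N..N}. entries \<upsilon> j 0 q * of_int j ^ p) = (if p = q then fact q * \<i> ^ q else 0)" by simp
 then have "\<i> ^ p * ((- \<i>) ^ p * (\<Sum>j\<in>{-N..N}. entries \<upsilon> j 0 q * of_int j ^ p)) = \<i> ^ p * (if p = q then fact q * \<i> ^ q else 0)" by simp
 moreover have "\<i> ^ p * (- \<i>) ^ p = 1" by (simp flip: power_mult_distrib)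
 moreover have "\<i> ^ q * \<i> ^ q = (-1) ^ q" by (simp flip: power_mult_distrib)
 ultimately show ?thesis by (auto simp: mult.assoc[symmetric] split: if_splits)
qed

lemma compact_supp_iff: "compact_supp f \<longleftrightarrow> (\<exists>L. \<forall>x. L < \<bar>x\<bar> --> f x = 0)"
proof
 assume "compact_supp f"
 then have "bounded (closure {x. f x ~= 0})" by (simp add: compact_supp_def compact_imp_bounded)
 then obtain L where "\<forall>x\<in>closure {x. f x ~= 0}. norm x \<le> L" unfolding bounded_iff by (rule exE)
 then have "L < \<bar>x\<bar> --> f x = 0" for x using closure_subset[of "{x. f x ~= 0}"] by force
 then show "\<exists>L. \<forall>x. L < \<bar>x\<bar> --> f x = 0" by blast
next
 assume "\<exists>L. \<forall>x. L < \<bar>x\<bar> --> f x = 0"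
 then obtain L where L: "\<forall>x. L < \<bar>x\<bar> --> f x = 0" by (rule exE)
 have "x \<in> {-L..L}" if "f x ~= 0" for x
  using L[rule_format, of x] that by (cases "L < \<bar>x\<bar>") auto
 then have "closure {x. f x ~= 0} \<subseteq> {-L..L}" by (intro closure_minimal) auto
 then show "compact_supp f" unfolding compact_supp_def
  using compact_Icc closed_closure by (metis compact_Int_closed inf.absorb_iff2)
qed

text \<open>Spanning in dual form: a unit vector is a finite combination of the given columns, so a
  functional vanishing on them has zero component there.\<close>

lemma stable_shifts_dual:
 assumes "stable_shifts r \<phi>" and \<gamma>: "!!k :: int. (\<Sum>l<r. \<gamma> l * dist_hat r \<phi> (\<xi> + 2 * pi * of_int k) $$ (l, 0)) = 0" and l: "l < r"
 shows "\<gamma> l = 0"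
proof -
 interpret vec_space "TYPE(complex)" r .
 define S where "S = range (\<lambda>k :: int. Matrix.col (dist_hat r \<phi> (\<xi> + 2 * pi * of_int k)) 0)"
 have SV: "S \<subseteq> carrier_vec r" by (auto simp: S_def dist_hat_def)
 have "unit_vec r l \<in> span S" using assms(1) by (simp add: stable_shifts_def S_def)
 then obtain c X where X: "finite X" "X \<subseteq> S" "unit_vec r l = lincomb c X" unfolding span_def by blast
 have "(\<Sum>i<r. \<gamma> i * vec_index x i) = 0" if xX: "x \<in> X" for x
 proof -
  obtain k :: int where "x = Matrix.col (dist_hat r \<phi> (\<xi> + 2 * pi * of_int k)) 0" using xX X(2) unfolding S_def by blast
  then show ?thesis using \<gamma>[of k] by (simp add: dist_hat_def)
 qed
 then have z: "(\<Sum>x\<in>X. c x * (\<Sum>i<r. \<gamma> i * vec_index x i)) = 0" by simp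
 have "vec_index (unit_vec r l) i = (\<Sum>x\<in>X. c x * vec_index x i)" if "i < r" for i
  unfolding X(3) using X(2) SV that by (intro lincomb_index) auto
 then have "(\<Sum>i<r. \<gamma> i * vec_index (unit_vec r l) i) = (\<Sum>i<r. \<Sum>x\<in>X. c x * (\<gamma> i * vec_index x i))"
  by (intro sum.cong refl) (simp add: sum_distrib_left mult_ac)
 also have "... = 0" using z by (subst sum.swap) (simp add: sum_distrib_left)
 also have "(\<Sum>i<r. \<gamma> i * vec_index (unit_vec r l) i) = (\<Sum>i<r. if i = l then \<gamma> l else 0)"
  using l by (intro sum.cong refl) (auto simp: unit_vec_def)
 finally show ?thesis using l by (simp add: sum.delta)
qed

lemma C_norm_le:
 assumes "0 < r" "!!l j x. l < r ==> j \<le> m ==> cmod (nderiv j (f l) x) \<le> e"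
 shows "C_norm r m f \<le> e"
proof -
 have "(\<lambda>(l, j). SUP x. cmod (nderiv j (f l) x)) y \<le> e" if "y \<in> {..<r} \<times> {..m}" for y
  using assms(2) that by (auto intro!: cSUP_least)
 moreover have "{..<r} \<times> {..m} ~= {}" using assms(1) by auto
 ultimately show ?thesis unfolding C_norm_def by (subst Max_le_iff) auto
qed

text \<open>\<open>C_norm\<close> uses suprema over the whole line, which dominate the values only
  for bounded functions; compact support supplies the boundedness.\<close>

lemma le_C_norm:
 assumes f: "C_k m (f l)" "!!x. L < \<bar>x\<bar> ==> f l x = 0" and l: "l < r" and j: "j \<le> m"
 shows "cmod (nderiv j (f l) x) \<le> C_norm r m f"
proof -
 have "bounded (nderiv j (f l) ` {-L..L})"
  by (rule compact_imp_bounded[OF compact_continuous_image[OF continuous_on_subset[OF C_k_continuous_nderiv[OF f(1) j]] compact_Icc]]) auto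
 then obtain B where B: "\<forall>y\<in>nderiv j (f l) ` {-L..L}. cmod y \<le> B" unfolding bounded_iff by (rule exE)
 have "cmod (nderiv j (f l) x) \<le> max B 0" for x
 proof (cases "L < \<bar>x\<bar>")
  case True
  then show ?thesis using nderiv_zero_outside[OF f j] by simp
 next
  case False
  then have "x \<in> {-L..L}" by auto
  then have "cmod (nderiv j (f l) x) \<le> B" using B by blast
  then show ?thesis by simp
 qed
 then have "bdd_above (range (\<lambda>x. cmod (nderiv j (f l) x)))" by (intro bdd_aboveI2)
 then have "cmod (nderiv j (f l) x) \<le> (SUP x. cmod (nderiv j (f l) x))" by (rule cSUP_upper[OF UNIV_I])
 also have "... \<le> C_norm r m f" unfolding C_norm_def
  by (rule Max_ge) (use l j in force)+
 finally show ?thesis .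
qed

lemma max_norm_le_iff:
 assumes "X \<in> carrier_mat s t" "0 < s" "0 < t"
 shows "max_norm X \<le> K \<longleftrightarrow> (\<forall>i<s. \<forall>j<t. cmod (X $$ (i, j)) \<le> K)"
proof -
 have e: "elements_mat X = {X $$ (i, j) | i j. i < s \<and> j < t}"
  using assms(1) by (auto simp: elements_mat_def) blast
 have "elements_mat X ~= {}" using assms e by auto
 moreover have "finite (elements_mat X)" by (simp add: elements_mat_def)
 ultimately have "max_norm X \<le> K \<longleftrightarrow> (\<forall>y\<in>elements_mat X. cmod y \<le> K)" unfolding max_norm_def by (subst Max_le_iff) auto
 then show ?thesis unfolding e by blast
qed

text \<open>\<open>N\<close> is a parameter rather than derived from the data, so that the same mask
  and filter can be instantiated with a larger window that also contains the support of a second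
  matching filter.\<close>

locale subdivision_setting =
 fixes r m :: nat and N :: int and a \<upsilon> :: "int => complex mat" and \<phi> :: "nat => (real => complex) => complex"
 assumes r_pos: "0 < r" and r_le: "r \<le> m + 1" and N0: "0 \<le> N"
  and a_l0: "a \<in> l0 r r" and a_supported: "supported N a" and \<upsilon>_supported: "supported N \<upsilon>"
  and dominant: "dominant_eigenvalue_one m (seq_hat a 0)"
  and sum_rules: "sum_rules r a \<upsilon> (m + 1)"
  and hermite_filter: "hermite_filter r \<upsilon> (m + 1)"
  and refinable: "refinable_vector r a \<upsilon> \<phi>"
  and stable: "stable_shifts r \<phi>"
begin

lemma a_lZ: "a \<in> lZ r r" by (rule l0_lZ[OF a_l0])

lemma \<upsilon>_lZ: "\<upsilon> \<in> lZ 1 r" using sum_rules l0_lZ by (auto simp: sum_rules_def)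

lemmas a_data = a_lZ a_supported
lemmas \<upsilon>_data = \<upsilon>_lZ \<upsilon>_supported

lemma \<upsilon>_hat_0: "l < r ==> seq_hat \<upsilon> 0 $$ (0, l) = (if l = 0 then 1 else 0)"
 using hermite_filter_moments[OF hermite_filter \<upsilon>_data, of l 0] r_le
 by (simp add: seq_hat_nth[OF \<upsilon>_data])

sublocale hermite_mask r N "entries a" "\<lambda>j. entries \<upsilon> j 0" m
proof -
 interpret sum_rule_mask r N "entries a" "\<lambda>j. entries \<upsilon> j 0" m
  by (rule sum_rule_mask_entries[OF a_data \<upsilon>_data r_pos N0 sum_rules \<upsilon>_hat_0])
 show "hermite_mask r N (entries a) (\<lambda>j. entries \<upsilon> j 0) m"
  by unfold_locales (use r_le hermite_filter_moments[OF hermite_filter \<upsilon>_data] in auto)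
qed

lemma A_seq_hat: "l < r ==> j < r ==> A \<xi> l j = seq_hat a \<xi> $$ (l, j)"
 by (simp add: A_def seq_hat_nth[OF a_data] mult_ac)

lemma A_row_0: "l < r ==> seq_hat a 0 $$ (0, l) = (if l = 0 then 1 else 0)"
proof -
 assume l: "l < r"
 have "(seq_hat \<upsilon> (2 * 0) * seq_hat a (0 + 0)) $$ (0, l) = seq_hat \<upsilon> 0 $$ (0, l)"
  using nderiv_seq_hat_product[OF a_data \<upsilon>_data l, of 0 0] nderiv_seq_hat[OF a_data \<upsilon>_data l, of 0]
   sum_rules_moments(1)[OF a_data \<upsilon>_data sum_rules _ l, of 0] by simp
 moreover have "(seq_hat \<upsilon> 0 * seq_hat a 0) $$ (0, l) = (\<Sum>k<r. seq_hat \<upsilon> 0 $$ (0, k) * seq_hat a 0 $$ (k, l))"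
  using seq_hat_carrier[OF a_lZ, of 0] seq_hat_carrier[OF \<upsilon>_lZ, of 0] l by (simp add: scalar_prod_def atLeast0LessThan)
 moreover have "... = (\<Sum>k<r. if k = 0 then seq_hat a 0 $$ (0, l) else 0)"
  by (intro sum.cong refl) (simp add: \<upsilon>_hat_0)
 ultimately show ?thesis using l r_pos \<upsilon>_hat_0[OF l] by (simp add: sum.delta)
qed

lemma order_one: "Polynomial.order 1 (char_poly (seq_hat a 0)) = 1"
 using dominant by (simp add: dominant_eigenvalue_one_def)

lemma not_eigenvalue: "\<kappa> ~= 1 ==> 1 / 2 ^ m \<le> cmod \<kappa> ==> \<not> eigenvalue (seq_hat a 0) \<kappa>"
 using dominant by (force simp: dominant_eigenvalue_one_def)

text \<open>For k >= 1 the modulus 2^k exceeds 1 and hence that of every eigenvalue. For k = 0 the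
  first row of the symbol at 0 is the first unit vector, so simplicity of 1 leaves no eigenvector
  with first entry 0.\<close>

lemma spectrum:
 assumes w: "!!l. l < r ==> (\<Sum>j<r. A 0 l j * w j) = 2 ^ k * w l" and w0: "k = 0 ==> w 0 = 0" and l: "l < r"
 shows "w l = 0"
proof (cases "k = 0")
 case True
 obtain n where n: "r = Suc n" using r_pos gr0_implies_Suc by blast
 show ?thesis
 proof (rule simple_right_eigenvector_eq_0[of "seq_hat a 0" n w l])
  show "seq_hat a 0 \<in> carrier_mat (Suc n) (Suc n)" using seq_hat_carrier[OF a_lZ] n by simp
  show "(\<Sum>j<Suc n. seq_hat a 0 $$ (l, j) * w j) = w l" if "l < Suc n" for l
   using w[of l] that True n by (simp add: A_seq_hat del: sum.lessThan_Suc)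
 qed (use order_one A_row_0 w0 True l n in auto)
next
 case False
 have "\<not> eigenvalue (seq_hat a 0) (2 ^ k)"
 proof (rule not_eigenvalue)
  have "cmod (2 ^ k) = 2 ^ k" by (simp add: norm_power)
  moreover have "(2 :: real) ^ k > 1" using False by (simp add: one_less_power)
  moreover have "1 / 2 ^ m \<le> (1 :: real)" by (simp add: divide_le_eq_1)
  ultimately show "(2 ^ k :: complex) ~= 1" "1 / 2 ^ m \<le> cmod (2 ^ k)" by (metis less_irrefl norm_one, linarith)
 qed
 then show ?thesis
  by (rule right_eigenvector_eq_0[OF seq_hat_carrier[OF a_lZ]]) (use w l A_seq_hat in auto)
qed

lemma \<phi>_functional: "l < r ==> \<exists>\<rho> d c. compact_functional (\<phi> l) \<rho> d c"
 using refinable compact_distribution_functional by (auto simp: refinable_vector_def)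

lemma \<phi>_refinable:
 assumes l: "l < r"
 shows "\<phi> l (\<lambda>x. wave (2 * \<xi>) x) = (\<Sum>j<r. A \<xi> l j * \<phi> j (\<lambda>x. wave \<xi> x))"
proof -
 have "dist_hat r \<phi> (2 * \<xi>) $$ (l, 0) = (seq_hat a \<xi> * dist_hat r \<phi> \<xi>) $$ (l, 0)"
  using refinable by (simp add: refinable_vector_def)
 also have "... = (\<Sum>j<r. A \<xi> l j * dist_hat r \<phi> \<xi> $$ (j, 0))"
  using seq_hat_carrier[OF a_lZ, of \<xi>] l by (simp add: scalar_prod_def atLeast0LessThan A_seq_hat dist_hat_def)
 finally show ?thesis using l by (simp add: dist_hat_def)
qed

lemma \<phi>_0: "\<phi> 0 (\<lambda>x. 1) = 1"
proof -
 have "(seq_hat \<upsilon> 0 * dist_hat r \<phi> 0) $$ (0, 0) = (1\<^sub>m 1 :: complex mat) $$ (0, 0)"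
  using refinable by (simp add: refinable_vector_def)
 moreover have "(seq_hat \<upsilon> 0 * dist_hat r \<phi> 0) $$ (0, 0) = (\<Sum>k<r. seq_hat \<upsilon> 0 $$ (0, k) * dist_hat r \<phi> 0 $$ (k, 0))"
  using seq_hat_carrier[OF \<upsilon>_lZ, of 0] by (simp add: scalar_prod_def atLeast0LessThan dist_hat_def)
 moreover have "... = (\<Sum>k<r. if k = 0 then dist_hat r \<phi> 0 $$ (0, 0) else 0)"
  by (intro sum.cong refl) (simp add: \<upsilon>_hat_0)
 ultimately have "dist_hat r \<phi> 0 $$ (0, 0) = 1" using r_pos by (simp add: sum.delta)
 then show ?thesis using r_pos by (simp add: dist_hat_def)
qed

context
 fixes g L
 assumes g: "csupp L g" "!!l. l < r ==> C_k m (g l)" "!!l x. l < r ==> g l x = R g l x" and M0: "M 0 0 (Phi g 0) = 1"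
begin

lemma \<phi>_integral: "l < r ==> smooth_fun \<psi> ==> \<phi> l \<psi> = (LINT x|lborel. g l x * \<psi> x)"
proof -
 assume l: "l < r" and \<psi>: "smooth_fun \<psi>"
 obtain \<rho> d c where \<phi>: "!!l. l < r ==> compact_functional (\<phi> l) (\<rho> l) (d l) (c l)" using \<phi>_functional by metis
 show ?thesis
 proof (rule refinable_functional_represented[where \<Theta> = \<phi> and \<rho> = \<rho> and d = d and c = c and g = g and L = L and \<psi> = \<psi> and l = l])
  show "!!k w l. (!!l. l < r ==> (\<Sum>j<r. A 0 l j * w j) = 2 ^ k * w l) ==> (k = 0 ==> w 0 = 0) ==> l < r ==> w l = 0"
   by (rule spectrum)
  show "!!l x. l < r ==> g l x = R g l x" by (rule g(3))
 qed (use \<phi> \<phi>_refinable \<phi>_0 g(1) C_k_continuous[OF g(2)] M0 \<psi> l in auto)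
qed

lemma \<phi>_represented: "l < r ==> represents (g l) (\<phi> l)"
 using \<phi>_integral by (simp add: represents_def)

lemma refinable_decays: "decays (Suc m)"
proof -
 have "decays_weakly (Suc m)"
 proof (rule stable_hat_decays_weakly[OF g M0])
  fix \<xi> \<gamma> l
  assume z: "!!k :: int. (\<Sum>l<r. \<gamma> l * (LINT x|lborel. g l x * wave (\<xi> + 2 * pi * of_int k) x)) = 0" and l: "l < r"
  show "\<gamma> l = 0"
  proof (rule stable_shifts_dual[OF stable _ l])
   fix k :: int
   have "(\<Sum>l<r. \<gamma> l * dist_hat r \<phi> (\<xi> + 2 * pi * of_int k) $$ (l, 0)) = (\<Sum>l<r. \<gamma> l * (LINT x|lborel. g l x * wave (\<xi> + 2 * pi * of_int k) x))"
   proof (intro sum.cong refl arg_cong2[of _ _ _ _ times])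
    fix l assume "l \<in> {..<r}"
    then have l: "l < r" by simp
    have "dist_hat r \<phi> \<zeta> $$ (l, 0) = \<phi> l (\<lambda>x. wave \<zeta> x)" for \<zeta>
     using l by (simp add: dist_hat_def)
    then show "dist_hat r \<phi> (\<xi> + 2 * pi * of_int k) $$ (l, 0) = (LINT x|lborel. g l x * wave (\<xi> + 2 * pi * of_int k) x)"
     by (simp only: \<phi>_integral[OF l smooth_exp])
   qed
   then show "(\<Sum>l<r. \<gamma> l * dist_hat r \<phi> (\<xi> + 2 * pi * of_int k) $$ (l, 0)) = 0" using z by simp
  qed
 qed
 then show ?thesis by (rule decays_weakly_imp_decays) simp
qed

end

lemma cascade_R: "l < r ==> (cascade r a ^^ n) f l x = (R ^^ n) f l x"
proof (induction n arbitrary: l x)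
 case (Suc n)
 have sub: "seq_supp a \<subseteq> {-N..N}" using a_supported by (force simp: supported_def)
 have "(cascade r a ^^ Suc n) f l x = 2 * (\<Sum>k\<in>seq_supp a. \<Sum>j<r. entries a k l j * (R ^^ n) f j (2 * x - of_int k))"
  using Suc by (simp add: cascade_def[of r a "(cascade r a ^^ n) f" l x] entries_nth[OF a_lZ])
 also have "(\<Sum>k\<in>seq_supp a. \<Sum>j<r. entries a k l j * (R ^^ n) f j (2 * x - of_int k)) = (\<Sum>k\<in>{-N..N}. \<Sum>j<r. entries a k l j * (R ^^ n) f j (2 * x - of_int k))"
 proof (rule sum.mono_neutral_left[OF _ sub])
  show "\<forall>k\<in>{-N..N} - seq_supp a. (\<Sum>j<r. entries a k l j * (R ^^ n) f j (2 * x - of_int k)) = 0"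
  proof
   fix k assume "k \<in> {-N..N} - seq_supp a"
   then have "a k = 0\<^sub>m r r" using lZ_carrier[OF a_lZ, of k] by (simp add: seq_supp_def)
   then have "entries a k l j = 0" for j by (simp add: entries_def)
   then show "(\<Sum>j<r. entries a k l j * (R ^^ n) f j (2 * x - of_int k)) = 0" by simp
  qed
 qed simp
 finally show ?case by (simp add: R_def[of "(R ^^ n) f" l x])
qed simp

text \<open>Multiplying by the filter turns the kernel at x into kernels at x + j, whose derivatives
  at the origin produce the powers of j + x in \<open>mom\<close>; the offset 2 pi k survives as
  \<open>ef (- k)\<close>. Admissibility thus becomes a condition on Fourier coefficients of
  periodised moments.\<close>

lemma seq_hat_fun_hat:
 assumes f: "csupp L f" "!!l. l < r ==> continuous_on UNIV (f l)"
 shows "nderiv p (\<lambda>\<xi>. (seq_hat \<upsilon> \<xi> * fun_hat r f (\<xi> + 2 * pi * of_int k)) $$ (0, 0)) 0 = (- \<i>) ^ p * (LINT x|lborel. mom p f x * ef (- k) x)"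
proof -
 define S where "S = {-N..N} \<times> {..<r}"
 define w where "w s x = entries \<upsilon> (fst s) 0 (snd s) * f (snd s) x * ef (- k) x" for s :: "int \<times> nat" and x
 have fz: "f l x = 0" if "l < r" "L < \<bar>x\<bar>" for l x using f(1) that by (auto simp: csupp_def)
 have cw: "continuous_on X (w s)" if "s \<in> S" for s X
  unfolding w_def[abs_def] by (rule continuous_on_subset[of UNIV]) (use that f(2) in \<open>auto intro!: continuous_intros simp: S_def\<close>)
 have "(seq_hat \<upsilon> \<xi> * fun_hat r f (\<xi> + 2 * pi * of_int k)) $$ (0, 0) = (\<Sum>s\<in>S. integral {-L..L} (\<lambda>x. w s x * wave (x + of_int (fst s)) \<xi>))" for \<xi>
 proof -
  have int: "(LINT x|lborel. f l x * wave (\<xi> + 2 * pi * of_int k) x) = integral {-L..L} (\<lambda>x. f l x * wave (\<xi> + 2 * pi * of_int k) x)" if "l < r" for l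
   by (rule lborel_integral_compact_support) (use f(2) fz that in \<open>auto intro!: continuous_intros\<close>)
  have "(seq_hat \<upsilon> \<xi> * fun_hat r f (\<xi> + 2 * pi * of_int k)) $$ (0, 0) = (\<Sum>l<r. seq_hat \<upsilon> \<xi> $$ (0, l) * integral {-L..L} (\<lambda>x. f l x * wave (\<xi> + 2 * pi * of_int k) x))"
   using seq_hat_carrier[OF \<upsilon>_lZ, of \<xi>] int by (simp add: scalar_prod_def atLeast0LessThan fun_hat_def)
  also have "... = (\<Sum>l<r. \<Sum>j\<in>{-N..N}. integral {-L..L} (\<lambda>x. w (j, l) x * wave (x + of_int j) \<xi>))"
  proof (intro sum.cong refl)
   fix l assume "l \<in> {..<r}"
   have "entries \<upsilon> j 0 l * intwave j \<xi> * integral {-L..L} (\<lambda>x. f l x * wave (\<xi> + 2 * pi * of_int k) x)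
    = integral {-L..L} (\<lambda>x. w (j, l) x * wave (x + of_int j) \<xi>)" for j
    unfolding integral_mult_right[symmetric] w_def ef_def by (intro integral_cong) (simp add: algebra_simps flip: exp_add)
   then show "seq_hat \<upsilon> \<xi> $$ (0, l) * integral {-L..L} (\<lambda>x. f l x * wave (\<xi> + 2 * pi * of_int k) x)
    = (\<Sum>j\<in>{-N..N}. integral {-L..L} (\<lambda>x. w (j, l) x * wave (x + of_int j) \<xi>))"
    using \<open>l \<in> {..<r}\<close> by (simp add: seq_hat_nth[OF \<upsilon>_data] sum_distrib_right)
  qed
  also have "... = (\<Sum>s\<in>S. integral {-L..L} (\<lambda>x. w s x * wave (x + of_int (fst s)) \<xi>))"
   unfolding S_def by (subst sum.swap) (simp add: sum_pairs)
  finally show ?thesis .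
 qed
 then have "nderiv p (\<lambda>\<xi>. (seq_hat \<upsilon> \<xi> * fun_hat r f (\<xi> + 2 * pi * of_int k)) $$ (0, 0)) 0 =
  (\<Sum>s\<in>S. integral {-L..L} (\<lambda>x. w s x * (- \<i> * of_real (x + of_int (fst s))) ^ p * wave (x + of_int (fst s)) 0))"
  by (simp only: nderiv_exponential_integral[OF cw])
 also have "... = integral {-L..L} (\<lambda>x. \<Sum>s\<in>S. w s x * (- \<i> * of_real (x + of_int (fst s))) ^ p * wave (x + of_int (fst s)) 0)"
  by (rule integral_sum[symmetric]) (auto simp: S_def intro!: integrable_continuous_real continuous_intros cw[unfolded S_def])
 also have "... = integral {-L..L} (\<lambda>x. (- \<i>) ^ p * (mom p f x * ef (- k) x))"
 proof (rule integral_cong)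
  fix x
  have "(- \<i> * of_real (x + of_int (fst s))) ^ p = (- \<i>) ^ p * (of_int (fst s) + of_real x) ^ p" for s :: "int \<times> nat"
   by (simp only: power_mult_distrib of_real_add of_real_of_int_eq add.commute)
  then show "(\<Sum>s\<in>S. w s x * (- \<i> * of_real (x + of_int (fst s))) ^ p * wave (x + of_int (fst s)) 0) = (- \<i>) ^ p * (mom p f x * ef (- k) x)"
   unfolding mom_def S_def w_def by (simp only:) (simp add: sum_pairs sum_distrib_left sum_distrib_right mult_ac)
 qed
 also have "... = (- \<i>) ^ p * integral {-L..L} (\<lambda>x. mom p f x * ef (- k) x)" by (rule integral_mult_right)
 also have "integral {-L..L} (\<lambda>x. mom p f x * ef (- k) x) = (LINT x|lborel. mom p f x * ef (- k) x)"
  by (rule lborel_integral_compact_support[symmetric]) (use continuous_mom[OF f(2)] mom_outside[OF f(1)] in \<open>auto intro!: continuous_intros\<close>)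
 finally show ?thesis .
qed

lemma admissible_initial_iff:
 "admissible_initial r m \<upsilon> f \<longleftrightarrow> (\<forall>l<r. C_k m (f l)) \<and> (\<exists>L. csupp L f \<and> admissible f)"
proof -
 have supp: "(\<forall>l<r. compact_supp (f l)) \<longleftrightarrow> (\<exists>L. csupp L f)"
 proof
  assume "\<forall>l<r. compact_supp (f l)"
  then obtain L where L: "!!l x. l < r ==> L l < \<bar>x\<bar> ==> f l x = 0" unfolding compact_supp_iff by metis
  have "csupp (Max (L ` {..<r})) f" unfolding csupp_def
  proof (intro allI impI)
   fix l x assume l: "l < r" and x: "Max (L ` {..<r}) < \<bar>x\<bar>"
   have "L l \<le> Max (L ` {..<r})" using l by simp
   then show "f l x = 0" using L[OF l] x by simp
  qed
  then show "\<exists>L. csupp L f" by blast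
 qed (auto simp: csupp_def compact_supp_iff)
 have "(seq_hat \<upsilon> 0 * fun_hat r f 0 = 1\<^sub>m 1 \<and> (\<forall>k::int. k ~= 0 --> eq_upto_O (m + 1) (\<lambda>\<xi>. seq_hat \<upsilon> \<xi> * fun_hat r f (\<xi> + 2 * pi * of_int k)) (\<lambda>_. 0\<^sub>m 1 1))) \<longleftrightarrow> admissible f"
  if f: "csupp L f" "!!l. l < r ==> continuous_on UNIV (f l)" for L
 proof -
  have d: "dim_row (seq_hat \<upsilon> \<xi> * fun_hat r f \<xi>') = 1" "dim_col (seq_hat \<upsilon> \<xi> * fun_hat r f \<xi>') = 1" for \<xi> \<xi>'
   using seq_hat_carrier[OF \<upsilon>_lZ, of \<xi>] by (simp_all add: fun_hat_def)
  have "Z = 1\<^sub>m 1 \<longleftrightarrow> Z $$ (0, 0) = 1" if "dim_row Z = 1" "dim_col Z = 1" for Z :: "complex mat"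
   using that by (auto intro!: eq_matI)
  from this[OF d[of 0 0]] have "seq_hat \<upsilon> 0 * fun_hat r f 0 = 1\<^sub>m 1 \<longleftrightarrow> (seq_hat \<upsilon> 0 * fun_hat r f 0) $$ (0, 0) = 1" .
  also have "... \<longleftrightarrow> (LINT x|lborel. mom 0 f x) = 1" using seq_hat_fun_hat[OF f, of 0 0] by simp
  finally have 1: "seq_hat \<upsilon> 0 * fun_hat r f 0 = 1\<^sub>m 1 \<longleftrightarrow> (LINT x|lborel. mom 0 f x) = 1" .
  have 2: "eq_upto_O (m + 1) (\<lambda>\<xi>. seq_hat \<upsilon> \<xi> * fun_hat r f (\<xi> + 2 * pi * of_int k)) (\<lambda>_. 0\<^sub>m 1 1) \<longleftrightarrow> (\<forall>p\<le>m. (LINT x|lborel. mom p f x * ef (- k) x) = 0)" for k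
   unfolding eq_upto_O_def d using seq_hat_fun_hat[OF f, of _ k] nderiv_const[of _ 0] by (auto simp: less_Suc_eq_le)
  have "(\<forall>k::int. k ~= 0 --> (\<forall>p\<le>m. (LINT x|lborel. mom p f x * ef (- k) x) = 0)) \<longleftrightarrow> (\<forall>p\<le>m. \<forall>n. n ~= 0 --> (LINT x|lborel. mom p f x * ef n x) = 0)"
  proof (intro iffI allI impI)
   fix p n assume *: "\<forall>k::int. k ~= 0 --> (\<forall>p\<le>m. (LINT x|lborel. mom p f x * ef (- k) x) = 0)" and p: "p \<le> m" and n: "n ~= (0 :: int)"
   show "(LINT x|lborel. mom p f x * ef n x) = 0" using *[rule_format, of "- n" p] p n by simp
  qed simp
  moreover have "admissible f \<longleftrightarrow> (LINT x|lborel. mom 0 f x) = 1 \<and> (\<forall>p\<le>m. \<forall>n. n ~= 0 --> (LINT x|lborel. mom p f x * ef n x) = 0)"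
   by (rule admissible_iff_fourier[OF f])
  ultimately show ?thesis unfolding 1 2 by simp
 qed
 note * = this
 show ?thesis
 proof
  assume ad: "admissible_initial r m \<upsilon> f"
  then have C: "\<forall>l<r. C_k m (f l)" by (simp add: admissible_initial_def)
  obtain L where L: "csupp L f" using ad supp by (auto simp: admissible_initial_def)
  have "admissible f"
   by (rule *[OF L, THEN iffD1]) (use ad C C_k_continuous in \<open>auto simp: admissible_initial_def\<close>)
  then show "(\<forall>l<r. C_k m (f l)) \<and> (\<exists>L. csupp L f \<and> admissible f)" using C L by blast
 next
  assume "(\<forall>l<r. C_k m (f l)) \<and> (\<exists>L. csupp L f \<and> admissible f)"
  then obtain L where C: "\<forall>l<r. C_k m (f l)" and L: "csupp L f" and ad: "admissible f" by blast
  note *[OF L, THEN iffD2, OF _ ad]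
  moreover have "continuous_on UNIV (f l)" if "l < r" for l using C C_k_continuous that by blast
  moreover have "\<forall>l<r. compact_supp (f l)" using supp L by blast
  ultimately show "admissible_initial r m \<upsilon> f" unfolding admissible_initial_def using C by (simp only: simp_thms) simp
 qed
qed

lemma cascade_converges_iff: "cascade_converges r m a \<upsilon> \<phi> \<longleftrightarrow> decays (Suc m)"
proof
 assume conv: "cascade_converges r m a \<upsilon> \<phi>"
 have "decays_weakly (Suc m)"
 proof (rule cascade_convergence_imp_decays_weakly)
  fix f L assume f: "!!l. l < r ==> C_k m (f l)" "csupp L f" "admissible f"
  have "admissible_initial r m \<upsilon> f" unfolding admissible_initial_iff using f by blast
  then obtain g where g: "!!l. l < r ==> C_k m (g l)" "!!l. l < r ==> represents (g l) (\<phi> l)"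
   and lim: "(\<lambda>n. C_norm r m (\<lambda>l x. (cascade r a ^^ n) f l x - g l x)) \<longlonglongrightarrow> 0"
   using conv unfolding cascade_converges_def by blast
  obtain \<rho> d c where \<phi>: "!!l. l < r ==> compact_functional (\<phi> l) (\<rho> l) (d l) (c l)" using \<phi>_functional by metis
  \<comment> \<open>The limit comes without a support condition; it must be compactly supported
    before \<open>C_norm\<close> controls pointwise values.\<close>
  have gz: "g l x = 0" if "l < r" "\<rho> l < \<bar>x\<bar>" for l x
   by (rule functional_represented_support[OF \<phi>[OF that(1)] C_k_continuous[OF g(1)[OF that(1)]] _ that(2)])
    (use g(2)[OF that(1)] in \<open>auto simp: represents_def\<close>)
  define L' where "L' = max L (of_int N)"
  have L': "csupp L' f" "of_int N \<le> L'" using csupp_mono[OF f(2)] by (auto simp: L'_def)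
  have "\<forall>\<^sub>F n in sequentially. \<forall>l<r. \<forall>x. cmod (nderiv m ((R ^^ n) f l) x - nderiv m (g l) x) \<le> \<epsilon>" if \<epsilon>: "0 < \<epsilon>" for \<epsilon>
  proof (rule eventually_mono[OF order_tendstoD(2)[OF lim \<epsilon>]], intro allI impI)
   fix n l x assume n: "C_norm r m (\<lambda>l x. (cascade r a ^^ n) f l x - g l x) < \<epsilon>" and l: "l < r"
   have eq: "(\<lambda>x. (cascade r a ^^ n) f l x - g l x) = (\<lambda>x. (R ^^ n) f l x - g l x)" by (simp add: cascade_R[OF l])
   have "cmod (nderiv m (\<lambda>x. (cascade r a ^^ n) f l x - g l x) x) \<le> C_norm r m (\<lambda>l x. (cascade r a ^^ n) f l x - g l x)"
   proof (rule le_C_norm[where f = "\<lambda>l x. (cascade r a ^^ n) f l x - g l x" and L = "max L' (\<rho> l)"])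
    show "C_k m (\<lambda>x. (cascade r a ^^ n) f l x - g l x)"
     unfolding eq by (intro C_k_diff C_k_R_iterate f(1) g(1) l)
    show "(cascade r a ^^ n) f l x - g l x = 0" if "max L' (\<rho> l) < \<bar>x\<bar>" for x
     using csupp_R_iterate[OF L', of n] gz[OF l] l that by (simp add: cascade_R csupp_def)
   qed (use l in auto)
   also have "nderiv m (\<lambda>x. (cascade r a ^^ n) f l x - g l x) x = nderiv m ((R ^^ n) f l) x - nderiv m (g l) x"
    unfolding eq by (simp add: nderiv_diff[OF C_k_R_iterate[OF f(1) l] g(1)[OF l]])
   finally show "cmod (nderiv m ((R ^^ n) f l) x - nderiv m (g l) x) \<le> \<epsilon>" using n by simp
  qed
  then show "\<exists>g. (\<forall>l<r. C_k m (g l)) \<and> (\<forall>\<epsilon>>0. \<forall>\<^sub>F n in sequentially. \<forall>l<r. \<forall>x. cmod (nderiv m ((R ^^ n) f l) x - nderiv m (g l) x) \<le> \<epsilon>)"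
   using g(1) by blast
 qed
 then show "decays (Suc m)" by (rule decays_weakly_imp_decays) simp
next
 assume dec: "decays (Suc m)"
 show "cascade_converges r m a \<upsilon> \<phi>"
  unfolding cascade_converges_def
 proof (intro allI impI)
  fix f assume "admissible_initial r m \<upsilon> f"
  then obtain L where f: "!!l. l < r ==> C_k m (f l)" "csupp L f" "admissible f" unfolding admissible_initial_iff by blast
  define L' where "L' = max L (of_int N)"
  have L': "csupp L' f" "of_int N \<le> L'" using csupp_mono[OF f(2)] by (auto simp: L'_def)
  obtain g K \<theta> where g: "!!l. l < r ==> C_k m (g l)" "csupp L' g" "!!l x. l < r ==> g l x = R g l x"
   and M0: "!!x. M 0 0 (Phi g x) = 1" and \<theta>: "0 \<le> \<theta>" "\<theta> < 1"
   and K: "!!l j n x. l < r ==> j \<le> m ==> cmod (nderiv j ((R ^^ n) f l) x - nderiv j (g l) x) \<le> K * \<theta> ^ n"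
   using cascade_limit[OF dec f(1) L'(1) f(3) L'(2)] by metis
  have deriv: "nderiv j (\<lambda>x. (cascade r a ^^ n) f l x - g l x) x = nderiv j ((R ^^ n) f l) x - nderiv j (g l) x" if "l < r" "j \<le> m" for l j n x
   using nderiv_diff[OF C_k_R_iterate[OF f(1) that(1)] g(1)[OF that(1)] that(2)] by (simp add: cascade_R[OF that(1)])
  have le: "C_norm r m (\<lambda>l x. (cascade r a ^^ n) f l x - g l x) \<le> K * \<theta> ^ n" for n
   by (rule C_norm_le[OF r_pos]) (simp only: deriv K)
  have ge: "0 \<le> C_norm r m (\<lambda>l x. (cascade r a ^^ n) f l x - g l x)" for n
  proof -
   have "cmod (nderiv 0 (\<lambda>x. (cascade r a ^^ n) f 0 x - g 0 x) 0) \<le> C_norm r m (\<lambda>l x. (cascade r a ^^ n) f l x - g l x)"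
   proof (rule le_C_norm[where f = "\<lambda>l x. (cascade r a ^^ n) f l x - g l x" and L = L'])
    show "C_k m (\<lambda>x. (cascade r a ^^ n) f 0 x - g 0 x)"
     using C_k_diff[OF C_k_R_iterate[OF f(1) r_pos] g(1)[OF r_pos]] by (simp add: cascade_R[OF r_pos])
    show "(cascade r a ^^ n) f 0 x - g 0 x = 0" if "L' < \<bar>x\<bar>" for x
     using csupp_R_iterate[OF L', of n] g(2) r_pos that by (simp add: cascade_R csupp_def)
   qed (use r_pos in auto)
   then show ?thesis using norm_ge_zero order_trans by blast
  qed
  have "(\<lambda>n. K * \<theta> ^ n) \<longlonglongrightarrow> K * 0" using \<theta> by (intro tendsto_mult tendsto_const LIMSEQ_power_zero) simp
  then have "(\<lambda>n. C_norm r m (\<lambda>l x. (cascade r a ^^ n) f l x - g l x)) \<longlonglongrightarrow> 0"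
   by (intro tendsto_sandwich[OF always_eventually[OF allI[OF ge]] always_eventually[OF allI[OF le]]]) simp_all
  then show "\<exists>g. (\<forall>l<r. C_k m (g l) \<and> represents (g l) (\<phi> l)) \<and> (\<lambda>n. C_norm r m (\<lambda>l x. (cascade r a ^^ n) f l x - g l x)) \<longlonglongrightarrow> 0"
   using g(1) \<phi>_represented[OF g(2,1,3) M0] by blast
 qed
qed

end

section \<open>The smoothness exponent\<close>

text \<open>The strict inequality leaves room for a rate \<open>q\<close> below \<open>h\<close>,
  and the constant absorbs the finitely many early terms. Conversely, the n-th root of a positive
  constant tends to 1.\<close>

lemma limsup_root_less_iff:
 fixes x :: "nat => real"
 assumes x: "!!n. 0 \<le> x n" and h: "0 < h"
 shows "limsup (\<lambda>n. ereal (root n (x n))) < ereal h \<longleftrightarrow> (\<exists>q K. 0 \<le> q \<and> q < h \<and> (\<forall>n. x n \<le> K * q ^ n))"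
proof
 assume "limsup (\<lambda>n. ereal (root n (x n))) < ereal h"
 then obtain q where q: "limsup (\<lambda>n. ereal (root n (x n))) < ereal q" "ereal q < ereal h" using ereal_dense2 by blast
 have ev: "\<forall>\<^sub>F n in sequentially. ereal (root n (x n)) < ereal q" by (rule Limsup_lessD[OF q(1)])
 then obtain n0 where n0: "!!n. n0 \<le> n ==> root n (x n) < q" unfolding eventually_sequentially by auto
 have "0 \<le> root n0 (x n0)" by (rule real_root_ge_zero[OF x])
 then have q0: "0 < q" using n0[of n0] by simp
 define K where "K = 1 + (\<Sum>n\<le>n0. x n / q ^ n)"
 have K1: "1 \<le> K" unfolding K_def using x q0 by (simp add: sum_nonneg)
 have "x n \<le> K * q ^ n" for n
 proof (cases "n \<le> n0")
  case True
  have "x n / q ^ n \<le> (\<Sum>n\<le>n0. x n / q ^ n)" by (rule member_le_sum) (use True x q0 in auto)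
  then have "x n / q ^ n \<le> K" by (simp add: K_def)
  then show ?thesis using q0 by (simp add: pos_divide_le_eq)
 next
  case False
  then have n: "0 < n" by simp
  have "x n = root n (x n) ^ n" using x n by simp
  also have "... \<le> q ^ n" using n0[of n] False x n by (intro power_mono) auto
  also have "... \<le> K * q ^ n" using mult_right_mono[OF K1, of "q ^ n"] q0 by simp
  finally show ?thesis .
 qed
 then show "\<exists>q K. 0 \<le> q \<and> q < h \<and> (\<forall>n. x n \<le> K * q ^ n)" using q(2) q0 by (intro exI[of _ q] exI[of _ K]) auto
next
 assume "\<exists>q K. 0 \<le> q \<and> q < h \<and> (\<forall>n. x n \<le> K * q ^ n)"
 then obtain q K where q: "0 \<le> q" "q < h" and K: "!!n. x n \<le> K * q ^ n" by blast
 have "\<forall>\<^sub>F n in sequentially. ereal (root n (x n)) \<le> ereal (root n (\<bar>K\<bar> + 1) * q)"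
  unfolding eventually_sequentially
 proof (intro exI[of _ 1] allI impI)
  fix n :: nat assume n: "1 \<le> n"
  have "x n \<le> (\<bar>K\<bar> + 1) * q ^ n" using K[of n] q by (intro order_trans[OF K[of n]] mult_right_mono) auto
  then have "root n (x n) \<le> root n ((\<bar>K\<bar> + 1) * q ^ n)" using n by simp
  also have "... = root n (\<bar>K\<bar> + 1) * q" using n q by (simp add: real_root_mult real_root_power_cancel)
  finally show "ereal (root n (x n)) \<le> ereal (root n (\<bar>K\<bar> + 1) * q)" by simp
 qed
 then have "limsup (\<lambda>n. ereal (root n (x n))) \<le> limsup (\<lambda>n. ereal (root n (\<bar>K\<bar> + 1) * q))" by (rule Limsup_mono)
 also have "... = ereal (1 * q)"
  by (intro lim_imp_Limsup tendsto_ereal tendsto_mult LIMSEQ_root_const tendsto_const) auto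
 also have "... < ereal h" using q by simp
 finally show "limsup (\<lambda>n. ereal (root n (x n))) < ereal h" .
qed

lemma less_neg_log2_iff:
 assumes "0 \<le> \<rho>"
 shows "ereal (real m) < neg_log2 \<rho> \<longleftrightarrow> \<rho> < ereal (1 / 2 ^ m)"
proof (cases \<rho>)
 case (real x)
 show ?thesis
 proof (cases "x = 0")
  case True
  then show ?thesis using real by (simp add: neg_log2_def zero_ereal_def)
 next
  case False
  then have x: "0 < x" using real assms by simp
  have "real m < - log 2 x \<longleftrightarrow> log 2 x < - real m" by linarith
  also have "... \<longleftrightarrow> x < 2 powr (- real m)" using log_less_iff[of 2 x "- real m"] x by simp
  also have "2 powr (- real m) = 1 / 2 ^ m" by (simp add: powr_minus powr_realpow divide_inverse)
  finally show ?thesis using real x by (simp add: neg_log2_def zero_ereal_def)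
 qed
qed (use assms in \<open>auto simp: neg_log2_def\<close>)

section \<open>Decay of a single sequence\<close>

context mask
begin

lemma Sub_cong: "(!!k l. l < r ==> w k l = w' k l) ==> Sub w = Sub w'"
 by (auto simp: Sub_def fun_eq_iff intro!: arg_cong[where f = zsum] sum.cong)

text \<open>No matching filter occurs, so the notion can be shared by the two filters that are
  compared later.\<close>

definition decaying :: "real => (int => nat => complex) => bool" where
 "decaying h u \<longleftrightarrow> (\<exists>q K. 0 \<le> q \<and> q < h \<and> (\<forall>n. bounded_by (K * q ^ n) (C n u)))"

lemma decaying_lincomb:
 assumes "decaying h u" "decaying h w"
 shows "decaying h (\<lambda>k l. \<alpha> * u k l + \<beta> * w k l)"
proof -
 obtain q K where q: "0 \<le> q" "q < h" "!!n. bounded_by (K * q ^ n) (C n u)" using assms(1) by (auto simp: decaying_def)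
 obtain q' K' where q': "0 \<le> q'" "q' < h" "!!n. bounded_by (K' * q' ^ n) (C n w)" using assms(2) by (auto simp: decaying_def)
 define Q where "Q = max q q'"
 have "bounded_by ((cmod \<alpha> * \<bar>K\<bar> + cmod \<beta> * \<bar>K'\<bar>) * Q ^ n) (C n (\<lambda>k l. \<alpha> * u k l + \<beta> * w k l))" for n
  unfolding bounded_by_def
 proof (intro allI impI)
  fix j l assume l: "l < r"
  have 1: "cmod (C n u j l) \<le> \<bar>K\<bar> * Q ^ n"
  proof -
   have "cmod (C n u j l) \<le> K * q ^ n" using q(3)[of n] l by (simp add: bounded_by_def)
   also have "... \<le> \<bar>K\<bar> * Q ^ n" using q(1) by (intro mult_mono power_mono) (auto simp: Q_def)
   finally show ?thesis .
  qed
  have 2: "cmod (C n w j l) \<le> \<bar>K'\<bar> * Q ^ n"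
  proof -
   have "cmod (C n w j l) \<le> K' * q' ^ n" using q'(3)[of n] l by (simp add: bounded_by_def)
   also have "... \<le> \<bar>K'\<bar> * Q ^ n" using q'(1) by (intro mult_mono power_mono) (auto simp: Q_def)
   finally show ?thesis .
  qed
  have "cmod (C n (\<lambda>k l. \<alpha> * u k l + \<beta> * w k l) j l) \<le> cmod \<alpha> * cmod (C n u j l) + cmod \<beta> * cmod (C n w j l)"
   unfolding C_lincomb by (rule order_trans[OF norm_triangle_ineq]) (simp add: norm_mult)
  also have "... \<le> cmod \<alpha> * (\<bar>K\<bar> * Q ^ n) + cmod \<beta> * (\<bar>K'\<bar> * Q ^ n)"
   using 1 2 by (intro add_mono mult_left_mono) auto
  finally show "cmod (C n (\<lambda>k l. \<alpha> * u k l + \<beta> * w k l) j l) \<le> (cmod \<alpha> * \<bar>K\<bar> + cmod \<beta> * \<bar>K'\<bar>) * Q ^ n"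
   by (simp add: algebra_simps)
 qed
 moreover have "0 \<le> Q" "Q < h" using q q' by (auto simp: Q_def)
 ultimately show ?thesis unfolding decaying_def by blast
qed

lemma decaying_cong: "decaying h u ==> (!!k l. l < r ==> u k l = w k l) ==> decaying h w"
 using C_cong[of u w] by (auto simp: decaying_def bounded_by_def)

lemma decaying_shift: "decaying h u ==> decaying h (\<lambda>k. u (k - t))"
 unfolding decaying_def bounded_by_def C_shift by blast

lemma decaying_zero: "0 < h ==> decaying h (\<lambda>k l. 0)"
proof -
 assume h: "0 < h"
 have "C n (\<lambda>k l. 0) j l = 0" for n j l using C_scale[of n 0 "\<lambda>k l. 0" j l] by simp
 then show ?thesis using h by (auto simp: decaying_def bounded_by_def intro!: exI[of _ 0])
qed

end

context sum_rule_mask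
begin

lemma decays_at_iff: "decays_at n h \<longleftrightarrow> (\<forall>u. V n u --> decaying h u)"
 by (simp add: decays_at_def decaying_def)

lemma decays_iff: "decays n \<longleftrightarrow> (\<forall>u. V n u --> decaying ((1 / 2) ^ n) u)"
 by (simp add: decays_def decays_at_iff)

text \<open>The filter enters only through its own moments of order at most \<open>p\<close>, so
  filters with equal moments define the same spaces.\<close>

lemma M_moments:
 assumes "fsupp u"
 shows "M p 0 u = (\<Sum>l<r. \<Sum>s\<le>p. of_nat (p choose s) * (\<Sum>j\<in>{-N..N}. v j l * of_int j ^ s) * zsum (\<lambda>k. of_int k ^ (p - s) * u k l))"
proof -
 have "zsum (\<lambda>k. (of_int j + of_int k + 0) ^ p * u k l) = (\<Sum>s\<le>p. of_nat (p choose s) * of_int j ^ s * zsum (\<lambda>k. of_int k ^ (p - s) * u k l))" if l: "l < r" for j l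
 proof -
  have "zsum (\<lambda>k. (of_int j + of_int k + 0) ^ p * u k l) = zsum (\<lambda>k. \<Sum>s\<le>p. of_nat (p choose s) * of_int j ^ s * (of_int k ^ (p - s) * u k l))"
   by (simp add: binomial_ring sum_distrib_right mult.assoc)
  also have "... = (\<Sum>s\<le>p. zsum (\<lambda>k. of_nat (p choose s) * of_int j ^ s * (of_int k ^ (p - s) * u k l)))"
  proof (rule zsum_sum)
   fix s
   show "finite {k. of_nat (p choose s) * of_int j ^ s * (of_int k ^ (p - s) * u k l) ~= 0}"
    using fsupp_finite[OF assms l, of "\<lambda>k. of_nat (p choose s) * of_int j ^ s * of_int k ^ (p - s)"] by (simp only: mult.assoc)
  qed simp
  finally show ?thesis by (simp only: zsum_cmult)
 qed
 then have "M p 0 u = (\<Sum>j\<in>{-N..N}. \<Sum>l<r. \<Sum>s\<le>p. of_nat (p choose s) * (v j l * of_int j ^ s) * zsum (\<lambda>k. of_int k ^ (p - s) * u k l))"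
  unfolding M_def by (intro sum.cong refl) (simp add: sum_distrib_left mult_ac)
 also have "... = (\<Sum>l<r. \<Sum>s\<le>p. \<Sum>j\<in>{-N..N}. of_nat (p choose s) * (v j l * of_int j ^ s) * zsum (\<lambda>k. of_int k ^ (p - s) * u k l))"
  by (subst sum.swap) (intro sum.cong refl sum.swap)
 finally show ?thesis by (simp add: sum_distrib_left sum_distrib_right)
qed

end

section \<open>Matrix-valued subdivision, mask iterates and norms in terms of \<open>Sub\<close> and
  \<open>C\<close>\<close>

context subdivision_setting
begin

lemma subdivision_Sub:
 assumes w: "w \<in> lZ s r"
 shows "subdivision a w \<in> lZ s r \<and> (\<forall>p<s. \<forall>q<r. subdivision a w j $$ (p, q) = Sub (\<lambda>k l. w k $$ (p, l)) j q)"
proof (intro conjI allI impI)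
 show "subdivision a w \<in> lZ s r"
  using lZ_carrier[OF w, of 0] lZ_carrier[OF a_lZ, of 0] by (simp add: lZ_def subdivision_def)
 fix p q assume p: "p < s" and q: "q < r"
 define S where "S = {k. j - 2 * k \<in> seq_supp a}"
 have "S \<subseteq> {-(\<bar>j\<bar> + N)..\<bar>j\<bar> + N}"
 proof
  fix k assume "k \<in> S"
  then have "\<not> N < \<bar>j - 2 * k\<bar>" using a_supported by (auto simp: S_def supported_def)
  then show "k \<in> {-(\<bar>j\<bar> + N)..\<bar>j\<bar> + N}" using N0 by auto
 qed
 then have S: "finite S" using finite_subset by blast
 have "subdivision a w j $$ (p, q) = 2 * (\<Sum>k\<in>S. (w k * a (j - 2 * k)) $$ (p, q))"
  using lZ_carrier[OF w, of 0] lZ_carrier[OF a_lZ, of 0] p q by (simp add: subdivision_def S_def)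
 also have "(\<Sum>k\<in>S. (w k * a (j - 2 * k)) $$ (p, q)) = (\<Sum>k\<in>S. \<Sum>l<r. w k $$ (p, l) * entries a (j - 2 * k) l q)"
 proof (intro sum.cong refl)
  fix k
  show "(w k * a (j - 2 * k)) $$ (p, q) = (\<Sum>l<r. w k $$ (p, l) * entries a (j - 2 * k) l q)"
   using lZ_carrier[OF w, of k] lZ_carrier[OF a_lZ, of "j - 2 * k"] p q
   by (simp add: scalar_prod_def atLeast0LessThan entries_nth[OF a_lZ])
 qed
 also have "... = zsum (\<lambda>k. \<Sum>l<r. w k $$ (p, l) * entries a (j - 2 * k) l q)"
 proof (rule zsum_eq[OF S, symmetric])
  fix k assume "k \<notin> S"
  then have "a (j - 2 * k) = 0\<^sub>m r r" using lZ_carrier[OF a_lZ, of "j - 2 * k"] by (simp add: S_def seq_supp_def)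
  then have "entries a (j - 2 * k) l q = 0" for l by (simp add: entries_def)
  then show "(\<Sum>l<r. w k $$ (p, l) * entries a (j - 2 * k) l q) = 0" by simp
 qed
 finally show "subdivision a w j $$ (p, q) = Sub (\<lambda>k l. w k $$ (p, l)) j q" by (simp only: Sub_def)
qed

lemma subdivision_iterate:
 assumes w: "w \<in> lZ s r"
 shows "(subdivision a ^^ n) w \<in> lZ s r \<and> (\<forall>p<s. \<forall>q<r. \<forall>j. (subdivision a ^^ n) w j $$ (p, q) = (Sub ^^ n) (\<lambda>k l. w k $$ (p, l)) j q)"
proof (induction n)
 case (Suc n)
 have "(subdivision a ^^ Suc n) w j $$ (p, q) = (Sub ^^ Suc n) (\<lambda>k l. w k $$ (p, l)) j q" if "p < s" "q < r" for p q j
 proof -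
  have "(subdivision a ^^ Suc n) w j $$ (p, q) = Sub (\<lambda>k l. (subdivision a ^^ n) w k $$ (p, l)) j q"
   using subdivision_Sub[OF Suc.IH[THEN conjunct1], of j] that by simp
  also have "Sub (\<lambda>k l. (subdivision a ^^ n) w k $$ (p, l)) = Sub ((Sub ^^ n) (\<lambda>k l. w k $$ (p, l)))"
   by (rule Sub_cong) (use Suc.IH that in blast)
  finally show ?thesis by simp
 qed
 moreover have "(subdivision a ^^ Suc n) w \<in> lZ s r" using subdivision_Sub[OF Suc.IH[THEN conjunct1]] by simp
 ultimately show ?case by blast
qed (simp add: w)

lemma hermite_iter_nth:
 assumes w: "w \<in> lZ 1 r"
 shows "hermite_iter r a w n k \<in> carrier_mat 1 r" and "q < r ==> hermite_iter r a w n k $$ (0, q) = 2 ^ (n * q) * (Sub ^^ n) (\<lambda>k l. w k $$ (0, l)) k q"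
proof -
 note it = subdivision_iterate[OF w, of n]
 have W: "(subdivision a ^^ n) w k \<in> carrier_mat 1 r" by (rule lZ_carrier[OF it[THEN conjunct1]])
 have e: "hermite_iter r a w n k = Matrix.mat 1 r (\<lambda>(i, j). (subdivision a ^^ n) w k $$ (i, j) * ((1 / 2) ^ j) powi (- int n))"
  unfolding hermite_iter_def D_pow_def by (rule mat_diag_mult_right[OF W])
 then show "hermite_iter r a w n k \<in> carrier_mat 1 r" by simp
 assume q: "q < r"
 have "((1 / 2 :: complex) ^ q) powi (- int n) = 2 ^ (n * q)"
  by (simp add: power_int_minus power_mult power_one_over mult.commute[of n] flip: power_mult)
 then show "hermite_iter r a w n k $$ (0, q) = 2 ^ (n * q) * (Sub ^^ n) (\<lambda>k l. w k $$ (0, l)) k q"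
  using it q unfolding e by simp
qed

lemma hermite_limit_iff:
 fixes K :: real
 assumes w: "w \<in> lZ 1 r" and K: "0 < K"
 shows "(\<lambda>n. Max ((\<lambda>k. max_norm (hermite_iter r a w n k - Matrix.mat 1 r (\<lambda>(_, l). nderiv l \<eta> (of_int k / 2 ^ n))))
   ` {k::int. - (2 ^ n * K) \<le> of_int k \<and> of_int k \<le> 2 ^ n * K})) \<longlonglongrightarrow> 0 \<longleftrightarrow>
  (\<forall>\<epsilon>>0. \<forall>\<^sub>F n in sequentially. \<forall>j. \<bar>of_int j\<bar> \<le> 2 ^ n * K -->
   (\<forall>q<r. cmod (2 ^ (n * q) * (Sub ^^ n) (\<lambda>k l. w k $$ (0, l)) j q - nderiv q \<eta> (of_int j / 2 ^ n)) \<le> \<epsilon>))"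
proof -
 define D where "D n k = hermite_iter r a w n k - Matrix.mat 1 r (\<lambda>(_, l). nderiv l \<eta> (of_int k / 2 ^ n))" for n k
 define I where "I n = {k::int. - (2 ^ n * K) \<le> of_int k \<and> of_int k \<le> 2 ^ n * K}" for n :: nat
 have D: "D n k \<in> carrier_mat 1 r" for n k unfolding D_def by (rule minus_carrier_mat) simp
 have Dn: "D n k $$ (0, q) = 2 ^ (n * q) * (Sub ^^ n) (\<lambda>k l. w k $$ (0, l)) k q - nderiv q \<eta> (of_int k / 2 ^ n)" if "q < r" for n k q
  using hermite_iter_nth(2)[OF w that, where n = n and k = k] that by (simp add: D_def)
 have I: "I n ~= {}" "finite (I n)" "j \<in> I n \<longleftrightarrow> \<bar>of_int j\<bar> \<le> 2 ^ n * K" for n j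
 proof -
  have "0 \<in> I n" using K by (simp add: I_def)
  then show "I n ~= {}" by blast
  have "I n \<subseteq> {-\<lceil>2 ^ n * K\<rceil>..\<lceil>2 ^ n * K\<rceil>}" by (auto simp: I_def) linarith+
  then show "finite (I n)" by (rule finite_subset) simp
  show "j \<in> I n \<longleftrightarrow> \<bar>of_int j\<bar> \<le> 2 ^ n * K" by (auto simp: I_def)
 qed
 have max_le: "Max ((\<lambda>k. max_norm (D n k)) ` I n) \<le> \<epsilon> \<longleftrightarrow> (\<forall>j. \<bar>of_int j\<bar> \<le> 2 ^ n * K -->
   (\<forall>q<r. cmod (2 ^ (n * q) * (Sub ^^ n) (\<lambda>k l. w k $$ (0, l)) j q - nderiv q \<eta> (of_int j / 2 ^ n)) \<le> \<epsilon>))" for n \<epsilon>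
 proof -
  have "Max ((\<lambda>k. max_norm (D n k)) ` I n) \<le> \<epsilon> \<longleftrightarrow> (\<forall>j\<in>I n. max_norm (D n j) \<le> \<epsilon>)" using I(1,2) by (subst Max_le_iff) auto
  moreover have "max_norm (D n j) \<le> \<epsilon> \<longleftrightarrow> (\<forall>q<r. cmod (2 ^ (n * q) * (Sub ^^ n) (\<lambda>k l. w k $$ (0, l)) j q - nderiv q \<eta> (of_int j / 2 ^ n)) \<le> \<epsilon>)" for j
   using max_norm_le_iff[OF D, of n j \<epsilon>] r_pos by (simp add: Dn)
  ultimately show ?thesis unfolding Ball_def I(3) by (simp only:)
 qed
 have ge: "0 \<le> Max ((\<lambda>k. max_norm (D n k)) ` I n)" for n
 proof -
  obtain k where k: "k \<in> I n" using I(1) by blast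
  have "cmod (D n k $$ (0, 0)) \<le> max_norm (D n k)"
   using max_norm_le_iff[OF D _ r_pos, of n k "max_norm (D n k)"] r_pos by simp
  also have "... \<le> Max ((\<lambda>k. max_norm (D n k)) ` I n)" using k I(2) by (intro Max_ge) auto
  finally show ?thesis using norm_ge_zero order_trans by blast
 qed
 have "(\<lambda>n. Max ((\<lambda>k. max_norm (D n k)) ` I n)) \<longlonglongrightarrow> 0 \<longleftrightarrow> (\<forall>\<epsilon>>0. \<forall>\<^sub>F n in sequentially. Max ((\<lambda>k. max_norm (D n k)) ` I n) \<le> \<epsilon>)"
 proof
  assume lim: "(\<lambda>n. Max ((\<lambda>k. max_norm (D n k)) ` I n)) \<longlonglongrightarrow> 0"
  show "\<forall>\<epsilon>>0. \<forall>\<^sub>F n in sequentially. Max ((\<lambda>k. max_norm (D n k)) ` I n) \<le> \<epsilon>"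
   by (intro allI impI) (rule eventually_mono[OF order_tendstoD(2)[OF lim]], auto)
 next
  assume le: "\<forall>\<epsilon>>0. \<forall>\<^sub>F n in sequentially. Max ((\<lambda>k. max_norm (D n k)) ` I n) \<le> \<epsilon>"
  show "(\<lambda>n. Max ((\<lambda>k. max_norm (D n k)) ` I n)) \<longlonglongrightarrow> 0"
  proof (rule order_tendstoI)
   fix \<epsilon> :: real assume "0 < \<epsilon>"
   then have "\<forall>\<^sub>F n in sequentially. Max ((\<lambda>k. max_norm (D n k)) ` I n) \<le> \<epsilon> / 2" by (intro le[rule_format]) simp
   then show "\<forall>\<^sub>F n in sequentially. Max ((\<lambda>k. max_norm (D n k)) ` I n) < \<epsilon>"
    by (rule eventually_mono) (use \<open>0 < \<epsilon>\<close> in simp)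
  next
   fix b :: real assume "b < 0"
   then show "\<forall>\<^sub>F n in sequentially. b < Max ((\<lambda>k. max_norm (D n k)) ` I n)"
    by (intro always_eventually allI less_le_trans[OF _ ge])
  qed
 qed
 then show ?thesis unfolding max_le unfolding D_def I_def .
qed

lemma hermite_scheme_converges_iff: "hermite_scheme_converges r m a \<longleftrightarrow> decays (Suc m)"
proof
 assume conv: "hermite_scheme_converges r m a"
 have "\<exists>g L. csupp L g \<and> (\<forall>l<r. C_k m (g l)) \<and> (\<forall>l<r. \<forall>x. g l x = R g l x) \<and> M 0 0 (Phi g 0) = 1"
 proof (rule hermite_convergence_imp_refinable)
  fix l assume l: "l < r"
  define w where "w k = Matrix.mat 1 r (\<lambda>(_, l'). delta 0 l k l')" for k
  have w: "w \<in> lZ 1 r" by (simp add: w_def lZ_def)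
  obtain \<eta> where \<eta>0: "C_k m \<eta> \<and> (\<forall>K::real. K > 0 -->
     (\<lambda>n. Max ((\<lambda>k. max_norm (hermite_iter r a w n k - Matrix.mat 1 r (\<lambda>(_, l). nderiv l \<eta> (of_int k / 2 ^ n))))
          ` {k::int. - (2 ^ n * K) \<le> of_int k \<and> of_int k \<le> 2 ^ n * K})) \<longlonglongrightarrow> 0)"
   using bspec[OF conv[unfolded hermite_scheme_converges_def] w] by (rule exE)
  note \<eta> = \<eta>0[THEN conjunct1] \<eta>0[THEN conjunct2, rule_format]
  have Sub_w: "(Sub ^^ n) (\<lambda>k l. w k $$ (0, l)) j 0 = (Sub ^^ n) (delta 0 l) j 0" for n j
  proof (cases n)
   case 0
   then show ?thesis using r_pos by (simp add: w_def)
  next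
   case (Suc n')
   have "Sub (\<lambda>k l. w k $$ (0, l)) = Sub (delta 0 l)" by (rule Sub_cong) (simp add: w_def)
   then show ?thesis by (simp add: Suc funpow_swap1)
  qed
  have "\<forall>\<^sub>F n in sequentially. \<forall>j. \<bar>of_int j\<bar> \<le> 2 ^ n * K --> cmod ((Sub ^^ n) (delta 0 l) j 0 - \<eta> (of_int j / 2 ^ n)) \<le> \<epsilon>"
   if "0 < K" "0 < \<epsilon>" for K \<epsilon> :: real
  proof (rule eventually_mono[OF hermite_limit_iff[OF w that(1), THEN iffD1, rule_format, OF \<eta>(2)[OF that(1)] that(2)]], intro allI impI)
   fix n j assume *: "\<forall>j. \<bar>of_int j\<bar> \<le> 2 ^ n * K --> (\<forall>q<r. cmod (2 ^ (n * q) * (Sub ^^ n) (\<lambda>k l. w k $$ (0, l)) j q - nderiv q \<eta> (of_int j / 2 ^ n)) \<le> \<epsilon>)"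
    and j: "\<bar>of_int j\<bar> \<le> 2 ^ n * K"
   show "cmod ((Sub ^^ n) (delta 0 l) j 0 - \<eta> (of_int j / 2 ^ n)) \<le> \<epsilon>"
    using *[rule_format, OF j r_pos] by (simp add: Sub_w)
  qed
  then show "\<exists>\<eta>. C_k m \<eta> \<and> (\<forall>K>0. \<forall>\<epsilon>>0. \<forall>\<^sub>F n in sequentially. \<forall>j. \<bar>of_int j\<bar> \<le> 2 ^ n * (K :: real) -->
   cmod ((Sub ^^ n) (delta 0 l) j 0 - \<eta> (of_int j / 2 ^ n)) \<le> \<epsilon>)" using \<eta>(1) by blast
 qed
 then obtain g L where g: "csupp L g" "!!l. l < r ==> C_k m (g l)" "!!l x. l < r ==> g l x = R g l x" "M 0 0 (Phi g 0) = 1"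
  by (elim exE conjE) (rule that, auto)
 show "decays (Suc m)" by (rule refinable_decays[OF g])
next
 assume dec: "decays (Suc m)"
 show "hermite_scheme_converges r m a"
  unfolding hermite_scheme_converges_def
 proof
  fix w :: "int => complex mat" assume w: "w \<in> lZ 1 r"
  obtain \<eta> where \<eta>: "C_k m \<eta>" "!!q K \<epsilon>. q < r ==> 0 < (K :: real) ==> 0 < \<epsilon> ==> \<forall>\<^sub>F n in sequentially. \<forall>j. \<bar>of_int j\<bar> \<le> 2 ^ n * K -->
    cmod (2 ^ (n * q) * (Sub ^^ n) (\<lambda>k l. w k $$ (0, l)) j q - nderiv q \<eta> (of_int j / 2 ^ n)) \<le> \<epsilon>"
   using decays_imp_hermite_convergence[OF dec, of "\<lambda>k l. w k $$ (0, l)"] by (elim exE conjE) (rule that, auto)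
  have "(\<lambda>n. Max ((\<lambda>k. max_norm (hermite_iter r a w n k - Matrix.mat 1 r (\<lambda>(_, l). nderiv l \<eta> (of_int k / 2 ^ n))))
    ` {k::int. - (2 ^ n * K) \<le> of_int k \<and> of_int k \<le> 2 ^ n * K})) \<longlonglongrightarrow> 0" if K: "K > 0" for K :: real
   unfolding hermite_limit_iff[OF w K]
  proof (intro allI impI)
   fix \<epsilon> :: real assume \<epsilon>: "0 < \<epsilon>"
   have "\<forall>\<^sub>F n in sequentially. \<forall>q\<in>{..<r}. \<forall>j. \<bar>of_int j\<bar> \<le> 2 ^ n * K -->
    cmod (2 ^ (n * q) * (Sub ^^ n) (\<lambda>k l. w k $$ (0, l)) j q - nderiv q \<eta> (of_int j / 2 ^ n)) \<le> \<epsilon>"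
    by (rule eventually_ball_finite) (use \<eta>(2)[OF _ K \<epsilon>] in auto)
   then show "\<forall>\<^sub>F n in sequentially. \<forall>j. \<bar>of_int j\<bar> \<le> 2 ^ n * K -->
    (\<forall>q<r. cmod (2 ^ (n * q) * (Sub ^^ n) (\<lambda>k l. w k $$ (0, l)) j q - nderiv q \<eta> (of_int j / 2 ^ n)) \<le> \<epsilon>)"
    by (rule eventually_mono) simp
  qed
  then show "\<exists>\<eta>. C_k m \<eta> \<and> (\<forall>K::real. K > 0 --> (\<lambda>n. Max ((\<lambda>k. max_norm (hermite_iter r a w n k - Matrix.mat 1 r (\<lambda>(_, l). nderiv l \<eta> (of_int k / 2 ^ n))))
    ` {k::int. - (2 ^ n * K) \<le> of_int k \<and> of_int k \<le> 2 ^ n * K})) \<longlonglongrightarrow> 0)"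
   using \<eta>(1) by blast
 qed
qed

lemma mask_iter_nth:
 shows "mask_iter r a n k \<in> carrier_mat r r" and "p < r ==> q < r ==> mask_iter r a n k $$ (p, q) = C n (delta 0 q) k p"
proof -
 define w where "w = (\<lambda>k :: int. if k = 0 then 1\<^sub>m r else 0\<^sub>m r r :: complex mat)"
 have w: "w \<in> lZ r r" by (simp add: w_def lZ_def)
 note it = subdivision_iterate[OF w, of n]
 have W: "(subdivision a ^^ n) w k \<in> carrier_mat r r" by (rule lZ_carrier[OF it[THEN conjunct1]])
 have e: "mask_iter r a n k = (1 / 2 ^ n) \<cdot>\<^sub>m (subdivision a ^^ n) w k" by (simp add: mask_iter_def w_def)
 show "mask_iter r a n k \<in> carrier_mat r r" using W by (simp add: e)
 assume p: "p < r" and q: "q < r"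
 have "(Sub ^^ n) (\<lambda>k l. w k $$ (p, l)) k q = (Sub ^^ n) (delta 0 p) k q"
 proof (cases n)
  case 0
  then show ?thesis using p q by (simp add: w_def delta_def)
 next
  case (Suc n')
  have "Sub (\<lambda>k l. w k $$ (p, l)) = Sub (delta 0 p)" by (rule Sub_cong) (use p in \<open>simp add: w_def delta_def\<close>)
  then show ?thesis by (simp add: Suc funpow_swap1)
 qed
 then show "mask_iter r a n k $$ (p, q) = C n (delta 0 q) k p"
  using it p q W by (simp add: e Sub_iterate_delta)
qed

definition column :: "(int => complex mat) => int => nat => complex" where
 "column u k l = entries u k l 0"

lemma supp_in_column: "supported L u ==> supp_in L (column u)"
 by (simp add: supp_in_def column_def entries_outside)

lemma fsupp_column: "u \<in> l0 r 1 ==> fsupp (column u)"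
 using l0_supported[of u r 1] supp_in_column unfolding fsupp_def by blast

lemma seq_conv_nth:
 assumes u: "u \<in> l0 r 1"
 shows "seq_conv (mask_iter r a n) u j \<in> carrier_mat r 1"
  and "p < r ==> seq_conv (mask_iter r a n) u j $$ (p, 0) = C n (column u) j p"
proof -
 have d: "dim_row (mask_iter r a n 0) = r" "dim_col (u 0) = 1"
  using mask_iter_nth(1)[of n 0] lZ_carrier[OF l0_lZ[OF u], of 0] by auto
 then show "seq_conv (mask_iter r a n) u j \<in> carrier_mat r 1" by (simp add: seq_conv_def)
 assume p: "p < r"
 obtain L where L: "supported L u" using l0_supported[OF u] by blast
 have "seq_conv (mask_iter r a n) u j $$ (p, 0) = (\<Sum>k\<in>seq_supp u. (mask_iter r a n (j - k) * u k) $$ (p, 0))"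
  using p d by (simp add: seq_conv_def)
 also have "... = (\<Sum>k\<in>seq_supp u. \<Sum>q<r. C n (delta 0 q) (j - k) p * column u k q)"
 proof (intro sum.cong refl)
  fix k
  show "(mask_iter r a n (j - k) * u k) $$ (p, 0) = (\<Sum>q<r. C n (delta 0 q) (j - k) p * column u k q)"
   using lZ_carrier[OF l0_lZ[OF u], of k] mask_iter_nth(1)[of n "j - k"] p
   by (simp add: scalar_prod_def atLeast0LessThan column_def entries_nth[OF l0_lZ[OF u]] mask_iter_nth(2))
 qed
 also have "... = (\<Sum>k\<in>{-L..L}. \<Sum>q<r. C n (delta 0 q) (j - k) p * column u k q)"
 proof (rule sum.mono_neutral_left)
  show "seq_supp u \<subseteq> {-L..L}" using L by (force simp: supported_def)
  show "\<forall>k\<in>{-L..L} - seq_supp u. (\<Sum>q<r. C n (delta 0 q) (j - k) p * column u k q) = 0"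
  proof
   fix k assume "k \<in> {-L..L} - seq_supp u"
   then have "u k = 0\<^sub>m r 1" using lZ_carrier[OF l0_lZ[OF u], of k] by (simp add: seq_supp_def)
   then have "column u k q = 0" for q by (simp add: column_def entries_def)
   then show "(\<Sum>q<r. C n (delta 0 q) (j - k) p * column u k q) = 0" by simp
  qed
 qed simp
 also have "... = C n (column u) j p" by (rule C_delta_expansion[OF supp_in_column[OF L] p, symmetric])
 finally show "seq_conv (mask_iter r a n) u j $$ (p, 0) = C n (column u) j p" .
qed

lemma linf_norm_le_iff:
 assumes u: "u \<in> l0 r 1"
 shows "linf_norm (seq_conv (mask_iter r a n) u) \<le> K \<longleftrightarrow> bounded_by K (C n (column u))"
proof -
 have max: "max_norm (seq_conv (mask_iter r a n) u j) \<le> K \<longleftrightarrow> (\<forall>l<r. cmod (C n (column u) j l) \<le> K)" for j K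
  using max_norm_le_iff[OF seq_conv_nth(1)[OF u] r_pos, of n j K] by (simp add: seq_conv_nth(2)[OF u])
 obtain B where "bounded_by B (C n (column u))" using ex_bounded_by[OF fsupp_column[OF u], of n] by blast
 then have "bdd_above (range (\<lambda>j. max_norm (seq_conv (mask_iter r a n) u j)))"
  by (intro bdd_aboveI2[of _ _ B]) (simp add: max bounded_by_def)
 then show ?thesis unfolding linf_norm_def by (subst cSUP_le_iff) (auto simp: max bounded_by_def)
qed

lemma limsup_less_iff_decaying:
 assumes u: "u \<in> l0 r 1" and h: "0 < h"
 shows "limsup (\<lambda>n. ereal (root n (linf_norm (seq_conv (mask_iter r a n) u)))) < ereal h \<longleftrightarrow> decaying h (column u)"
proof -
 have "0 \<le> linf_norm (seq_conv (mask_iter r a n) u)" for n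
 proof -
  have "bounded_by (linf_norm (seq_conv (mask_iter r a n) u)) (C n (column u))" using linf_norm_le_iff[OF u] by blast
  then show ?thesis using r_pos norm_ge_zero order_trans unfolding bounded_by_def by blast
 qed
 from limsup_root_less_iff[OF this h] show ?thesis unfolding decaying_def linf_norm_le_iff[OF u] .
qed

end

text \<open>The binomial expansion of the sum rule. Its term s = p is 2^p times the p-th moment
  vector multiplied by the symbol at 0, so the lower moments determine the p-th one unless 2^(-p) is
  an eigenvalue.\<close>

lemma moment_recursion:
 assumes a: "a \<in> lZ r r" "supported N a" and \<upsilon>: "\<upsilon> \<in> lZ 1 r" "supported N \<upsilon>"
  and sr: "sum_rules r a \<upsilon> (n + 1)" and p: "p \<le> n" and l': "l' < r"
 shows "(\<Sum>j\<in>{-N..N}. entries \<upsilon> j 0 l' * of_int j ^ p) =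
  (\<Sum>l<r. \<Sum>s\<le>p. of_nat (p choose s) * 2 ^ s * (\<Sum>j\<in>{-N..N}. entries \<upsilon> j 0 l * of_int j ^ s) * (\<Sum>i\<in>{-N..N}. entries a i l l' * of_int i ^ (p - s)))"
proof -
 define b where "b s = (of_nat (p choose s) * 2 ^ s :: complex)" for s
 have "(\<Sum>j\<in>{-N..N}. entries \<upsilon> j 0 l' * of_int j ^ p) = (\<Sum>j\<in>{-N..N}. \<Sum>i\<in>{-N..N}. \<Sum>l<r. entries \<upsilon> j 0 l * entries a i l l' * (2 * of_int j + of_int i) ^ p)"
  by (rule sum_rules_moments(1)[OF a \<upsilon> sr p l', symmetric])
 also have "... = (\<Sum>j\<in>{-N..N}. \<Sum>i\<in>{-N..N}. \<Sum>l<r. \<Sum>s\<le>p. b s * (entries \<upsilon> j 0 l * of_int j ^ s) * (entries a i l l' * of_int i ^ (p - s)))"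
  by (simp add: b_def binomial_ring power_mult_distrib sum_distrib_left mult_ac)
 also have "... = (\<Sum>j\<in>{-N..N}. \<Sum>l<r. \<Sum>i\<in>{-N..N}. \<Sum>s\<le>p. b s * (entries \<upsilon> j 0 l * of_int j ^ s) * (entries a i l l' * of_int i ^ (p - s)))"
  by (intro sum.cong refl sum.swap)
 also have "... = (\<Sum>j\<in>{-N..N}. \<Sum>l<r. \<Sum>s\<le>p. \<Sum>i\<in>{-N..N}. b s * (entries \<upsilon> j 0 l * of_int j ^ s) * (entries a i l l' * of_int i ^ (p - s)))"
  by (intro sum.cong refl sum.swap)
 also have "... = (\<Sum>l<r. \<Sum>j\<in>{-N..N}. \<Sum>s\<le>p. \<Sum>i\<in>{-N..N}. b s * (entries \<upsilon> j 0 l * of_int j ^ s) * (entries a i l l' * of_int i ^ (p - s)))"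
  by (rule sum.swap)
 also have "... = (\<Sum>l<r. \<Sum>s\<le>p. \<Sum>j\<in>{-N..N}. \<Sum>i\<in>{-N..N}. b s * (entries \<upsilon> j 0 l * of_int j ^ s) * (entries a i l l' * of_int i ^ (p - s)))"
  by (intro sum.cong refl sum.swap)
 also have "... = (\<Sum>l<r. \<Sum>s\<le>p. b s * (\<Sum>j\<in>{-N..N}. entries \<upsilon> j 0 l * of_int j ^ s) * (\<Sum>i\<in>{-N..N}. entries a i l l' * of_int i ^ (p - s)))"
  by (simp only: sum_distrib_left sum_distrib_right)
   (intro sum.cong refl sum.swap)
 finally show ?thesis by (simp only: b_def)
qed

section \<open>Comparison with another matching filter\<close>

context subdivision_setting
begin

definition to_seq :: "(int => nat => complex) => int => complex mat" where
 "to_seq w = (\<lambda>k. Matrix.mat r 1 (\<lambda>(l, _). w k l))"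

lemma column_to_seq: "l < r ==> column (to_seq w) k l = w k l"
 by (simp add: column_def to_seq_def entries_def)

lemma to_seq_cong: "(!!k l. l < r ==> w k l = w' k l) ==> to_seq w = to_seq w'"
 unfolding to_seq_def by (intro ext eq_matI) auto

lemma to_seq_l0:
 assumes "fsupp w" shows "to_seq w \<in> l0 r 1"
proof -
 obtain L where L: "supp_in L w" using assms by (auto simp: fsupp_def)
 have "seq_supp (to_seq w) \<subseteq> {-L..L}"
 proof
  fix k assume k: "k \<in> seq_supp (to_seq w)"
  have "to_seq w k = 0\<^sub>m r 1" if "L < \<bar>k\<bar>"
   unfolding to_seq_def by (rule eq_matI) (use L that in \<open>auto simp: supp_in_def\<close>)
  then show "k \<in> {-L..L}" using k by (force simp: seq_supp_def to_seq_def)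
 qed
 then have "finite (seq_supp (to_seq w))" using finite_subset by blast
 then show ?thesis by (simp add: l0_def lZ_def to_seq_def)
qed

lemma column_nth: "u \<in> lZ r 1 ==> l < r ==> column u k l = u k $$ (l, 0)"
 by (simp add: column_def entries_nth)

lemma to_seq_column: "u \<in> lZ r 1 ==> to_seq (column u) = u"
proof
 fix k assume u: "u \<in> lZ r 1"
 show "to_seq (column u) k = u k"
  unfolding to_seq_def by (rule eq_matI) (use lZ_carrier[OF u, of k] column_nth[OF u] in auto)
qed

lemma seq_span_eq:
 assumes "S \<subseteq> lZ r 1"
 shows "seq_span r S = {to_seq (\<lambda>k l. \<Sum>v\<in>T. c v * column v k l) | T c. finite T \<and> T \<subseteq> S}"
proof -
 have "(\<lambda>j. Matrix.mat r 1 (\<lambda>(p, q). \<Sum>v\<in>T. c v * v j $$ (p, q))) = to_seq (\<lambda>k l. \<Sum>v\<in>T. c v * column v k l)" if "T \<subseteq> S" for T c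
  unfolding to_seq_def
 proof (intro ext eq_matI)
  fix k i j assume "i < dim_row (Matrix.mat r 1 (\<lambda>(l, _). \<Sum>v\<in>T. c v * column v k l))" "j < dim_col (Matrix.mat r 1 (\<lambda>(l, _). \<Sum>v\<in>T. c v * column v k l))"
  then have "i < r" "j = 0" by auto
  then show "Matrix.mat r 1 (\<lambda>(p, q). \<Sum>v\<in>T. c v * v k $$ (p, q)) $$ (i, j) = Matrix.mat r 1 (\<lambda>(l, _). \<Sum>v\<in>T. c v * column v k l) $$ (i, j)"
   using that assms by (auto simp: column_nth intro!: sum.cong)
 qed auto
 then show ?thesis unfolding seq_span_def by (intro Collect_cong ex_cong1) auto
qed

lemma l0_shift:
 assumes "u \<in> l0 r 1" shows "(\<lambda>k. u (k - t)) \<in> l0 r 1"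
proof -
 have "seq_supp (\<lambda>k. u (k - t)) \<subseteq> (\<lambda>k. k + t) ` seq_supp u"
  by (auto simp: seq_supp_def image_iff intro!: exI[of _ "_ - t"])
 then have "finite (seq_supp (\<lambda>k. u (k - t)))" using assms finite_surj by (auto simp: l0_def)
 then show ?thesis using assms by (simp add: l0_def lZ_def)
qed

context
 fixes M' :: nat and \<upsilon>' :: "int => complex mat"
 assumes supported': "supported N \<upsilon>'" and matching': "matching_filter r a \<phi> M' \<upsilon>'"
begin

lemma lZ': "\<upsilon>' \<in> lZ 1 r" and sum_rules': "sum_rules r a \<upsilon>' (M' + 1)"
 using matching' l0_lZ by (auto simp: matching_filter_def sum_rules_def)

lemmas data' = lZ' supported'

lemma a_hat_0: "l < r ==> l' < r ==> (\<Sum>i\<in>{-N..N}. entries a i l l' * of_int i ^ 0) = seq_hat a 0 $$ (l, l')"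
 by (simp add: seq_hat_nth[OF a_data])

text \<open>The value at 0 is a left eigenvector for the simple eigenvalue 1, hence a multiple of
  the first unit vector; pairing with the transform of \<phi> at 0 fixes the multiple. So every
  matching filter meets the normalisation in \<open>sum_rule_mask\<close>.\<close>

lemma hat_0': 
 assumes l: "l < r"
 shows "seq_hat \<upsilon>' 0 $$ (0, l) = (if l = 0 then 1 else 0)"
proof -
 define y where "y l = seq_hat \<upsilon>' 0 $$ (0, l)" for l
 have y: "y l = (\<Sum>j\<in>{-N..N}. entries \<upsilon>' j 0 l * of_int j ^ 0)" if "l < r" for l
  using that by (simp add: y_def seq_hat_nth[OF data'])
 have eig: "(\<Sum>l<r. y l * seq_hat a 0 $$ (l, l')) = y l'" if l': "l' < r" for l'
 proof -
  have "y l' = (\<Sum>l<r. y l * (\<Sum>i\<in>{-N..N}. entries a i l l' * of_int i ^ 0))"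
   using moment_recursion[OF a_data data' sum_rules' le0 l'] by (simp add: y l')
  then show ?thesis using a_hat_0 l' by simp
 qed
 have y0: "y l = y 0 * (if l = 0 then 1 else 0)" if l: "l < r" for l
 proof -
  obtain n where n: "r = Suc n" using r_pos gr0_implies_Suc by blast
  have "y l - y 0 * (if l = 0 then 1 else 0) = 0"
  proof (rule simple_left_eigenvector_eq_0[of "seq_hat a 0" n "\<lambda>l. y l - y 0 * (if l = 0 then 1 else 0)" l])
   show "seq_hat a 0 \<in> carrier_mat (Suc n) (Suc n)" using seq_hat_carrier[OF a_lZ] n by simp
   fix j assume j: "j < Suc n"
   have "(\<Sum>l<r. (y l - y 0 * (if l = 0 then 1 else 0)) * seq_hat a 0 $$ (l, j)) = y j - (\<Sum>l<r. if l = 0 then y 0 * seq_hat a 0 $$ (0, j) else 0)"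
    using eig[of j] j n by (simp only: left_diff_distrib sum_subtractf) (intro arg_cong2[of _ _ _ _ "(-)"] sum.cong, auto)
   also have "... = y j - y 0 * (if j = 0 then 1 else 0)" using r_pos A_row_0[of j] j n by (simp add: sum.delta del: sum.lessThan_Suc)
   finally show "(\<Sum>l<Suc n. (y l - y 0 * (if l = 0 then 1 else 0)) * seq_hat a 0 $$ (l, j)) = y j - y 0 * (if j = 0 then 1 else 0)"
    by (simp only: n)
  qed (use order_one A_row_0 l n in auto)
  then show ?thesis by simp
 qed
 have "(seq_hat \<upsilon>' 0 * dist_hat r \<phi> 0) $$ (0, 0) = (1\<^sub>m 1 :: complex mat) $$ (0, 0)"
  using matching' by (simp add: matching_filter_def)
 moreover have "(seq_hat \<upsilon>' 0 * dist_hat r \<phi> 0) $$ (0, 0) = (\<Sum>k<r. y k * dist_hat r \<phi> 0 $$ (k, 0))"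
  using seq_hat_carrier[OF lZ', of 0] by (simp add: scalar_prod_def atLeast0LessThan dist_hat_def y_def)
 moreover have "... = (\<Sum>k<r. if k = 0 then y 0 * dist_hat r \<phi> 0 $$ (0, 0) else 0)"
  by (rule sum.cong[OF refl], subst y0) auto
 ultimately have "y 0 * dist_hat r \<phi> 0 $$ (0, 0) = 1" using r_pos by (simp add: sum.delta)
 moreover have "dist_hat r \<phi> 0 $$ (0, 0) = 1" using r_pos \<phi>_0 by (simp add: dist_hat_def)
 ultimately have "y 0 = 1" by simp
 then show ?thesis using y0[OF l] by (simp add: y_def)
qed

lemma sum_rule_mask': "sum_rule_mask r N (entries a) (\<lambda>j. entries \<upsilon>' j 0) M'"
 by (rule sum_rule_mask_entries[OF a_data data' r_pos N0 sum_rules' hat_0'])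

interpretation W: sum_rule_mask r N "entries a" "\<lambda>j. entries \<upsilon>' j 0" M'
 by (rule sum_rule_mask')

lemma order_bound':
 assumes "0 \<le> L" "supported L a"
 shows "M' + 1 \<le> r * nat (2 * L + 1)"
 by (rule W.sum_rule_order_bound[OF assms(1)]) (rule entries_outside[OF assms(2)])

context
 assumes M': "m \<le> M'"
begin

text \<open>By \<open>moment_recursion\<close> and induction, the difference of the p-th moments is
  a left eigenvector for 2^(-p). For 1 <= p <= m this is not an eigenvalue, because all eigenvalues
  other than 1 are smaller than 2^(-m) in modulus.\<close>

lemma moments_agree:
 assumes "p \<le> m" "l < r"
 shows "(\<Sum>j\<in>{-N..N}. entries \<upsilon>' j 0 l * of_int j ^ p) = (\<Sum>j\<in>{-N..N}. entries \<upsilon> j 0 l * of_int j ^ p)"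
 using assms
proof (induction p arbitrary: l rule: less_induct)
 case (less p)
 define y' where "y' s l = (\<Sum>j\<in>{-N..N}. entries \<upsilon>' j 0 l * of_int j ^ s)" for s l
 define y where "y s l = (\<Sum>j\<in>{-N..N}. entries \<upsilon> j 0 l * of_int j ^ s)" for s l
 show ?case
 proof (cases "p = 0")
  case True
  then show ?thesis
   using hat_0'[OF less.prems(2)] \<upsilon>_hat_0[OF less.prems(2)] seq_hat_nth[OF data' _ less.prems(2), of 0 0] seq_hat_nth[OF \<upsilon>_data _ less.prems(2), of 0 0]
   by simp
 next
  case False
  have IH: "y' s l = y s l" if "s < p" "l < r" for s l
   using less.IH[OF that(1) _ that(2)] that less.prems(1) by (simp add: y'_def y_def)
  have eig: "(\<Sum>l<r. (y' p l - y p l) * seq_hat a 0 $$ (l, l')) = (1 / 2 ^ p) * (y' p l' - y p l')" if l': "l' < r" for l'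
  proof -
   define c where "c t l = (\<Sum>i\<in>{-N..N}. entries a i l l' * of_int i ^ t)" for t l
   have 1: "y' p l' = (\<Sum>l<r. \<Sum>s\<le>p. of_nat (p choose s) * 2 ^ s * y' s l * c (p - s) l)"
    unfolding y'_def c_def by (rule moment_recursion[OF a_data data' sum_rules' _ l']) (use less.prems M' in simp)
   have 2: "y p l' = (\<Sum>l<r. \<Sum>s\<le>p. of_nat (p choose s) * 2 ^ s * y s l * c (p - s) l)"
    unfolding y_def c_def by (rule moment_recursion[OF a_data \<upsilon>_data sum_rules less.prems(1) l'])
   have "y' p l' - y p l' = (\<Sum>l<r. \<Sum>s\<le>p. of_nat (p choose s) * 2 ^ s * (y' s l - y s l) * c (p - s) l)"
    unfolding 1 2 by (simp add: sum_subtractf[symmetric] algebra_simps)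
   also have "... = (\<Sum>l<r. \<Sum>s\<le>p. if s = p then 2 ^ p * ((y' p l - y p l) * c 0 l) else 0)"
    by (intro sum.cong refl) (use IH in auto)
   also have "... = (\<Sum>l<r. 2 ^ p * ((y' p l - y p l) * c 0 l))" by (simp add: sum.delta)
   also have "... = 2 ^ p * (\<Sum>l<r. (y' p l - y p l) * seq_hat a 0 $$ (l, l'))"
    using a_hat_0 l' by (simp add: sum_distrib_left c_def)
   finally show ?thesis by simp
  qed
  have "\<not> eigenvalue (seq_hat a 0) (1 / 2 ^ p)"
  proof (rule not_eigenvalue)
   have "(2 :: real) ^ p > 1" using False by (simp add: one_less_power)
   then have "cmod (1 / 2 ^ p) < 1" by (simp add: norm_divide norm_power)
   then show "(1 / 2 ^ p :: complex) ~= 1" by (metis less_irrefl norm_one)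
   show "1 / 2 ^ m \<le> cmod (1 / 2 ^ p)"
    using power_increasing[OF less.prems(1), of "2 :: real"] by (simp add: norm_divide norm_power frac_le)
  qed
  from left_eigenvector_eq_0[OF seq_hat_carrier[OF a_lZ] this, of "\<lambda>l. y' p l - y p l" l] eig less.prems(2)
  show ?thesis by (simp add: y'_def y_def)
 qed
qed

lemma V_agree:
 assumes "n \<le> m + 1" shows "W.V n u \<longleftrightarrow> V n u"
proof -
 have "W.M p 0 u = M p 0 u" if "fsupp u" "p \<le> m" for p
  unfolding W.M_moments[OF that(1)] M_moments[OF that(1)]
  by (intro sum.cong refl arg_cong2[of _ _ _ _ times] moments_agree) (use that(2) in auto)
 then show ?thesis using assms unfolding W.V_def V_def by auto
qed

lemma V_space_iff: "u \<in> V_space r M' \<upsilon>' \<longleftrightarrow> u \<in> l0 r 1 \<and> W.V (M' + 1) (column u)"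
proof (cases "u \<in> l0 r 1")
 case True
 obtain L where L: "supported L u" using l0_supported[OF True] by blast
 define X where "X = {-N..N} \<times> {..<r} \<times> {-L..L}"
 define b where "b y = entries \<upsilon>' (fst y) 0 (fst (snd y)) * column u (snd (snd y)) (fst (snd y))" for y
 have "(seq_hat \<upsilon>' \<xi> * seq_hat u \<xi>) $$ (0, 0) = (\<Sum>y\<in>X. b y * intwave (fst y + snd (snd y)) \<xi>)" for \<xi>
 proof -
  have "(seq_hat \<upsilon>' \<xi> * seq_hat u \<xi>) $$ (0, 0) = (\<Sum>l<r. seq_hat \<upsilon>' \<xi> $$ (0, l) * seq_hat u \<xi> $$ (l, 0))"
   using seq_hat_carrier[OF lZ', of \<xi>] seq_hat_carrier[OF l0_lZ[OF True], of \<xi>] by (simp add: scalar_prod_def atLeast0LessThan)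
  also have "... = (\<Sum>l<r. \<Sum>j\<in>{-N..N}. \<Sum>k\<in>{-L..L}. (entries \<upsilon>' j 0 l * column u k l) * intwave (j + k) \<xi>)"
  proof (intro sum.cong refl)
   fix l assume "l \<in> {..<r}"
   then show "seq_hat \<upsilon>' \<xi> $$ (0, l) * seq_hat u \<xi> $$ (l, 0) = (\<Sum>j\<in>{-N..N}. \<Sum>k\<in>{-L..L}. (entries \<upsilon>' j 0 l * column u k l) * intwave (j + k) \<xi>)"
    by (simp add: seq_hat_nth[OF data'] seq_hat_nth[OF l0_lZ[OF True] L] sum_product column_def)
     (intro sum.cong refl, simp add: algebra_simps flip: exp_add)
  qed
  also have "... = (\<Sum>j\<in>{-N..N}. \<Sum>l<r. \<Sum>k\<in>{-L..L}. (entries \<upsilon>' j 0 l * column u k l) * intwave (j + k) \<xi>)"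
   by (rule sum.swap)
  finally show ?thesis by (simp add: X_def b_def sum_pairs)
 qed
 then have nd: "nderiv p (\<lambda>\<xi>. (seq_hat \<upsilon>' \<xi> * seq_hat u \<xi>) $$ (0, 0)) 0 = (- \<i>) ^ p * (\<Sum>y\<in>X. b y * of_int (fst y + snd (snd y)) ^ p)" for p
  by (simp only: nderiv_exp_moment)
 have M: "W.M p 0 (column u) = (\<Sum>y\<in>X. b y * of_int (fst y + snd (snd y)) ^ p)" for p
 proof -
  have "zsum (\<lambda>k. (of_int j + of_int k + 0) ^ p * column u k l) = (\<Sum>k\<in>{-L..L}. (of_int j + of_int k + 0) ^ p * column u k l)" for j l
  proof (rule zsum_eq)
   fix k assume "k \<notin> {-L..L}"
   then have "column u k l = 0" unfolding column_def by (intro entries_outside[OF L]) auto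
   then show "(of_int j + of_int k + 0) ^ p * column u k l = 0" by simp
  qed simp
  then show ?thesis unfolding W.M_def by (simp add: X_def b_def sum_pairs sum_distrib_left mult_ac)
 qed
 have d: "dim_row (seq_hat \<upsilon>' \<xi> * seq_hat u \<xi>') = 1" "dim_col (seq_hat \<upsilon>' \<xi> * seq_hat u \<xi>') = 1" for \<xi> \<xi>'
  using seq_hat_carrier[OF lZ', of \<xi>] seq_hat_carrier[OF l0_lZ[OF True], of \<xi>'] by auto
 have "eq_upto_O (M' + 1) (\<lambda>\<xi>. seq_hat \<upsilon>' \<xi> * seq_hat u \<xi>) (\<lambda>_. 0\<^sub>m 1 1) \<longleftrightarrow> (\<forall>p<M' + 1. W.M p 0 (column u) = 0)"
  unfolding eq_upto_O_def d M using nd nderiv_const[of _ 0] by auto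
 then show ?thesis using True fsupp_column[OF True] unfolding V_space_def W.V_def by blast
qed (simp add: V_space_def)

lemma to_seq_V_space:
 assumes "W.V (M' + 1) w" shows "to_seq w \<in> V_space r M' \<upsilon>'"
 unfolding V_space_iff
 using to_seq_l0[OF W.V_fsupp[OF assms]] W.V_cong[OF assms] column_to_seq by metis

lemma V_space_shift: "u \<in> V_space r M' \<upsilon>' ==> (\<lambda>k. u (k - t)) \<in> V_space r M' \<upsilon>'"
proof -
 assume u: "u \<in> V_space r M' \<upsilon>'"
 have "column (\<lambda>k. u (k - t)) = (\<lambda>k. column u (k - t))" by (simp add: column_def entries_def fun_eq_iff)
 then show ?thesis using u W.V_shift[of "M' + 1" "column u" t] l0_shift[of u t] by (simp add: V_space_iff)
qed

lemma seq_span_V_space: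
 assumes "S \<subseteq> V_space r M' \<upsilon>'"
 shows "seq_span r S \<subseteq> V_space r M' \<upsilon>'"
proof
 have SZ: "S \<subseteq> lZ r 1" using assms l0_lZ by (auto simp: V_space_def)
 fix u assume "u \<in> seq_span r S"
 then obtain T c where T: "finite T" "T \<subseteq> S" "u = to_seq (\<lambda>k l. \<Sum>v\<in>T. c v * column v k l)"
  unfolding seq_span_eq[OF SZ] by blast
 have V: "W.V (M' + 1) (column v)" if "v \<in> T" for v using that T(2) assms V_space_iff by blast
 have "W.V (M' + 1) (\<lambda>k l. \<Sum>v\<in>T. c v * column v k l)"
  unfolding W.V_def
 proof (intro conjI allI impI)
  show "fsupp (\<lambda>k l. \<Sum>v\<in>T. c v * column v k l)" by (rule fsupp_sum[OF T(1)]) (use V W.V_fsupp in blast)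
  fix p assume "p < M' + 1"
  then show "W.M p 0 (\<lambda>k l. \<Sum>v\<in>T. c v * column v k l) = 0"
   by (subst W.M_sum[OF T(1)]) (use V in \<open>auto simp: W.V_def\<close>)
 qed
 then show "u \<in> V_space r M' \<upsilon>'" unfolding T(3) by (rule to_seq_V_space)
qed

lemma seq_span_step:
 assumes S: "S \<subseteq> lZ r 1" and w: "to_seq w \<in> seq_span r S" and v: "v \<in> S" and u: "!!k l. l < r ==> u k l = x * column v k l + w k l"
 shows "to_seq u \<in> seq_span r S"
proof -
 obtain T c where T: "finite T" "T \<subseteq> S" "to_seq w = to_seq (\<lambda>k l. \<Sum>v\<in>T. c v * column v k l)"
  using w unfolding seq_span_eq[OF S] by blast
 define c' where "c' y = (if y \<in> T then c y else 0) + (if y = v then x else 0)" for y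
 have "u k l = (\<Sum>y\<in>insert v T. c' y * column y k l)" if l: "l < r" for k l
 proof -
  have "w k l = (\<Sum>v\<in>T. c v * column v k l)" 
  proof -
   have "column (to_seq w) k l = column (to_seq (\<lambda>k l. \<Sum>v\<in>T. c v * column v k l)) k l" by (simp only: T(3))
   then show ?thesis by (simp only: column_to_seq[OF l])
  qed
  also have "... = (\<Sum>y\<in>insert v T. (if y \<in> T then c y else 0) * column y k l)"
   by (rule sum.mono_neutral_cong_left) (use T(1) in auto)
  finally have 1: "w k l = (\<Sum>y\<in>insert v T. (if y \<in> T then c y else 0) * column y k l)" .
  have "(\<Sum>y\<in>insert v T. (if y = v then x else 0) * column y k l) = (\<Sum>y\<in>insert v T. if y = v then x * column v k l else 0)"
   by (intro sum.cong) auto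
  also have "... = x * column v k l" using T(1) by (simp add: sum.delta)
  finally show ?thesis unfolding u[OF l] 1 c'_def by (simp add: distrib_right sum.distrib)
 qed
 then have "to_seq u = to_seq (\<lambda>k l. \<Sum>y\<in>insert v T. c' y * column y k l)" by (rule to_seq_cong)
 moreover have "finite (insert v T)" "insert v T \<subseteq> S" using T v by auto
 ultimately show ?thesis unfolding seq_span_eq[OF S] by blast
qed

text \<open>Ensures that the choice operator in \<open>sm_infty\<close> really selects a generating
  set.\<close>

lemma exists_generating: "\<exists>B. generates r B (V_space r M' \<upsilon>')"
proof -
 obtain F where F: "finite F" "\<forall>b\<in>F. W.V (M' + 1) b" "\<forall>u. W.V (M' + 1) u --> shift_span F u"
  using W.V_finitely_generated[of "M' + 1"] by (elim exE conjE)
 define B where "B = to_seq ` F"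
 define S where "S = {(\<lambda>j. u (j - k)) | u k. u \<in> B}"
 have BV: "B \<subseteq> V_space r M' \<upsilon>'" using F(2) to_seq_V_space by (auto simp: B_def)
 have SV: "S \<subseteq> V_space r M' \<upsilon>'" using BV V_space_shift by (auto simp: S_def)
 then have SZ: "S \<subseteq> lZ r 1" using l0_lZ by (auto simp: V_space_def)
 have span: "to_seq w \<in> seq_span r S" if "shift_span F w" for w
  using that
 proof (induction rule: shift_span.induct)
  case (zero u)
  have "to_seq u = to_seq (\<lambda>k l. \<Sum>v\<in>{}. 0 * column v k l)" by (rule to_seq_cong) (simp add: zero)
  then show ?case unfolding seq_span_eq[OF SZ]
   by (intro CollectI exI[of _ "{} :: (int => complex mat) set"] exI[of _ "\<lambda>_. 0"]) simp
 next
  case (step w b u c t)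
  have "(\<lambda>k. to_seq b (k - t)) \<in> S" using step.hyps(2) by (auto simp: S_def B_def)
  moreover have "column (\<lambda>k. to_seq b (k - t)) k l = b (k - t) l" if "l < r" for k l
   using column_to_seq[OF that, of b "k - t"] by (simp add: column_def entries_def)
  ultimately show ?case by (intro seq_span_step[OF SZ step.IH]) (auto simp: step.hyps(3))
 qed
 have "V_space r M' \<upsilon>' \<subseteq> seq_span r S"
 proof
  fix u assume u: "u \<in> V_space r M' \<upsilon>'"
  then have "to_seq (column u) \<in> seq_span r S" using F(3) span V_space_iff by blast
  moreover have "u \<in> lZ r 1" using u l0_lZ V_space_iff by blast
  ultimately show "u \<in> seq_span r S" by (simp add: to_seq_column)
 qed
 then have "seq_span r S = V_space r M' \<upsilon>'" using seq_span_V_space[OF SV] by blast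
 then have "generates r B (V_space r M' \<upsilon>')" using F(1) BV by (simp add: generates_def B_def S_def)
 then show ?thesis by blast
qed

section \<open>Generating sets and the quantity rho\<close>

context
 fixes B assumes B: "generates r B (V_space r M' \<upsilon>')"
begin

lemma generators_V_space: "B \<subseteq> V_space r M' \<upsilon>'" and finite_generators: "finite B"
 and span_generators: "seq_span r {(\<lambda>j. u (j - k)) | u k. u \<in> B} = V_space r M' \<upsilon>'"
 using B by (simp_all add: generates_def)

lemma generators_shifts: "{(\<lambda>j. u (j - k)) | u k. u \<in> B} \<subseteq> lZ r 1"
 using generators_V_space V_space_shift l0_lZ by (fastforce simp: V_space_def)

text \<open>The maximum in \<open>rho_infty\<close> needs a nonempty set. An iterated difference
  with enough vanishing moments is a nonzero element of the space, since its next moment is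
  nonzero.\<close>

lemma generators_nonempty: "B ~= {}"
proof
 assume e: "B = {}"
 have d: "W.V (M' + 1) (W.diff_power (M' + 1))" "W.M (M' + 1) 0 (W.diff_power (M' + 1)) ~= 0"
  using W.diff_power[of "M' + 1"] by auto
 have "to_seq (W.diff_power (M' + 1)) \<in> seq_span r {}"
  using to_seq_V_space[OF d(1)] span_generators unfolding e by simp
 then have "to_seq (W.diff_power (M' + 1)) = to_seq (\<lambda>k l. 0)"
  unfolding seq_span_eq[OF empty_subsetI] by auto
 then have "W.diff_power (M' + 1) k l = 0" if "l < r" for k l
  using column_to_seq[OF that] by metis
 then have "W.M (M' + 1) 0 (W.diff_power (M' + 1)) = W.M (M' + 1) 0 (\<lambda>k l. 0)" by (intro W.M_cong)
 then show False using d(2) by (simp add: W.M_def zsum_def)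
qed

text \<open>Decay at a fixed threshold survives shifts and linear combinations, so it passes from
  generators to the whole space with M' + 1 vanishing moments and then down to m + 1. The converse
  uses only the inclusion of the spaces.\<close>

lemma decays_iff_generators: "decays (Suc m) \<longleftrightarrow> (\<forall>b\<in>B. decaying ((1 / 2) ^ Suc m) (column b))"
proof
 assume dec: "decays (Suc m)"
 show "\<forall>b\<in>B. decaying ((1 / 2) ^ Suc m) (column b)"
 proof
  fix b assume "b \<in> B"
  then have "W.V (M' + 1) (column b)" using generators_V_space V_space_iff by blast
  then have "W.V (Suc m) (column b)" by (rule W.V_mono) (use M' in simp)
  then have "V (Suc m) (column b)" using V_agree[of "Suc m"] by simp
  then show "decaying ((1 / 2) ^ Suc m) (column b)" using dec by (simp only: decays_iff)
 qed
next
 assume gen: "\<forall>b\<in>B. decaying ((1 / 2) ^ Suc m) (column b)"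
 have "decaying ((1 / 2) ^ Suc m) w" if w: "W.V (M' + 1) w" for w
 proof -
  have "to_seq w \<in> seq_span r {(\<lambda>j. u (j - k)) | u k. u \<in> B}" using to_seq_V_space[OF w] span_generators by simp
  then obtain T c where T: "finite T" "T \<subseteq> {(\<lambda>j. u (j - k)) | u k. u \<in> B}" "to_seq w = to_seq (\<lambda>k l. \<Sum>v\<in>T. c v * column v k l)"
   unfolding seq_span_eq[OF generators_shifts] by blast
  have dv: "decaying ((1 / 2) ^ Suc m) (column v)" if vT: "v \<in> T" for v
  proof -
   obtain b t where b: "b \<in> B" "v = (\<lambda>j. b (j - t))" using T(2) vT by blast
   have "column v = (\<lambda>k. column b (k - t))" by (simp add: b(2) column_def entries_def fun_eq_iff)
   then show ?thesis using decaying_shift[of _ "column b" t] gen b(1) by simp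
  qed
  have "decaying ((1 / 2) ^ Suc m) (\<lambda>k l. \<Sum>v\<in>T. c v * column v k l)"
   using T(1) dv
  proof (induction T rule: finite_induct)
   case empty
   show ?case using decaying_zero[of "(1 / 2) ^ Suc m"] by simp
  next
   case (insert v T)
   have "decaying ((1 / 2) ^ Suc m) (\<lambda>k l. c v * column v k l + 1 * (\<Sum>v\<in>T. c v * column v k l))"
    by (rule decaying_lincomb) (use insert in auto)
   then show ?case using insert by simp
  qed
  then show ?thesis
  proof (rule decaying_cong)
   fix k l assume l: "l < r"
   have "column (to_seq w) k l = column (to_seq (\<lambda>k l. \<Sum>v\<in>T. c v * column v k l)) k l" by (simp only: T(3))
   then show "(\<Sum>v\<in>T. c v * column v k l) = w k l" by (simp only: column_to_seq[OF l])
  qed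
 qed
 then have "W.decays_at (M' + 1) ((1 / 2) ^ Suc m)" unfolding W.decays_at_iff by blast
 \<comment> \<open>The quotient eigenvalues met on the way, 2^(-i-1) for m + 1 <= i <= M', lie below
   the threshold 2^(-m-1).\<close>
 then have "W.decays_at (Suc m) ((1 / 2) ^ Suc m)" by (rule W.decays_at_antimono) (use M' in simp_all)
 then show "decays (Suc m)" using V_agree[of "Suc m"] by (simp add: W.decays_at_iff decays_iff)
qed

lemma rho_less_iff: "ereal (real m) < neg_log2 (rho_infty r a B) \<longleftrightarrow> decays (Suc m)"
proof -
 define L where "L u = limsup (\<lambda>n. ereal (root n (linf_norm (seq_conv (mask_iter r a n) u))))" for u
 have l0: "b \<in> l0 r 1" if "b \<in> B" for b using that generators_V_space by (auto simp: V_space_def)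
 have nonneg: "0 \<le> L b" if b: "b \<in> B" for b
 proof -
  have "0 \<le> linf_norm (seq_conv (mask_iter r a n) b)" for n
  proof -
   have "bounded_by (linf_norm (seq_conv (mask_iter r a n) b)) (C n (column b))" using linf_norm_le_iff[OF l0[OF b]] by blast
   then show ?thesis using r_pos norm_ge_zero order_trans unfolding bounded_by_def by blast
  qed
  then have "\<forall>\<^sub>F n in sequentially. 0 \<le> ereal (root n (linf_norm (seq_conv (mask_iter r a n) b)))"
   by (intro always_eventually allI) (simp add: real_root_ge_zero)
  then show ?thesis unfolding L_def by (rule le_Limsup[OF sequentially_bot])
 qed
 have Max0: "0 \<le> Max (L ` B)"
  using nonneg generators_nonempty finite_generators by (subst Max_ge_iff) auto
 \<comment> \<open>The factor 2 in \<open>rho_infty\<close> turns the condition rho < 2^(-m) into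
   the rate 2^(-m-1) of \<open>decays (Suc m)\<close>.\<close>
 have half: "2 * y < ereal (1 / 2 ^ m) \<longleftrightarrow> y < ereal ((1 / 2) ^ Suc m)" if "0 \<le> y" for y
  using that by (cases y) (auto simp: field_simps power_one_over)
 have "ereal (real m) < neg_log2 (rho_infty r a B) \<longleftrightarrow> 2 * Max (L ` B) < ereal (1 / 2 ^ m)"
  unfolding rho_infty_def L_def[symmetric, abs_def] by (rule less_neg_log2_iff) (use Max0 in simp)
 also have "... \<longleftrightarrow> (\<forall>b\<in>B. L b < ereal ((1 / 2) ^ Suc m))"
  unfolding half[OF Max0] using generators_nonempty finite_generators by (subst Max_less_iff) auto
 also have "... \<longleftrightarrow> (\<forall>b\<in>B. decaying ((1 / 2) ^ Suc m) (column b))"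
  unfolding L_def by (intro ball_cong refl limsup_less_iff_decaying l0) auto
 finally show ?thesis by (simp only: decays_iff_generators)
qed

end

end

end

end

theorem theorem1p4:
  fixes r m :: nat
    and a \<upsilon> :: "int \<Rightarrow> complex mat"
    and \<phi> :: "nat \<Rightarrow> (real \<Rightarrow> complex) \<Rightarrow> complex"
  assumes "r \<ge> 1" and "m \<ge> r - 1"
    and "a \<in> l0 r r"
    and "dominant_eigenvalue_one m (seq_hat a 0)"
    and "sum_rules r a \<upsilon> (m + 1)"
    and "hermite_filter r \<upsilon> (m + 1)"
    and "refinable_vector r a \<upsilon> \<phi>"
    and "stable_shifts r \<phi>"
  shows "(hermite_scheme_converges r m a \<longleftrightarrow> cascade_converges r m a \<upsilon> \<phi>)
    \<and> (cascade_converges r m a \<upsilon> \<phi> \<longleftrightarrow> sm_infty r a \<phi> > ereal (real m))"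
proof -
  have \<upsilon>: "\<upsilon> \<in> l0 1 r" using assms(5) by (simp add: sum_rules_def)
  obtain Na where Na: "\<And>N. Na \<le> N \<Longrightarrow> supported N a" using l0_supported[OF assms(3)] by blast
  obtain Nv where Nv: "\<And>N. Nv \<le> N \<Longrightarrow> supported N \<upsilon>" using l0_supported[OF \<upsilon>] by blast
  define L where "L = max 0 (max Na Nv)"
  have setting: "subdivision_setting r m N a \<upsilon> \<phi>" if "L \<le> N" for N
    by unfold_locales (use assms Na[of N] Nv[of N] that in \<open>auto simp: L_def\<close>)
  have L: "0 \<le> L" "supported L a" using Na[of L] by (auto simp: L_def)
  have common: "\<exists>N\<ge>L. supported N \<upsilon>'" if "\<upsilon>' \<in> l0 1 r" for \<upsilon>'
  proof -
    obtain N' where N': "\<And>N. N' \<le> N \<Longrightarrow> supported N \<upsilon>'" using l0_supported[OF \<open>\<upsilon>' \<in> l0 1 r\<close>] by blast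
    show ?thesis by (rule exI[of _ "max L N'"]) (use N' in simp)
  qed
  define Q where "Q K \<longleftrightarrow> dominant_eigenvalue_one K (seq_hat a 0) \<and> (\<exists>\<upsilon>'. matching_filter r a \<phi> K \<upsilon>')" for K
  have Qm: "Q m" unfolding Q_def
    using assms(4,5,7) by (auto simp: matching_filter_def refinable_vector_def)
  \<comment> \<open>\<open>L\<close> is fixed by the mask and \<upsilon> before the competing filter
    and its window are chosen, so the bound is uniform in the filter.\<close>
  have bound: "K \<le> r * nat (2 * L + 1)" if QK: "Q K" for K
  proof -
    obtain \<upsilon>' where \<upsilon>': "matching_filter r a \<phi> K \<upsilon>'" using QK unfolding Q_def by blast
    then have "\<upsilon>' \<in> l0 1 r" by (simp add: matching_filter_def sum_rules_def)
    then obtain N where NL: "L \<le> N" "supported N \<upsilon>'" using common by blast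
    interpret subdivision_setting r m N a \<upsilon> \<phi> by (rule setting[OF NL(1)])
    show ?thesis using order_bound'[OF NL(2) \<upsilon>' L] by simp
  qed
  define K where "K = max_sum_rules r a \<phi>"
  have K: "K = (GREATEST K. Q K)" by (simp add: K_def max_sum_rules_def Q_def)
  \<comment> \<open>\<open>GREATEST\<close> has a meaning here because \<open>Q\<close> holds at
    \<open>m\<close> and is bounded.\<close>
  have QK: "Q K" unfolding K by (rule GreatestI_nat[of Q, OF Qm bound])
  have mK: "m \<le> K" unfolding K by (rule Greatest_le_nat[of Q, OF Qm bound])
  define \<upsilon>' where "\<upsilon>' = (SOME \<upsilon>. matching_filter r a \<phi> K \<upsilon>)"
  have \<upsilon>': "matching_filter r a \<phi> K \<upsilon>'" 
  proof -
    obtain w where "matching_filter r a \<phi> K w" using QK unfolding Q_def by blast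
    then show ?thesis unfolding \<upsilon>'_def by (rule someI[of "matching_filter r a \<phi> K"])
  qed
  then have "\<upsilon>' \<in> l0 1 r" by (simp add: matching_filter_def sum_rules_def)
  then obtain N where NL: "L \<le> N" "supported N \<upsilon>'" using common by blast
  \<comment> \<open>The window is enlarged to contain the filter picked by the choice operator; the
    two convergence statements and the exponent are then compared in this one instance.\<close>
  interpret subdivision_setting r m N a \<upsilon> \<phi> by (rule setting[OF NL(1)])
  define B where "B = (SOME B. generates r B (V_space r K \<upsilon>'))"
  have B: "generates r B (V_space r K \<upsilon>')" unfolding B_def by (rule someI_ex[OF exists_generating[OF NL(2) \<upsilon>' mK]])
  have "sm_infty r a \<phi> = neg_log2 (rho_infty r a B)"
    unfolding B_def \<upsilon>'_def K_def sm_infty_def Let_def ..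
  then have "sm_infty r a \<phi> > ereal (real m) \<longleftrightarrow> decays (Suc m)"
    using rho_less_iff[OF NL(2) \<upsilon>' mK B] by simp
  then show ?thesis by (simp only: hermite_scheme_converges_iff cascade_converges_iff)
qed

end
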